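(* Let $n\in\mathbb{Z}$ and let $T\in \mathrm{Aut}(S^2\hat{\mathbb{C}}(n))$. Then $T$ is uniquely determined by $T_\Delta=\Delta_n\circ T\circ\Delta_n^{-1}$, and the component functions $f,g^\pm,\psi^\pm$ of $T_\Delta$ are as follows. First, $$f(z)=\frac{az+b}{cz+d}\qquad\text{for some } a,b,c,d\in\textstyle\bigwedge_{*-2}^0 \text{ with } ad-bc=1 .$$ (i) If $n=0$, then $$\psi^\pm(z)=\frac{\psi_1^\pm z+\psi_0^\pm}{cz+d},\qquad g^\pm(z)=\frac{\epsilon^\pm}{cz+d}+\frac{f^\pm z+h^\pm}{(cz+d)^2}$$ for some $\psi^\pm_j\in\bigwedge^1_{*-2}$ ($j=0,1$), $\epsilon^\pm\in(\bigwedge^0_{*-2})^\times$ and $f^\pm,h^\pm\in\bigwedge_{*-2}^0$ satisfying $$\epsilon^+\epsilon^-=1-\psi_1^+\psi_0^--\psi_1^-\psi_0^+,\qquad f^\pm=\mp\epsilon^\pm\psi_1^+\psi_1^-d,$$ $$h^\pm=\pm\epsilon^\pm\left(\psi_0^+\psi_0^-c-(\psi_1^+\psi_0^--\psi_1^-\psi_0^+)d\mp\psi_1^+\psi_1^-\psi_0^+\psi_0^-d\right).$$ (ii) If $n=1$, then $$\psi^+(z)=\psi_0^+,\qquad \psi^-(z)=\frac{\psi_2^-z^2+\psi_1^-z+\psi_0^-}{(cz+d)^2},\qquad g^+(z)=\epsilon,$$ $$g^-(z)=\frac{1}{\epsilon(cz+d)^2}+\frac{\psi_0^+\left(2\psi_2^-dz-\psi_1^-(cz-d)-2\psi_0^-c\right)}{\epsilon(cz+d)^3}$$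 for some $\psi_0^+,\psi_j^-\in\bigwedge^1_{*-2}$ ($j=0,1,2$) and $\epsilon\in(\bigwedge^0_{*-2})^\times$. (iii) If $n=-1$, then $$\psi^+(z)=\frac{\psi_2^+z^2+\psi_1^+z+\psi_0^+}{(cz+d)^2},\qquad \psi^-(z)=\psi_0^-,$$ $$g^+(z)=\frac{1}{\epsilon(cz+d)^2}-\frac{\left(2\psi_2^+dz-\psi_1^+(cz-d)-2\psi_0^+c\right)\psi_0^-}{\epsilon(cz+d)^3},\qquad g^-(z)=\epsilon$$ for some $\psi_j^+,\psi_0^-\in\bigwedge^1_{*-2}$ ($j=0,1,2$) and $\epsilon\in(\bigwedge^0_{*-2})^\times$. (iv) If $n\ge 2$, then $$\psi^+(z)=0,\qquad \psi^-(z)=\frac{\psi^-_{n+1}z^{n+1}+\psi_n^-z^n+\cdots+\psi_1^-z+\psi_0^-}{(cz+d)^{n+1}},\qquad g^\pm(z)=\epsilon^{\pm1}(cz+d)^{\pm n-1}$$ for some $\psi_j^-\in\bigwedge^1_{*-2}$ ($j=0,1,\dots,n+1$) and $\epsilon\in(\bigwedge^0_{*-2})^\times$. (v) If $n\le -2$, then $$\psi^+(z)=\frac{\psi^+_{-n+1}z^{-n+1}+\psi^+_{-n}z^{-n}+\cdots+\psi_1^+z+\psi_0^+}{(cz+d)^{-n+1}},\qquad \psi^-(z)=0,\qquad g^\pm(z)=\epsilon^{\mp1}(cz+d)^{\pm n-1}$$ for some $\psi_j^+\in\bigwedge^1_{*-2}$ ($j=0,1,\dots,-n+1$) and $\ep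silon\in(\bigwedge^0_{*-2})^\times$.
   Context: Grassmann algebras. $\bigwedge_L$ is the exterior algebra over $\mathbb{C}$ on generators $\zeta_1,\dots,\zeta_L$; $\bigwedge_\infty$ is the direct limit of $\bigwedge_L\subset\bigwedge_{L+1}\subset\cdots$. Each is $\mathbb{Z}_2$-graded, $\bigwedge_*=\bigwedge_*^0\oplus\bigwedge_*^1$ (even and odd parts). Fix $\bigwedge_{*>1}$, which is either $\bigwedge_L$ for a fixed $L\ge 2$ or $\bigwedge_\infty$; correspondingly $\bigwedge_{*-2}$ denotes $\bigwedge_{L-2}$ or $\bigwedge_\infty$. Each $a\in\bigwedge_*$ decomposes as $a=a_B+a_S$ with body $a_B\in\mathbb{C}$ and (nilpotent) soul $a_S$; $a$ is invertible iff $a_B\ne0$; $(\cdot)^\times$ denotes invertible elements. Superfunctions. For $f$ complex analytic near $z_B$ and $z\in\bigwedge^0_{*>1}$ put $f(z)=\sum_{l\ge0}\frac{z_S^l}{l!}f^{(l)}(z_B)$. A superanalytic $(1,0)$-superfunction here is $f(z)=\sum_{(k)}f_{(k)}(z)\zeta_{k_1}\cdots\zeta_{k_s}$, with $f_{(k)}$ complex analytic in $z_B$ and the $\zeta$-monomials in $\bigwedge_{*-2}$. A superanalytic $(1,2)$-superfunction in an even variable $z\in\bigwedge_{*>1}^0$ and odd variables $\theta^\pm\in\bigwedge_{*>1}^1$ is $f_0(z)+\theta^+f_1(z)+\theta^-f_2(z)+\theta^+\theta^-f_3(z)$ with each $f_i$ such a $(1,0)$-superfunction. Domains are open in the DeWitt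 topology: open sets of $\bigwedge^0_{*>1}\oplus(\bigwedge^1_{*>1})^2$ are the preimages of open subsets of $\mathbb{C}$ under $(z,\theta^+,\theta^-)\mapsto z_B$. N=2 superconformal functions. Let $D^\pm=\frac{\partial}{\partial\theta^\pm}+\theta^\mp\frac{\partial}{\partial z}$. A superanalytic map $H(z,\theta^+,\theta^-)=(\tilde z,\tilde\theta^+,\tilde\theta^-)$ ($\tilde z$ even, $\tilde\theta^\pm$ odd superanalytic $(1,2)$-superfunctions) is N=2 superconformal if $D^\pm\tilde\theta^\mp=0$, $D^\pm\tilde z-\tilde\theta^\mp D^\pm\tilde\theta^\pm=0$, and $D^\pm\tilde\theta^\pm$ is not identically zero. Every such $H$ is uniquely of the form $$\tilde z=f(z)+\theta^+g^+(z)\psi^-(z)+\theta^-g^-(z)\psi^+(z)+\theta^+\theta^-(\psi^+(z)\psi^-(z))',$$ $$\tilde\theta^\pm=\psi^\pm(z)+\theta^\pm g^\pm(z)\pm\theta^+\theta^-(\psi^\pm)'(z),$$ with $f,g^\pm$ even and $\psi^\pm$ odd superanalytic $(1,0)$-superfunctions satisfying $f'=(\psi^+)'\psi^--\psi^+(\psi^-)'+g^+g^-$. The five functions $f,g^\pm,\psi^\pm$ are called the component functions of $H$. Spheres. An N=2 superconformal super-Riemann surface over $\bigwedge_{*>1}$ is a space with a (maximal) atlas of charts to DeWitt open subsets of $\bigwedge^0_{*>1}\oplus(\bigwedge^1_{*>1})^2$ with N=2 superconformal transition functions; a map of such surfaces is N=2 superconformal if it is so in all charts. For $n\in\mathbb{Z}$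 let $$I_n(z,\theta^+,\theta^-)=\left(\frac1z,\ \frac{i\theta^+z^n}{z},\ \frac{i\theta^-z^{-n}}{z}\right)\quad\text{on }(\textstyle\bigwedge^0_{*>1})^\times\oplus(\bigwedge^1_{*>1})^2 .$$ $S^2\hat{\mathbb{C}}(n)$ is the N=2 superconformal super-Riemann surface covered by two charts $(U_{\Delta_n},\Delta_n)$, $(U_{\Upsilon_n},\Upsilon_n)$, each a homeomorphism onto all of $\bigwedge^0_{*>1}\oplus(\bigwedge^1_{*>1})^2$, with transition function $\Delta_n\circ\Upsilon_n^{-1}=I_n$ on $(\bigwedge^0_{*>1})^\times\oplus(\bigwedge^1_{*>1})^2$. Its body is the Riemann sphere. $\mathrm{Aut}(S^2\hat{\mathbb{C}}(n))$ is the group of N=2 superconformal automorphisms of $S^2\hat{\mathbb{C}}(n)$. For $T$ in this group, $T_\Delta=\Delta_n\circ T\circ\Delta_n^{-1}$ (where defined) is an N=2 superconformal function. *)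

theory Defs
  imports "HOL-Complex_Analysis.Complex_Analysis" "HOL-Library.Extended_Nat"
begin

section \<open>Grassmann algebras\<close>

text \<open>
  The type \<open>gr\<close> is the algebra \<open>\<And>\<^sub>\<infinity>\<close>.  An element is the finitely supported family of its
  coefficients with respect to the basis of monomials
  \<open>\<zeta>\<^bsub>a\<^sub>1\<^esub> \<cdots> \<zeta>\<^bsub>a\<^sub>s\<^esub>\<close> with \<open>a\<^sub>1 < \<dots> < a\<^sub>s\<close>, indexed by the finite sets \<open>{a\<^sub>1, \<dots>, a\<^sub>s}\<close>.
  Generators are numbered from 0, so \<open>i :: nat\<close> stands for \<open>\<zeta>\<^bsub>i+1\<^esub>\<close>.
\<close>

typedef gr = "{f :: nat set \<Rightarrow> complex. finite {A. f A \<noteq> 0} \<and> (\<forall>A. f A \<noteq> 0 \<longrightarrow> finite A)}"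
  morphisms gr_coeff Abs_gr
  by (rule exI[of _ "\<lambda>_. 0"]) auto

text \<open>\<open>\<zeta>\<^sub>A \<zeta>\<^sub>B = gr_sign A B \<zeta>\<^bsub>A \<union> B\<^esub>\<close> for disjoint \<open>A\<close>, \<open>B\<close>.\<close>

definition gr_sign :: "nat set \<Rightarrow> nat set \<Rightarrow> complex" where
  "gr_sign A B = (- 1) ^ card {(i, j). i \<in> A \<and> j \<in> B \<and> j < i}"

lemma gr_eqI: "(\<And>A. gr_coeff a A = gr_coeff b A) \<Longrightarrow> a = b"
  by (simp add: gr_coeff_inject[symmetric] fun_eq_iff)

lemma gr_coeff_infinite: "infinite A \<Longrightarrow> gr_coeff a A = 0"
  using gr_coeff[of a] by auto

lemma gr_coeff_finite_support: "finite {A. gr_coeff a A \<noteq> 0}"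
  using gr_coeff[of a] by auto

instantiation gr :: "{zero, one, plus, minus, uminus, times}"
begin

definition zero_gr :: gr where "0 = Abs_gr (\<lambda>_. 0)"

definition one_gr :: gr where "1 = Abs_gr (\<lambda>A. if A = {} then 1 else 0)"

definition plus_gr :: "gr \<Rightarrow> gr \<Rightarrow> gr" where
  "a + b = Abs_gr (\<lambda>A. gr_coeff a A + gr_coeff b A)"

definition minus_gr :: "gr \<Rightarrow> gr \<Rightarrow> gr" where
  "a - b = Abs_gr (\<lambda>A. gr_coeff a A - gr_coeff b A)"

definition uminus_gr :: "gr \<Rightarrow> gr" where
  "- a = Abs_gr (\<lambda>A. - gr_coeff a A)"

definition times_gr :: "gr \<Rightarrow> gr \<Rightarrow> gr" where
  "a * b = Abs_gr (\<lambda>C. \<Sum>A\<in>Pow C. gr_sign A (C - A) * gr_coeff a A * gr_coeff b (C - A))"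

instance ..
end

lemma gr_coeff_zero [simp]: "gr_coeff 0 A = 0"
  by (simp add: zero_gr_def Abs_gr_inverse)

lemma gr_coeff_one: "gr_coeff 1 A = (if A = {} then 1 else 0)"
  by (simp add: one_gr_def Abs_gr_inverse)

lemma gr_coeff_add [simp]: "gr_coeff (a + b) A = gr_coeff a A + gr_coeff b A"
proof -
  have "finite {A. gr_coeff a A + gr_coeff b A \<noteq> 0}"
    by (rule finite_subset[of _ "{A. gr_coeff a A \<noteq> 0} \<union> {A. gr_coeff b A \<noteq> 0}"])
       (auto simp: gr_coeff_finite_support)
  moreover have "finite A" if "gr_coeff a A + gr_coeff b A \<noteq> 0" for A
    using that gr_coeff_infinite[of A] by (cases "finite A") auto
  ultimately show ?thesis
    unfolding plus_gr_def by (subst Abs_gr_inverse) auto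
qed

lemma gr_coeff_uminus [simp]: "gr_coeff (- a) A = - gr_coeff a A"
  unfolding uminus_gr_def
  by (subst Abs_gr_inverse) (use gr_coeff_finite_support gr_coeff_infinite in auto)

lemma gr_coeff_diff [simp]: "gr_coeff (a - b) A = gr_coeff a A - gr_coeff b A"
proof -
  have "a - b = a + (- b)"
    by (simp add: minus_gr_def plus_gr_def)
  then show ?thesis by simp
qed

lemma gr_coeff_times:
  "gr_coeff (a * b) C = (\<Sum>A\<in>Pow C. gr_sign A (C - A) * gr_coeff a A * gr_coeff b (C - A))"
proof -
  let ?f = "\<lambda>C. \<Sum>A\<in>Pow C. gr_sign A (C - A) * gr_coeff a A * gr_coeff b (C - A)"
  let ?S = "(\<lambda>(A, B). A \<union> B) ` ({A. gr_coeff a A \<noteq> 0} \<times> {B. gr_coeff b B \<noteq> 0})"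
  have "{C. ?f C \<noteq> 0} \<subseteq> ?S"
  proof
    fix C assume "C \<in> {C. ?f C \<noteq> 0}"
    then obtain A where "A \<subseteq> C" "gr_coeff a A \<noteq> 0" "gr_coeff b (C - A) \<noteq> 0"
      by (auto elim!: sum.not_neutral_contains_not_neutral)
    then show "C \<in> ?S" by (intro image_eqI[of _ _ "(A, C - A)"]) auto
  qed
  then have "finite {C. ?f C \<noteq> 0}"
    by (rule finite_subset) (simp add: gr_coeff_finite_support)
  moreover have "finite C" if "?f C \<noteq> 0" for C
    using that by (metis sum.infinite finite_Pow_iff)
  ultimately show ?thesis
    unfolding times_gr_def by (subst Abs_gr_inverse) auto
qed

lemma gr_sign_empty [simp]: "gr_sign {} B = 1" "gr_sign A {} = 1"
  by (simp_all add: gr_sign_def)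

lemma gr_sign_Un_left:
  assumes "finite A" "finite B" "finite C" "A \<inter> B = {}"
  shows "gr_sign (A \<union> B) C = gr_sign A C * gr_sign B C"
proof -
  let ?I = "\<lambda>A C. {(i, j). i \<in> A \<and> j \<in> C \<and> j < (i::nat)}"
  have "?I (A \<union> B) C = ?I A C \<union> ?I B C" "?I A C \<inter> ?I B C = {}"
    using assms(4) by auto
  moreover have "finite (?I A C)" "finite (?I B C)"
    by (rule finite_subset[of _ "A \<times> C"], use assms in auto)
       (rule finite_subset[of _ "B \<times> C"], use assms in auto)
  ultimately show ?thesis
    by (simp add: gr_sign_def card_Un_disjoint power_add)
qed

lemma gr_sign_Un_right:
  assumes "finite A" "finite B" "finite C" "B \<inter> C = {}"
  shows "gr_sign A (B \<union> C) = gr_sign A B * gr_sign A C"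
proof -
  let ?I = "\<lambda>A C. {(i, j). i \<in> A \<and> j \<in> C \<and> j < (i::nat)}"
  have "?I A (B \<union> C) = ?I A B \<union> ?I A C" "?I A B \<inter> ?I A C = {}"
    using assms(4) by auto
  moreover have "finite (?I A B)" "finite (?I A C)"
    by (rule finite_subset[of _ "A \<times> B"], use assms in auto)
       (rule finite_subset[of _ "A \<times> C"], use assms in auto)
  ultimately show ?thesis
    by (simp add: gr_sign_def card_Un_disjoint power_add)
qed

lemma gr_mult_assoc: "(a * b) * c = a * (b * (c :: gr))"
proof (rule gr_eqI)
  fix D
  show "gr_coeff (a * b * c) D = gr_coeff (a * (b * c)) D"
  proof (cases "finite D")
    case False
    then show ?thesis by (simp add: gr_coeff_infinite)
  next
    case fin: True
    let ?t = "\<lambda>A B E. gr_sign A B * gr_sign A E * gr_sign B E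
                * gr_coeff a A * gr_coeff b B * gr_coeff c E"
    have L: "gr_coeff (a * b * c) D
        = (\<Sum>(C, A)\<in>(SIGMA C:Pow D. Pow C). ?t A (C - A) (D - C))"
    proof -
      have "gr_coeff (a * b * c) D
          = (\<Sum>C\<in>Pow D. \<Sum>A\<in>Pow C. gr_sign C (D - C) * (gr_sign A (C - A) * gr_coeff a A
               * gr_coeff b (C - A)) * gr_coeff c (D - C))"
        by (simp add: gr_coeff_times sum_distrib_left sum_distrib_right)
      also have "\<dots> = (\<Sum>C\<in>Pow D. \<Sum>A\<in>Pow C. ?t A (C - A) (D - C))"
      proof (intro sum.cong refl)
        fix C A assume CA: "C \<in> Pow D" "A \<in> Pow C"
        then have "finite A" "finite (C - A)" "finite (D - C)" "A \<union> (C - A) = C"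
          using fin by (auto intro: finite_subset)
        then have "gr_sign C (D - C) = gr_sign A (D - C) * gr_sign (C - A) (D - C)"
          using gr_sign_Un_left[of A "C - A" "D - C"] by auto
        then show "gr_sign C (D - C) * (gr_sign A (C - A) * gr_coeff a A
               * gr_coeff b (C - A)) * gr_coeff c (D - C) = ?t A (C - A) (D - C)"
          by simp
      qed
      also have "\<dots> = (\<Sum>(C, A)\<in>(SIGMA C:Pow D. Pow C). ?t A (C - A) (D - C))"
        using fin by (intro sum.Sigma) (auto intro: finite_subset)
      finally show ?thesis .
    qed
    have R: "gr_coeff (a * (b * c)) D
        = (\<Sum>(A, B)\<in>(SIGMA A:Pow D. Pow (D - A)). ?t A B (D - A - B))"
    proof -
      have "gr_coeff (a * (b * c)) D
          = (\<Sum>A\<in>Pow D. \<Sum>B\<in>Pow (D - A). gr_sign A (D - A) * gr_coeff a A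
               * (gr_sign B (D - A - B) * gr_coeff b B * gr_coeff c (D - A - B)))"
        by (simp add: gr_coeff_times sum_distrib_left sum_distrib_right)
      also have "\<dots> = (\<Sum>A\<in>Pow D. \<Sum>B\<in>Pow (D - A). ?t A B (D - A - B))"
      proof (intro sum.cong refl)
        fix A B assume AB: "A \<in> Pow D" "B \<in> Pow (D - A)"
        then have "finite A" "finite B" "finite (D - A - B)" "B \<union> (D - A - B) = D - A"
          using fin by (auto intro: finite_subset)
        then have "gr_sign A (D - A) = gr_sign A B * gr_sign A (D - A - B)"
          using gr_sign_Un_right[of A B "D - A - B"] by auto
        then show "gr_sign A (D - A) * gr_coeff a A
               * (gr_sign B (D - A - B) * gr_coeff b B * gr_coeff c (D - A - B))
             = ?t A B (D - A - B)"
          by simp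
      qed
      also have "\<dots> = (\<Sum>(A, B)\<in>(SIGMA A:Pow D. Pow (D - A)). ?t A B (D - A - B))"
        using fin by (intro sum.Sigma) (auto intro: finite_subset)
      finally show ?thesis .
    qed
    show ?thesis
      unfolding L R
      by (rule sum.reindex_bij_witness[of _ "\<lambda>(A, B). (A \<union> B, A)" "\<lambda>(C, A). (A, C - A)"])
         (auto simp: Diff_Diff_Int intro!: arg_cong2[where f = "(*)"] arg_cong[where f = "gr_coeff c"]
            arg_cong[where f = "gr_sign _"])
  qed
qed

instance gr :: ring_1
proof
  fix a b c :: gr
  show "a + b + c = a + (b + c)" "a + b = b + a" "0 + a = a" "- a + a = 0" "a - b = a + - b"
    by (auto intro: gr_eqI)
  show "a * b * c = a * (b * c)" by (rule gr_mult_assoc)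
  show "(a + b) * c = a * c + b * c" "a * (b + c) = a * b + a * c"
    by (auto intro!: gr_eqI simp: gr_coeff_times algebra_simps sum.distrib)
  show "1 * a = a"
  proof (rule gr_eqI)
    fix C show "gr_coeff (1 * a) C = gr_coeff a C"
    proof (cases "finite C")
      case True
      have "gr_coeff (1 * a) C = (\<Sum>A\<in>Pow C. if A = {} then gr_coeff a C else 0)"
        unfolding gr_coeff_times by (rule sum.cong) (auto simp: gr_coeff_one)
      with True show ?thesis by simp
    qed (simp add: gr_coeff_infinite)
  qed
  show "a * 1 = a"
  proof (rule gr_eqI)
    fix C show "gr_coeff (a * 1) C = gr_coeff a C"
    proof (cases "finite C")
      case True
      have "gr_coeff (a * 1) C = (\<Sum>A\<in>Pow C. if A = C then gr_coeff a C else 0)"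
        unfolding gr_coeff_times by (rule sum.cong) (auto simp: gr_coeff_one)
      with True show ?thesis by simp
    qed (simp add: gr_coeff_infinite)
  qed
  show "(0::gr) \<noteq> 1"
    by (metis gr_coeff_zero gr_coeff_one zero_neq_one)
qed

text \<open>The value 0 on non-invertible elements is a convention.  Wherever a quotient occurs below,
  the denominator is an invertible even, hence central, element.\<close>

instantiation gr :: inverse
begin

definition inverse_gr :: "gr \<Rightarrow> gr" where
  "inverse (a :: gr) = (if \<exists>b. a * b = 1 \<and> b * a = 1 then THE b. a * b = 1 \<and> b * a = 1 else 0)"

definition divide_gr :: "gr \<Rightarrow> gr \<Rightarrow> gr" where
  "(a :: gr) div b = a * inverse b"

instance ..
end

definition gr_of_complex :: "complex \<Rightarrow> gr" where
  "gr_of_complex x = Abs_gr (\<lambda>A. if A = {} then x else 0)"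

definition gr_mono :: "nat set \<Rightarrow> gr" where
  "gr_mono A = Abs_gr (\<lambda>B. if B = A \<and> finite A then 1 else 0)"

definition gr_body :: "gr \<Rightarrow> complex" where
  "gr_body a = gr_coeff a {}"

definition gr_soul :: "gr \<Rightarrow> gr" where
  "gr_soul a = a - gr_of_complex (gr_body a)"

text \<open>\<open>gr_alg L\<close> is \<open>\<And>\<^sub>L\<close>, where \<open>L = \<infinity>\<close> is allowed.  As \<open>\<infinity> - 2 = \<infinity>\<close> on \<open>enat\<close>, the algebra
  \<open>\<And>\<^bsub>*-2\<^esub>\<close> is \<open>gr_alg (L - 2)\<close> in both cases.\<close>

definition gr_alg :: "enat \<Rightarrow> gr set" where
  "gr_alg L = {a. \<forall>A. gr_coeff a A \<noteq> 0 \<longrightarrow> (\<forall>i\<in>A. enat i < L)}"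

definition gr_even :: "enat \<Rightarrow> gr set" where
  "gr_even L = {a \<in> gr_alg L. \<forall>A. gr_coeff a A \<noteq> 0 \<longrightarrow> even (card A)}"

definition gr_odd :: "enat \<Rightarrow> gr set" where
  "gr_odd L = {a \<in> gr_alg L. \<forall>A. gr_coeff a A \<noteq> 0 \<longrightarrow> odd (card A)}"

definition gr_even_units :: "enat \<Rightarrow> gr set" where
  "gr_even_units L = {a \<in> gr_even L. \<exists>b\<in>gr_even L. a * b = 1 \<and> b * a = 1}"


section \<open>Superfunctions\<close>

text \<open>The sum over \<open>l\<close> is finite, as the soul is nilpotent.\<close>

definition gr_extend :: "(complex \<Rightarrow> complex) \<Rightarrow> gr \<Rightarrow> gr" where
  "gr_extend f z = (\<Sum>l | gr_soul z ^ l \<noteq> 0.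
     gr_of_complex ((deriv ^^ l) f (gr_body z) / fact l) * gr_soul z ^ l)"

text \<open>
  A superanalytic (1,0)-superfunction \<open>\<Sum>\<^bsub>(k)\<^esub> f\<^bsub>(k)\<^esub>(z) \<zeta>\<^bsub>k\<^sub>1\<^esub> \<cdots> \<zeta>\<^bsub>k\<^sub>s\<^esub>\<close> is encoded by its family of
  coefficient functions \<open>f\<^bsub>(k)\<^esub> : U \<rightarrow> \<complex>\<close>, packed into one function \<open>\<phi> : U \<rightarrow> \<And>\<^bsub>*-2\<^esub>\<close> with
  \<open>\<phi>(w) = \<Sum>\<^bsub>(k)\<^esub> f\<^bsub>(k)\<^esub>(w) \<zeta>\<^bsub>k\<^sub>1\<^esub> \<cdots> \<zeta>\<^bsub>k\<^sub>s\<^esub>\<close>, that is, \<open>f\<^bsub>(k)\<^esub> = sf_comp \<phi> k\<close>.  The open set \<open>U\<close> is the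
  body of the domain, and \<open>sf_val \<phi> z\<close> is the value of the superfunction at an even \<open>z\<close> with
  body in \<open>U\<close>.  In \<open>sf_val\<close> and \<open>sf_deriv\<close> only finitely many coefficient functions contribute at a
  point: since \<open>\<phi>\<close> takes values in \<open>\<And>\<^sub>\<infinity>\<close>, only countably many finite sets can occur as
  support of \<open>\<phi>(w)\<close>, and so by the identity theorem only finitely many \<open>f\<^bsub>(k)\<^esub>\<close> are nonzero on a
  connected component of \<open>U\<close>.
\<close>

type_synonym sfun = "complex \<Rightarrow> gr"

definition sf_comp :: "sfun \<Rightarrow> nat set \<Rightarrow> complex \<Rightarrow> complex" where
  "sf_comp \<phi> k w = gr_coeff (\<phi> w) k"

definition superanalytic :: "enat \<Rightarrow> complex set \<Rightarrow> sfun \<Rightarrow> bool" where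
  "superanalytic L U \<phi> \<longleftrightarrow> open U \<and> (\<forall>w\<in>U. \<phi> w \<in> gr_alg (L - 2)) \<and>
     (\<forall>k. sf_comp \<phi> k holomorphic_on U)"

definition sf_val :: "sfun \<Rightarrow> gr \<Rightarrow> gr" where
  "sf_val \<phi> z = (\<Sum>k | gr_extend (sf_comp \<phi> k) z \<noteq> 0. gr_extend (sf_comp \<phi> k) z * gr_mono k)"

definition sf_deriv :: "sfun \<Rightarrow> sfun" where
  "sf_deriv \<phi> w = Abs_gr (\<lambda>k. deriv (sf_comp \<phi> k) w)"

definition sf_even :: "enat \<Rightarrow> complex set \<Rightarrow> sfun \<Rightarrow> bool" where
  "sf_even L U \<phi> \<longleftrightarrow> superanalytic L U \<phi> \<and> (\<forall>w\<in>U. \<phi> w \<in> gr_even (L - 2))"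

definition sf_odd :: "enat \<Rightarrow> complex set \<Rightarrow> sfun \<Rightarrow> bool" where
  "sf_odd L U \<phi> \<longleftrightarrow> superanalytic L U \<phi> \<and> (\<forall>w\<in>U. \<phi> w \<in> gr_odd (L - 2))"

text \<open>The quadruple \<open>(f\<^sub>0, f\<^sub>1, f\<^sub>2, f\<^sub>3)\<close> encodes the (1,2)-superfunction
  \<open>f\<^sub>0(z) + \<theta>\<^sup>+ f\<^sub>1(z) + \<theta>\<^sup>- f\<^sub>2(z) + \<theta>\<^sup>+ \<theta>\<^sup>- f\<^sub>3(z)\<close>; a point \<open>(z, \<theta>\<^sup>+, \<theta>\<^sup>-)\<close> is written
  \<open>(z, p, m)\<close>.\<close>

type_synonym sfun2 = "sfun \<times> sfun \<times> sfun \<times> sfun"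
type_synonym spoint = "gr \<times> gr \<times> gr"

fun superanalytic2 :: "enat \<Rightarrow> complex set \<Rightarrow> sfun2 \<Rightarrow> bool" where
  "superanalytic2 L U (f0, f1, f2, f3) \<longleftrightarrow> superanalytic L U f0 \<and> superanalytic L U f1 \<and>
     superanalytic L U f2 \<and> superanalytic L U f3"

fun sf2_val :: "sfun2 \<Rightarrow> spoint \<Rightarrow> gr" where
  "sf2_val (f0, f1, f2, f3) (z, p, m) =
     sf_val f0 z + p * sf_val f1 z + m * sf_val f2 z + p * m * sf_val f3 z"

text \<open>Left derivatives: \<open>\<partial>/\<partial>\<theta>\<^sup>- (\<theta>\<^sup>+ \<theta>\<^sup>- f\<^sub>3) = - \<theta>\<^sup>+ f\<^sub>3\<close>.\<close>

fun dtheta_plus :: "sfun2 \<Rightarrow> sfun2" where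
  "dtheta_plus (f0, f1, f2, f3) = (f1, (\<lambda>_. 0), f3, (\<lambda>_. 0))"

fun dtheta_minus :: "sfun2 \<Rightarrow> sfun2" where
  "dtheta_minus (f0, f1, f2, f3) = (f2, (\<lambda>w. - f3 w), (\<lambda>_. 0), (\<lambda>_. 0))"

fun dz :: "sfun2 \<Rightarrow> sfun2" where
  "dz (f0, f1, f2, f3) = (sf_deriv f0, sf_deriv f1, sf_deriv f2, sf_deriv f3)"

definition D_plus :: "sfun2 \<Rightarrow> spoint \<Rightarrow> gr" where
  "D_plus F = (\<lambda>(z, p, m). sf2_val (dtheta_plus F) (z, p, m) + m * sf2_val (dz F) (z, p, m))"

definition D_minus :: "sfun2 \<Rightarrow> spoint \<Rightarrow> gr" where
  "D_minus F = (\<lambda>(z, p, m). sf2_val (dtheta_minus F) (z, p, m) + p * sf2_val (dz F) (z, p, m))"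


section \<open>N=2 superconformal functions\<close>

definition superspace :: "enat \<Rightarrow> spoint set" where
  "superspace L = gr_even L \<times> gr_odd L \<times> gr_odd L"

definition spoint_body :: "spoint \<Rightarrow> complex" where
  "spoint_body x = gr_body (fst x)"

definition dewitt :: "enat \<Rightarrow> spoint topology" where
  "dewitt L = pullback_topology (superspace L) spoint_body euclidean"

text \<open>A superfunction with values in superspace is a partial map, whose domain is a DeWitt open
  set.\<close>

definition n2_superconformal :: "enat \<Rightarrow> (spoint \<rightharpoonup> spoint) \<Rightarrow> bool" where
  "n2_superconformal L H \<longleftrightarrow> openin (dewitt L) (dom H) \<and> ran H \<subseteq> superspace L \<and>
     (\<exists>Z P M. superanalytic2 L (spoint_body ` dom H) Z \<and>
        superanalytic2 L (spoint_body ` dom H) P \<and>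
        superanalytic2 L (spoint_body ` dom H) M \<and>
        (\<forall>x\<in>dom H. H x = Some (sf2_val Z x, sf2_val P x, sf2_val M x)) \<and>
        (\<forall>x\<in>dom H. D_plus M x = 0) \<and>
        (\<forall>x\<in>dom H. D_minus P x = 0) \<and>
        (\<forall>x\<in>dom H. D_plus Z x - sf2_val M x * D_plus P x = 0) \<and>
        (\<forall>x\<in>dom H. D_minus Z x - sf2_val P x * D_minus M x = 0) \<and>
        (\<exists>x\<in>dom H. D_plus P x \<noteq> 0) \<and>
        (\<exists>x\<in>dom H. D_minus M x \<noteq> 0))"

text \<open>The even points of the domain of \<open>H\<close>: the domain of the component functions of \<open>H\<close>.\<close>

definition even_dom :: "(spoint \<rightharpoonup> spoint) \<Rightarrow> gr set" where
  "even_dom H = {z. (z, 0, 0) \<in> dom H}"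

text \<open>\<open>f, gp, gm, pp, pm\<close> are the component functions \<open>f, g\<^sup>+, g\<^sup>-, \<psi>\<^sup>+, \<psi>\<^sup>-\<close> of \<open>H\<close>.\<close>

definition n2_components ::
  "enat \<Rightarrow> (spoint \<rightharpoonup> spoint) \<Rightarrow> sfun \<Rightarrow> sfun \<Rightarrow> sfun \<Rightarrow> sfun \<Rightarrow> sfun \<Rightarrow> bool" where
  "n2_components L H f gp gm pp pm \<longleftrightarrow>
     (let U = spoint_body ` dom H in
        sf_even L U f \<and> sf_even L U gp \<and> sf_even L U gm \<and> sf_odd L U pp \<and> sf_odd L U pm \<and>
        (\<forall>z\<in>even_dom H. sf_val (sf_deriv f) z =
            sf_val (sf_deriv pp) z * sf_val pm z - sf_val pp z * sf_val (sf_deriv pm) z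
            + sf_val gp z * sf_val gm z) \<and>
        (\<forall>(z, p, m)\<in>dom H. H (z, p, m) = Some
           (sf_val f z + p * sf_val gp z * sf_val pm z + m * sf_val gm z * sf_val pp z
              + p * m * sf_val (sf_deriv (\<lambda>w. pp w * pm w)) z,
            sf_val pp z + p * sf_val gp z + p * m * sf_val (sf_deriv pp) z,
            sf_val pm z + m * sf_val gm z - p * m * sf_val (sf_deriv pm) z)))"


section \<open>N=2 superconformal super-Riemann surfaces\<close>

text \<open>A chart is a pair of a coordinate neighbourhood and a coordinate map.  A surface is given by
  its topology \<open>X\<close> and an atlas \<open>A\<close>.\<close>

type_synonym 's chart = "'s set \<times> ('s \<Rightarrow> spoint)"

text \<open>The expression \<open>\<psi> \<circ> T \<circ> \<phi>\<^sup>-\<^sup>1\<close> of \<open>T\<close> in charts \<open>(U, \<phi>)\<close> and \<open>(V, \<psi>)\<close>, defined on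
  \<open>\<phi>(U \<inter> T\<^sup>-\<^sup>1(V))\<close>.\<close>

fun coord_expr :: "'s chart \<Rightarrow> 't chart \<Rightarrow> ('s \<Rightarrow> 't) \<Rightarrow> (spoint \<rightharpoonup> spoint)" where
  "coord_expr (U, \<phi>) (V, \<psi>) T =
     (\<lambda>x. if x \<in> \<phi> ` {y \<in> U. T y \<in> V} then Some (\<psi> (T (inv_into U \<phi> x))) else None)"

definition n2_superconformal_in_charts ::
  "enat \<Rightarrow> 's chart \<Rightarrow> 't chart \<Rightarrow> ('s \<Rightarrow> 't) \<Rightarrow> bool" where
  "n2_superconformal_in_charts L c d T \<longleftrightarrow>
     {y \<in> fst c. T y \<in> fst d} \<noteq> {} \<longrightarrow> n2_superconformal L (coord_expr c d T)"

definition is_chart :: "enat \<Rightarrow> 's topology \<Rightarrow> 's chart \<Rightarrow> bool" where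
  "is_chart L X = (\<lambda>(U, \<phi>). openin X U \<and> openin (dewitt L) (\<phi> ` U) \<and>
     homeomorphic_map (subtopology X U) (subtopology (dewitt L) (\<phi> ` U)) \<phi>)"

definition charts_compatible :: "enat \<Rightarrow> 's chart \<Rightarrow> 's chart \<Rightarrow> bool" where
  "charts_compatible L c d \<longleftrightarrow>
     n2_superconformal_in_charts L c d id \<and> n2_superconformal_in_charts L d c id"

definition n2_surface :: "enat \<Rightarrow> 's topology \<Rightarrow> 's chart set \<Rightarrow> bool" where
  "n2_surface L X A \<longleftrightarrow> (\<forall>c\<in>A. is_chart L X c) \<and> (\<Union>c\<in>A. fst c) = topspace X \<and>
     (\<forall>c\<in>A. \<forall>d\<in>A. charts_compatible L c d)"

definition maximal_atlas :: "enat \<Rightarrow> 's topology \<Rightarrow> 's chart set \<Rightarrow> 's chart set" where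
  "maximal_atlas L X A = {c. is_chart L X c \<and> (\<forall>d\<in>A. charts_compatible L c d)}"

definition n2_superconformal_map ::
  "enat \<Rightarrow> 's topology \<Rightarrow> 's chart set \<Rightarrow> 't topology \<Rightarrow> 't chart set \<Rightarrow> ('s \<Rightarrow> 't) \<Rightarrow> bool" where
  "n2_superconformal_map L X A Y B T \<longleftrightarrow> continuous_map X Y T \<and>
     (\<forall>c\<in>maximal_atlas L X A. \<forall>d\<in>maximal_atlas L Y B. n2_superconformal_in_charts L c d T)"

text \<open>Automorphisms are relevant only up to equality on \<open>topspace X\<close>.\<close>

definition n2_Aut :: "enat \<Rightarrow> 's topology \<Rightarrow> 's chart set \<Rightarrow> ('s \<Rightarrow> 's) set" where
  "n2_Aut L X A = {T. bij_betw T (topspace X) (topspace X) \<and>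
     n2_superconformal_map L X A X A T \<and>
     n2_superconformal_map L X A X A (inv_into (topspace X) T)}"


section \<open>The super-Riemann spheres\<close>

definition sphere_transition :: "enat \<Rightarrow> int \<Rightarrow> (spoint \<rightharpoonup> spoint)" where
  "sphere_transition L n = (\<lambda>(z, p, m).
     if z \<in> gr_even_units L \<and> p \<in> gr_odd L \<and> m \<in> gr_odd L
     then Some (1 / z, gr_of_complex \<i> * p * z powi n / z, gr_of_complex \<i> * m * z powi (- n) / z)
     else None)"

text \<open>\<open>X\<close> with the charts \<open>Delta\<close> and \<open>Upsilon\<close> is the sphere with parameter \<open>n\<close>.\<close>

definition n2_sphere ::
  "enat \<Rightarrow> int \<Rightarrow> 's topology \<Rightarrow> 's chart \<Rightarrow> 's chart \<Rightarrow> bool" where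
  "n2_sphere L n X Delta Upsilon \<longleftrightarrow> n2_surface L X {Delta, Upsilon} \<and>
     snd Delta ` fst Delta = superspace L \<and>
     snd Upsilon ` fst Upsilon = superspace L \<and>
     coord_expr Upsilon Delta id = sphere_transition L n"

end

theory Submission
  imports Defs
begin

text \<open>
  On bodies, an automorphism \<open>T\<close> is an injective map of the Riemann sphere to itself.  So exactly one
  point of the sphere is sent to the point at infinity.  In a source coordinate whose domain contains
  it, at \<open>w\<^sub>0\<close> say, the component functions of \<open>T\<close> are holomorphic on \<open>\<complex> - {w\<^sub>0}\<close>.  The other target
  coordinate describes \<open>T\<close> near \<open>w\<^sub>0\<close>, the other source coordinate describes it near infinity, and the
  transition function \<open>I\<^sub>n\<close> compares these descriptions (\<open>pole_data_exists\<close>).  Hence every component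
  function has poles of known order at \<open>w\<^sub>0\<close> and at infinity, and Liouville's theorem, applied to each
  coefficient, makes it rational (\<open>gr_polynomial\<close>).

  This analysis takes place at points without soul, where a superfunction is a holomorphic function
  of a complex variable with values in \<open>\<And>\<^bsub>*-2\<^esub>\<close>.  The odd variables are eliminated by comparing
  coefficients: \<open>\<And>\<^bsub>*\<^esub>\<close> contains two generators that no given finite set of elements of \<open>\<And>\<^bsub>*-2\<^esub>\<close> involves
  (\<open>theta_expansion_zero\<close>).  In the end, evaluation of superfunctions at a point \<open>z\<close> with soul is a
  ring homomorphism (\<open>sf_val_mult\<close>), because it is Taylor expansion around the body, and so the
  rational formulas hold at all even points.

  If \<open>\<alpha>\<close> is the value of \<open>f\<close> at infinity, then \<open>1 / (f - \<alpha>)\<close> has no pole at \<open>w\<^sub>0\<close> and a simple pole at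
  infinity.  So it is a linear polynomial, and \<open>f\<close> is a Moebius transformation; a square root
  normalizes its determinant (\<open>gr_moebius\<close>).  Put \<open>x = c z + d\<close>.  The transition functions say that
  \<open>x\<^bsup>n+1\<^esup> \<psi>\<^sup>-\<close> is a polynomial of degree at most \<open>n + 1\<close>, that \<open>x\<^bsup>1-n\<^esup> \<psi>\<^sup>+\<close> is a polynomial of degree at most
  \<open>1 - n\<close>, so that \<open>\<psi>\<^sup>+\<close> vanishes for \<open>n \<ge> 2\<close>, and that \<open>x\<^bsup>1-n\<^esup> g\<^sup>+\<close> and \<open>x\<^bsup>1+n\<^esup> g\<^sup>-\<close> are constant up to a
  nilpotent correction in \<open>\<psi>\<^sup>+ \<psi>\<^sup>-\<close>.  For \<open>n \<ge> 2\<close> the correction vanishes with \<open>\<psi>\<^sup>+\<close>.  For \<open>n = 1\<close> it is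
  absent from \<open>g\<^sup>+\<close>, and the equation for \<open>f'\<close> determines \<open>g\<^sup>-\<close>.  For \<open>n = 0\<close> it makes \<open>x\<^sup>2 g\<^sup>+\<close> and \<open>x\<^sup>2 g\<^sup>-\<close>
  linear polynomials that satisfy one more equation each (\<open>gp_zero\<close>); its solutions are the multiples
  of one polynomial (\<open>rational_zero_epsilon\<close>), and the equation for \<open>f'\<close> determines the product of the
  two factors.  Negative \<open>n\<close> reduce to positive ones by exchanging the two odd variables.

  If \<open>T\<close> fixes the point at infinity, the source coordinate with the pole is that of \<open>Upsilon\<close>, with
  \<open>w\<^sub>0 = 0\<close>.  The substitution \<open>w = 1 / y\<close> then carries the formulas over to the coordinate of \<open>Delta\<close>
  and replaces \<open>(a, b, c, d)\<close> by \<open>\<i> (b, a, d, c)\<close> (\<open>rational_sections_swap\<close>).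

  Uniqueness is continuity: the expression of \<open>T\<close> in the coordinate of \<open>Delta\<close> determines \<open>T\<close> over all
  but at most two points of the sphere, and component functions extend uniquely over a point
  (\<open>n2_superconformal_unique_extension\<close>).
\<close>

section \<open>The Grassmann algebra as a complex superalgebra\<close>

abbreviation gc :: "complex \<Rightarrow> gr" where "gc \<equiv> gr_of_complex"

lemma gr_coeff_gc: "gr_coeff (gc x) A = (if A = {} then x else 0)"
  unfolding gr_of_complex_def by (subst Abs_gr_inverse) auto

lemma gr_coeff_mono: "gr_coeff (gr_mono K) B = (if B = K \<and> finite K then 1 else 0)"
proof -
  have "finite {A. (if A = K \<and> finite K then 1 else (0::complex)) \<noteq> 0}"
    by (rule finite_subset[of _ "{K}"]) auto
  then show ?thesis
    unfolding gr_mono_def by (subst Abs_gr_inverse) auto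
qed

lemma gr_coeff_gc_mult [simp]: "gr_coeff (gc x * a) C = x * gr_coeff a C"
proof (cases "finite C")
  case True
  have "gr_coeff (gc x * a) C = (\<Sum>A\<in>Pow C. if A = {} then x * gr_coeff a C else 0)"
    unfolding gr_coeff_times by (rule sum.cong) (auto simp: gr_coeff_gc)
  with True show ?thesis by simp
qed (simp add: gr_coeff_infinite)

lemma gr_coeff_mult_gc [simp]: "gr_coeff (a * gc x) C = x * gr_coeff a C"
proof (cases "finite C")
  case True
  have "gr_coeff (a * gc x) C = (\<Sum>A\<in>Pow C. if A = C then x * gr_coeff a C else 0)"
    unfolding gr_coeff_times by (rule sum.cong) (auto simp: gr_coeff_gc)
  with True show ?thesis by simp
qed (simp add: gr_coeff_infinite)

lemma gc_commute: "a * gc x = gc x * a"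
  by (rule gr_eqI) simp

lemma gc_0 [simp]: "gc 0 = 0" and gc_1 [simp]: "gc 1 = 1"
  by (auto intro!: gr_eqI simp: gr_coeff_gc gr_coeff_one)

lemma gc_add: "gc (x + y) = gc x + gc y" and gc_diff: "gc (x - y) = gc x - gc y"
  and gc_minus: "gc (- x) = - gc x" and gc_mult: "gc (x * y) = gc x * gc y"
  by (auto intro!: gr_eqI simp: gr_coeff_gc)

lemma gc_power: "gc (x ^ k) = gc x ^ k"
  by (induction k) (simp_all add: gc_mult)

lemma gc_numeral: "gc (numeral k) = numeral k"
proof -
  have "gc (of_nat k) = of_nat k" for k by (induction k) (simp_all add: gc_add)
  then show ?thesis by (metis of_nat_numeral)
qed

lemma gc_cancel: "x \<noteq> 0 \<Longrightarrow> gc x * a = gc x * b \<longleftrightarrow> a = b"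
  by (metis gc_1 gc_mult left_inverse mult.assoc mult_1)

lemma gr_coeff_sum [simp]: "gr_coeff (sum f I) A = (\<Sum>i\<in>I. gr_coeff (f i) A)"
  by (induction I rule: infinite_finite_induct) auto

lemma gr_body_simps [simp]:
  "gr_body 0 = 0" "gr_body 1 = 1" "gr_body (gc x) = x"
  "gr_body (a + b) = gr_body a + gr_body b" "gr_body (a - b) = gr_body a - gr_body b"
  "gr_body (- a) = - gr_body a" "gr_body (a * b) = gr_body a * gr_body b"
  by (simp_all add: gr_body_def gr_coeff_one gr_coeff_gc gr_coeff_times)

lemma gr_body_power [simp]: "gr_body (a ^ k) = gr_body a ^ k"
  by (induction k) auto

lemma gr_body_numeral [simp]: "gr_body (numeral k) = numeral k"
  by (metis gc_numeral gr_body_simps(3))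

lemma gr_body_sum [simp]: "gr_body (sum f I) = (\<Sum>i\<in>I. gr_body (f i))"
  by (simp add: gr_body_def)

lemma gr_soul_decomp: "a = gc (gr_body a) + gr_soul a"
  by (simp add: gr_soul_def)

lemma gr_body_soul [simp]: "gr_body (gr_soul a) = 0"
  by (simp add: gr_soul_def)

lemma gr_soul_gc [simp]: "gr_soul (gc w) = 0"
  by (simp add: gr_soul_def)

lemma gr_coeff_times_nonzeroE:
  assumes "gr_coeff (a * b) C \<noteq> 0"
  obtains A B where "finite C" "C = A \<union> B" "A \<inter> B = {}" "gr_coeff a A \<noteq> 0" "gr_coeff b B \<noteq> 0"
proof -
  have fin: "finite C" using assms gr_coeff_infinite by blast
  from assms obtain A where "A \<in> Pow C" "gr_sign A (C - A) * gr_coeff a A * gr_coeff b (C - A) \<noteq> 0"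
    unfolding gr_coeff_times by (meson sum.not_neutral_contains_not_neutral)
  then show thesis by (intro that[of A "C - A"] fin) auto
qed

subsection \<open>Parity\<close>

lemma gr_sign_swap:
  assumes "finite A" "finite B" "A \<inter> B = {}"
  shows "gr_sign A B * gr_sign B A = (- 1) ^ (card A * card B)"
proof -
  let ?I = "\<lambda>A B. {(i, j). i \<in> A \<and> j \<in> B \<and> j < (i::nat)}"
  have fin: "finite (?I A B)" "finite (?I B A)"
    by (rule finite_subset[of _ "A \<times> B"], use assms in auto)
       (rule finite_subset[of _ "B \<times> A"], use assms in auto)
  have "bij_betw prod.swap (?I B A) {(i, j). i \<in> A \<and> j \<in> B \<and> i < j}"
    by (rule bij_betwI[of _ _ _ prod.swap]) auto
  then have c: "card (?I B A) = card {(i, j). i \<in> A \<and> j \<in> B \<and> i < j}"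
    by (rule bij_betw_same_card)
  have "i \<noteq> j" if "i \<in> A" "j \<in> B" for i j using that assms(3) by auto
  then have "A \<times> B = ?I A B \<union> {(i, j). i \<in> A \<and> j \<in> B \<and> i < j}"
    by (auto simp: not_less nat_neq_iff)
  moreover have "finite {(i, j). i \<in> A \<and> j \<in> B \<and> i < j}"
    by (rule finite_subset[of _ "A \<times> B"]) (use assms in auto)
  moreover have "?I A B \<inter> {(i, j). i \<in> A \<and> j \<in> B \<and> i < j} = {}"
    by auto
  ultimately have "card (A \<times> B) = card (?I A B) + card {(i, j). i \<in> A \<and> j \<in> B \<and> i < j}"
    using card_Un_disjoint[OF fin(1)] by simp
  then show ?thesis
    using c by (simp add: gr_sign_def power_add[symmetric] card_cartesian_product)
qed

lemma gr_sign_sq: "gr_sign A B * gr_sign A B = 1"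
  by (simp add: gr_sign_def flip: power_mult_distrib)

lemma gr_coeff_times_swap:
  "gr_coeff (b * a) C = (\<Sum>A\<in>Pow C. gr_sign (C - A) A * gr_coeff a A * gr_coeff b (C - A))"
proof -
  have "gr_coeff (b * a) C = (\<Sum>A\<in>Pow C. gr_sign A (C - A) * gr_coeff b A * gr_coeff a (C - A))"
    by (rule gr_coeff_times)
  also have "\<dots> = (\<Sum>A\<in>Pow C. gr_sign (C - A) A * gr_coeff a A * gr_coeff b (C - A))"
    by (rule sum.reindex_bij_witness[of _ "\<lambda>A. C - A" "\<lambda>A. C - A"])
       (auto simp: Diff_Diff_Int Int_absorb1)
  finally show ?thesis .
qed

lemma gr_even_commute:
  assumes "a \<in> gr_even L" shows "b * a = a * b"
proof (rule gr_eqI)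
  fix C
  show "gr_coeff (b * a) C = gr_coeff (a * b) C"
  proof (cases "finite C")
    case True
    have "gr_sign (C - A) A * gr_coeff a A = gr_sign A (C - A) * gr_coeff a A" if "A \<subseteq> C" for A
    proof (cases "gr_coeff a A = 0")
      case False
      then have "even (card A)" using assms by (auto simp: gr_even_def)
      moreover have "finite A" "finite (C - A)" using True that finite_subset by auto
      ultimately have "gr_sign A (C - A) * gr_sign (C - A) A = 1"
        by (subst gr_sign_swap) auto
      then show ?thesis by (metis gr_sign_sq mult.assoc mult.left_neutral mult.right_neutral)
    qed simp
    then show ?thesis
      unfolding gr_coeff_times_swap[of b a] gr_coeff_times[of a b]
      by (intro sum.cong) auto
  qed (simp add: gr_coeff_infinite)
qed

lemma gr_odd_anticommute:
  assumes "a \<in> gr_odd L" "b \<in> gr_odd L'" shows "b * a = - (a * b)"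
proof (rule gr_eqI)
  fix C
  show "gr_coeff (b * a) C = gr_coeff (- (a * b)) C"
  proof (cases "finite C")
    case True
    have "gr_sign (C - A) A * gr_coeff a A * gr_coeff b (C - A)
        = - (gr_sign A (C - A) * gr_coeff a A * gr_coeff b (C - A))" if "A \<subseteq> C" for A
    proof (cases "gr_coeff a A = 0 \<or> gr_coeff b (C - A) = 0")
      case False
      then have "odd (card A)" "odd (card (C - A))" using assms by (auto simp: gr_odd_def)
      moreover have "finite A" "finite (C - A)" using True that finite_subset by auto
      ultimately have "gr_sign A (C - A) * gr_sign (C - A) A = - 1"
        by (subst gr_sign_swap) auto
      then have "gr_sign (C - A) A = - gr_sign A (C - A)"
        by (metis gr_sign_sq mult.assoc mult.left_neutral mult.right_neutral mult_minus_right)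
      then show ?thesis by simp
    qed auto
    then show ?thesis
      unfolding gr_coeff_times_swap[of b a] gr_coeff_uminus gr_coeff_times[of a b] sum_negf[symmetric]
      by (intro sum.cong) auto
  qed (simp add: gr_coeff_infinite)
qed

lemma gr_odd_square:
  assumes "a \<in> gr_odd L" shows "a * a = 0"
proof (rule gr_eqI)
  fix A
  have "a * a = - (a * a)" using gr_odd_anticommute[OF assms assms] .
  then have "gr_coeff (a * a) A = - gr_coeff (a * a) A" by (metis gr_coeff_uminus)
  then show "gr_coeff (a * a) A = gr_coeff 0 A" by simp
qed

lemma gr_alg_mono: "L \<le> L' \<Longrightarrow> gr_alg L \<subseteq> gr_alg L'"
  by (auto simp: gr_alg_def) (metis less_le_trans)

lemma enat_minus_le: "L - 2 \<le> (L :: enat)"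
  by (cases L) (auto simp: numeral_eq_enat)

lemma gr_alg_minus: "a \<in> gr_alg (L - 2) \<Longrightarrow> a \<in> gr_alg L"
  using gr_alg_mono[OF enat_minus_le] by blast

lemma gr_even_minus: "a \<in> gr_even (L - 2) \<Longrightarrow> a \<in> gr_even L"
  by (auto simp: gr_even_def gr_alg_minus)

lemma gr_odd_minus: "a \<in> gr_odd (L - 2) \<Longrightarrow> a \<in> gr_odd L"
  by (auto simp: gr_odd_def gr_alg_minus)

lemma gr_even_alg: "a \<in> gr_even L \<Longrightarrow> a \<in> gr_alg L"
  by (simp add: gr_even_def)

lemma gr_alg_times:
  assumes "a \<in> gr_alg L" "b \<in> gr_alg L" shows "a * b \<in> gr_alg L"
  unfolding gr_alg_def
proof safe
  fix C i assume "gr_coeff (a * b) C \<noteq> 0" "i \<in> C"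
  then show "enat i < L"
    by (elim gr_coeff_times_nonzeroE) (use assms in \<open>auto simp: gr_alg_def\<close>)
qed

lemma gr_coeff_add_nonzero: "gr_coeff (a + b) A \<noteq> 0 \<Longrightarrow> gr_coeff a A \<noteq> 0 \<or> gr_coeff b A \<noteq> 0"
  by auto

lemma gr_even_gc [simp, intro]: "gc x \<in> gr_even L"
  by (auto simp: gr_even_def gr_alg_def gr_coeff_gc split: if_splits)

lemma gr_zero_mem [simp, intro]: "0 \<in> gr_even L" "0 \<in> gr_odd L" "0 \<in> gr_alg L"
  by (auto simp: gr_even_def gr_odd_def gr_alg_def)

lemma gr_even_one [simp, intro]: "1 \<in> gr_even L"
  by (metis gc_1 gr_even_gc)

lemma gr_even_numeral [simp, intro]: "numeral k \<in> gr_even L"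
  by (metis gc_numeral gr_even_gc)

lemma gr_alg_add [intro]: "a \<in> gr_alg L \<Longrightarrow> b \<in> gr_alg L \<Longrightarrow> a + b \<in> gr_alg L"
  and gr_even_add [intro]: "a \<in> gr_even L \<Longrightarrow> b \<in> gr_even L \<Longrightarrow> a + b \<in> gr_even L"
  and gr_odd_add [intro]: "a \<in> gr_odd L \<Longrightarrow> b \<in> gr_odd L \<Longrightarrow> a + b \<in> gr_odd L"
  unfolding gr_alg_def gr_even_def gr_odd_def by (blast dest: gr_coeff_add_nonzero)+

lemma gr_alg_uminus [intro]: "a \<in> gr_alg L \<Longrightarrow> - a \<in> gr_alg L"
  and gr_even_uminus [intro]: "a \<in> gr_even L \<Longrightarrow> - a \<in> gr_even L"
  and gr_odd_uminus [intro]: "a \<in> gr_odd L \<Longrightarrow> - a \<in> gr_odd L"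
  unfolding gr_alg_def gr_even_def gr_odd_def by auto

lemma gr_alg_diff [intro]: "a \<in> gr_alg L \<Longrightarrow> b \<in> gr_alg L \<Longrightarrow> a - b \<in> gr_alg L"
  and gr_even_diff [intro]: "a \<in> gr_even L \<Longrightarrow> b \<in> gr_even L \<Longrightarrow> a - b \<in> gr_even L"
  and gr_odd_diff [intro]: "a \<in> gr_odd L \<Longrightarrow> b \<in> gr_odd L \<Longrightarrow> a - b \<in> gr_odd L"
  using gr_alg_add[of a L "- b"] gr_even_add[of a L "- b"] gr_odd_add[of a L "- b"] by auto

lemma gr_even_times [intro]:
  assumes "a \<in> gr_even L" "b \<in> gr_even L" shows "a * b \<in> gr_even L"
proof -
  have "even (card C)" if "gr_coeff (a * b) C \<noteq> 0" for C
    using that by (elim gr_coeff_times_nonzeroE)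
      (use assms in \<open>auto simp: gr_even_def card_Un_disjoint\<close>)
  then show ?thesis using assms by (auto simp: gr_even_def gr_alg_times)
qed

lemma gr_even_odd_times [intro]:
  assumes "a \<in> gr_even L" "b \<in> gr_odd L" shows "a * b \<in> gr_odd L"
proof -
  have "odd (card C)" if "gr_coeff (a * b) C \<noteq> 0" for C
    using that by (elim gr_coeff_times_nonzeroE)
      (use assms in \<open>auto simp: gr_even_def gr_odd_def card_Un_disjoint\<close>)
  then show ?thesis using assms by (auto simp: gr_even_def gr_odd_def gr_alg_times)
qed

lemma gr_odd_even_times [intro]: "b \<in> gr_odd L \<Longrightarrow> a \<in> gr_even L \<Longrightarrow> b * a \<in> gr_odd L"
  using gr_even_commute gr_even_odd_times by metis

lemma gr_odd_times [intro]:
  assumes "a \<in> gr_odd L" "b \<in> gr_odd L" shows "a * b \<in> gr_even L"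
proof -
  have "even (card C)" if "gr_coeff (a * b) C \<noteq> 0" for C
    using that by (elim gr_coeff_times_nonzeroE)
      (use assms in \<open>auto simp: gr_odd_def card_Un_disjoint\<close>)
  then show ?thesis using assms by (auto simp: gr_odd_def gr_even_def gr_alg_times)
qed

lemma gr_even_power [intro]: "a \<in> gr_even L \<Longrightarrow> a ^ k \<in> gr_even L"
  by (induction k) auto

lemma gr_even_sum [intro]: "(\<And>i. i \<in> I \<Longrightarrow> f i \<in> gr_even L) \<Longrightarrow> sum f I \<in> gr_even L"
  by (induction I rule: infinite_finite_induct) auto

lemma gr_even_soul [intro]: "a \<in> gr_even L \<Longrightarrow> gr_soul a \<in> gr_even L"
  by (auto simp: gr_soul_def)

lemma gr_body_odd [simp]: "a \<in> gr_odd L \<Longrightarrow> gr_body a = 0"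
  by (auto simp: gr_body_def gr_odd_def)

subsection \<open>Nilpotent souls and inverses\<close>

lemma gr_alg_finite_generators: "\<exists>M. a \<in> gr_alg (enat M)"
proof -
  let ?S = "\<Union>{A. gr_coeff a A \<noteq> 0}"
  have "finite ?S"
    using gr_coeff_finite_support gr_coeff_infinite by (intro finite_Union) auto
  then obtain M where "\<forall>i\<in>?S. i < M" using finite_nat_set_iff_bounded by auto
  then show ?thesis by (auto simp: gr_alg_def intro!: exI[of _ M])
qed

lemma gr_coeff_power_body0:
  assumes "gr_body s = 0" "gr_coeff (s ^ l) C \<noteq> 0" shows "l \<le> card C"
  using assms(2)
proof (induction l arbitrary: C)
  case (Suc l)
  then obtain A B where AB: "finite C" "C = A \<union> B" "A \<inter> B = {}" "gr_coeff s A \<noteq> 0" "gr_coeff (s ^ l) B \<noteq> 0"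
    by (auto elim: gr_coeff_times_nonzeroE)
  then have "A \<noteq> {}" using assms(1) by (auto simp: gr_body_def)
  then have "card A > 0" using AB by (simp add: card_gt_0_iff)
  moreover have "l \<le> card B" using AB Suc by simp
  ultimately show ?case using AB by (simp add: card_Un_disjoint)
qed simp

lemma gr_alg_power: "a \<in> gr_alg L \<Longrightarrow> a ^ k \<in> gr_alg L"
proof (induction k)
  case 0
  then show ?case using gr_even_alg[OF gr_even_one] by simp
qed (simp add: gr_alg_times)

text \<open>A product of more elements without body than there are generators involves some generator
  twice in each of its terms.\<close>

lemma gr_nilpotent:
  assumes "gr_body s = 0" shows "\<exists>M. s ^ M = 0"
proof -
  obtain M where M: "s \<in> gr_alg (enat M)" using gr_alg_finite_generators by blast
  have "gr_coeff (s ^ Suc M) C = 0" for C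
  proof (rule ccontr)
    assume *: "gr_coeff (s ^ Suc M) C \<noteq> 0"
    then have "C \<subseteq> {..<M}"
      using gr_alg_power[OF M, of "Suc M"] unfolding gr_alg_def by auto
    then have "card C \<le> M" using card_mono[of "{..<M}" C] by simp
    with gr_coeff_power_body0[OF assms *] show False by simp
  qed
  then show ?thesis by (intro exI[of _ "Suc M"] gr_eqI) simp
qed

lemma gr_inverse_eqI:
  assumes "a * b = 1" "b * a = (1 :: gr)" shows "inverse a = b"
proof -
  have "(THE b. a * b = 1 \<and> b * a = 1) = b"
    using assms by (intro the_equality) (auto, metis mult.assoc mult_1_left mult_1_right)
  then show ?thesis using assms by (auto simp: inverse_gr_def)
qed

lemma gr_geometric:
  fixes u :: gr
  shows "(1 - u) * (\<Sum>i<M. u ^ i) = 1 - u ^ M" "(\<Sum>i<M. u ^ i) * (1 - u) = 1 - u ^ M"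
proof -
  show 1: "(1 - u) * (\<Sum>i<M. u ^ i) = 1 - u ^ M"
    by (induction M) (simp_all add: distrib_left left_diff_distrib)
  have "(\<Sum>i<M. u ^ i) * u = u * (\<Sum>i<M. u ^ i)"
    by (simp add: sum_distrib_left sum_distrib_right power_commutes)
  with 1 show "(\<Sum>i<M. u ^ i) * (1 - u) = 1 - u ^ M" by (simp add: algebra_simps)
qed

text \<open>The geometric series in the nilpotent soul.\<close>

lemma gr_inverse_exists:
  assumes "gr_body a \<noteq> 0"
  shows "\<exists>b. a * b = 1 \<and> b * a = 1 \<and> (\<forall>L. a \<in> gr_even L \<longrightarrow> b \<in> gr_even L)"
proof -
  let ?x = "gr_body a"
  define u where "u = 1 - gc (inverse ?x) * a"
  have "gr_body u = 0" using assms by (simp add: u_def)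
  then obtain M where M: "u ^ M = 0" using gr_nilpotent by blast
  define g where "g = (\<Sum>i<M. u ^ i)"
  have a: "gc (inverse ?x) * a = 1 - u" by (simp add: u_def)
  have 1: "gc (inverse ?x) * a * g = 1" "g * (gc (inverse ?x) * a) = 1"
    unfolding a g_def gr_geometric M by simp_all
  have "a * (gc (inverse ?x) * g) = 1"
    using 1(1) by (metis gc_commute mult.assoc)
  moreover have "gc (inverse ?x) * g * a = 1"
    using 1(2) by (metis gc_commute mult.assoc)
  moreover have "gc (inverse ?x) * g \<in> gr_even L" if "a \<in> gr_even L" for L
    using that unfolding g_def u_def by (intro gr_even_times gr_even_sum gr_even_power) auto
  ultimately show ?thesis by blast
qed

lemma gr_inverse_left [simp]: "gr_body a \<noteq> 0 \<Longrightarrow> inverse a * a = 1"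
  and gr_inverse_right [simp]: "gr_body a \<noteq> 0 \<Longrightarrow> a * inverse a = 1"
  using gr_inverse_exists gr_inverse_eqI by metis+

lemma gr_inverse_even [intro]: "gr_body a \<noteq> 0 \<Longrightarrow> a \<in> gr_even L \<Longrightarrow> inverse a \<in> gr_even L"
  using gr_inverse_exists gr_inverse_eqI by metis

lemma gr_body_inverse [simp]: "gr_body a \<noteq> 0 \<Longrightarrow> gr_body (inverse a) = inverse (gr_body a)"
  by (metis gr_body_simps(2,7) gr_inverse_left inverse_unique mult.commute)

lemma gr_unit_cancel: "gr_body a \<noteq> 0 \<Longrightarrow> a * b = a * c \<longleftrightarrow> b = (c :: gr)"
  by (metis gr_inverse_left mult.assoc mult_1)

lemma gr_even_units_iff: "a \<in> gr_even_units L \<longleftrightarrow> a \<in> gr_even L \<and> gr_body a \<noteq> 0"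
proof
  assume "a \<in> gr_even_units L"
  then obtain b where "a \<in> gr_even L" "a * b = 1" by (auto simp: gr_even_units_def)
  then show "a \<in> gr_even L \<and> gr_body a \<noteq> 0"
    by (metis gr_body_simps(2,7) mult_zero_left zero_neq_one)
qed (auto simp: gr_even_units_def gr_inverse_exists intro!: bexI[of _ "inverse a"])

lemma gc_inverse: "gc (inverse x) = inverse (gc x)"
proof (cases "x = 0")
  case False
  then show ?thesis by (intro gr_inverse_eqI[symmetric]) (simp_all flip: gc_mult)
next
  case True
  then show ?thesis by (simp add: inverse_gr_def)
qed

lemma gr_inverse_mult:
  assumes "gr_body a \<noteq> 0" "gr_body b \<noteq> 0" shows "inverse (a * b) = inverse b * inverse a"
proof (rule gr_inverse_eqI)
  show "a * b * (inverse b * inverse a) = 1"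
    using assms by (metis gr_inverse_right mult.assoc mult.right_neutral)
  show "inverse b * inverse a * (a * b) = 1"
    using assms by (metis gr_inverse_left mult.assoc mult.right_neutral)
qed

lemma gr_inverse_inverse: "gr_body a \<noteq> 0 \<Longrightarrow> inverse (inverse a) = a"
  by (rule gr_inverse_eqI) auto

lemma gr_inverse_power:
  assumes "gr_body a \<noteq> 0" shows "inverse (a ^ k) = inverse a ^ k"
proof (induction k)
  case 0
  show ?case by (simp add: gr_inverse_eqI)
next
  case (Suc k)
  then show ?case using assms by (simp add: gr_inverse_mult power_commutes)
qed

lemma gr_divide_eqI: "gr_body c \<noteq> 0 \<Longrightarrow> a * c = b \<Longrightarrow> a = b / (c :: gr)"
  by (auto simp: divide_gr_def mult.assoc)

lemma gr_divide_inverse: "a / b = a * inverse (b :: gr)"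
  by (simp add: divide_gr_def)

subsection \<open>Fresh generators\<close>

definition gr_free_of :: "nat \<Rightarrow> gr \<Rightarrow> bool" where
  "gr_free_of i a \<longleftrightarrow> (\<forall>A. gr_coeff a A \<noteq> 0 \<longrightarrow> i \<notin> A)"

abbreviation gr_zeta :: "nat \<Rightarrow> gr" where "gr_zeta i \<equiv> gr_mono {i}"

lemma gr_zeta_odd: "enat i < L \<Longrightarrow> gr_zeta i \<in> gr_odd L"
  by (auto simp: gr_odd_def gr_alg_def gr_coeff_mono split: if_splits)

lemma gr_coeff_zeta_mult:
  assumes "i \<notin> C" shows "gr_coeff (gr_zeta i * a) (insert i C) = gr_sign {i} C * gr_coeff a C"
proof (cases "finite C")
  case True
  have "gr_coeff (gr_zeta i * a) (insert i C)
      = (\<Sum>A\<in>Pow (insert i C). if A = {i} then gr_sign {i} C * gr_coeff a C else 0)"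
    unfolding gr_coeff_times using assms by (intro sum.cong) (auto simp: gr_coeff_mono)
  with True show ?thesis by simp
qed (simp add: gr_coeff_infinite)

lemma gr_sign_nonzero: "gr_sign A B \<noteq> 0"
  by (simp add: gr_sign_def)

lemma gr_zeta_cancel:
  assumes "gr_free_of i a" "gr_zeta i * a = 0" shows "a = 0"
proof (rule gr_eqI)
  fix C
  show "gr_coeff a C = gr_coeff 0 C"
    using assms gr_coeff_zeta_mult[of i C a] gr_sign_nonzero[of "{i}" C]
    by (cases "i \<in> C") (auto simp: gr_free_of_def)
qed

lemma gr_free_of_zeta_mult: "i \<noteq> j \<Longrightarrow> gr_free_of i a \<Longrightarrow> gr_free_of i (gr_zeta j * a)"
  unfolding gr_free_of_def
  by (safe, erule gr_coeff_times_nonzeroE) (auto simp: gr_coeff_mono split: if_splits)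

text \<open>For finite \<open>L\<close> the two last generators are missing from \<open>\<And>\<^bsub>L-2\<^esub>\<close>; for \<open>L = \<infinity>\<close> finitely many
  elements involve finitely many generators.\<close>

lemma gr_fresh:
  assumes "2 \<le> L" "finite F" "F \<subseteq> gr_alg (L - 2)"
  obtains i j where "i \<noteq> j" "enat i < L" "enat j < L"
    "\<And>a. a \<in> F \<Longrightarrow> gr_free_of i a" "\<And>a. a \<in> F \<Longrightarrow> gr_free_of j a"
proof (cases L)
  case (enat N)
  have N: "N \<ge> 2" using assms(1) enat by (simp add: numeral_eq_enat)
  have "gr_free_of k a" if "a \<in> F" "k \<ge> N - 2" for a k
    using that assms(3) enat by (fastforce simp: gr_free_of_def gr_alg_def numeral_eq_enat)
  then show thesis using N enat by (intro that[of "N - 2" "N - 1"]) auto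
next
  case infinity
  have "\<forall>a\<in>F. \<exists>M. a \<in> gr_alg (enat M)" using gr_alg_finite_generators by blast
  then obtain M where M: "\<And>a. a \<in> F \<Longrightarrow> a \<in> gr_alg (enat (M a))" by metis
  define K where "K = (\<Sum>a\<in>F. M a)"
  have "gr_free_of k a" if "a \<in> F" "k \<ge> K" for a k
  proof -
    have "M a \<le> K" using that assms(2) by (auto simp: K_def intro: member_le_sum)
    then show ?thesis using M[OF that(1)] that by (fastforce simp: gr_free_of_def gr_alg_def)
  qed
  then show thesis using infinity by (intro that[of K "K + 1"]) auto
qed

text \<open>Substituting for \<open>p\<close> and \<open>m\<close> zero or a generator that the coefficients do not involve
  isolates one coefficient after the other, as multiplication by such a generator is injective.\<close>

lemma theta_expansion_zero:
  assumes L: "2 \<le> L" and mem: "a \<in> gr_alg (L - 2)" "b \<in> gr_alg (L - 2)" "c \<in> gr_alg (L - 2)" "d \<in> gr_alg (L - 2)"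
    and eq: "\<And>p m. p \<in> gr_odd L \<Longrightarrow> m \<in> gr_odd L \<Longrightarrow> a + p * b + m * c + p * m * d = 0"
  shows "a = 0" "b = 0" "c = 0" "d = 0"
proof -
  obtain i j where ij: "i \<noteq> j" "enat i < L" "enat j < L"
    and fi: "gr_free_of i b" "gr_free_of i c" "gr_free_of i d"
    and fj: "gr_free_of j b" "gr_free_of j c" "gr_free_of j d"
    by (rule gr_fresh[OF L, of "{b, c, d}"]) (use mem in auto)
  show a: "a = 0" using eq[of 0 0] by simp
  show b: "b = 0"
    using eq[of "gr_zeta i" 0] ij fi a by (auto intro: gr_zeta_cancel simp: gr_zeta_odd)
  show c: "c = 0"
    using eq[of 0 "gr_zeta i"] ij fi a by (auto intro: gr_zeta_cancel simp: gr_zeta_odd)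
  have "gr_zeta i * (gr_zeta j * d) = 0"
    using eq[of "gr_zeta i" "gr_zeta j"] ij a b c by (simp add: gr_zeta_odd mult.assoc)
  then show "d = 0"
    using ij fi fj by (meson gr_zeta_cancel gr_free_of_zeta_mult)
qed

lemma theta_expansion_eq:
  assumes L: "2 \<le> L"
    and mem: "a \<in> gr_alg (L - 2)" "b \<in> gr_alg (L - 2)" "c \<in> gr_alg (L - 2)" "d \<in> gr_alg (L - 2)"
      "a' \<in> gr_alg (L - 2)" "b' \<in> gr_alg (L - 2)" "c' \<in> gr_alg (L - 2)" "d' \<in> gr_alg (L - 2)"
    and eq: "\<And>p m. p \<in> gr_odd L \<Longrightarrow> m \<in> gr_odd L \<Longrightarrow>
      a + p * b + m * c + p * m * d = a' + p * b' + m * c' + p * m * d'"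
  shows "a = a'" "b = b'" "c = c'" "d = d'"
proof -
  have "a - a' = 0" "b - b' = 0" "c - c' = 0" "d - d' = 0"
    by (rule theta_expansion_zero[OF L, of "a - a'" "b - b'" "c - c'" "d - d'"];
        use mem eq in \<open>auto simp: algebra_simps\<close>)+
  then show "a = a'" "b = b'" "c = c'" "d = d'" by auto
qed

lemma gr_odd_cancel:
  assumes L: "2 \<le> L" and mem: "b \<in> gr_alg (L - 2)" "b' \<in> gr_alg (L - 2)"
    and eq: "\<And>p. p \<in> gr_odd L \<Longrightarrow> p * b = p * b'"
  shows "b = b'"
  using theta_expansion_eq(2)[OF L, of 0 b 0 0 0 b' 0 0] mem eq by simp

text \<open>The parity of a value at odd arguments determines the parity of the coefficients.\<close>

lemma gr_even_theta_expansion: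
  assumes L: "2 \<le> L" and mem: "b \<in> gr_alg (L - 2)"
  shows "(\<And>p. p \<in> gr_odd L \<Longrightarrow> p * b \<in> gr_odd L) \<Longrightarrow> b \<in> gr_even (L - 2)"
    and "(\<And>p. p \<in> gr_odd L \<Longrightarrow> p * b \<in> gr_even L) \<Longrightarrow> b \<in> gr_odd (L - 2)"
proof -
  obtain i where i: "enat i < L" "gr_free_of i b"
    by (rule gr_fresh[OF L, of "{b}"]) (use mem in auto)
  have nz: "gr_coeff (gr_zeta i * b) (insert i A) \<noteq> 0" "finite A" "i \<notin> A" if "gr_coeff b A \<noteq> 0" for A
  proof -
    show "i \<notin> A" using i that by (auto simp: gr_free_of_def)
    then show "gr_coeff (gr_zeta i * b) (insert i A) \<noteq> 0"
      using that gr_coeff_zeta_mult[of i A b] gr_sign_nonzero[of "{i}" A] by simp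
    show "finite A" using that gr_coeff_infinite by blast
  qed
  show "b \<in> gr_even (L - 2)" if "\<And>p. p \<in> gr_odd L \<Longrightarrow> p * b \<in> gr_odd L"
    using that[OF gr_zeta_odd[OF i(1)]] nz mem by (fastforce simp: gr_even_def gr_odd_def)
  show "b \<in> gr_odd (L - 2)" if "\<And>p. p \<in> gr_odd L \<Longrightarrow> p * b \<in> gr_even L"
    using that[OF gr_zeta_odd[OF i(1)]] nz mem by (fastforce simp: gr_even_def gr_odd_def)
qed

section \<open>Holomorphic functions with values in the Grassmann algebra\<close>

text \<open>Superanalytic functions without a bound on the generators that their values involve.\<close>

definition gr_holo :: "complex set \<Rightarrow> sfun \<Rightarrow> bool" where
  "gr_holo U \<phi> \<longleftrightarrow> (\<forall>k. sf_comp \<phi> k holomorphic_on U)"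

lemma gr_holoI: "(\<And>k. (\<lambda>w. gr_coeff (\<phi> w) k) holomorphic_on U) \<Longrightarrow> gr_holo U \<phi>"
  by (simp add: gr_holo_def sf_comp_def[abs_def])

lemma gr_holoD: "gr_holo U \<phi> \<Longrightarrow> (\<lambda>w. gr_coeff (\<phi> w) k) holomorphic_on U"
  by (simp add: gr_holo_def sf_comp_def[abs_def])

lemma gr_holo_body: "gr_holo U \<phi> \<Longrightarrow> (\<lambda>w. gr_body (\<phi> w)) holomorphic_on U"
  by (simp add: gr_body_def gr_holoD)

lemma gr_holo_const: "gr_holo U (\<lambda>_. a)"
  by (rule gr_holoI) auto

lemma gr_holo_gc: "f holomorphic_on U \<Longrightarrow> gr_holo U (\<lambda>w. gc (f w))"
proof (rule gr_holoI)
  fix k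
  assume "f holomorphic_on U"
  then show "(\<lambda>w. gr_coeff (gc (f w)) k) holomorphic_on U"
    by (cases "k = {}") (auto simp: gr_coeff_gc)
qed

lemma gr_holo_gc_id: "gr_holo U gc"
  by (rule gr_holo_gc[of "\<lambda>w. w"]) simp

lemma gr_holo_add: "gr_holo U \<phi> \<Longrightarrow> gr_holo U \<psi> \<Longrightarrow> gr_holo U (\<lambda>w. \<phi> w + \<psi> w)"
  and gr_holo_diff: "gr_holo U \<phi> \<Longrightarrow> gr_holo U \<psi> \<Longrightarrow> gr_holo U (\<lambda>w. \<phi> w - \<psi> w)"
  and gr_holo_minus: "gr_holo U \<phi> \<Longrightarrow> gr_holo U (\<lambda>w. - \<phi> w)"
  by (auto intro!: gr_holoI holomorphic_intros dest: gr_holoD)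

lemma gr_holo_mult:
  assumes "gr_holo U \<phi>" "gr_holo U \<psi>" shows "gr_holo U (\<lambda>w. \<phi> w * \<psi> w)"
  by (rule gr_holoI) (auto simp: gr_coeff_times intro!: holomorphic_intros gr_holoD assms)

lemma gr_holo_power: "gr_holo U \<phi> \<Longrightarrow> gr_holo U (\<lambda>w. \<phi> w ^ k)"
  by (induction k) (auto intro: gr_holo_const gr_holo_mult)

lemma gr_holo_sum: "(\<And>i. i \<in> I \<Longrightarrow> gr_holo U (\<phi> i)) \<Longrightarrow> gr_holo U (\<lambda>w. \<Sum>i\<in>I. \<phi> i w)"
  by (induction I rule: infinite_finite_induct) (auto intro: gr_holo_const gr_holo_add)

lemma gr_holo_subset: "gr_holo U \<phi> \<Longrightarrow> V \<subseteq> U \<Longrightarrow> gr_holo V \<phi>"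
  by (auto simp: gr_holo_def intro: holomorphic_on_subset)

lemma gr_holo_cong: "gr_holo U \<phi> \<Longrightarrow> (\<And>w. w \<in> U \<Longrightarrow> \<phi> w = \<psi> w) \<Longrightarrow> gr_holo U \<psi>"
  by (rule gr_holoI) (erule holomorphic_transform[OF gr_holoD], simp)

lemma gr_holo_Un:
  "gr_holo U \<phi> \<Longrightarrow> gr_holo V \<phi> \<Longrightarrow> open U \<Longrightarrow> open V \<Longrightarrow> gr_holo (U \<union> V) \<phi>"
  by (auto simp: gr_holo_def intro: holomorphic_on_Un)

text \<open>The coefficients of an inverse are found by recursion on the size of the index set; each step
  divides by the body.\<close>

lemma gr_holo_inverse:
  assumes holo: "gr_holo U \<phi>" and nz: "\<And>w. w \<in> U \<Longrightarrow> gr_body (\<phi> w) \<noteq> 0"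
  shows "gr_holo U (\<lambda>w. inverse (\<phi> w))"
proof (rule gr_holoI)
  fix C :: "nat set"
  show "(\<lambda>w. gr_coeff (inverse (\<phi> w)) C) holomorphic_on U"
  proof (cases "finite C")
    case True
    then show ?thesis
    proof (induction C rule: finite_psubset_induct)
      case (psubset C)
      let ?r = "\<lambda>w. ((if C = {} then 1 else 0)
        - (\<Sum>A\<in>Pow C - {{}}. gr_sign A (C - A) * gr_coeff (\<phi> w) A * gr_coeff (inverse (\<phi> w)) (C - A)))
        / gr_body (\<phi> w)"
      have "?r holomorphic_on U"
      proof (intro holomorphic_intros gr_holoD[OF holo] gr_holo_body[OF holo] nz)
        fix A assume "A \<in> Pow C - {{}}"
        then show "(\<lambda>w. gr_coeff (inverse (\<phi> w)) (C - A)) holomorphic_on U"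
          by (intro psubset.IH) auto
      qed auto
      moreover have "?r w = gr_coeff (inverse (\<phi> w)) C" if "w \<in> U" for w
      proof -
        have "(if C = {} then 1 else 0) = gr_coeff (\<phi> w * inverse (\<phi> w)) C"
          using nz[OF that] by (simp add: gr_coeff_one)
        also have "\<dots> = gr_body (\<phi> w) * gr_coeff (inverse (\<phi> w)) C
          + (\<Sum>A\<in>Pow C - {{}}. gr_sign A (C - A) * gr_coeff (\<phi> w) A * gr_coeff (inverse (\<phi> w)) (C - A))"
          unfolding gr_coeff_times using psubset.hyps
          by (subst sum.remove[of "Pow C" "{}"]) (auto simp: gr_body_def)
        finally show ?thesis using nz[OF that] by (simp add: field_simps)
      qed
      ultimately show ?case by (rule holomorphic_transform) auto
    qed
  qed (simp add: gr_coeff_infinite)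
qed

text \<open>By continuity.  This removes the exceptional points \<open>w\<^sub>0\<close> and \<open>0\<close> from identities.\<close>

lemma gr_holo_eq_puncture:
  assumes "open U" "gr_holo U \<phi>" "gr_holo U \<psi>" "\<And>w. w \<in> U \<Longrightarrow> w \<noteq> w0 \<Longrightarrow> \<phi> w = \<psi> w" "w \<in> U"
  shows "\<phi> w = \<psi> w"
proof (cases "w = w0")
  case True
  show ?thesis
  proof (rule gr_eqI)
    fix k
    have "continuous (at w) (\<lambda>w. gr_coeff (\<phi> w) k - gr_coeff (\<psi> w) k)"
      using assms by (intro continuous_on_interior[of U] holomorphic_on_imp_continuous_on
          holomorphic_intros gr_holoD) (auto simp: interior_open)
    then have "((\<lambda>w. gr_coeff (\<phi> w) k - gr_coeff (\<psi> w) k) \<longlongrightarrow> gr_coeff (\<phi> w) k - gr_coeff (\<psi> w) k) (at w)"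
      by (simp add: continuous_at)
    moreover have "((\<lambda>w. gr_coeff (\<phi> w) k - gr_coeff (\<psi> w) k) \<longlongrightarrow> 0) (at w)"
    proof (rule tendsto_eventually)
      show "\<forall>\<^sub>F w in at w. gr_coeff (\<phi> w) k - gr_coeff (\<psi> w) k = 0"
        using assms True by (auto simp: eventually_at_topological)
    qed
    ultimately have "gr_coeff (\<phi> w) k - gr_coeff (\<psi> w) k = 0"
      using tendsto_unique trivial_limit_at by blast
    then show "gr_coeff (\<phi> w) k = gr_coeff (\<psi> w) k" by simp
  qed
qed (use assms in auto)

text \<open>Only countably many index sets can occur, and a coefficient function that does not vanish
  identically has countably many zeros.  As a ball is uncountable, at one of its points all nonzero
  coefficient functions are nonzero; there are only finitely many of them there.\<close>

lemma gr_holo_locally_finite: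
  assumes "gr_holo U \<phi>" "ball b r \<subseteq> U" "r > 0"
  shows "finite {k. \<exists>w\<in>ball b r. gr_coeff (\<phi> w) k \<noteq> 0}"
proof -
  let ?B = "ball b r"
  let ?K = "{k. \<exists>w\<in>?B. gr_coeff (\<phi> w) k \<noteq> 0}"
  let ?Z = "\<lambda>k. {w \<in> ?B. gr_coeff (\<phi> w) k = 0}"
  have "?K \<subseteq> {A. finite A}" using gr_coeff_infinite by auto
  then have cK: "countable ?K"
    using countable_Collect_finite countable_subset by blast
  have cZ: "countable (?Z k)" if "k \<in> ?K" for k
  proof (cases "(\<lambda>w. gr_coeff (\<phi> w) k) constant_on ?B")
    case True
    then have "?Z k = {}" using that unfolding constant_on_def by fastforce
    then show ?thesis by (metis countable_empty)
  next
    case False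
    obtain C :: "nat \<Rightarrow> complex set" where "\<And>n. compact (C n)" "\<Union> (range C) = ?B"
      by (rule open_Union_compact_subsets[of ?B]) auto
    then have "fsigma ?B" unfolding fsigma_Union_compact by (intro exI[of _ C]) auto
    then show ?thesis
      using False assms by (intro holomorphic_countable_zeros)
        (auto intro: gr_holoD gr_holo_subset holomorphic_on_subset)
  qed
  have cU: "countable (\<Union>k\<in>?K. ?Z k)" by (rule countable_UN[OF cK cZ])
  have "uncountable ?B" using assms(3) by (rule uncountable_ball)
  then have "\<not> ?B \<subseteq> (\<Union>k\<in>?K. ?Z k)" by (rule contrapos_nn) (rule countable_subset[OF _ cU])
  then obtain w where w: "w \<in> ?B" "w \<notin> (\<Union>k\<in>?K. ?Z k)" by (meson subsetI)
  then have "?K \<subseteq> {k. gr_coeff (\<phi> w) k \<noteq> 0}" by blast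
  then show ?thesis using gr_coeff_finite_support finite_subset by blast
qed

lemma gr_holo_finite_near:
  assumes "gr_holo U \<phi>" "open U" "b \<in> U"
  obtains K r where "finite K" "r > 0" "ball b r \<subseteq> U"
    "\<And>k w. k \<notin> K \<Longrightarrow> w \<in> ball b r \<Longrightarrow> sf_comp \<phi> k w = 0"
proof -
  obtain r where "r > 0" "ball b r \<subseteq> U" using assms openE by blast
  then show thesis
    using gr_holo_locally_finite[OF assms(1)]
    by (intro that[of "{k. \<exists>w\<in>ball b r. gr_coeff (\<phi> w) k \<noteq> 0}" r]) (auto simp: sf_comp_def)
qed

text \<open>By local finiteness, the Taylor coefficients of the coefficient functions are the coefficients
  of an element of \<open>\<And>\<^sub>\<infinity>\<close>.\<close>

definition gr_taylor :: "nat \<Rightarrow> sfun \<Rightarrow> complex \<Rightarrow> gr" where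
  "gr_taylor l \<phi> b = Abs_gr (\<lambda>k. (deriv ^^ l) (sf_comp \<phi> k) b / fact l)"

lemma higher_deriv_zero_near:
  fixes f :: "complex \<Rightarrow> complex"
  assumes "open V" "b \<in> V" "\<And>w. w \<in> V \<Longrightarrow> f w = 0"
  shows "(deriv ^^ l) f b = 0"
proof -
  have "f holomorphic_on V" by (rule holomorphic_transform[of "\<lambda>_. 0"]) (auto simp: assms)
  then have "(deriv ^^ l) f b = (deriv ^^ l) (\<lambda>_. 0) b"
    by (rule higher_deriv_transform_within_open[of _ V]) (use assms in auto)
  then show ?thesis by simp
qed

lemma gr_coeff_taylor:
  assumes "gr_holo U \<phi>" "open U" "b \<in> U"
  shows "gr_coeff (gr_taylor l \<phi> b) k = (deriv ^^ l) (sf_comp \<phi> k) b / fact l"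
proof -
  obtain K r where K: "finite K" "r > 0" "ball b r \<subseteq> U"
    "\<And>k w. k \<notin> K \<Longrightarrow> w \<in> ball b r \<Longrightarrow> sf_comp \<phi> k w = 0"
    using gr_holo_finite_near[OF assms] by metis
  have 0: "(deriv ^^ l) (sf_comp \<phi> k) b = 0" if "k \<notin> K" for k
    by (rule higher_deriv_zero_near[of "ball b r"]) (use K that in auto)
  have 1: "(deriv ^^ l) (sf_comp \<phi> k) b = 0" if "infinite k" for k
    by (rule higher_deriv_zero_near[of UNIV]) (use that in \<open>auto simp: sf_comp_def gr_coeff_infinite\<close>)
  have "finite {k. (deriv ^^ l) (sf_comp \<phi> k) b / fact l \<noteq> 0}"
    by (rule finite_subset[OF _ K(1)]) (use 0 in auto)
  then show ?thesis unfolding gr_taylor_def by (subst Abs_gr_inverse) (use 1 in auto)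
qed

lemma sf_deriv_eq_taylor: "sf_deriv \<phi> b = gr_taylor 1 \<phi> b"
  by (simp add: sf_deriv_def gr_taylor_def)

lemma gr_coeff_sf_deriv:
  assumes "gr_holo U \<phi>" "open U" "b \<in> U"
  shows "gr_coeff (sf_deriv \<phi> b) k = deriv (\<lambda>w. gr_coeff (\<phi> w) k) b"
  using gr_coeff_taylor[OF assms, of 1 k] by (simp add: sf_deriv_eq_taylor sf_comp_def[abs_def])

lemma gr_holo_sf_deriv:
  assumes "gr_holo U \<phi>" "open U" shows "gr_holo U (sf_deriv \<phi>)"
proof (rule gr_holoI)
  fix k
  have "deriv (\<lambda>w. gr_coeff (\<phi> w) k) holomorphic_on U"
    using assms by (intro holomorphic_deriv gr_holoD)
  then show "(\<lambda>w. gr_coeff (sf_deriv \<phi> w) k) holomorphic_on U"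
    by (rule holomorphic_transform) (simp add: gr_coeff_sf_deriv[OF assms])
qed

lemma gr_taylor_0:
  assumes "gr_holo U \<phi>" "open U" "b \<in> U" shows "gr_taylor 0 \<phi> b = \<phi> b"
  by (rule gr_eqI) (simp add: gr_coeff_taylor[OF assms] sf_comp_def)

lemma gr_taylor_cong:
  assumes "gr_holo U \<phi>" "open U" "b \<in> U" "\<And>w. w \<in> U \<Longrightarrow> \<phi> w = \<psi> w"
  shows "gr_taylor l \<phi> b = gr_taylor l \<psi> b"
proof -
  have \<psi>: "gr_holo U \<psi>" using assms gr_holo_cong by blast
  show ?thesis
  proof (rule gr_eqI, unfold gr_coeff_taylor[OF assms(1-3)] gr_coeff_taylor[OF \<psi> assms(2,3)])
    fix k
    have "(deriv ^^ l) (sf_comp \<phi> k) b = (deriv ^^ l) (sf_comp \<psi> k) b"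
      by (rule higher_deriv_transform_within_open[of _ U])
        (use assms \<psi> in \<open>auto simp: gr_holo_def sf_comp_def\<close>)
    then show "(deriv ^^ l) (sf_comp \<phi> k) b / fact l = (deriv ^^ l) (sf_comp \<psi> k) b / fact l" by simp
  qed
qed

lemma gr_taylor_add:
  assumes "gr_holo U \<phi>" "gr_holo U \<psi>" "open U" "b \<in> U"
  shows "gr_taylor l (\<lambda>w. \<phi> w + \<psi> w) b = gr_taylor l \<phi> b + gr_taylor l \<psi> b"
proof (rule gr_eqI)
  fix k
  have "(deriv ^^ l) (\<lambda>w. sf_comp \<phi> k w + sf_comp \<psi> k w) b
      = (deriv ^^ l) (sf_comp \<phi> k) b + (deriv ^^ l) (sf_comp \<psi> k) b"
    using assms by (intro higher_deriv_add) (auto simp: gr_holo_def)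
  moreover have "sf_comp (\<lambda>w. \<phi> w + \<psi> w) k = (\<lambda>w. sf_comp \<phi> k w + sf_comp \<psi> k w)"
    by (auto simp: sf_comp_def)
  ultimately show "gr_coeff (gr_taylor l (\<lambda>w. \<phi> w + \<psi> w) b) k
      = gr_coeff (gr_taylor l \<phi> b + gr_taylor l \<psi> b) k"
    using assms gr_holo_add[OF assms(1,2)] by (simp add: gr_coeff_taylor[of U] add_divide_distrib)
qed

lemma gr_taylor_minus:
  assumes "gr_holo U \<phi>" "open U" "b \<in> U"
  shows "gr_taylor l (\<lambda>w. - \<phi> w) b = - gr_taylor l \<phi> b"
proof (rule gr_eqI)
  fix k
  have "(deriv ^^ l) (\<lambda>w. - sf_comp \<phi> k w) b = - (deriv ^^ l) (sf_comp \<phi> k) b"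
    using assms by (intro higher_deriv_uminus[of _ U]) (auto simp: gr_holo_def)
  moreover have "sf_comp (\<lambda>w. - \<phi> w) k = (\<lambda>w. - sf_comp \<phi> k w)"
    by (auto simp: sf_comp_def)
  ultimately show "gr_coeff (gr_taylor l (\<lambda>w. - \<phi> w) b) k = gr_coeff (- gr_taylor l \<phi> b) k"
    using assms gr_holo_minus[OF assms(1)] by (simp add: gr_coeff_taylor[of U])
qed

lemma higher_deriv_sum_fun:
  assumes "finite I" "\<And>i. i \<in> I \<Longrightarrow> f i holomorphic_on U" "open U" "b \<in> U"
  shows "(deriv ^^ l) (\<lambda>w. \<Sum>i\<in>I. f i w) b = (\<Sum>i\<in>I. (deriv ^^ l) (f i) b)"
  using assms(1,2)
proof (induction I)
  case (insert i I)
  then have "(deriv ^^ l) (\<lambda>w. f i w + (\<Sum>i\<in>I. f i w)) b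
     = (deriv ^^ l) (f i) b + (deriv ^^ l) (\<lambda>w. \<Sum>i\<in>I. f i w) b"
    using assms by (intro higher_deriv_add[of _ U]) (auto intro!: holomorphic_intros)
  with insert show ?case by simp
qed simp

lemma higher_deriv_mult_taylor:
  assumes "f holomorphic_on U" "g holomorphic_on U" "open U" "b \<in> U"
  shows "(deriv ^^ l) (\<lambda>w. f w * g w) b / fact l
     = (\<Sum>i\<le>l. ((deriv ^^ i) f b / fact i) * ((deriv ^^ (l - i)) g b / fact (l - i)))"
proof -
  have "(deriv ^^ l) (\<lambda>w. f w * g w) b / fact l
    = (\<Sum>i\<le>l. of_nat (l choose i) * (deriv ^^ i) f b * (deriv ^^ (l - i)) g b / fact l)"
    unfolding higher_deriv_mult[OF assms] by (simp add: sum_divide_distrib atLeast0AtMost)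
  also have "\<dots> = (\<Sum>i\<le>l. ((deriv ^^ i) f b / fact i) * ((deriv ^^ (l - i)) g b / fact (l - i)))"
  proof (rule sum.cong)
    fix i assume "i \<in> {..l}"
    then have "of_nat (l choose i) = (fact l / (fact i * fact (l - i)) :: complex)"
      by (simp add: binomial_fact)
    then show "of_nat (l choose i) * (deriv ^^ i) f b * (deriv ^^ (l - i)) g b / fact l
        = ((deriv ^^ i) f b / fact i) * ((deriv ^^ (l - i)) g b / fact (l - i))" by simp
  qed simp
  finally show ?thesis .
qed

text \<open>The Leibniz rule, which makes \<open>sf_deriv\<close> a derivation and \<open>sf_val\<close> multiplicative.  It needs no
  sign, as the variable is even.\<close>

lemma gr_taylor_mult:
  assumes \<phi>: "gr_holo U \<phi>" and \<psi>: "gr_holo U \<psi>" and U: "open U" "b \<in> U"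
  shows "gr_taylor l (\<lambda>w. \<phi> w * \<psi> w) b = (\<Sum>i\<le>l. gr_taylor i \<phi> b * gr_taylor (l - i) \<psi> b)"
proof (rule gr_eqI)
  fix C
  show "gr_coeff (gr_taylor l (\<lambda>w. \<phi> w * \<psi> w) b) C
     = gr_coeff (\<Sum>i\<le>l. gr_taylor i \<phi> b * gr_taylor (l - i) \<psi> b) C"
  proof (cases "finite C")
    case True
    have "gr_coeff (gr_taylor l (\<lambda>w. \<phi> w * \<psi> w) b) C
        = (deriv ^^ l) (\<lambda>w. \<Sum>A\<in>Pow C. gr_sign A (C - A) * (sf_comp \<phi> A w * sf_comp \<psi> (C - A) w)) b / fact l"
      using gr_coeff_taylor[OF gr_holo_mult[OF \<phi> \<psi>] U, of l C]
      by (simp add: sf_comp_def[abs_def] gr_coeff_times mult.assoc)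
    also have "\<dots> = (\<Sum>A\<in>Pow C. (deriv ^^ l) (\<lambda>w. gr_sign A (C - A) * (sf_comp \<phi> A w * sf_comp \<psi> (C - A) w)) b / fact l)"
      using True \<phi> \<psi> U
      by (subst higher_deriv_sum_fun[of _ _ U]) (auto simp: sum_divide_distrib gr_holo_def intro!: holomorphic_intros)
    also have "\<dots> = (\<Sum>A\<in>Pow C. gr_sign A (C - A) * (\<Sum>i\<le>l. gr_coeff (gr_taylor i \<phi> b) A * gr_coeff (gr_taylor (l - i) \<psi> b) (C - A)))"
    proof (rule sum.cong)
      fix A
      have h: "sf_comp \<phi> A holomorphic_on U" "sf_comp \<psi> (C - A) holomorphic_on U"
        using \<phi> \<psi> by (auto simp: gr_holo_def)
      have "(deriv ^^ l) (\<lambda>w. gr_sign A (C - A) * (sf_comp \<phi> A w * sf_comp \<psi> (C - A) w)) b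
         = gr_sign A (C - A) * (deriv ^^ l) (\<lambda>w. sf_comp \<phi> A w * sf_comp \<psi> (C - A) w) b"
        using h U by (intro higher_deriv_cmult[of _ U]) (auto intro!: holomorphic_intros)
      then show "(deriv ^^ l) (\<lambda>w. gr_sign A (C - A) * (sf_comp \<phi> A w * sf_comp \<psi> (C - A) w)) b / fact l
         = gr_sign A (C - A) * (\<Sum>i\<le>l. gr_coeff (gr_taylor i \<phi> b) A * gr_coeff (gr_taylor (l - i) \<psi> b) (C - A))"
        using higher_deriv_mult_taylor[OF h U]
        by (simp add: gr_coeff_taylor[OF \<phi> U] gr_coeff_taylor[OF \<psi> U] flip: times_divide_eq_right)
    qed simp
    also have "\<dots> = gr_coeff (\<Sum>i\<le>l. gr_taylor i \<phi> b * gr_taylor (l - i) \<psi> b) C"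
      by (simp add: gr_coeff_times sum_distrib_left mult.assoc) (rule sum.swap)
    finally show ?thesis .
  qed (simp add: gr_coeff_infinite)
qed

lemma sf_deriv_mult:
  assumes "gr_holo U \<phi>" "gr_holo U \<psi>" "open U" "b \<in> U"
  shows "sf_deriv (\<lambda>w. \<phi> w * \<psi> w) b = sf_deriv \<phi> b * \<psi> b + \<phi> b * sf_deriv \<psi> b"
  using gr_taylor_mult[OF assms, of 1] assms
  by (simp add: sf_deriv_eq_taylor gr_taylor_0[of U] add.commute)

lemma sf_deriv_add:
  assumes "gr_holo U \<phi>" "gr_holo U \<psi>" "open U" "b \<in> U"
  shows "sf_deriv (\<lambda>w. \<phi> w + \<psi> w) b = sf_deriv \<phi> b + sf_deriv \<psi> b"
  using gr_taylor_add[OF assms, of 1] by (simp add: sf_deriv_eq_taylor)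

lemma sf_deriv_cong:
  assumes "gr_holo U \<phi>" "open U" "b \<in> U" "\<And>w. w \<in> U \<Longrightarrow> \<phi> w = \<psi> w"
  shows "sf_deriv \<phi> b = sf_deriv \<psi> b"
  using gr_taylor_cong[OF assms] by (simp add: sf_deriv_eq_taylor)

lemma sf_deriv_const: "sf_deriv (\<lambda>_. a) b = 0"
  using gr_coeff_sf_deriv[OF gr_holo_const, of UNIV b] by (intro gr_eqI) simp

lemma sf_deriv_gc: "sf_deriv gc b = 1"
proof (rule gr_eqI)
  fix k
  have "gr_coeff (sf_deriv gc b) k = deriv (\<lambda>w. gr_coeff (gc w) k) b"
    using gr_coeff_sf_deriv[OF gr_holo_gc_id, of UNIV b] by simp
  also have "\<dots> = gr_coeff 1 k" by (cases "k = {}") (simp_all add: gr_coeff_gc gr_coeff_one)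
  finally show "gr_coeff (sf_deriv gc b) k = gr_coeff 1 k" .
qed

lemma gr_body_sf_deriv:
  assumes "gr_holo U \<phi>" "open U" "b \<in> U"
  shows "gr_body (sf_deriv \<phi> b) = deriv (\<lambda>w. gr_body (\<phi> w)) b"
  by (simp add: gr_body_def gr_coeff_sf_deriv[OF assms])

lemma gr_taylor_support:
  assumes "gr_holo U \<phi>" "open U" "b \<in> U" "gr_coeff (gr_taylor l \<phi> b) k \<noteq> 0"
  shows "\<exists>w\<in>U. gr_coeff (\<phi> w) k \<noteq> 0"
proof (rule ccontr)
  assume "\<not> ?thesis"
  then have "(deriv ^^ l) (sf_comp \<phi> k) b = 0"
    using assms by (intro higher_deriv_zero_near[of U]) (auto simp: sf_comp_def)
  then show False using assms by (simp add: gr_coeff_taylor[of U])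
qed

lemma gr_taylor_mem:
  assumes "gr_holo U \<phi>" "open U" "b \<in> U"
  shows "(\<And>w. w \<in> U \<Longrightarrow> \<phi> w \<in> gr_even L) \<Longrightarrow> gr_taylor l \<phi> b \<in> gr_even L"
    and "(\<And>w. w \<in> U \<Longrightarrow> \<phi> w \<in> gr_odd L) \<Longrightarrow> gr_taylor l \<phi> b \<in> gr_odd L"
    and "(\<And>w. w \<in> U \<Longrightarrow> \<phi> w \<in> gr_alg L) \<Longrightarrow> gr_taylor l \<phi> b \<in> gr_alg L"
  using gr_taylor_support[OF assms] by (fastforce simp: gr_even_def gr_odd_def gr_alg_def)+

subsection \<open>Values of superfunctions at points with soul\<close>

lemma power_zero_mono: "s ^ M = 0 \<Longrightarrow> M \<le> l \<Longrightarrow> s ^ l = (0 :: gr)"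
  by (metis le_add_diff_inverse mult_zero_left power_add)

lemma gr_extend_eq:
  assumes M: "gr_soul z ^ M = 0"
  shows "gr_extend f z = (\<Sum>l<M. gc ((deriv ^^ l) f (gr_body z) / fact l) * gr_soul z ^ l)"
  unfolding gr_extend_def
proof (rule sum.mono_neutral_left)
  show "{l. gr_soul z ^ l \<noteq> 0} \<subseteq> {..<M}"
    using power_zero_mono[OF M] by (auto simp: not_le[symmetric])
qed auto

text \<open>The double sum over powers of the soul and index sets, read in the other order: a Taylor
  expansion with coefficients in \<open>\<And>\<^sub>\<infinity>\<close>, in which the nilpotent soul is the increment.\<close>

lemma sf_val_eq_taylor:
  assumes \<phi>: "gr_holo U \<phi>" "open U" "gr_body z \<in> U" and M: "gr_soul z ^ M = 0"
  shows "sf_val \<phi> z = (\<Sum>l<M. gr_soul z ^ l * gr_taylor l \<phi> (gr_body z))"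
proof -
  let ?b = "gr_body z" and ?s = "gr_soul z"
  let ?c = "\<lambda>l k. (deriv ^^ l) (sf_comp \<phi> k) ?b / fact l"
  obtain K r where K: "finite K" "r > 0" "ball ?b r \<subseteq> U"
    "\<And>k w. k \<notin> K \<Longrightarrow> w \<in> ball ?b r \<Longrightarrow> sf_comp \<phi> k w = 0"
    using gr_holo_finite_near[OF \<phi>] by metis
  have 0: "?c l k = 0" if "k \<notin> K" for l k
    using higher_deriv_zero_near[of "ball ?b r" ?b "sf_comp \<phi> k"] K that by simp
  have 1: "?c l k = 0" if "infinite k" for l k
    using higher_deriv_zero_near[of UNIV ?b "sf_comp \<phi> k"] that
    by (simp add: sf_comp_def gr_coeff_infinite)
  have "sf_val \<phi> z = (\<Sum>k\<in>K. gr_extend (sf_comp \<phi> k) z * gr_mono k)"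
    unfolding sf_val_def
  proof (rule sum.mono_neutral_left)
    have "gr_extend (sf_comp \<phi> k) z = 0" if "k \<notin> K" for k
      using 0[OF that] by (simp add: gr_extend_eq[OF M])
    then show "{k. gr_extend (sf_comp \<phi> k) z \<noteq> 0} \<subseteq> K" by blast
  qed (use K(1) in auto)
  also have "\<dots> = (\<Sum>k\<in>K. \<Sum>l<M. ?s ^ l * (gc (?c l k) * gr_mono k))"
    unfolding gr_extend_eq[OF M] sum_distrib_right
    by (intro sum.cong refl) (metis gc_commute mult.assoc)
  also have "\<dots> = (\<Sum>l<M. ?s ^ l * (\<Sum>k\<in>K. gc (?c l k) * gr_mono k))"
    by (subst sum.swap) (simp add: sum_distrib_left)
  finally have *: "sf_val \<phi> z = (\<Sum>l<M. ?s ^ l * (\<Sum>k\<in>K. gc (?c l k) * gr_mono k))" .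
  have "(\<Sum>k\<in>K. gc (?c l k) * gr_mono k) = gr_taylor l \<phi> ?b" for l
  proof (rule gr_eqI)
    fix A
    have "gr_coeff (\<Sum>k\<in>K. gc (?c l k) * gr_mono k) A = (\<Sum>k\<in>K. if A = k then ?c l A else 0)"
      unfolding gr_coeff_sum
      by (intro sum.cong refl) (use 1[of A l] in \<open>auto simp: gr_coeff_mono\<close>)
    also have "\<dots> = gr_coeff (gr_taylor l \<phi> ?b) A"
      using K(1) 0[of A l] 1[of A l] by (auto simp: gr_coeff_taylor[OF \<phi>])
    finally show "gr_coeff (\<Sum>k\<in>K. gc (?c l k) * gr_mono k) A = gr_coeff (gr_taylor l \<phi> ?b) A" .
  qed
  with * show ?thesis by (simp only:)
qed

lemma gr_soul_nilpotent: obtains M where "gr_soul z ^ M = 0"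
  using gr_nilpotent[of "gr_soul z"] by auto

lemma sf_val_gc:
  assumes "gr_holo U \<phi>" "open U" "w \<in> U" shows "sf_val \<phi> (gc w) = \<phi> w"
  using sf_val_eq_taylor[of U \<phi> "gc w" 1] gr_taylor_0[OF assms] assms by simp

lemma sf_val_cong:
  assumes "gr_holo U \<phi>" "open U" "gr_body z \<in> U" "\<And>w. w \<in> U \<Longrightarrow> \<phi> w = \<psi> w"
  shows "sf_val \<phi> z = sf_val \<psi> z"
proof -
  obtain M where M: "gr_soul z ^ M = 0" by (rule gr_soul_nilpotent)
  have "gr_holo U \<psi>" using assms gr_holo_cong by blast
  then show ?thesis
    by (simp add: sf_val_eq_taylor[OF _ assms(2,3) M] assms(1) gr_taylor_cong[OF assms])
qed

lemma sf_val_add: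
  assumes "gr_holo U \<phi>" "gr_holo U \<psi>" "open U" "gr_body z \<in> U"
  shows "sf_val (\<lambda>w. \<phi> w + \<psi> w) z = sf_val \<phi> z + sf_val \<psi> z"
proof -
  obtain M where M: "gr_soul z ^ M = 0" by (rule gr_soul_nilpotent)
  show ?thesis
    using assms gr_holo_add[OF assms(1,2)]
    by (simp add: sf_val_eq_taylor[of U _ z M] M gr_taylor_add[OF assms] distrib_left sum.distrib)
qed

lemma sf_val_minus:
  assumes "gr_holo U \<phi>" "open U" "gr_body z \<in> U"
  shows "sf_val (\<lambda>w. - \<phi> w) z = - sf_val \<phi> z"
proof -
  obtain M where M: "gr_soul z ^ M = 0" by (rule gr_soul_nilpotent)
  show ?thesis
    using assms gr_holo_minus[OF assms(1)]
    by (simp add: sf_val_eq_taylor[of U _ z M] M gr_taylor_minus[OF assms] sum_negf)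
qed

lemma sf_val_diff:
  assumes "gr_holo U \<phi>" "gr_holo U \<psi>" "open U" "gr_body z \<in> U"
  shows "sf_val (\<lambda>w. \<phi> w - \<psi> w) z = sf_val \<phi> z - sf_val \<psi> z"
  using sf_val_add[OF assms(1) gr_holo_minus[OF assms(2)] assms(3,4)] sf_val_minus[OF assms(2-4)] by simp

lemma sf_val_const: "sf_val (\<lambda>_. a) z = a"
proof -
  obtain M where M: "gr_soul z ^ M = 0" by (rule gr_soul_nilpotent)
  then have M': "gr_soul z ^ Suc M = 0" by simp
  have "gr_taylor (Suc l) (\<lambda>_. a) (gr_body z) = 0" for l
    using gr_coeff_taylor[OF gr_holo_const, of UNIV "gr_body z" "Suc l" a]
    by (intro gr_eqI) (simp add: sf_comp_def[abs_def])
  then show ?thesis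
    using gr_taylor_0[OF gr_holo_const, of UNIV "gr_body z" a]
    by (simp add: sf_val_eq_taylor[OF gr_holo_const _ _ M', of UNIV] sum.lessThan_Suc_shift del: sum.lessThan_Suc)
qed

lemma sf_val_id: "sf_val gc z = z"
proof -
  obtain M where M: "gr_soul z ^ M = 0" by (rule gr_soul_nilpotent)
  then have M': "gr_soul z ^ Suc (Suc M) = 0" by simp
  have "gr_taylor (Suc (Suc l)) gc (gr_body z) = 0" for l
  proof (rule gr_eqI)
    fix k
    have "(deriv ^^ Suc (Suc l)) (sf_comp gc k) (gr_body z) = 0"
    proof (cases "k = {}")
      case True
      then have "sf_comp gc k = (\<lambda>w. w)" by (simp add: sf_comp_def[abs_def] gr_coeff_gc)
      then show ?thesis using higher_deriv_ident[of "Suc (Suc l)" "gr_body z"] by simp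
    next
      case False
      then have "sf_comp gc k = (\<lambda>w. 0)" by (simp add: sf_comp_def[abs_def] gr_coeff_gc)
      then show ?thesis using higher_deriv_const[of "Suc (Suc l)" 0] by simp
    qed
    then show "gr_coeff (gr_taylor (Suc (Suc l)) gc (gr_body z)) k = gr_coeff 0 k"
      using gr_coeff_taylor[OF gr_holo_gc_id, of UNIV "gr_body z"] by simp
  qed
  then show ?thesis
    using gr_taylor_0[OF gr_holo_gc_id, of UNIV "gr_body z"] sf_deriv_gc[of "gr_body z"]
    by (simp add: sf_val_eq_taylor[OF gr_holo_gc_id _ _ M', of UNIV] sum.lessThan_Suc_shift
        sf_deriv_eq_taylor del: sum.lessThan_Suc flip: gr_soul_decomp)
qed

text \<open>The Cauchy product of two Taylor expansions.  The soul of an even \<open>z\<close> commutes with the Taylor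
  coefficients.\<close>

lemma sf_val_mult:
  assumes \<phi>: "gr_holo U \<phi>" and \<psi>: "gr_holo U \<psi>" and U: "open U" "gr_body z \<in> U" and z: "z \<in> gr_even L"
  shows "sf_val (\<lambda>w. \<phi> w * \<psi> w) z = sf_val \<phi> z * sf_val \<psi> z"
proof -
  obtain M where M: "gr_soul z ^ M = 0" by (rule gr_soul_nilpotent)
  let ?s = "gr_soul z" and ?a = "\<lambda>l. gr_taylor l \<phi> (gr_body z)" and ?b = "\<lambda>l. gr_taylor l \<psi> (gr_body z)"
  have comm: "x * ?s ^ l = ?s ^ l * x" for x l
    using gr_even_commute[OF gr_even_power[OF gr_even_soul[OF z]]] .
  have "sf_val \<phi> z * sf_val \<psi> z = (\<Sum>i<M. \<Sum>j<M. ?s ^ (i + j) * (?a i * ?b j))"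
    unfolding sf_val_eq_taylor[OF \<phi> U M] sf_val_eq_taylor[OF \<psi> U M] sum_product
    by (intro sum.cong refl) (metis comm mult.assoc power_add)
  also have "\<dots> = (\<Sum>(i, j)\<in>{..<M} \<times> {..<M}. ?s ^ (i + j) * (?a i * ?b j))"
    by (simp add: sum.cartesian_product)
  also have "\<dots> = (\<Sum>(i, j)\<in>{(i, j). i + j < M}. ?s ^ (i + j) * (?a i * ?b j))"
  proof (rule sum.mono_neutral_right)
    have "?s ^ (i + j) = 0" if "\<not> i + j < M" for i j
      using that by (intro power_zero_mono[OF M]) simp
    then have *: "?s ^ (i + j) * (?a i * ?b j) = 0" if "\<not> i + j < M" for i j
      using that by (metis mult_zero_left)
    show "\<forall>x\<in>{..<M} \<times> {..<M} - {(i, j). i + j < M}. (case x of (i, j) \<Rightarrow> ?s ^ (i + j) * (?a i * ?b j)) = 0"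
    proof (intro ballI)
      fix x assume "x \<in> {..<M} \<times> {..<M} - {(i, j). i + j < M}"
      then show "(case x of (i, j) \<Rightarrow> ?s ^ (i + j) * (?a i * ?b j)) = 0"
        using *[of "fst x" "snd x"] by (simp add: case_prod_unfold)
    qed
  qed auto
  also have "\<dots> = (\<Sum>l<M. ?s ^ l * (\<Sum>i\<le>l. ?a i * ?b (l - i)))"
    by (subst sum.triangle_reindex) (simp add: sum_distrib_left)
  also have "\<dots> = sf_val (\<lambda>w. \<phi> w * \<psi> w) z"
    unfolding sf_val_eq_taylor[OF gr_holo_mult[OF \<phi> \<psi>] U M] by (simp add: gr_taylor_mult[OF \<phi> \<psi> U])
  finally show ?thesis by simp
qed

lemma sf_val_power:
  assumes "gr_holo U \<phi>" "open U" "gr_body z \<in> U" "z \<in> gr_even L"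
  shows "sf_val (\<lambda>w. \<phi> w ^ k) z = sf_val \<phi> z ^ k"
  by (induction k) (auto simp: sf_val_const sf_val_mult[OF assms(1) gr_holo_power[OF assms(1)] assms(2-4)])

lemma sf_val_sum:
  assumes "finite I" "\<And>i. i \<in> I \<Longrightarrow> gr_holo U (\<phi> i)" "open U" "gr_body z \<in> U"
  shows "sf_val (\<lambda>w. \<Sum>i\<in>I. \<phi> i w) z = (\<Sum>i\<in>I. sf_val (\<phi> i) z)"
  using assms(1,2)
  by (induction I) (auto simp: sf_val_const sf_val_add[of U] gr_holo_sum assms)

section \<open>Liouville's theorem and superfunctions on the punctured sphere\<close>

text \<open>Each coefficient function is entire and grows at most like the \<open>N\<close>-th power, so it equals its
  Taylor polynomial of degree \<open>N\<close>.\<close>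

lemma gr_liouville:
  assumes \<Phi>: "gr_holo UNIV \<Phi>" and W: "open W" "0 \<in> W" and A: "gr_holo W A"
    and eq: "\<And>y. y \<in> W \<Longrightarrow> y \<noteq> 0 \<Longrightarrow> \<Phi> (1 / y) * gc y ^ N = A y"
  shows "\<Phi> w = (\<Sum>j\<le>N. gr_taylor j \<Phi> 0 * gc w ^ j)"
proof (rule gr_eqI)
  fix k
  let ?f = "\<lambda>w. gr_coeff (\<Phi> w) k" and ?g = "\<lambda>y. gr_coeff (A y) k"
  have cont: "continuous_on W ?g"
    using A W by (intro holomorphic_on_imp_continuous_on gr_holoD)
  obtain r where r: "r > 0" "cball 0 r \<subseteq> W" using W open_contains_cball by blast
  have "compact (?g ` cball 0 r)"
    using r by (intro compact_continuous_image continuous_on_subset[OF cont]) auto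
  then obtain B where B: "\<And>y. y \<in> cball 0 r \<Longrightarrow> norm (?g y) \<le> B"
    unfolding bounded_iff[THEN iffD1, OF compact_imp_bounded, THEN exE]
    using compact_imp_bounded bounded_iff by (metis image_eqI)
  have "norm (?f z) \<le> B * norm z ^ N" if z: "1 / r \<le> norm z" for z
  proof -
    have z0: "z \<noteq> 0" using z r(1) by (auto simp: divide_le_0_iff)
    have y: "1 / z \<in> cball 0 r"
      using z z0 r(1) by (simp add: norm_divide field_simps)
    have "gr_coeff (\<Phi> z * gc (1 / z) ^ N) k = ?g (1 / z)"
      using eq[of "1 / z"] y r(2) z0 by auto
    then have "?f z = ?g (1 / z) * z ^ N"
      using z0 by (simp add: field_simps flip: gc_power)
    then show ?thesis
      using B[OF y] by (simp add: norm_mult norm_power mult_right_mono)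
  qed
  then have "?f w = (\<Sum>j\<le>N. (deriv ^^ j) ?f 0 / fact j * w ^ j)"
    by (rule Liouville_polynomial[OF gr_holoD[OF \<Phi>]])
  also have "\<dots> = gr_coeff (\<Sum>j\<le>N. gr_taylor j \<Phi> 0 * gc w ^ j) k"
    using gr_coeff_taylor[OF \<Phi>, of 0]
    by (simp add: sf_comp_def[abs_def] mult.commute flip: gc_power)
  finally show "?f w = gr_coeff (\<Sum>j\<le>N. gr_taylor j \<Phi> 0 * gc w ^ j) k" .
qed

lemma gr_coeff_zero_puncture:
  assumes "gr_holo U \<phi>" "open U" "\<And>w. w \<in> U \<Longrightarrow> w \<noteq> w0 \<Longrightarrow> gr_coeff (\<phi> w) k = 0" "w \<in> U"
  shows "gr_coeff (\<phi> w) k = 0"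
proof -
  have "gr_holo U (\<lambda>w. gc (gr_coeff (\<phi> w) k))" using assms by (intro gr_holo_gc gr_holoD)
  then have "gc (gr_coeff (\<phi> w) k) = 0"
    by (rule gr_holo_eq_puncture[OF assms(2) _ gr_holo_const, where ?w0.0 = w0]) (use assms in auto)
  then show ?thesis by (metis gr_body_simps(1,3))
qed

lemma gr_mem_puncture:
  assumes "gr_holo U \<phi>" "open U" "w \<in> U"
  shows "(\<And>w. w \<in> U \<Longrightarrow> w \<noteq> w0 \<Longrightarrow> \<phi> w \<in> gr_even L) \<Longrightarrow> \<phi> w \<in> gr_even L"
    and "(\<And>w. w \<in> U \<Longrightarrow> w \<noteq> w0 \<Longrightarrow> \<phi> w \<in> gr_odd L) \<Longrightarrow> \<phi> w \<in> gr_odd L"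
  using gr_coeff_zero_puncture[OF assms(1,2) _ assms(3), of w0]
  unfolding gr_even_def gr_odd_def gr_alg_def by blast+

lemma gr_holo_glue:
  assumes "gr_holo (- {w0}) \<phi>" "open V" "w0 \<in> V" "gr_holo V \<psi>"
    "\<And>w. w \<in> V \<Longrightarrow> w \<noteq> w0 \<Longrightarrow> \<phi> w = \<psi> w"
  shows "gr_holo UNIV (\<lambda>w. if w = w0 then \<psi> w else \<phi> w)"
proof -
  have "gr_holo (- {w0} \<union> V) (\<lambda>w. if w = w0 then \<psi> w else \<phi> w)"
  proof (rule gr_holo_Un)
    show "gr_holo (- {w0}) (\<lambda>w. if w = w0 then \<psi> w else \<phi> w)"
      by (rule gr_holo_cong[OF assms(1)]) simp
    show "gr_holo V (\<lambda>w. if w = w0 then \<psi> w else \<phi> w)"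
      by (rule gr_holo_cong[OF assms(4)]) (simp add: assms(5))
  qed (use assms in auto)
  moreover have "- {w0} \<union> V = UNIV" using assms by auto
  ultimately show ?thesis by simp
qed

text \<open>A removable singularity at \<open>w\<^sub>0\<close> and at most a pole of order \<open>N\<close> at infinity: \<open>\<phi>\<close> and \<open>\<psi>\<close> glue to an
  entire function.  The coefficients are Taylor coefficients, so they have the parity of the values.\<close>

lemma gr_polynomial:
  assumes \<phi>: "gr_holo (- {w0}) \<phi>"
    and V: "open V" "w0 \<in> V" and \<psi>: "gr_holo V \<psi>" "\<And>w. w \<in> V \<Longrightarrow> w \<noteq> w0 \<Longrightarrow> \<phi> w = \<psi> w"
    and W: "open W" "0 \<in> W" "\<And>y. y \<in> W \<Longrightarrow> y \<noteq> 0 \<Longrightarrow> 1 / y \<noteq> w0" and A: "gr_holo W A"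
    and eq: "\<And>y. y \<in> W \<Longrightarrow> y \<noteq> 0 \<Longrightarrow> \<phi> (1 / y) * gc y ^ N = A y"
  obtains q where "\<forall>w. w \<noteq> w0 \<longrightarrow> \<phi> w = (\<Sum>j\<le>N. q j * gc w ^ j)"
    "\<forall>w\<in>V. \<psi> w = (\<Sum>j\<le>N. q j * gc w ^ j)"
    "(\<forall>w. w \<noteq> w0 \<longrightarrow> \<phi> w \<in> gr_even L) \<longrightarrow> (\<forall>j. q j \<in> gr_even L)"
    "(\<forall>w. w \<noteq> w0 \<longrightarrow> \<phi> w \<in> gr_odd L) \<longrightarrow> (\<forall>j. q j \<in> gr_odd L)"
proof -
  define \<Phi> where "\<Phi> = (\<lambda>w. if w = w0 then \<psi> w else \<phi> w)"
  have \<Phi>: "gr_holo UNIV \<Phi>"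
    unfolding \<Phi>_def by (rule gr_holo_glue[OF \<phi> V \<psi>])
  have poly: "\<Phi> w = (\<Sum>j\<le>N. gr_taylor j \<Phi> 0 * gc w ^ j)" for w
    by (rule gr_liouville[OF \<Phi> W(1,2) A]) (use W eq in \<open>auto simp: \<Phi>_def\<close>)
  show thesis
  proof (rule that[of "\<lambda>j. gr_taylor j \<Phi> 0"]; intro allI ballI impI)
    show "\<phi> w = (\<Sum>j\<le>N. gr_taylor j \<Phi> 0 * gc w ^ j)" if "w \<noteq> w0" for w
      using poly[of w] that by (simp add: \<Phi>_def)
    show "\<psi> w = (\<Sum>j\<le>N. gr_taylor j \<Phi> 0 * gc w ^ j)" if "w \<in> V" for w
      using poly[of w] that \<psi> by (auto simp: \<Phi>_def split: if_splits)
    show "gr_taylor j \<Phi> 0 \<in> gr_even L" if "\<forall>w. w \<noteq> w0 \<longrightarrow> \<phi> w \<in> gr_even L" for j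
      by (rule gr_taylor_mem(1)[OF \<Phi>]; (rule gr_mem_puncture(1)[OF \<Phi>, of _ w0])?)
        (use that in \<open>auto simp: \<Phi>_def\<close>)
    show "gr_taylor j \<Phi> 0 \<in> gr_odd L" if "\<forall>w. w \<noteq> w0 \<longrightarrow> \<phi> w \<in> gr_odd L" for j
      by (rule gr_taylor_mem(2)[OF \<Phi>]; (rule gr_mem_puncture(2)[OF \<Phi>, of _ w0])?)
        (use that in \<open>auto simp: \<Phi>_def\<close>)
  qed
qed

text \<open>The case \<open>N = 0\<close> of a constant, which is its value at infinity.\<close>

lemma gr_vanishing:
  assumes \<phi>: "gr_holo (- {w0}) \<phi>"
    and V: "open V" "w0 \<in> V" and \<psi>: "gr_holo V \<psi>" "\<And>w. w \<in> V \<Longrightarrow> w \<noteq> w0 \<Longrightarrow> \<phi> w = \<psi> w"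
    and W: "open W" "0 \<in> W" "\<And>y. y \<in> W \<Longrightarrow> y \<noteq> 0 \<Longrightarrow> 1 / y \<noteq> w0" and A: "gr_holo W A"
    and eq: "\<And>y. y \<in> W \<Longrightarrow> y \<noteq> 0 \<Longrightarrow> \<phi> (1 / y) = A y"
    and 0: "A 0 = 0" and w: "w \<noteq> w0"
  shows "\<phi> w = 0"
proof -
  have eq': "\<phi> (1 / y) * gc y ^ 0 = A y" if "y \<in> W" "y \<noteq> 0" for y
    using eq that by simp
  obtain q where "\<forall>w. w \<noteq> w0 \<longrightarrow> \<phi> w = (\<Sum>j\<le>0. q j * gc w ^ j)"
    by (rule gr_polynomial[OF \<phi> V \<psi> W A eq'])
  then have q: "\<And>w. w \<noteq> w0 \<Longrightarrow> \<phi> w = q 0" by simp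
  have "A 0 = q 0"
    by (rule gr_holo_eq_puncture[OF W(1) A gr_holo_const, where ?w0.0 = 0]) (use W eq q in \<open>auto simp flip: eq\<close>)
  then show ?thesis using 0 q[OF w] by simp
qed

lemma sf_val_even:
  assumes "gr_holo U \<phi>" "open U" "gr_body z \<in> U" "z \<in> gr_even L" "\<And>w. w \<in> U \<Longrightarrow> \<phi> w \<in> gr_even L"
  shows "sf_val \<phi> z \<in> gr_even L"
proof -
  obtain M where M: "gr_soul z ^ M = 0" by (rule gr_soul_nilpotent)
  show ?thesis
    unfolding sf_val_eq_taylor[OF assms(1-3) M]
    using assms by (intro gr_even_sum gr_even_times gr_even_power gr_even_soul gr_taylor_mem(1)[OF assms(1-3)])
qed

text \<open>The value at \<open>a\<close> of the superfunction given by a branch of the complex square root near the body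
  of \<open>a\<close>.\<close>

lemma gr_even_sqrt:
  assumes a: "a \<in> gr_even L" "gr_body a \<noteq> 0"
  obtains s where "s \<in> gr_even L" "s * s = a" "gr_body s \<noteq> 0"
proof -
  define b where "b = gr_body a"
  define \<phi> where "\<phi> = (\<lambda>w. gc (csqrt b * csqrt (w / b)))"
  have b: "b \<noteq> 0" using a by (simp add: b_def)
  have "w / b \<notin> \<real>\<^sub>\<le>\<^sub>0" if "w \<in> ball b (norm b)" for w
  proof -
    have "norm (w / b - 1) < 1"
      using that b by (simp add: diff_divide_eq_iff norm_divide dist_norm norm_minus_commute)
    then have "\<bar>Re (w / b - 1)\<bar> < 1" using abs_Re_le_cmod le_less_trans by blast
    then show ?thesis by (auto simp: complex_nonpos_Reals_iff)
  qed
  then have holo: "gr_holo (ball b (norm b)) \<phi>"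
    unfolding \<phi>_def using b by (intro gr_holo_gc holomorphic_intros holomorphic_on_csqrt') auto
  have bU: "gr_body a \<in> ball b (norm b)" using b by (simp add: b_def)
  have "sf_val \<phi> a * sf_val \<phi> a = sf_val (\<lambda>w. \<phi> w * \<phi> w) a"
    by (rule sf_val_mult[symmetric, OF holo holo _ bU a(1)]) simp
  also have "(\<lambda>w. \<phi> w * \<phi> w) = gc"
  proof
    fix w
    have "(csqrt b * csqrt (w / b)) * (csqrt b * csqrt (w / b)) = (csqrt b)\<^sup>2 * (csqrt (w / b))\<^sup>2"
      by (simp add: power2_eq_square)
    also have "\<dots> = w" using b by simp
    finally show "\<phi> w * \<phi> w = gc w" by (simp add: \<phi>_def flip: gc_mult)
  qed
  finally have sq: "sf_val \<phi> a * sf_val \<phi> a = a" by (simp add: sf_val_id)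
  have "sf_val \<phi> a \<in> gr_even L"
    by (rule sf_val_even[OF holo _ bU a(1)]) (auto simp: \<phi>_def)
  moreover have "gr_body (sf_val \<phi> a) \<noteq> 0"
    using sq a(2) by (metis gr_body_simps(7) mult_zero_left)
  ultimately show thesis using sq that by blast
qed

lemma gr_holo_divided_difference:
  assumes "gr_holo W \<phi>" "open W" "0 \<in> W"
  obtains \<kappa> where "gr_holo W \<kappa>" "\<And>y. y \<in> W \<Longrightarrow> \<phi> y - \<phi> 0 = gc y * \<kappa> y"
    "\<kappa> 0 = sf_deriv \<phi> 0"
proof -
  define \<kappa> where "\<kappa> = (\<lambda>y. if y = 0 then sf_deriv \<phi> 0 else gc (1 / y) * (\<phi> y - \<phi> 0))"
  have "gr_holo W \<kappa>"
  proof (rule gr_holoI)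
    fix k
    have "(\<lambda>z. if z = 0 then deriv (\<lambda>w. gr_coeff (\<phi> w) k) 0
       else (gr_coeff (\<phi> z) k - gr_coeff (\<phi> 0) k) / (z - 0)) holomorphic_on W"
      using assms by (intro pole_lemma gr_holoD) (auto simp: interior_open)
    then show "(\<lambda>y. gr_coeff (\<kappa> y) k) holomorphic_on W"
      by (rule holomorphic_transform) (auto simp: \<kappa>_def gr_coeff_sf_deriv[OF assms])
  qed
  moreover have "\<phi> y - \<phi> 0 = gc y * \<kappa> y" for y
    by (auto simp: \<kappa>_def mult.assoc[symmetric] simp flip: gc_mult)
  moreover have "\<kappa> 0 = sf_deriv \<phi> 0" by (simp add: \<kappa>_def)
  ultimately show thesis using that by blast
qed

text \<open>Let \<open>\<alpha> = fh 0\<close> be the value at infinity.  By injectivity of the body, \<open>u = 1 / (f - \<alpha>)\<close> is defined off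
  \<open>w\<^sub>0\<close> and has a simple pole at infinity; near \<open>w\<^sub>0\<close> it equals \<open>h / (1 - \<alpha> h)\<close>.  So \<open>u = \<gamma> w + \<delta>\<close> with
  invertible \<open>\<gamma>\<close>, and \<open>f = \<alpha> + 1 / u\<close> is the Moebius transformation with
  \<open>(c, d) = s (\<gamma>, \<delta>)\<close> and \<open>(a, b) = \<alpha> (c, d) + (0, s)\<close>.  Its determinant is \<open>- s\<^sup>2 \<gamma>\<close>.\<close>

lemma gr_moebius:
  assumes f: "gr_holo (- {w0}) f" "\<And>w. w \<noteq> w0 \<Longrightarrow> f w \<in> gr_even L"
    and V: "open V" "w0 \<in> V" and h: "gr_holo V h" "\<And>w. w \<in> V \<Longrightarrow> w \<noteq> w0 \<Longrightarrow> f w * h w = 1"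
      "gr_body (h w0) = 0"
    and W: "open W" "0 \<in> W" "\<And>y. y \<in> W \<Longrightarrow> y \<noteq> 0 \<Longrightarrow> 1 / y \<noteq> w0"
    and fh: "gr_holo W fh" "\<And>y. y \<in> W \<Longrightarrow> y \<noteq> 0 \<Longrightarrow> f (1 / y) = fh y"
    and inj: "\<And>w. w \<noteq> w0 \<Longrightarrow> gr_body (f w) \<noteq> gr_body (fh 0)" "gr_body (sf_deriv fh 0) \<noteq> 0"
  obtains a b c d where "a \<in> gr_even L" "b \<in> gr_even L" "c \<in> gr_even L" "d \<in> gr_even L"
    "a * d - b * c = 1" "gr_body c \<noteq> 0" "\<And>w. w \<noteq> w0 \<Longrightarrow> gr_body (c * gc w + d) \<noteq> 0"
    "gr_body (c * gc w0 + d) = 0" "\<And>w. w \<noteq> w0 \<Longrightarrow> f w * (c * gc w + d) = a * gc w + b"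
proof -
  define \<alpha> where "\<alpha> = fh 0"
  have fh_even: "fh y \<in> gr_even L" if "y \<in> W" for y
    by (rule gr_mem_puncture(1)[OF fh(1) W(1) that, of 0]) (use f fh(2) W in \<open>metis\<close>)
  then have \<alpha>: "\<alpha> \<in> gr_even L" using W by (simp add: \<alpha>_def)
  have nz: "gr_body (f w - \<alpha>) \<noteq> 0" if "w \<noteq> w0" for w using inj(1)[OF that] by (simp add: \<alpha>_def)
  define u where "u = (\<lambda>w. inverse (f w - \<alpha>))"
  have u: "gr_holo (- {w0}) u"
    unfolding u_def by (intro gr_holo_inverse gr_holo_diff f gr_holo_const) (use nz in auto)
  have u_even: "u w \<in> gr_even L" if "w \<noteq> w0" for w
    unfolding u_def using that f(2) \<alpha> nz by (intro gr_inverse_even) auto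
  have hb: "gr_body (1 - \<alpha> * h w) \<noteq> 0" if "w \<in> V" for w
  proof (cases "w = w0")
    case False
    have "(f w - \<alpha>) * h w = 1 - \<alpha> * h w" using h(2)[OF that False] by (simp add: left_diff_distrib)
    moreover have "gr_body (h w) \<noteq> 0"
      using h(2)[OF that False] by (metis gr_body_simps(2,7) mult_zero_right zero_neq_one)
    ultimately show ?thesis using nz[OF False] by (metis gr_body_simps(7) mult_eq_0_iff)
  qed (simp add: h(3))
  obtain \<kappa> where \<kappa>: "gr_holo W \<kappa>" "\<And>y. y \<in> W \<Longrightarrow> fh y - \<alpha> = gc y * \<kappa> y" "\<kappa> 0 = sf_deriv fh 0"
    using gr_holo_divided_difference[OF fh(1) W(1,2)] unfolding \<alpha>_def by metis
  have \<kappa>b: "gr_body (\<kappa> y) \<noteq> 0" if "y \<in> W" for y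
  proof (cases "y = 0")
    case False
    then have "gr_body (fh y - \<alpha>) \<noteq> 0" using nz[OF W(3)[OF that False]] fh(2)[OF that False] by simp
    then show ?thesis using \<kappa>(2)[OF that] by auto
  qed (simp add: \<kappa> inj)
  have inf: "u (1 / y) * gc y ^ 1 = inverse (\<kappa> y)" if "y \<in> W" "y \<noteq> 0" for y
  proof -
    have "u (1 / y) = inverse (gc y * \<kappa> y)"
      unfolding u_def using fh(2)[OF that] \<kappa>(2)[OF that(1)] by simp
    also have "\<dots> = inverse (\<kappa> y) * inverse (gc y)"
      using that \<kappa>b by (intro gr_inverse_mult) auto
    finally show ?thesis using that by (simp add: mult.assoc)
  qed
  have H1: "gr_holo V (\<lambda>w. h w * inverse (1 - \<alpha> * h w))"
    using h hb by (intro gr_holo_mult gr_holo_inverse gr_holo_diff gr_holo_const) auto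
  have H2: "u w = h w * inverse (1 - \<alpha> * h w)" if "w \<in> V" "w \<noteq> w0" for w
  proof -
    have "(f w - \<alpha>) * (h w * inverse (1 - \<alpha> * h w)) = (1 - \<alpha> * h w) * inverse (1 - \<alpha> * h w)"
      unfolding mult.assoc[symmetric] left_diff_distrib h(2)[OF that] ..
    also have "\<dots> = (f w - \<alpha>) * u w" using hb nz that by (simp add: u_def)
    finally show ?thesis using nz that by (metis gr_unit_cancel)
  qed
  have H3: "gr_holo W (\<lambda>y. inverse (\<kappa> y))" by (rule gr_holo_inverse[OF \<kappa>(1)]) (rule \<kappa>b)
  obtain q where "\<forall>w. w \<noteq> w0 \<longrightarrow> u w = (\<Sum>j\<le>1. q j * gc w ^ j)"
    "\<forall>w\<in>V. h w * inverse (1 - \<alpha> * h w) = (\<Sum>j\<le>1. q j * gc w ^ j)"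
    "(\<forall>w. w \<noteq> w0 \<longrightarrow> u w \<in> gr_even L) \<longrightarrow> (\<forall>j. q j \<in> gr_even L)"
    by (rule gr_polynomial[OF u V H1 H2 W H3 inf])
  then have q: "\<And>w. w \<noteq> w0 \<Longrightarrow> u w = q 0 + q 1 * gc w"
    "\<And>w. w \<in> V \<Longrightarrow> h w * inverse (1 - \<alpha> * h w) = q 0 + q 1 * gc w"
    "\<And>j. q j \<in> gr_even L"
    using u_even by simp_all
  define \<gamma> \<delta> where "\<gamma> = q 1" and "\<delta> = q 0"
  have uq: "u w = \<gamma> * gc w + \<delta>" if "w \<noteq> w0" for w
    using q(1)[OF that] by (simp add: \<gamma>_def \<delta>_def add.commute)
  have ev: "\<gamma> \<in> gr_even L" "\<delta> \<in> gr_even L" using q(3) by (simp_all add: \<gamma>_def \<delta>_def)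
  have "inverse (\<kappa> 0) = \<gamma> + \<delta> * gc 0"
  proof (rule gr_holo_eq_puncture[OF W(1), where ?w0.0 = 0 and \<phi> = "\<lambda>y. inverse (\<kappa> y)" and \<psi> = "\<lambda>y. \<gamma> + \<delta> * gc y"])
    show "inverse (\<kappa> y) = \<gamma> + \<delta> * gc y" if "y \<in> W" "y \<noteq> 0" for y
    proof -
      have "inverse (\<kappa> y) = (\<gamma> * gc (1 / y) + \<delta>) * gc y"
        using inf[OF that] uq[OF W(3)[OF that]] by simp
      then show ?thesis using that by (simp add: distrib_right mult.assoc flip: gc_mult)
    qed
  qed (use W \<kappa> \<kappa>b in \<open>auto intro!: gr_holo_inverse gr_holo_add gr_holo_mult gr_holo_const gr_holo_gc_id\<close>)
  then have \<gamma>b: "gr_body \<gamma> \<noteq> 0" using \<kappa>b[OF W(2)] by (metis gc_0 gr_body_inverse add_0_right mult_zero_right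
        inverse_nonzero_iff_nonzero)
  \<comment> \<open>This choice of \<open>s\<close> makes the determinant equal to 1.\<close>
  obtain s where s: "s \<in> gr_even L" "s * s = - inverse \<gamma>" "gr_body s \<noteq> 0"
    by (rule gr_even_sqrt[of "- inverse \<gamma>" L]) (use ev \<gamma>b in auto)
  have comm: "x * s = s * x" "x * \<gamma> = \<gamma> * x" "x * \<delta> = \<delta> * x" "x * \<alpha> = \<alpha> * x" for x
    using gr_even_commute s(1) ev \<alpha> by metis+
  define c d a b where "c = s * \<gamma>" and "d = s * \<delta>" and "a = \<alpha> * c" and "b = \<alpha> * d + s"
  show thesis
  proof (rule that[of a b c d])
    show "a \<in> gr_even L" "b \<in> gr_even L" "c \<in> gr_even L" "d \<in> gr_even L"
      unfolding a_def b_def c_def d_def using s(1) ev \<alpha> by auto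
    have "a * d - b * c = \<alpha> * (c * d - d * c) - s * s * \<gamma>"
      unfolding a_def b_def c_def by (simp add: algebra_simps)
    also have "c * d = d * c" using \<open>d \<in> gr_even L\<close> gr_even_commute by metis
    also have "\<alpha> * (d * c - d * c) - s * s * \<gamma> = 1" using s(2) \<gamma>b by simp
    finally show "a * d - b * c = 1" .
    show "gr_body c \<noteq> 0" unfolding c_def using s(3) \<gamma>b by simp
    have cd: "c * gc w + d = s * (\<gamma> * gc w + \<delta>)" for w by (simp add: c_def d_def algebra_simps)
    show "gr_body (c * gc w + d) \<noteq> 0" if "w \<noteq> w0" for w
    proof -
      have "gr_body (u w) \<noteq> 0" unfolding u_def using nz[OF that] by simp
      then show ?thesis unfolding cd uq[OF that, symmetric] using s(3) by simp
    qed
    have "\<gamma> * gc w0 + \<delta> = h w0 * inverse (1 - \<alpha> * h w0)"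
      using q(2)[OF V(2)] by (simp add: \<gamma>_def \<delta>_def add.commute)
    then show "gr_body (c * gc w0 + d) = 0" unfolding cd using h(3) by (simp del: gr_body_simps(4))
    show "f w * (c * gc w + d) = a * gc w + b" if "w \<noteq> w0" for w
    proof -
      have 1: "(f w - \<alpha>) * u w = 1" unfolding u_def using nz[OF that] by simp
      have "f w * (c * gc w + d) = s * ((f w - \<alpha>) * u w + \<alpha> * u w)"
        unfolding cd uq[OF that, symmetric] by (metis comm(1) mult.assoc diff_add_cancel distrib_right)
      also have "\<dots> = s + \<alpha> * (c * gc w + d)"
        unfolding 1 cd uq[OF that, symmetric] by (metis comm(1) mult.assoc mult.right_neutral distrib_left)
      finally show ?thesis by (simp add: a_def b_def algebra_simps)
    qed
  qed
qed

section \<open>Component functions\<close>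

lemma gc_superspace: "p \<in> gr_odd L \<Longrightarrow> m \<in> gr_odd L \<Longrightarrow> (gc w, p, m) \<in> superspace L"
  by (simp add: superspace_def)

lemma spoint_body_gc [simp]: "spoint_body (gc w, p, m) = w"
  by (simp add: spoint_body_def)

lemma openin_dewitt:
  assumes "openin (dewitt L) D"
  shows "open (spoint_body ` D)" "D = {x \<in> superspace L. spoint_body x \<in> spoint_body ` D}"
proof -
  obtain V where V: "open V" "D = spoint_body -` V \<inter> superspace L"
    using assms by (auto simp: dewitt_def openin_pullback_topology)
  have "spoint_body ` D = V"
  proof
    show "V \<subseteq> spoint_body ` D"
    proof
      fix w assume "w \<in> V"
      then have "(gc w, 0, 0) \<in> D" using V gc_superspace[of 0 L 0 w] by auto
      then show "w \<in> spoint_body ` D" by (metis image_eqI spoint_body_gc)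
    qed
  qed (use V in auto)
  with V show "open (spoint_body ` D)" "D = {x \<in> superspace L. spoint_body x \<in> spoint_body ` D}" by auto
qed

lemma superanalyticD:
  assumes "superanalytic L U \<phi>"
  shows "open U" "gr_holo U \<phi>" "w \<in> U \<Longrightarrow> \<phi> w \<in> gr_alg (L - 2)"
  using assms by (auto simp: superanalytic_def gr_holo_def)

lemma superanalytic_gc:
  assumes "superanalytic L U \<phi>" "w \<in> U"
  shows "sf_val \<phi> (gc w) = \<phi> w" "sf_val (sf_deriv \<phi>) (gc w) = sf_deriv \<phi> w"
    "sf_deriv \<phi> w \<in> gr_alg (L - 2)"
proof -
  note D = superanalyticD[OF assms(1)]
  show "sf_val \<phi> (gc w) = \<phi> w" "sf_val (sf_deriv \<phi>) (gc w) = sf_deriv \<phi> w"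
    using sf_val_gc[OF D(2,1) assms(2)] sf_val_gc[OF gr_holo_sf_deriv[OF D(2,1)] D(1) assms(2)] by auto
  show "sf_deriv \<phi> w \<in> gr_alg (L - 2)"
    unfolding sf_deriv_eq_taylor by (rule gr_taylor_mem(3)[OF D(2,1) assms(2) D(3)])
qed

lemma theta_mult:
  assumes "p \<in> gr_odd L" "m \<in> gr_odd L"
  shows "p * p = 0" "m * m = 0" "m * p = - (p * m)" "p * (p * x) = 0" "m * (m * x) = 0"
    "m * (p * x) = - (p * (m * x))"
  using gr_odd_square[OF assms(1)] gr_odd_square[OF assms(2)] gr_odd_anticommute[OF assms]
  by (auto simp flip: mult.assoc)

lemma D_plus_gc:
  assumes "superanalytic2 L U (f0, f1, f2, f3)" "w \<in> U" "p \<in> gr_odd L" "m \<in> gr_odd L"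
  shows "D_plus (f0, f1, f2, f3) (gc w, p, m)
     = f1 w + p * 0 + m * (f3 w + sf_deriv f0 w) + p * m * (- sf_deriv f1 w)"
  using assms by (simp add: D_plus_def superanalytic_gc[of L U] sf_val_const distrib_left mult.assoc
      theta_mult[OF assms(3,4)])

lemma D_minus_gc:
  assumes "superanalytic2 L U (f0, f1, f2, f3)" "w \<in> U" "p \<in> gr_odd L" "m \<in> gr_odd L"
  shows "D_minus (f0, f1, f2, f3) (gc w, p, m)
     = f2 w + p * (sf_deriv f0 w - f3 w) + m * 0 + p * m * sf_deriv f2 w"
proof -
  have "sf_val (\<lambda>w. - f3 w) (gc w) = - f3 w"
    using assms superanalyticD[of L U f3] sf_val_minus[of U f3 "gc w"] by (auto simp: superanalytic_gc[of L U])
  then show ?thesis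
    using assms by (simp add: D_minus_def superanalytic_gc[of L U] sf_val_const distrib_left mult.assoc
        theta_mult[OF assms(3,4)] right_diff_distrib)
qed

lemma sf2_val_gc:
  assumes "superanalytic2 L U (f0, f1, f2, f3)" "w \<in> U"
  shows "sf2_val (f0, f1, f2, f3) (gc w, p, m) = f0 w + p * f1 w + m * f2 w + p * m * f3 w"
  using assms by (simp add: superanalytic_gc[of L U])

lemma even_from_alg: "x \<in> gr_alg L' \<Longrightarrow> x \<in> gr_even L \<Longrightarrow> x \<in> gr_even L'"
  and odd_from_alg: "x \<in> gr_alg L' \<Longrightarrow> x \<in> gr_odd L \<Longrightarrow> x \<in> gr_odd L'"
  by (auto simp: gr_even_def gr_odd_def)

text \<open>At a point \<open>(w, p, m)\<close> with complex \<open>w\<close> the superconformal equations are polynomials in the odd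
  variables \<open>p\<close>, \<open>m\<close>, and the coefficients of \<open>1\<close>, \<open>p\<close>, \<open>m\<close> vanish separately.  The equations for the even
  coordinate determine only the sum and the difference of \<open>z3\<close> and \<open>sf_deriv z0\<close>, whence the division
  by 2.\<close>

lemma n2_superconformal_complex:
  assumes L: "2 \<le> L" and sc: "n2_superconformal L H"
  defines "U \<equiv> spoint_body ` dom H"
  obtains z0 z1 z2 z3 p0 p1 p2 p3 m0 m1 m2 m3
  where "superanalytic2 L U (z0, z1, z2, z3)" "superanalytic2 L U (p0, p1, p2, p3)"
    "superanalytic2 L U (m0, m1, m2, m3)"
    "\<forall>x\<in>dom H. H x = Some (sf2_val (z0, z1, z2, z3) x, sf2_val (p0, p1, p2, p3) x, sf2_val (m0, m1, m2, m3) x)"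
    "\<forall>w\<in>U. z0 w \<in> gr_even (L - 2) \<and> p1 w \<in> gr_even (L - 2) \<and> m2 w \<in> gr_even (L - 2)
       \<and> p0 w \<in> gr_odd (L - 2) \<and> m0 w \<in> gr_odd (L - 2)"
    "\<forall>w\<in>U. p2 w = 0 \<and> p3 w = sf_deriv p0 w \<and> m1 w = 0 \<and> m3 w = - sf_deriv m0 w"
    "\<forall>w\<in>U. z1 w = p1 w * m0 w \<and> z2 w = m2 w * p0 w \<and> z3 w = sf_deriv p0 w * m0 w + p0 w * sf_deriv m0 w"
    "\<forall>w\<in>U. sf_deriv z0 w = sf_deriv p0 w * m0 w - p0 w * sf_deriv m0 w + p1 w * m2 w"
proof -
  have op: "openin (dewitt L) (dom H)" and ran: "ran H \<subseteq> superspace L"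
    using sc by (auto simp: n2_superconformal_def)
  have U: "open U" and dom: "dom H = {x \<in> superspace L. spoint_body x \<in> U}"
    using openin_dewitt[OF op] by (simp_all add: U_def)
  obtain Z P M where
    sa: "superanalytic2 L U Z" "superanalytic2 L U P" "superanalytic2 L U M"
    and H: "\<And>x. x \<in> dom H \<Longrightarrow> H x = Some (sf2_val Z x, sf2_val P x, sf2_val M x)"
    and DM: "\<And>x. x \<in> dom H \<Longrightarrow> D_plus M x = 0"
    and DP: "\<And>x. x \<in> dom H \<Longrightarrow> D_minus P x = 0"
    and DpZ: "\<And>x. x \<in> dom H \<Longrightarrow> D_plus Z x - sf2_val M x * D_plus P x = 0"
    and DmZ: "\<And>x. x \<in> dom H \<Longrightarrow> D_minus Z x - sf2_val P x * D_minus M x = 0"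
    using sc unfolding n2_superconformal_def U_def[symmetric] by blast
  obtain z0 z1 z2 z3 where Z: "Z = (z0, z1, z2, z3)" by (cases Z) auto
  obtain p0 p1 p2 p3 where P: "P = (p0, p1, p2, p3)" by (cases P) auto
  obtain m0 m1 m2 m3 where M: "M = (m0, m1, m2, m3)" by (cases M) auto
  note sa' = sa[unfolded Z P M]
  note sas = sa'[unfolded superanalytic2.simps]
  have pt: "(gc w, p, m) \<in> dom H" if "w \<in> U" "p \<in> gr_odd L" "m \<in> gr_odd L" for w p m
    using that dom gc_superspace by auto
  have alg: "z0 w \<in> gr_alg (L - 2)" "z1 w \<in> gr_alg (L - 2)" "z2 w \<in> gr_alg (L - 2)" "z3 w \<in> gr_alg (L - 2)"
    "p0 w \<in> gr_alg (L - 2)" "p1 w \<in> gr_alg (L - 2)" "p2 w \<in> gr_alg (L - 2)" "p3 w \<in> gr_alg (L - 2)"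
    "m0 w \<in> gr_alg (L - 2)" "m1 w \<in> gr_alg (L - 2)" "m2 w \<in> gr_alg (L - 2)" "m3 w \<in> gr_alg (L - 2)"
    if "w \<in> U" for w
    using sas that by (auto dest: superanalyticD(3))
  have alg': "sf_deriv z0 w \<in> gr_alg (L - 2)" "sf_deriv z1 w \<in> gr_alg (L - 2)" "sf_deriv z2 w \<in> gr_alg (L - 2)"
    "sf_deriv p0 w \<in> gr_alg (L - 2)" "sf_deriv p1 w \<in> gr_alg (L - 2)" "sf_deriv p2 w \<in> gr_alg (L - 2)"
    "sf_deriv m0 w \<in> gr_alg (L - 2)" "sf_deriv m1 w \<in> gr_alg (L - 2)" "sf_deriv m2 w \<in> gr_alg (L - 2)"
    if "w \<in> U" for w
    using sas that by (auto dest: superanalytic_gc(3))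
  have vals: "sf2_val Z x \<in> gr_even L" "sf2_val P x \<in> gr_odd L" "sf2_val M x \<in> gr_odd L" if "x \<in> dom H" for x
  proof -
    have "(sf2_val Z x, sf2_val P x, sf2_val M x) \<in> ran H" using H[OF that] by (rule ranI)
    then show "sf2_val Z x \<in> gr_even L" "sf2_val P x \<in> gr_odd L" "sf2_val M x \<in> gr_odd L"
      using ran by (auto simp: superspace_def)
  qed
  have par: "z0 w \<in> gr_even (L - 2)" "p0 w \<in> gr_odd (L - 2)" "m0 w \<in> gr_odd (L - 2)"
    "p1 w \<in> gr_even (L - 2)" "m2 w \<in> gr_even (L - 2)" if w: "w \<in> U" for w
  proof -
    note v = vals[OF pt[OF w], unfolded Z P M sf2_val_gc[OF sa'(1) w] sf2_val_gc[OF sa'(2) w] sf2_val_gc[OF sa'(3) w]]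
    show z: "z0 w \<in> gr_even (L - 2)" "p0 w \<in> gr_odd (L - 2)" "m0 w \<in> gr_odd (L - 2)"
      using v(1-3)[of 0 0] alg[OF w] by (auto intro: even_from_alg odd_from_alg)
    show "p1 w \<in> gr_even (L - 2)"
    proof (rule gr_even_theta_expansion(1)[OF L alg(6)[OF w]])
      fix p assume "p \<in> gr_odd L"
      from gr_odd_diff[OF v(2)[OF this, of 0] gr_odd_minus[OF z(2)]] show "p * p1 w \<in> gr_odd L" by simp
    qed
    show "m2 w \<in> gr_even (L - 2)"
    proof (rule gr_even_theta_expansion(1)[OF L alg(11)[OF w]])
      fix m assume "m \<in> gr_odd L"
      from gr_odd_diff[OF v(3)[OF _ this, of 0] gr_odd_minus[OF z(3)]] show "m * m2 w \<in> gr_odd L" by simp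
    qed
  qed
  have A: "m1 w = 0 \<and> m3 w + sf_deriv m0 w = 0" if w: "w \<in> U" for w
  proof -
    have e: "m1 w + p * 0 + m * (m3 w + sf_deriv m0 w) + p * m * (- sf_deriv m1 w) = 0"
      if "p \<in> gr_odd L" "m \<in> gr_odd L" for p m
      using DM[OF pt[OF w that]] unfolding M D_plus_gc[OF sa'(3) w that] .
    have "- sf_deriv m1 w \<in> gr_alg (L - 2)" "m3 w + sf_deriv m0 w \<in> gr_alg (L - 2)"
      using alg[OF w] alg'[OF w] by auto
    from theta_expansion_zero(1,3)[OF L alg(10)[OF w] gr_zero_mem(3) this(2,1) e] show ?thesis by simp
  qed
  have B: "p2 w = 0 \<and> sf_deriv p0 w - p3 w = 0" if w: "w \<in> U" for w
  proof -
    have e: "p2 w + p * (sf_deriv p0 w - p3 w) + m * 0 + p * m * sf_deriv p2 w = 0"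
      if "p \<in> gr_odd L" "m \<in> gr_odd L" for p m
      using DP[OF pt[OF w that]] unfolding P D_minus_gc[OF sa'(2) w that] .
    have "sf_deriv p2 w \<in> gr_alg (L - 2)" "sf_deriv p0 w - p3 w \<in> gr_alg (L - 2)"
      using alg[OF w] alg'[OF w] by auto
    from theta_expansion_zero(1,2)[OF L alg(7)[OF w] this(2) gr_zero_mem(3) this(1) e] show ?thesis by simp
  qed
  have m3: "m3 w = - sf_deriv m0 w" and p3: "p3 w = sf_deriv p0 w" if "w \<in> U" for w
    using A[OF that] B[OF that] by (simp_all add: eq_neg_iff_add_eq_0)
  have C: "z1 w = m0 w * p1 w" "z3 w + sf_deriv z0 w = m2 w * p1 w - 2 * (m0 w * sf_deriv p0 w)"
    if w: "w \<in> U" for w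
  proof -
    have 0: "D_plus Z x = sf2_val M x * D_plus P x" if "x \<in> dom H" for x
      using DpZ[OF that] by simp
    have 1: "z1 w + m * (z3 w + sf_deriv z0 w)
        = m0 w * p1 w + m * (m2 w * p1 w - 2 * (m0 w * sf_deriv p0 w))"
      if m: "m \<in> gr_odd L" for m
    proof -
      have comm: "m0 w * m = - (m * m0 w)" "m2 w * m = m * m2 w" "m * m = 0"
        using gr_odd_anticommute[OF m par(3)[OF w]] gr_even_commute[OF par(5)[OF w], of m]
          gr_odd_square[OF m] by auto
      then have comm': "m0 w * (m * x) = - (m * (m0 w * x))" "m2 w * (m * x) = m * (m2 w * x)"
        "m * (m * x) = 0" for x
        by (simp_all flip: mult.assoc)
      have "z1 w + m * (z3 w + sf_deriv z0 w) = (m0 w + m * m2 w) * (p1 w + m * (sf_deriv p0 w + sf_deriv p0 w))"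
        using 0[OF pt[OF w gr_zero_mem(2) m]] A[OF w] p3[OF w]
        unfolding Z P M D_plus_gc[OF sa'(1) w gr_zero_mem(2) m] D_plus_gc[OF sa'(2) w gr_zero_mem(2) m]
          sf2_val_gc[OF sa'(3) w] by simp
      also have "\<dots> = m0 w * p1 w + m * (m2 w * p1 w - 2 * (m0 w * sf_deriv p0 w))"
        by (simp add: distrib_left distrib_right comm' mult.assoc right_diff_distrib mult_2 mult_2_right)
      finally show ?thesis .
    qed
    show z1: "z1 w = m0 w * p1 w" using 1[of 0] by simp
    show "z3 w + sf_deriv z0 w = m2 w * p1 w - 2 * (m0 w * sf_deriv p0 w)"
      by (rule gr_odd_cancel[OF L]; (use 1 z1 in simp)?)
        (use alg[OF w] alg'[OF w] in \<open>auto intro!: gr_alg_add gr_alg_diff gr_alg_times intro: gr_even_alg\<close>)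
  qed
  have D: "z2 w = p0 w * m2 w" "sf_deriv z0 w - z3 w = p1 w * m2 w - 2 * (p0 w * sf_deriv m0 w)"
    if w: "w \<in> U" for w
  proof -
    have 0: "D_minus Z x = sf2_val P x * D_minus M x" if "x \<in> dom H" for x
      using DmZ[OF that] by simp
    have 1: "z2 w + p * (sf_deriv z0 w - z3 w)
        = p0 w * m2 w + p * (p1 w * m2 w - 2 * (p0 w * sf_deriv m0 w))"
      if p: "p \<in> gr_odd L" for p
    proof -
      have comm: "p0 w * p = - (p * p0 w)" "p1 w * p = p * p1 w" "p * p = 0"
        using gr_odd_anticommute[OF p par(2)[OF w]] gr_even_commute[OF par(4)[OF w], of p]
          gr_odd_square[OF p] by auto
      then have comm': "p0 w * (p * x) = - (p * (p0 w * x))" "p1 w * (p * x) = p * (p1 w * x)"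
        "p * (p * x) = 0" for x
        by (simp_all flip: mult.assoc)
      have "z2 w + p * (sf_deriv z0 w - z3 w) = (p0 w + p * p1 w) * (m2 w + p * (sf_deriv m0 w + sf_deriv m0 w))"
        using 0[OF pt[OF w p gr_zero_mem(2)]] B[OF w] m3[OF w]
        unfolding Z P M D_minus_gc[OF sa'(1) w p gr_zero_mem(2)] D_minus_gc[OF sa'(3) w p gr_zero_mem(2)]
          sf2_val_gc[OF sa'(2) w] by simp
      also have "\<dots> = p0 w * m2 w + p * (p1 w * m2 w - 2 * (p0 w * sf_deriv m0 w))"
        by (simp add: distrib_left distrib_right comm' mult.assoc right_diff_distrib mult_2 mult_2_right)
      finally show ?thesis .
    qed
    show z2: "z2 w = p0 w * m2 w" using 1[of 0] by simp
    show "sf_deriv z0 w - z3 w = p1 w * m2 w - 2 * (p0 w * sf_deriv m0 w)"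
      by (rule gr_odd_cancel[OF L]; (use 1 z2 in simp)?)
        (use alg[OF w] alg'[OF w] in \<open>auto intro!: gr_alg_add gr_alg_diff gr_alg_times intro: gr_even_alg\<close>)
  qed
  have E: "z3 w = sf_deriv p0 w * m0 w + p0 w * sf_deriv m0 w"
    "sf_deriv z0 w = sf_deriv p0 w * m0 w - p0 w * sf_deriv m0 w + p1 w * m2 w" if w: "w \<in> U" for w
  proof -
    have "sf_deriv p0 w \<in> gr_odd (L - 2)"
      unfolding sf_deriv_eq_taylor using sas U w par(2) by (intro gr_taylor_mem(2)[of U]) (auto dest: superanalyticD)
    then have 1: "m0 w * sf_deriv p0 w = - (sf_deriv p0 w * m0 w)"
      using gr_odd_anticommute par(3)[OF w] by blast
    have 2: "m2 w * p1 w = p1 w * m2 w" using gr_even_commute par(4)[OF w] by blast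
    \<comment> \<open>The sum and the difference of \<open>z3 w\<close> and \<open>sf_deriv z0 w\<close> are known.\<close>
    have half: "x = y" if "2 * x = 2 * (y :: gr)" for x y
      using that gc_cancel[of 2 x y] by (simp add: gc_numeral)
    note C2 = C(2)[OF w, unfolded 1 2] and D2 = D(2)[OF w]
    have "2 * z3 w = (z3 w + sf_deriv z0 w) - (sf_deriv z0 w - z3 w)" by (simp add: mult_2)
    also have "\<dots> = 2 * (sf_deriv p0 w * m0 w + p0 w * sf_deriv m0 w)" unfolding C2 D2 by (simp add: algebra_simps)
    finally show "z3 w = sf_deriv p0 w * m0 w + p0 w * sf_deriv m0 w" by (rule half)
    have "2 * sf_deriv z0 w = (z3 w + sf_deriv z0 w) + (sf_deriv z0 w - z3 w)" by (simp add: mult_2)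
    also have "\<dots> = 2 * (sf_deriv p0 w * m0 w - p0 w * sf_deriv m0 w + p1 w * m2 w)"
      unfolding C2 D2 by (simp add: algebra_simps mult_2 mult_2_right)
    finally show "sf_deriv z0 w = sf_deriv p0 w * m0 w - p0 w * sf_deriv m0 w + p1 w * m2 w" by (rule half)
  qed
  show thesis
  proof (rule that[OF sa']; intro ballI)
    show "H x = Some (sf2_val (z0, z1, z2, z3) x, sf2_val (p0, p1, p2, p3) x, sf2_val (m0, m1, m2, m3) x)"
      if "x \<in> dom H" for x
      using H[OF that] unfolding Z P M .
    show "z1 w = p1 w * m0 w \<and> z2 w = m2 w * p0 w \<and> z3 w = sf_deriv p0 w * m0 w + p0 w * sf_deriv m0 w"
      if "w \<in> U" for w
      using C(1) D(1) E(1) that gr_even_commute[OF par(4)[OF that]] gr_even_commute[OF par(5)[OF that]] by auto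
  qed (use par A B m3 p3 E(2) in auto)
qed

text \<open>The coefficients found at complex points are component functions at all points, because \<open>sf_val\<close>
  respects products.\<close>

lemma n2_components_exist:
  assumes L: "2 \<le> L" and sc: "n2_superconformal L H"
  shows "\<exists>f gp gm pp pm. n2_components L H f gp gm pp pm"
proof -
  define U where "U = spoint_body ` dom H"
  have dom: "dom H = {x \<in> superspace L. spoint_body x \<in> U}" and U: "open U"
    using sc openin_dewitt[of L "dom H"] by (auto simp: U_def n2_superconformal_def)
  obtain z0 z1 z2 z3 p0 p1 p2 p3 m0 m1 m2 m3
  where sa: "superanalytic2 L U (z0, z1, z2, z3)" "superanalytic2 L U (p0, p1, p2, p3)"
    "superanalytic2 L U (m0, m1, m2, m3)"
    and H': "\<forall>x\<in>dom H. H x = Some (sf2_val (z0, z1, z2, z3) x, sf2_val (p0, p1, p2, p3) x, sf2_val (m0, m1, m2, m3) x)"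
    and par': "\<forall>w\<in>U. z0 w \<in> gr_even (L - 2) \<and> p1 w \<in> gr_even (L - 2) \<and> m2 w \<in> gr_even (L - 2)
       \<and> p0 w \<in> gr_odd (L - 2) \<and> m0 w \<in> gr_odd (L - 2)"
    and e1': "\<forall>w\<in>U. p2 w = 0 \<and> p3 w = sf_deriv p0 w \<and> m1 w = 0 \<and> m3 w = - sf_deriv m0 w"
    and e2': "\<forall>w\<in>U. z1 w = p1 w * m0 w \<and> z2 w = m2 w * p0 w \<and> z3 w = sf_deriv p0 w * m0 w + p0 w * sf_deriv m0 w"
    and e3': "\<forall>w\<in>U. sf_deriv z0 w = sf_deriv p0 w * m0 w - p0 w * sf_deriv m0 w + p1 w * m2 w"
    unfolding U_def by (rule n2_superconformal_complex[OF L sc])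
  note H = bspec[OF H'] and par = bspec[OF par'] and e1 = bspec[OF e1'] and e2 = bspec[OF e2'] and e3 = bspec[OF e3']
  have ho: "gr_holo U z0" "gr_holo U z1" "gr_holo U z2" "gr_holo U z3" "gr_holo U p0" "gr_holo U p1"
    "gr_holo U p2" "gr_holo U p3" "gr_holo U m0" "gr_holo U m1" "gr_holo U m2" "gr_holo U m3"
    using sa by (auto dest: superanalyticD)
  have ho': "gr_holo U (sf_deriv z0)" "gr_holo U (sf_deriv p0)" "gr_holo U (sf_deriv m0)"
    using gr_holo_sf_deriv ho U by auto
  have val: "sf_val (sf_deriv z0) z = sf_val (sf_deriv p0) z * sf_val m0 z - sf_val p0 z * sf_val (sf_deriv m0) z
      + sf_val p1 z * sf_val m2 z" "sf_val z1 z = sf_val p1 z * sf_val m0 z" "sf_val z2 z = sf_val m2 z * sf_val p0 z"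
      "sf_val z3 z = sf_val (sf_deriv (\<lambda>w. p0 w * m0 w)) z" "sf_val p2 z = 0" "sf_val m1 z = 0"
      "sf_val p3 z = sf_val (sf_deriv p0) z" "sf_val m3 z = - sf_val (sf_deriv m0) z"
    if z: "z \<in> gr_even L" "gr_body z \<in> U" for z
  proof -
    note [intro] = gr_holo_mult gr_holo_add gr_holo_diff
    note mult = sf_val_mult[OF _ _ U z(2,1)]
    have "sf_val (sf_deriv z0) z = sf_val (\<lambda>w. (sf_deriv p0 w * m0 w - p0 w * sf_deriv m0 w) + p1 w * m2 w) z"
      using e3 by (intro sf_val_cong[OF ho'(1) U z(2)]) auto
    also have "\<dots> = sf_val (\<lambda>w. sf_deriv p0 w * m0 w - p0 w * sf_deriv m0 w) z + sf_val (\<lambda>w. p1 w * m2 w) z"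
      using ho ho' by (intro sf_val_add[OF _ _ U z(2)]) auto
    also have "sf_val (\<lambda>w. sf_deriv p0 w * m0 w - p0 w * sf_deriv m0 w) z
      = sf_val (\<lambda>w. sf_deriv p0 w * m0 w) z - sf_val (\<lambda>w. p0 w * sf_deriv m0 w) z"
      using ho ho' by (intro sf_val_diff[OF _ _ U z(2)]) auto
    finally show "sf_val (sf_deriv z0) z = sf_val (sf_deriv p0) z * sf_val m0 z - sf_val p0 z * sf_val (sf_deriv m0) z
      + sf_val p1 z * sf_val m2 z"
      using mult ho ho' by simp
    have "sf_val z1 z = sf_val (\<lambda>w. p1 w * m0 w) z" using e2 by (intro sf_val_cong[OF ho(2) U z(2)]) auto
    then show "sf_val z1 z = sf_val p1 z * sf_val m0 z" using mult ho by simp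
    have "sf_val z2 z = sf_val (\<lambda>w. m2 w * p0 w) z" using e2 by (intro sf_val_cong[OF ho(3) U z(2)]) auto
    then show "sf_val z2 z = sf_val m2 z * sf_val p0 z" using mult ho by simp
    show "sf_val z3 z = sf_val (sf_deriv (\<lambda>w. p0 w * m0 w)) z"
      using e2 ho U by (intro sf_val_cong[OF ho(4) U z(2)]) (simp add: sf_deriv_mult[of U])
    show "sf_val p2 z = 0" "sf_val m1 z = 0"
      using sf_val_cong[OF ho(7) U z(2), of "\<lambda>_. 0"] sf_val_cong[OF ho(10) U z(2), of "\<lambda>_. 0"] e1
      by (simp_all add: sf_val_const)
    show "sf_val p3 z = sf_val (sf_deriv p0) z" using e1 by (intro sf_val_cong[OF ho(8) U z(2)]) auto
    have "sf_val m3 z = sf_val (\<lambda>w. - sf_deriv m0 w) z" using e1 by (intro sf_val_cong[OF ho(12) U z(2)]) auto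
    then show "sf_val m3 z = - sf_val (sf_deriv m0) z" using sf_val_minus[OF ho'(3) U z(2)] by simp
  qed
  have "n2_components L H z0 p1 m2 p0 m0"
    unfolding n2_components_def Let_def U_def[symmetric]
  proof (intro conjI ballI)
    show "sf_even L U z0" "sf_even L U p1" "sf_even L U m2" "sf_odd L U p0" "sf_odd L U m0"
      using sa par by (auto simp: sf_even_def sf_odd_def)
    show "sf_val (sf_deriv z0) z = sf_val (sf_deriv p0) z * sf_val m0 z - sf_val p0 z * sf_val (sf_deriv m0) z
      + sf_val p1 z * sf_val m2 z" if "z \<in> even_dom H" for z
      using that val(1)[of z] dom by (simp add: even_dom_def superspace_def spoint_body_def)
    fix x assume x: "x \<in> dom H"
    obtain z p m where zpm: "x = (z, p, m)" by (cases x) auto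
    have z: "z \<in> gr_even L" "gr_body z \<in> U" using x dom zpm by (auto simp: superspace_def spoint_body_def)
    show "case x of (z, p, m) \<Rightarrow> H (z, p, m) = Some
           (sf_val z0 z + p * sf_val p1 z * sf_val m0 z + m * sf_val m2 z * sf_val p0 z
              + p * m * sf_val (sf_deriv (\<lambda>w. p0 w * m0 w)) z,
            sf_val p0 z + p * sf_val p1 z + p * m * sf_val (sf_deriv p0) z,
            sf_val m0 z + m * sf_val m2 z - p * m * sf_val (sf_deriv m0) z)"
      using H[OF x] zpm val[OF z] by (simp add: mult.assoc)
  qed
  then show ?thesis by blast
qed

lemma n2_componentsD:
  assumes "n2_components L H f gp gm pp pm" "openin (dewitt L) (dom H)"
  defines "U \<equiv> spoint_body ` dom H"
  shows "open U" "gr_holo U f" "gr_holo U gp" "gr_holo U gm" "gr_holo U pp" "gr_holo U pm"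
    and "w \<in> U \<Longrightarrow> f w \<in> gr_even (L - 2)" "w \<in> U \<Longrightarrow> gp w \<in> gr_even (L - 2)"
    "w \<in> U \<Longrightarrow> gm w \<in> gr_even (L - 2)" "w \<in> U \<Longrightarrow> pp w \<in> gr_odd (L - 2)" "w \<in> U \<Longrightarrow> pm w \<in> gr_odd (L - 2)"
    and "w \<in> U \<Longrightarrow> sf_deriv f w = sf_deriv pp w * pm w - pp w * sf_deriv pm w + gp w * gm w"
    and "w \<in> U \<Longrightarrow> p \<in> gr_odd L \<Longrightarrow> m \<in> gr_odd L \<Longrightarrow> H (gc w, p, m) = Some
      (f w + p * (gp w * pm w) + m * (gm w * pp w) + p * m * sf_deriv (\<lambda>w. pp w * pm w) w,
       pp w + p * gp w + m * 0 + p * m * sf_deriv pp w,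
       pm w + p * 0 + m * gm w + p * m * (- sf_deriv pm w))"
proof -
  have sa: "sf_even L U f" "sf_even L U gp" "sf_even L U gm" "sf_odd L U pp" "sf_odd L U pm"
    using assms(1) unfolding n2_components_def Let_def U_def by auto
  show U: "open U" using openin_dewitt(1)[OF assms(2)] unfolding U_def .
  show ho: "gr_holo U f" "gr_holo U gp" "gr_holo U gm" "gr_holo U pp" "gr_holo U pm"
    using sa by (auto simp: sf_even_def sf_odd_def dest: superanalyticD)
  show "w \<in> U \<Longrightarrow> f w \<in> gr_even (L - 2)" "w \<in> U \<Longrightarrow> gp w \<in> gr_even (L - 2)"
    "w \<in> U \<Longrightarrow> gm w \<in> gr_even (L - 2)" "w \<in> U \<Longrightarrow> pp w \<in> gr_odd (L - 2)" "w \<in> U \<Longrightarrow> pm w \<in> gr_odd (L - 2)"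
    using sa by (auto simp: sf_even_def sf_odd_def)
  have pt: "(gc w, p, m) \<in> dom H" if "w \<in> U" "p \<in> gr_odd L" "m \<in> gr_odd L" for w p m
    using openin_dewitt(2)[OF assms(2)] gc_superspace that unfolding U_def by (metis (mono_tags, lifting) mem_Collect_eq spoint_body_gc)
  note val = sf_val_gc[OF ho(1) U] sf_val_gc[OF ho(2) U] sf_val_gc[OF ho(3) U] sf_val_gc[OF ho(4) U] sf_val_gc[OF ho(5) U]
    sf_val_gc[OF gr_holo_sf_deriv[OF ho(1) U] U] sf_val_gc[OF gr_holo_sf_deriv[OF ho(4) U] U]
    sf_val_gc[OF gr_holo_sf_deriv[OF ho(5) U] U] sf_val_gc[OF gr_holo_sf_deriv[OF gr_holo_mult[OF ho(4,5)] U] U]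
  show "sf_deriv f w = sf_deriv pp w * pm w - pp w * sf_deriv pm w + gp w * gm w" if w: "w \<in> U"
  proof -
    have "gc w \<in> even_dom H" using pt[OF w, of 0 0] by (simp add: even_dom_def)
    then have "sf_val (sf_deriv f) (gc w) = sf_val (sf_deriv pp) (gc w) * sf_val pm (gc w)
        - sf_val pp (gc w) * sf_val (sf_deriv pm) (gc w) + sf_val gp (gc w) * sf_val gm (gc w)"
      using assms(1) unfolding n2_components_def Let_def by blast
    then show ?thesis using val[OF w] by simp
  qed
  show "H (gc w, p, m) = Some
      (f w + p * (gp w * pm w) + m * (gm w * pp w) + p * m * sf_deriv (\<lambda>w. pp w * pm w) w,
       pp w + p * gp w + m * 0 + p * m * sf_deriv pp w,
       pm w + p * 0 + m * gm w + p * m * (- sf_deriv pm w))"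
    if w: "w \<in> U" "p \<in> gr_odd L" "m \<in> gr_odd L"
  proof -
    have "\<forall>(z, p, m)\<in>dom H. H (z, p, m) = Some
           (sf_val f z + p * sf_val gp z * sf_val pm z + m * sf_val gm z * sf_val pp z
              + p * m * sf_val (sf_deriv (\<lambda>w. pp w * pm w)) z,
            sf_val pp z + p * sf_val gp z + p * m * sf_val (sf_deriv pp) z,
            sf_val pm z + m * sf_val gm z - p * m * sf_val (sf_deriv pm) z)"
      using assms(1) unfolding n2_components_def Let_def by blast
    from bspec[OF this pt[OF w]] show ?thesis
      by (simp add: val[OF w(1)] mult.assoc)
  qed
qed

text \<open>Component functions can be read off at the complex points other than \<open>w\<^sub>0\<close>.  They agree at
  \<open>w\<^sub>0\<close> by continuity, and they determine the values at all points over \<open>V\<close>.\<close>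

lemma n2_superconformal_unique_extension:
  assumes L: "2 \<le> L" and H: "n2_superconformal L H" and H': "n2_superconformal L H'"
    and V: "open V" "V \<subseteq> spoint_body ` dom H" "V \<subseteq> spoint_body ` dom H'"
    and eq: "\<And>x. x \<in> superspace L \<Longrightarrow> spoint_body x \<in> V \<Longrightarrow> spoint_body x \<noteq> w0 \<Longrightarrow> H x = H' x"
    and x: "x \<in> superspace L" "spoint_body x \<in> V"
  shows "H x = H' x"
proof -
  have op: "openin (dewitt L) (dom H)" "openin (dewitt L) (dom H')"
    using H H' by (auto simp: n2_superconformal_def)
  obtain f gp gm pp pm where c: "n2_components L H f gp gm pp pm" using n2_components_exist[OF L H] by blast
  obtain f' gp' gm' pp' pm' where c': "n2_components L H' f' gp' gm' pp' pm'" using n2_components_exist[OF L H'] by blast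
  note C = n2_componentsD[OF c op(1)] and C' = n2_componentsD[OF c' op(2)]
  have away: "f w = f' w" "gp w = gp' w" "gm w = gm' w" "pp w = pp' w" "pm w = pm' w" if w: "w \<in> V" "w \<noteq> w0" for w
  proof -
    have wU: "w \<in> spoint_body ` dom H" "w \<in> spoint_body ` dom H'" using w V by auto
    have e: "H (gc w, p, m) = H' (gc w, p, m)" if "p \<in> gr_odd L" "m \<in> gr_odd L" for p m
      using w gc_superspace[OF that] by (intro eq) auto
    note e' = e[unfolded C(13)[OF wU(1)] C'(13)[OF wU(2)]]
    show "f w = f' w" "pp w = pp' w" "pm w = pm' w" using e[of 0 0] C(13)[OF wU(1), of 0 0] C'(13)[OF wU(2), of 0 0] by auto
    show "gp w = gp' w"
    proof (rule gr_odd_cancel[OF L])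
      show "gp w \<in> gr_alg (L - 2)" "gp' w \<in> gr_alg (L - 2)" using C(8) C'(8) wU gr_even_alg by auto
      show "p * gp w = p * gp' w" if "p \<in> gr_odd L" for p
        using e[OF that gr_zero_mem(2)] C(13)[OF wU(1) that gr_zero_mem(2)] C'(13)[OF wU(2) that gr_zero_mem(2)] \<open>pp w = pp' w\<close> by auto
    qed
    show "gm w = gm' w"
    proof (rule gr_odd_cancel[OF L])
      show "gm w \<in> gr_alg (L - 2)" "gm' w \<in> gr_alg (L - 2)" using C(9) C'(9) wU gr_even_alg by auto
      show "p * gm w = p * gm' w" if "p \<in> gr_odd L" for p
        using e[OF gr_zero_mem(2) that] C(13)[OF wU(1) gr_zero_mem(2) that] C'(13)[OF wU(2) gr_zero_mem(2) that] \<open>pm w = pm' w\<close> by auto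
    qed
  qed
  have ho: "gr_holo V f" "gr_holo V gp" "gr_holo V gm" "gr_holo V pp" "gr_holo V pm"
    "gr_holo V f'" "gr_holo V gp'" "gr_holo V gm'" "gr_holo V pp'" "gr_holo V pm'"
    using C(2-6) C'(2-6) V(2,3) gr_holo_subset by blast+
  have all: "f w = f' w" "gp w = gp' w" "gm w = gm' w" "pp w = pp' w" "pm w = pm' w" if w: "w \<in> V" for w
    using gr_holo_eq_puncture[OF V(1) ho(1) ho(6) away(1) w] gr_holo_eq_puncture[OF V(1) ho(2) ho(7) away(2) w]
      gr_holo_eq_puncture[OF V(1) ho(3) ho(8) away(3) w] gr_holo_eq_puncture[OF V(1) ho(4) ho(9) away(4) w]
      gr_holo_eq_puncture[OF V(1) ho(5) ho(10) away(5) w] by auto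
  obtain z p m where zpm: "x = (z, p, m)" by (cases x) auto
  have zV: "gr_body z \<in> V" using x zpm by (simp add: spoint_body_def)
  have dom: "x \<in> dom H" "x \<in> dom H'"
    using x V openin_dewitt(2)[OF op(1)] openin_dewitt(2)[OF op(2)] by blast+
  have val: "sf_val f z = sf_val f' z" "sf_val gp z = sf_val gp' z" "sf_val gm z = sf_val gm' z"
    "sf_val pp z = sf_val pp' z" "sf_val pm z = sf_val pm' z"
    using sf_val_cong[OF ho(1) V(1) zV all(1)] sf_val_cong[OF ho(2) V(1) zV all(2)] sf_val_cong[OF ho(3) V(1) zV all(3)]
      sf_val_cong[OF ho(4) V(1) zV all(4)] sf_val_cong[OF ho(5) V(1) zV all(5)] by auto
  have der: "sf_val (sf_deriv \<phi>) z = sf_val (sf_deriv \<psi>) z"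
    if "gr_holo V \<phi>" "\<And>w. w \<in> V \<Longrightarrow> \<phi> w = \<psi> w" for \<phi> \<psi>
    using that sf_deriv_cong[OF that(1) V(1)]
    by (intro sf_val_cong[OF gr_holo_sf_deriv[OF that(1) V(1)] V(1) zV]) auto
  have "sf_val (sf_deriv pp) z = sf_val (sf_deriv pp') z" "sf_val (sf_deriv pm) z = sf_val (sf_deriv pm') z"
    "sf_val (sf_deriv (\<lambda>w. pp w * pm w)) z = sf_val (sf_deriv (\<lambda>w. pp' w * pm' w)) z"
    using der[OF ho(4) all(4)] der[OF ho(5) all(5)] der[OF gr_holo_mult[OF ho(4,5)], of "\<lambda>w. pp' w * pm' w"] all by auto
  moreover have "H x = Some (sf_val f z + p * sf_val gp z * sf_val pm z + m * sf_val gm z * sf_val pp z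
      + p * m * sf_val (sf_deriv (\<lambda>w. pp w * pm w)) z,
      sf_val pp z + p * sf_val gp z + p * m * sf_val (sf_deriv pp) z,
      sf_val pm z + m * sf_val gm z - p * m * sf_val (sf_deriv pm) z)"
    using c dom(1) unfolding n2_components_def Let_def zpm by blast
  moreover have "H' x = Some (sf_val f' z + p * sf_val gp' z * sf_val pm' z + m * sf_val gm' z * sf_val pp' z
      + p * m * sf_val (sf_deriv (\<lambda>w. pp' w * pm' w)) z,
      sf_val pp' z + p * sf_val gp' z + p * m * sf_val (sf_deriv pp') z,
      sf_val pm' z + m * sf_val gm' z - p * m * sf_val (sf_deriv pm') z)"
    using c' dom(2) unfolding n2_components_def Let_def zpm by blast
  ultimately show ?thesis using val by simp
qed

section \<open>Bodies of automorphisms of the super-Riemann sphere\<close>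

subsection \<open>Integer powers of invertible elements\<close>

lemma gr_powi_Suc: "gr_body z \<noteq> 0 \<Longrightarrow> z powi (k + 1) = z powi k * z"
proof -
  assume z: "gr_body z \<noteq> 0"
  consider "k \<ge> 0" | "k = - 1" | "k < - 1" by linarith
  then show ?thesis
  proof cases
    case 1
    then have "nat (k + 1) = Suc (nat k)" by simp
    then show ?thesis using 1 by (simp add: power_int_def power_commutes)
  next
    case 2
    then show ?thesis using z by (simp add: power_int_def)
  next
    case 3
    then have "nat (- k) = Suc (nat (- (k + 1)))" by simp
    then have "z powi k = inverse z ^ nat (- (k + 1)) * inverse z"
      using 3 by (simp add: power_int_def power_commutes del: minus_add_distrib)
    then have "z powi k * z = inverse z ^ nat (- (k + 1))" using z by (simp add: mult.assoc)
    then show ?thesis using 3 by (simp add: power_int_def)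
  qed
qed

lemma gr_powi_minus_1: "gr_body z \<noteq> 0 \<Longrightarrow> z powi (k - 1) = z powi k * inverse z"
  using gr_powi_Suc[of z "k - 1"] by (simp add: mult.assoc)

lemma gr_powi_add: "gr_body z \<noteq> 0 \<Longrightarrow> z powi (j + k) = z powi j * z powi k"
proof (induction k rule: int_induct[where k = 0])
  case base
  then show ?case by (simp add: power_int_def)
next
  case (step1 i)
  then show ?case using gr_powi_Suc[of z "j + i"] gr_powi_Suc[of z i] by (simp add: add.assoc mult.assoc)
next
  case (step2 i)
  then show ?case using gr_powi_minus_1[of z "j + i"] gr_powi_minus_1[of z i]
    by (simp add: add_diff_eq mult.assoc)
qed

lemma gr_powi_nat: "z powi (int k) = (z :: gr) ^ k"
  by (simp add: power_int_def)

lemma gc_powi: "gc (w powi k) = gc w powi k"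
  by (simp add: power_int_def gc_power gc_inverse)

lemma gr_even_powi: "gr_body z \<noteq> 0 \<Longrightarrow> z \<in> gr_even L \<Longrightarrow> z powi k \<in> gr_even L"
  by (auto simp: power_int_def)

lemma gr_powi_inverse: "gr_body z \<noteq> 0 \<Longrightarrow> inverse z powi k = z powi (- k)"
  by (auto simp: power_int_def gr_inverse_inverse)

text \<open>The binomial expansion stops after the linear term.  The factors \<open>1 - k \<psi>\<^sup>+ \<psi>\<^sup>- / h\<close> below come from
  it.\<close>

lemma gr_powi_nilpotent_sum:
  assumes "\<epsilon> * \<epsilon> = 0" "\<epsilon> * h = h * \<epsilon>" "gr_body h \<noteq> 0"
  shows "(h + \<epsilon>) powi k = h powi k + of_int k * \<epsilon> * h powi (k - 1)"
proof (induction k rule: int_induct[where k = 0])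
  case base
  then show ?case by simp
next
  have eb: "gr_body \<epsilon> = 0" using arg_cong[OF assms(1), of gr_body] by simp
  then have heb: "gr_body (h + \<epsilon>) \<noteq> 0" using assms(3) by simp
  have hc: "h powi k * \<epsilon> = \<epsilon> * h powi k" for k
  proof -
    have 1: "h ^ j * \<epsilon> = \<epsilon> * h ^ j" for j
      by (induction j) (auto simp: mult.assoc, metis assms(2) mult.assoc)
    have "inverse h * \<epsilon> = inverse h * (\<epsilon> * h) * inverse h"
      using assms(3) by (simp add: mult.assoc)
    also have "\<dots> = \<epsilon> * inverse h" unfolding assms(2) using assms(3) by (simp flip: mult.assoc)
    finally have 0: "inverse h * \<epsilon> = \<epsilon> * inverse h" .
    have 2: "inverse h ^ j * \<epsilon> = \<epsilon> * inverse h ^ j" for j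
      by (induction j) (auto simp: mult.assoc, metis 0 mult.assoc)
    show ?thesis by (simp add: power_int_def 1 2)
  qed
  {
    case (step1 i)
    have "(h + \<epsilon>) powi (i + 1) = (h powi i + of_int i * \<epsilon> * h powi (i - 1)) * (h + \<epsilon>)"
      using gr_powi_Suc[OF heb, of i] step1 by simp
    also have "\<dots> = h powi i * h + h powi i * \<epsilon> + of_int i * (\<epsilon> * (h powi (i - 1) * h)) + of_int i * (\<epsilon> * (h powi (i - 1) * \<epsilon>))"
      by (simp add: distrib_left distrib_right mult.assoc)
    also have "h powi (i - 1) * h = h powi i" using gr_powi_Suc[OF assms(3), of "i - 1"] by simp
    also have "\<epsilon> * (h powi (i - 1) * \<epsilon>) = 0" unfolding hc using assms(1) by (simp flip: mult.assoc)
    also have "h powi i * h = h powi (i + 1)" using gr_powi_Suc[OF assms(3), of i] by simp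
    finally show ?case unfolding hc by (simp add: algebra_simps)
  next
    case (step2 i)
    let ?r = "h powi (i - 1) + of_int (i - 1) * \<epsilon> * h powi (i - 1 - 1)"
    have "?r * (h + \<epsilon>) = h powi (i - 1) * h + h powi (i - 1) * \<epsilon> + of_int (i - 1) * (\<epsilon> * (h powi (i - 1 - 1) * h))
        + of_int (i - 1) * (\<epsilon> * (h powi (i - 1 - 1) * \<epsilon>))"
      by (simp add: distrib_left distrib_right mult.assoc)
    also have "h powi (i - 1 - 1) * h = h powi (i - 1)" using gr_powi_Suc[OF assms(3), of "i - 1 - 1"] by simp
    also have "\<epsilon> * (h powi (i - 1 - 1) * \<epsilon>) = 0" unfolding hc using assms(1) by (simp flip: mult.assoc)
    also have "h powi (i - 1) * h = h powi i" using gr_powi_Suc[OF assms(3), of "i - 1"] by simp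
    also have "h powi i + h powi (i - 1) * \<epsilon> + of_int (i - 1) * (\<epsilon> * h powi (i - 1)) + of_int (i - 1) * 0 = (h + \<epsilon>) powi i"
      unfolding hc step2 by (simp add: algebra_simps)
    finally have "?r * (h + \<epsilon>) * inverse (h + \<epsilon>) = (h + \<epsilon>) powi (i - 1)"
      using gr_powi_minus_1[OF heb, of i] by simp
    then show ?case using heb by (simp add: mult.assoc del: gr_body_simps)
  }
qed

subsection \<open>The transition function\<close>

text \<open>The transition function \<open>I\<^sub>n\<close> for \<open>\<kappa> = \<i>\<close> and its inverse for \<open>\<kappa> = - \<i>\<close>.\<close>

definition sphere_tr :: "complex \<Rightarrow> int \<Rightarrow> spoint \<Rightarrow> spoint" where
  "sphere_tr \<kappa> n = (\<lambda>(z, p, m). (inverse z, gc \<kappa> * p * z powi (n - 1), gc \<kappa> * m * z powi (- n - 1)))"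

lemma sphere_transition_eq:
  assumes "x \<in> superspace L"
  shows "sphere_transition L n x = (if spoint_body x \<noteq> 0 then Some (sphere_tr \<i> n x) else None)"
proof -
  obtain z p m where x: "x = (z, p, m)" by (cases x) auto
  show ?thesis
    using assms unfolding x
    by (auto simp: sphere_transition_def sphere_tr_def superspace_def gr_even_units_iff spoint_body_def
        gr_divide_inverse gr_powi_minus_1 mult.assoc)
qed

lemma sphere_tr_gc:
  assumes "w \<noteq> 0"
  shows "sphere_tr \<kappa> n (gc w, p, m) = (gc (1 / w), gc (\<kappa> * w powi (n - 1)) * p, gc (\<kappa> * w powi (- n - 1)) * m)"
  by (simp add: sphere_tr_def gc_inverse[symmetric] gc_powi[symmetric] gc_mult inverse_eq_divide)
    (metis gc_commute mult.assoc)

lemma sphere_tr_superspace: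
  assumes "x \<in> superspace L" "spoint_body x \<noteq> 0"
  shows "spoint_body (sphere_tr \<kappa> n x) = 1 / spoint_body x"
  using assms by (auto simp: superspace_def spoint_body_def sphere_tr_def inverse_eq_divide)

subsection \<open>The body of a point and of an automorphism\<close>

lemma gr_body_sf_val:
  assumes "gr_holo U \<phi>" "open U" "gr_body z \<in> U"
  shows "gr_body (sf_val \<phi> z) = gr_body (\<phi> (gr_body z))"
proof -
  obtain M where M: "gr_soul z ^ M = 0" by (rule gr_soul_nilpotent)
  then have M': "gr_soul z ^ Suc M = 0" by simp
  show ?thesis
    using gr_taylor_0[OF assms]
    by (simp add: sf_val_eq_taylor[OF assms M'] sum.lessThan_Suc_shift del: sum.lessThan_Suc)
qed

locale n2_sphere_charts =
  fixes L :: enat and n :: int and X :: "'s topology" and Delta Upsilon :: "'s chart"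
  assumes L: "2 \<le> L" and sphere: "n2_sphere L n X Delta Upsilon"
begin

abbreviation Aut where "Aut \<equiv> n2_Aut L X {Delta, Upsilon}"

lemma surface: "n2_surface L X {Delta, Upsilon}"
  using sphere by (simp add: n2_sphere_def)

lemma chart_cover: "y \<in> topspace X \<longleftrightarrow> y \<in> fst Delta \<or> y \<in> fst Upsilon"
  using surface by (auto simp: n2_surface_def)

lemma chart_bij:
  assumes "c \<in> {Delta, Upsilon}" shows "bij_betw (snd c) (fst c) (superspace L)"
proof -
  have c: "is_chart L X c" using surface assms by (auto simp: n2_surface_def)
  obtain U \<phi> where U: "c = (U, \<phi>)" by (cases c)
  have "openin X U" "homeomorphic_map (subtopology X U) (subtopology (dewitt L) (\<phi> ` U)) \<phi>"
    using c by (auto simp: is_chart_def U)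
  then have "inj_on \<phi> U"
    using homeomorphic_imp_injective_map[of "subtopology X U"] openin_subset[of X U]
    by (auto simp: topspace_subtopology Int_absorb1)
  moreover have "snd c ` fst c = superspace L" using sphere assms by (auto simp: n2_sphere_def)
  ultimately show ?thesis by (simp add: bij_betw_def U)
qed

lemma chart_superspace: "c \<in> {Delta, Upsilon} \<Longrightarrow> y \<in> fst c \<Longrightarrow> snd c y \<in> superspace L"
  using chart_bij by (meson bij_betwE)

lemma chart_point:
  assumes "c \<in> {Delta, Upsilon}" "x \<in> superspace L"
  obtains y where "y \<in> fst c" "snd c y = x"
  using chart_bij[OF assms(1)] assms(2) by (metis bij_betw_iff_bijections)

lemma coord_expr_chart:
  assumes "c \<in> {Delta, Upsilon}" "y \<in> fst c"
  shows "coord_expr c d R (snd c y) = (if R y \<in> fst d then Some (snd d (R y)) else None)"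
proof -
  obtain U \<phi> where c: "c = (U, \<phi>)" by (cases c)
  obtain V \<psi> where d: "d = (V, \<psi>)" by (cases d)
  have inj: "inj_on \<phi> U" using chart_bij[OF assms(1)] by (simp add: c bij_betw_def)
  have y: "y \<in> U" using assms by (simp add: c)
  have "\<phi> y \<in> \<phi> ` {y \<in> U. R y \<in> V} \<longleftrightarrow> R y \<in> V"
    using inj y by (auto simp: inj_on_def)
  then show ?thesis using inv_into_f_f[OF inj y] by (simp add: c d)
qed

lemma transition:
  assumes "y \<in> fst Upsilon"
  shows "y \<in> fst Delta \<longleftrightarrow> spoint_body (snd Upsilon y) \<noteq> 0"
    and "y \<in> fst Delta \<Longrightarrow> snd Delta y = sphere_tr \<i> n (snd Upsilon y)"
proof -
  have "sphere_transition L n (snd Upsilon y) = (if y \<in> fst Delta then Some (snd Delta y) else None)"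
    using coord_expr_chart[of Upsilon y Delta id] assms sphere by (simp add: n2_sphere_def)
  with sphere_transition_eq[OF chart_superspace[of Upsilon y]] assms
  show "y \<in> fst Delta \<longleftrightarrow> spoint_body (snd Upsilon y) \<noteq> 0"
    "y \<in> fst Delta \<Longrightarrow> snd Delta y = sphere_tr \<i> n (snd Upsilon y)"
    by (auto split: if_splits)
qed

text \<open>The property of an automorphism and of its inverse from which the action on bodies is derived.\<close>

definition chartwise_superconformal :: "('s \<Rightarrow> 's) \<Rightarrow> bool" where
  "chartwise_superconformal R \<longleftrightarrow> R ` topspace X \<subseteq> topspace X \<and>
     (\<forall>c\<in>{Delta, Upsilon}. \<forall>d\<in>{Delta, Upsilon}. \<forall>y\<in>fst c. R y \<in> fst d \<longrightarrow> n2_superconformal L (coord_expr c d R))"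

lemma chartwise_superconformalI:
  assumes "n2_superconformal_map L X {Delta, Upsilon} X {Delta, Upsilon} R" "R ` topspace X \<subseteq> topspace X"
  shows "chartwise_superconformal R"
proof -
  have "{Delta, Upsilon} \<subseteq> maximal_atlas L X {Delta, Upsilon}"
    using surface by (auto simp: maximal_atlas_def n2_surface_def)
  then have "n2_superconformal_in_charts L c d R" if "c \<in> {Delta, Upsilon}" "d \<in> {Delta, Upsilon}" for c d
    using assms that unfolding n2_superconformal_map_def by blast
  then show ?thesis using assms(2) unfolding chartwise_superconformal_def n2_superconformal_in_charts_def by blast
qed

lemma chartwise_superconformalD:
  assumes "chartwise_superconformal R" "c \<in> {Delta, Upsilon}" "d \<in> {Delta, Upsilon}" "y \<in> fst c" "R y \<in> fst d"
  shows "n2_superconformal L (coord_expr c d R)"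
  using assms unfolding chartwise_superconformal_def by blast

lemma Aut_chartwise_superconformal:
  assumes "R \<in> Aut" shows "chartwise_superconformal R" "chartwise_superconformal (inv_into (topspace X) R)"
  using assms bij_betw_imp_surj_on[OF bij_betw_inv_into, of R "topspace X" "topspace X"]
    bij_betw_imp_surj_on[of R "topspace X" "topspace X"]
  by (auto intro!: chartwise_superconformalI simp: n2_Aut_def)

text \<open>The projection to the Riemann sphere, in the coordinate of \<open>Delta\<close>; \<open>None\<close> is the point at infinity.\<close>

definition sphere_body :: "'s \<Rightarrow> complex option" where
  "sphere_body y = (if y \<in> fst Delta then Some (spoint_body (snd Delta y)) else None)"

lemma sphere_body_eq_iff:
  assumes "c \<in> {Delta, Upsilon}" "y \<in> fst c" "y' \<in> fst c"
  shows "sphere_body y = sphere_body y' \<longleftrightarrow> spoint_body (snd c y) = spoint_body (snd c y')"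
proof -
  consider "c = Delta" | "c = Upsilon" using assms by blast
  then show ?thesis
  proof cases
    case 1
    then show ?thesis using assms by (simp add: sphere_body_def)
  next
    case 2
    have b: "y \<in> fst Delta \<Longrightarrow> spoint_body (snd Delta y) = 1 / spoint_body (snd Upsilon y)"
      if "y \<in> fst Upsilon" for y
      using transition[OF that] sphere_tr_superspace[OF chart_superspace[of Upsilon y]] that by simp
    show ?thesis
      using b[of y] b[of y'] transition(1)[of y] transition(1)[of y'] assms 2
      by (auto simp: sphere_body_def)
  qed
qed

lemma same_chart:
  assumes "y \<in> topspace X" "y' \<in> topspace X" "sphere_body y = sphere_body y'"
  obtains c where "c \<in> {Delta, Upsilon}" "y \<in> fst c" "y' \<in> fst c"
proof (cases "y \<in> fst Delta")
  case True
  then show thesis using assms that[of Delta] by (auto simp: sphere_body_def split: if_splits)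
next
  case False
  then have "y' \<notin> fst Delta" using assms by (auto simp: sphere_body_def split: if_splits)
  then show thesis using assms False chart_cover that[of Upsilon] by auto
qed

end

text \<open>Every term other than \<open>f\<close> has an odd factor, hence no body.\<close>

lemma n2_components_body:
  assumes c: "n2_components L H f gp gm pp pm" and op: "openin (dewitt L) (dom H)"
    and x: "H x = Some v"
  shows "spoint_body v = gr_body (f (spoint_body x))"
proof -
  obtain z p m where zpm: "x = (z, p, m)" by (cases x) auto
  note D = n2_componentsD[OF c op]
  have dom: "(z, p, m) \<in> dom H" using x zpm by auto
  then have mem: "gr_body z \<in> spoint_body ` dom H" "p \<in> gr_odd L" "m \<in> gr_odd L"
  proof -
    have "(z, p, m) \<in> superspace L" using openin_dewitt(2)[OF op] dom by blast
    then show "p \<in> gr_odd L" "m \<in> gr_odd L" by (auto simp: superspace_def)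
    show "gr_body z \<in> spoint_body ` dom H" using dom by (force simp: spoint_body_def)
  qed
  have "fst v = sf_val f z + p * sf_val gp z * sf_val pm z + m * sf_val gm z * sf_val pp z
      + p * m * sf_val (sf_deriv (\<lambda>w. pp w * pm w)) z"
  proof -
    have "\<forall>(z, p, m)\<in>dom H. H (z, p, m) = Some
           (sf_val f z + p * sf_val gp z * sf_val pm z + m * sf_val gm z * sf_val pp z
              + p * m * sf_val (sf_deriv (\<lambda>w. pp w * pm w)) z,
            sf_val pp z + p * sf_val gp z + p * m * sf_val (sf_deriv pp) z,
            sf_val pm z + m * sf_val gm z - p * m * sf_val (sf_deriv pm) z)"
      using c unfolding n2_components_def Let_def by blast
    from bspec[OF this dom] show ?thesis using x by (auto simp: zpm)
  qed
  then show ?thesis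
    using mem gr_body_sf_val[OF D(2,1) mem(1)] by (simp add: spoint_body_def zpm)
qed

context n2_sphere_charts
begin

text \<open>In coordinates the body of the image depends only on the body of the argument.  This includes
  whether the image lies in \<open>Delta\<close>, as domains are DeWitt open.\<close>

lemma sphere_body_cong:
  assumes R: "chartwise_superconformal R" and y: "y \<in> topspace X" "y' \<in> topspace X" "sphere_body y = sphere_body y'"
  shows "sphere_body (R y) = sphere_body (R y')"
proof -
  obtain c where c: "c \<in> {Delta, Upsilon}" "y \<in> fst c" "y' \<in> fst c" by (rule same_chart[OF y])
  have *: "R y' \<in> fst Delta \<and> spoint_body (snd Delta (R y)) = spoint_body (snd Delta (R y'))"
    if y: "y \<in> fst c" "y' \<in> fst c" and b: "spoint_body (snd c y) = spoint_body (snd c y')"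
      and Ry: "R y \<in> fst Delta" for y y'
  proof -
    let ?H = "coord_expr c Delta R"
    have H: "n2_superconformal L ?H" using chartwise_superconformalD[OF R c(1) _ y(1) Ry] by simp
    then have op: "openin (dewitt L) (dom ?H)" by (simp add: n2_superconformal_def)
    obtain f gp gm pp pm where comp: "n2_components L ?H f gp gm pp pm"
      using n2_components_exist[OF L H] by blast
    have Hy: "?H (snd c y) = Some (snd Delta (R y))" using coord_expr_chart[OF c(1) y(1), of Delta R] Ry by simp
    then have "snd c y \<in> dom ?H" by auto
    then have "snd c y' \<in> dom ?H"
      using openin_dewitt(2)[OF op] b chart_superspace[OF c(1) y(2)] by (metis (mono_tags, lifting) image_eqI mem_Collect_eq)
    then have Ry': "R y' \<in> fst Delta" and Hy': "?H (snd c y') = Some (snd Delta (R y'))"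
      using coord_expr_chart[OF c(1) y(2), of Delta R] by (auto split: if_splits)
    show ?thesis
      using Ry' n2_components_body[OF comp op Hy] n2_components_body[OF comp op Hy'] b by simp
  qed
  have b: "spoint_body (snd c y) = spoint_body (snd c y')" using sphere_body_eq_iff[OF c] y(3) by blast
  show ?thesis
  proof (cases "R y \<in> fst Delta")
    case True
    then show ?thesis using *[OF c(2,3) b] by (simp add: sphere_body_def)
  next
    case False
    then have "R y' \<notin> fst Delta" using *[OF c(3,2) b[symmetric]] by blast
    then show ?thesis using False by (simp add: sphere_body_def)
  qed
qed

text \<open>The previous lemma for an automorphism and for its inverse.\<close>

lemma sphere_body_Aut:
  assumes R: "R \<in> Aut" and y: "y \<in> topspace X" "y' \<in> topspace X"
  shows "sphere_body (R y) = sphere_body (R y') \<longleftrightarrow> sphere_body y = sphere_body y'"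
proof
  have bij: "bij_betw R (topspace X) (topspace X)" using R by (simp add: n2_Aut_def)
  have Ry: "R y \<in> topspace X" "R y' \<in> topspace X" using bij_betwE[OF bij] y by blast+
  assume "sphere_body (R y) = sphere_body (R y')"
  then have "sphere_body (inv_into (topspace X) R (R y)) = sphere_body (inv_into (topspace X) R (R y'))"
    by (rule sphere_body_cong[OF Aut_chartwise_superconformal(2)[OF R] Ry])
  then show "sphere_body y = sphere_body y'"
    unfolding inv_into_f_f[OF bij_betw_imp_inj_on[OF bij] y(1)] inv_into_f_f[OF bij_betw_imp_inj_on[OF bij] y(2)] .
next
  assume "sphere_body y = sphere_body y'"
  then show "sphere_body (R y) = sphere_body (R y')" by (rule sphere_body_cong[OF Aut_chartwise_superconformal(1)[OF R] y])
qed

end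

lemma sphere_tr_inverse:
  assumes "x \<in> superspace L" "spoint_body x \<noteq> 0" "\<kappa>' * \<kappa> = 1"
  shows "sphere_tr \<kappa>' n (sphere_tr \<kappa> n x) = x"
proof -
  obtain z p m where x: "x = (z, p, m)" by (cases x) auto
  have z: "z \<in> gr_even L" "gr_body z \<noteq> 0"
    using assms by (auto simp: x superspace_def spoint_body_def)
  have *: "gc \<kappa>' * (gc \<kappa> * q * z powi k) * inverse z powi k = q" for q k
  proof -
    have "z powi k * z powi (- k) = 1" using gr_powi_add[OF z(2), of k "- k"] by simp
    moreover have "gc \<kappa>' * gc \<kappa> = 1" using assms(3) by (simp flip: gc_mult)
    ultimately show ?thesis by (simp add: gr_powi_inverse z) (metis mult.assoc mult_1 mult.right_neutral)
  qed
  show ?thesis by (simp add: x sphere_tr_def gr_inverse_inverse z *)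
qed

lemma sphere_tr_mem:
  assumes "x \<in> superspace L" "spoint_body x \<noteq> 0"
  shows "sphere_tr \<kappa> n x \<in> superspace L"
  using assms
  by (auto simp: superspace_def spoint_body_def sphere_tr_def gr_even_powi
      intro!: gr_inverse_even gr_odd_even_times[OF gr_even_odd_times[OF gr_even_gc]])

subsection \<open>Change of the coordinate system\<close>

lemma gr_odd_multiple_square:
  assumes "p \<in> gr_odd L" "\<nu> \<in> gr_odd L'"
  shows "(p * \<nu>) * (p * \<nu>) = 0"
proof -
  have "(p * \<nu>) * (p * \<nu>) = p * (\<nu> * p) * \<nu>" by (simp add: mult.assoc)
  also have "\<dots> = - (p * p * \<nu> * \<nu>)" using gr_odd_anticommute[OF assms] by (simp add: mult.assoc)
  finally show ?thesis using gr_odd_square[OF assms(1)] by simp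
qed

lemma gc_left_commute: "a * (gc x * b) = gc x * (a * b)"
  by (metis gc_commute mult.assoc)

lemma gc_of_int: "of_int k = gc (of_int k)"
  by (induction k rule: int_induct[where k = 0]) (simp_all add: gc_add gc_diff)

text \<open>The odd coordinate \<open>P + p G\<close> over \<open>h + p G P'\<close> after the transition.  The increment \<open>p G P'\<close> has square
  zero, so the power is expanded to first order, and the arbitrary odd \<open>p\<close> is cancelled.\<close>

lemma target_change_half:
  assumes L: "2 \<le> L"
    and h: "h \<in> gr_even (L - 2)" "gr_body h \<noteq> 0"
    and mem: "G \<in> gr_even (L - 2)" "P \<in> gr_odd (L - 2)" "P' \<in> gr_odd (L - 2)" "g \<in> gr_even (L - 2)"
    and eq: "\<And>p. p \<in> gr_odd L \<Longrightarrow>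
      \<psi> + p * g = gc \<i> * (P + p * G) * (h + p * (G * P')) powi k"
  shows "\<psi> = gc \<i> * P * h powi k"
    and "g = gc \<i> * G * h powi k * (1 - of_int k * (P * P' * inverse h))"
proof -
  show psi: "\<psi> = gc \<i> * P * h powi k" using eq[of 0] by simp
  let ?\<nu> = "G * P'"
  have \<nu>: "?\<nu> \<in> gr_odd (L - 2)" using mem by auto
  have hk: "h powi j \<in> gr_even (L - 2)" for j using gr_even_powi h by blast
  have comm: "x * h powi j = h powi j * x" "x * G = G * x" "x * h = h * x" for x j
    using gr_even_commute hk mem h by metis+
  show "g = gc \<i> * G * h powi k * (1 - of_int k * (P * P' * inverse h))"
  proof (rule gr_odd_cancel[OF L])
    show "g \<in> gr_alg (L - 2)" using mem gr_even_alg by blast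
    have k: "of_int k \<in> gr_even (L - 2)" unfolding gc_of_int by simp
    then show "gc \<i> * G * h powi k * (1 - of_int k * (P * P' * inverse h)) \<in> gr_alg (L - 2)"
      by (intro gr_even_alg gr_even_times[OF gr_even_times[OF gr_even_times[OF gr_even_gc mem(1)] hk]
          gr_even_diff[OF gr_even_one gr_even_times[OF k gr_even_times[OF gr_odd_times[OF mem(2,3)]
          gr_inverse_even[OF h(2,1)]]]]])
    fix p assume p: "p \<in> gr_odd L"
    have Pp: "P * p = - (p * P)" using gr_odd_anticommute[OF p mem(2)] .
    have pw: "(h + p * ?\<nu>) powi k = h powi k + of_int k * (p * ?\<nu>) * h powi (k - 1)"
      by (rule gr_powi_nilpotent_sum[OF gr_odd_multiple_square[OF p \<nu>] comm(3) h(2)])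
    have 0: "p * G * (p * ?\<nu>) = 0"
    proof -
      have "p * G * (p * ?\<nu>) = p * (G * p) * ?\<nu>" by (simp add: mult.assoc)
      also have "\<dots> = p * p * G * ?\<nu>" unfolding comm(2)[of p, symmetric] by (simp add: mult.assoc)
      finally show ?thesis using gr_odd_square[OF p] by simp
    qed
    have "(P + p * G) * (h + p * ?\<nu>) powi k
      = P * h powi k + p * G * h powi k + of_int k * (P * (p * ?\<nu>) * h powi (k - 1))
        + of_int k * (p * G * (p * ?\<nu>) * h powi (k - 1))"
      unfolding pw gc_of_int by (simp add: distrib_left distrib_right mult.assoc gc_left_commute)
    also have "P * (p * ?\<nu>) = - (p * (P * ?\<nu>))" using Pp by (simp flip: mult.assoc)
    also have "P * ?\<nu> = G * (P * P')" using comm(2)[of P] by (simp flip: mult.assoc)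
    also have "h powi (k - 1) = h powi k * inverse h" using gr_powi_minus_1 h by blast
    finally have *: "(P + p * G) * (h + p * ?\<nu>) powi k = P * h powi k + p * G * h powi k
      + of_int k * (- (p * (G * (P * P'))) * (h powi k * inverse h)) + of_int k * (p * G * (p * ?\<nu>) * (h powi k * inverse h))" .
    have hPP: "h powi k * (P * (P' * inverse h)) = P * (P' * (h powi k * inverse h))"
    proof -
      have "h powi k * (P * (P' * inverse h)) = (P * P' * inverse h) * h powi k"
        unfolding comm(1)[of "P * P' * inverse h" k] by (simp only: mult.assoc)
      also have "\<dots> = P * (P' * (inverse h * h powi k))" by (simp only: mult.assoc)
      finally show ?thesis unfolding comm(1)[of "inverse h" k] .
    qed
    have "(P + p * G) * (h + p * ?\<nu>) powi k
      = P * h powi k + p * (G * h powi k * (1 - of_int k * (P * P' * inverse h)))"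
      unfolding * 0 using hPP
      unfolding gc_of_int by (simp add: right_diff_distrib mult.assoc gc_left_commute)
    then have "gc \<i> * ((P + p * G) * (h + p * ?\<nu>) powi k)
      = gc \<i> * (P * h powi k) + gc \<i> * (p * (G * h powi k * (1 - of_int k * (P * P' * inverse h))))"
      by (simp only: distrib_left)
    moreover have "gc \<i> * (P * h powi k) + p * g = gc \<i> * ((P + p * G) * (h + p * ?\<nu>) powi k)"
      using eq[OF p] psi by (simp only: mult.assoc)
    ultimately have "p * g = gc \<i> * (p * (G * h powi k * (1 - of_int k * (P * P' * inverse h))))"
      by simp
    then show "p * g = p * (gc \<i> * G * h powi k * (1 - of_int k * (P * P' * inverse h)))"
      by (simp only: mult.assoc gc_left_commute)
  qed
qed

lemma source_change_half:
  assumes L: "2 \<le> L" and mem: "g \<in> gr_even (L - 2)" "g' \<in> gr_even (L - 2)"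
    and eq: "\<And>p. p \<in> gr_odd L \<Longrightarrow> \<psi> + (gc \<alpha> * p) * g = \<psi>' + p * g'"
  shows "\<psi> = \<psi>'" "gc \<alpha> * g = g'"
proof -
  show psi: "\<psi> = \<psi>'" using eq[of 0] by simp
  show "gc \<alpha> * g = g'"
  proof (rule gr_odd_cancel[OF L])
    show "gc \<alpha> * g \<in> gr_alg (L - 2)" "g' \<in> gr_alg (L - 2)"
      using mem by (auto intro!: gr_even_alg[of _ "L - 2"])
    show "p * (gc \<alpha> * g) = p * g'" if "p \<in> gr_odd L" for p
      using eq[OF that] psi by (metis add_left_cancel gc_commute mult.assoc)
  qed
qed

subsection \<open>Component functions with a single pole\<close>

text \<open>The three descriptions of \<open>T\<close>, all at complex points: \<open>f\<close>, \<open>gp\<close>, \<open>gm\<close>, \<open>pp\<close>, \<open>pm\<close> are its component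
  functions with values in the coordinate of \<open>Delta\<close>, which have a pole at \<open>w0\<close>; \<open>h\<close>, \<open>Gp\<close>, \<open>Gm\<close>, \<open>Pp\<close>, \<open>Pm\<close>
  are those with values in the coordinate of \<open>Upsilon\<close>, near \<open>w0\<close>; \<open>fh\<close>, \<open>gph\<close>, \<open>gmh\<close>, \<open>pph\<close>, \<open>pmh\<close> are those
  in the other source coordinate \<open>y = 1 / w\<close>, near \<open>y = 0\<close>.  The assumptions \<open>pole\<close> and \<open>infinity\<close> are the
  transition functions of target and source.\<close>

locale pole_data =
  fixes L0 :: enat and n :: int and \<kappa> w0 :: complex and V W :: "complex set"
    and f gp gm pp pm h Gp Gm Pp Pm fh gph gmh pph pmh :: sfun
  assumes kappa: "\<kappa> \<noteq> 0"
    and V: "open V" "w0 \<in> V"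
    and W: "open W" "0 \<in> W" "\<And>y. y \<in> W \<Longrightarrow> y \<noteq> 0 \<Longrightarrow> 1 / y \<noteq> w0"
    and holo: "gr_holo (- {w0}) f" "gr_holo (- {w0}) gp" "gr_holo (- {w0}) gm"
      "gr_holo (- {w0}) pp" "gr_holo (- {w0}) pm"
    and holo_V: "gr_holo V h" "gr_holo V Gp" "gr_holo V Gm" "gr_holo V Pp" "gr_holo V Pm"
    and holo_W: "gr_holo W fh" "gr_holo W gph" "gr_holo W gmh" "gr_holo W pph" "gr_holo W pmh"
    and even: "\<And>w. w \<noteq> w0 \<Longrightarrow> f w \<in> gr_even L0" "\<And>w. w \<noteq> w0 \<Longrightarrow> gp w \<in> gr_even L0"
      "\<And>w. w \<noteq> w0 \<Longrightarrow> gm w \<in> gr_even L0"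
    and odd: "\<And>w. w \<noteq> w0 \<Longrightarrow> pp w \<in> gr_odd L0" "\<And>w. w \<noteq> w0 \<Longrightarrow> pm w \<in> gr_odd L0"
    and even_V: "\<And>w. w \<in> V \<Longrightarrow> h w \<in> gr_even L0" "\<And>w. w \<in> V \<Longrightarrow> Gp w \<in> gr_even L0"
      "\<And>w. w \<in> V \<Longrightarrow> Gm w \<in> gr_even L0"
    and odd_V: "\<And>w. w \<in> V \<Longrightarrow> Pp w \<in> gr_odd L0" "\<And>w. w \<in> V \<Longrightarrow> Pm w \<in> gr_odd L0"
    and superconformal: "\<And>w. w \<noteq> w0 \<Longrightarrow>
      sf_deriv f w = sf_deriv pp w * pm w - pp w * sf_deriv pm w + gp w * gm w"
    and pole: "\<And>w. w \<in> V \<Longrightarrow> w \<noteq> w0 \<Longrightarrow> f w * h w = 1"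
      "\<And>w. w \<in> V \<Longrightarrow> w \<noteq> w0 \<Longrightarrow> pp w = gc \<i> * Pp w * h w powi (n - 1)"
      "\<And>w. w \<in> V \<Longrightarrow> w \<noteq> w0 \<Longrightarrow> pm w = gc \<i> * Pm w * h w powi (- n - 1)"
      "\<And>w. w \<in> V \<Longrightarrow> w \<noteq> w0 \<Longrightarrow>
        gp w = gc \<i> * Gp w * h w powi (n - 1) * (1 - of_int (n - 1) * (Pp w * Pm w * inverse (h w)))"
      "\<And>w. w \<in> V \<Longrightarrow> w \<noteq> w0 \<Longrightarrow>
        gm w = gc \<i> * Gm w * h w powi (- n - 1) * (1 - of_int (- n - 1) * (Pm w * Pp w * inverse (h w)))"
    and zero: "gr_body (h w0) = 0"
    and infinity: "\<And>y. y \<in> W \<Longrightarrow> y \<noteq> 0 \<Longrightarrow> f (1 / y) = fh y"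
      "\<And>y. y \<in> W \<Longrightarrow> y \<noteq> 0 \<Longrightarrow> pp (1 / y) = pph y" "\<And>y. y \<in> W \<Longrightarrow> y \<noteq> 0 \<Longrightarrow> pm (1 / y) = pmh y"
      "\<And>y. y \<in> W \<Longrightarrow> y \<noteq> 0 \<Longrightarrow> gc (\<kappa> * y powi (n - 1)) * gp (1 / y) = gph y"
      "\<And>y. y \<in> W \<Longrightarrow> y \<noteq> 0 \<Longrightarrow> gc (\<kappa> * y powi (- n - 1)) * gm (1 / y) = gmh y"
    and injective: "\<And>w. w \<noteq> w0 \<Longrightarrow> gr_body (f w) \<noteq> gr_body (fh 0)" "gr_body (sf_deriv fh 0) \<noteq> 0"

context n2_sphere_charts
begin

text \<open>Source coordinates \<open>c\<close> and \<open>c'\<close>; \<open>\<kappa>\<close> is the constant of the transition from \<open>c'\<close> to \<open>c\<close>.\<close>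

definition chart_pair :: "'s chart \<Rightarrow> 's chart \<Rightarrow> complex \<Rightarrow> bool" where
  "chart_pair c c' \<kappa> \<longleftrightarrow> c = Delta \<and> c' = Upsilon \<and> \<kappa> = \<i> \<or> c = Upsilon \<and> c' = Delta \<and> \<kappa> = - \<i>"

lemma chart_pair_mem: "chart_pair c c' \<kappa> \<Longrightarrow> c \<in> {Delta, Upsilon} \<and> c' \<in> {Delta, Upsilon}"
  by (auto simp: chart_pair_def)

lemma chart_pair_transition:
  assumes "chart_pair c c' \<kappa>" "y \<in> fst c'"
  shows "y \<in> fst c \<longleftrightarrow> spoint_body (snd c' y) \<noteq> 0"
    and "y \<in> fst c \<Longrightarrow> snd c y = sphere_tr \<kappa> n (snd c' y)"
proof -
  have inv: "spoint_body (snd Delta y) \<noteq> 0 \<and> snd Upsilon y = sphere_tr (- \<i>) n (snd Delta y)"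
    if "y \<in> fst Delta" "y \<in> fst Upsilon" for y
  proof -
    note t = transition[OF that(2)] and s = chart_superspace[of Upsilon y]
    have b: "spoint_body (snd Upsilon y) \<noteq> 0" using t(1) that by simp
    show ?thesis
      using t(2)[OF that(1)] sphere_tr_superspace[OF s b, of \<i>] sphere_tr_inverse[OF s b, of "- \<i>" \<i>] b that by simp
  qed
  have "y \<in> fst Upsilon" if y: "y \<in> fst Delta" "spoint_body (snd Delta y) \<noteq> 0" for y
  proof -
    have sy: "snd Delta y \<in> superspace L" using chart_superspace y by simp
    let ?x = "sphere_tr (- \<i>) n (snd Delta y)"
    have x: "?x \<in> superspace L" "spoint_body ?x \<noteq> 0"
      using sphere_tr_mem[OF sy y(2)] sphere_tr_superspace[OF sy y(2)] y(2) by auto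
    obtain y2 where y2: "y2 \<in> fst Upsilon" "snd Upsilon y2 = ?x" using chart_point[OF _ x(1), of Upsilon] by auto
    then have "y2 \<in> fst Delta" using transition(1) x by simp
    moreover from this have "snd Delta y2 = snd Delta y"
      using transition(2)[OF y2(1)] y2 sphere_tr_inverse[OF sy y(2), of \<i> "- \<i>"] by simp
    ultimately have "y2 = y"
      using chart_bij[of Delta] y(1) by (metis bij_betw_imp_inj_on inj_onD insertI1)
    then show ?thesis using y2 by simp
  qed
  then show "y \<in> fst c \<longleftrightarrow> spoint_body (snd c' y) \<noteq> 0"
    "y \<in> fst c \<Longrightarrow> snd c y = sphere_tr \<kappa> n (snd c' y)"
    using assms inv transition unfolding chart_pair_def by blast+
qed

text \<open>If \<open>T\<close> does not fix infinity, the point that it sends to infinity lies in \<open>Delta\<close>, and \<open>Delta\<close> serves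
  as source.  Otherwise infinity, the point \<open>0\<close> of \<open>Upsilon\<close>, is the pole, and \<open>T\<close> maps \<open>Delta\<close> to itself.\<close>

lemma pole_configuration:
  assumes T: "T \<in> Aut"
  obtains c c' \<kappa> w0 where "chart_pair c c' \<kappa>"
    "\<forall>y\<in>fst c. T y \<in> fst Delta \<longleftrightarrow> spoint_body (snd c y) \<noteq> w0"
    "\<exists>y\<in>fst c'. spoint_body (snd c' y) = 0 \<and> T y \<in> fst Delta"
    "c = Delta \<or> c = Upsilon \<and> w0 = 0 \<and> (\<forall>y\<in>fst Delta. T y \<in> fst Delta)"
proof -
  have bij: "bij_betw T (topspace X) (topspace X)" using T by (simp add: n2_Aut_def)
  have 0: "(0, 0, 0) \<in> superspace L" by (simp add: superspace_def)
  obtain y0 where y0: "y0 \<in> fst Upsilon" "snd Upsilon y0 = (0, 0, 0)" using chart_point[OF _ 0, of Upsilon] by auto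
  have b0: "spoint_body (0, 0, 0) = 0" by (simp add: spoint_body_def)
  have y0X: "y0 \<in> topspace X" and sy0: "sphere_body y0 = None"
    using y0 b0 transition(1)[of y0] chart_cover by (auto simp: sphere_body_def)
  have inf: "T y \<in> fst Delta \<longleftrightarrow> sphere_body (T y) \<noteq> None" for y by (simp add: sphere_body_def)
  show thesis
  proof (cases "T y0 \<in> fst Delta")
    case True
    obtain y1 where y1: "y1 \<in> topspace X" "T y1 = y0" using bij y0X by (metis bij_betw_def imageE)
    have "sphere_body y1 \<noteq> sphere_body y0" using sphere_body_Aut[OF T y1(1) y0X] y1 sy0 True inf by metis
    then have y1D: "y1 \<in> fst Delta" using sy0 by (auto simp: sphere_body_def split: if_splits)
    show thesis
    proof (rule that[of Delta Upsilon \<i> "spoint_body (snd Delta y1)"])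
      show "\<forall>y\<in>fst Delta. T y \<in> fst Delta \<longleftrightarrow> spoint_body (snd Delta y) \<noteq> spoint_body (snd Delta y1)"
      proof
        fix y assume y: "y \<in> fst Delta"
        have "T y \<in> fst Delta \<longleftrightarrow> sphere_body (T y) \<noteq> sphere_body (T y1)" unfolding inf y1 sy0 ..
        also have "\<dots> \<longleftrightarrow> sphere_body y \<noteq> sphere_body y1" using sphere_body_Aut[OF T _ y1(1)] y chart_cover by simp
        also have "\<dots> \<longleftrightarrow> spoint_body (snd Delta y) \<noteq> spoint_body (snd Delta y1)"
          using sphere_body_eq_iff[of Delta y y1] y y1D by simp
        finally show "T y \<in> fst Delta \<longleftrightarrow> spoint_body (snd Delta y) \<noteq> spoint_body (snd Delta y1)" .
      qed
      show "\<exists>y\<in>fst Upsilon. spoint_body (snd Upsilon y) = 0 \<and> T y \<in> fst Delta"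
        using y0 b0 True by (intro bexI[of _ y0]) auto
    qed (auto simp: chart_pair_def)
  next
    case False
    have sT: "sphere_body (T y0) = None" using False by (simp add: sphere_body_def)
    have key: "T y \<in> fst Delta \<longleftrightarrow> sphere_body y \<noteq> sphere_body y0" if "y \<in> topspace X" for y
      using sphere_body_Aut[OF T that y0X] inf sT by metis
    show thesis
    proof (rule that[of Upsilon Delta "- \<i>" 0])
      show "\<forall>y\<in>fst Upsilon. T y \<in> fst Delta \<longleftrightarrow> spoint_body (snd Upsilon y) \<noteq> 0"
        using key chart_cover sphere_body_eq_iff[of Upsilon _ y0] y0 b0 by simp
      have D: "T y \<in> fst Delta" if "y \<in> fst Delta" for y
        using key[of y] that chart_cover sy0 by (simp add: sphere_body_def)
      then show "Upsilon = Delta \<or> Upsilon = Upsilon \<and> 0 = (0::complex) \<and> (\<forall>y\<in>fst Delta. T y \<in> fst Delta)"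
        by simp
      obtain y where "y \<in> fst Delta" "snd Delta y = (0, 0, 0)" using chart_point[OF _ 0, of Delta] by auto
      then show "\<exists>y\<in>fst Delta. spoint_body (snd Delta y) = 0 \<and> T y \<in> fst Delta"
        using D b0 by (intro bexI[of _ y]) auto
    qed (simp add: chart_pair_def)
  qed
qed

lemma coord_expr_body_dom:
  assumes "c \<in> {Delta, Upsilon}"
  shows "spoint_body ` dom (coord_expr c d R) = {spoint_body (snd c y) |y. y \<in> fst c \<and> R y \<in> fst d}"
proof -
  have "dom (coord_expr c d R) = {snd c y |y. y \<in> fst c \<and> R y \<in> fst d}"
    by (cases c; cases d) (auto split: if_splits)
  then show ?thesis by auto
qed

text \<open>The coordinate expressions of \<open>T\<close> for the three relevant pairs of charts are compared at points
  \<open>(w, p, m)\<close> with complex \<open>w\<close>.  Injectivity on bodies gives the two regularity conditions at infinity: a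
  value that is not taken elsewhere, and a nonzero derivative.\<close>

lemma pole_data_exists:
  assumes T: "T \<in> Aut" and cp: "chart_pair c c' \<kappa>"
    and A: "\<forall>y\<in>fst c. T y \<in> fst Delta \<longleftrightarrow> spoint_body (snd c y) \<noteq> w0"
    and B: "\<exists>y\<in>fst c'. spoint_body (snd c' y) = 0 \<and> T y \<in> fst Delta"
    and comp1: "n2_components L (coord_expr c Delta T) f gp gm pp pm"
    and comp3: "n2_components L (coord_expr c' Delta T) fh gph gmh pph pmh"
  shows "\<exists>V h Gp Gm Pp Pm. pole_data (L - 2) n \<kappa> w0 V (spoint_body ` dom (coord_expr c' Delta T))
    f gp gm pp pm h Gp Gm Pp Pm fh gph gmh pph pmh"
proof -
  let ?H1 = "coord_expr c Delta T" and ?H2 = "coord_expr c Upsilon T" and ?H3 = "coord_expr c' Delta T"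
  have c: "c \<in> {Delta, Upsilon}" "c' \<in> {Delta, Upsilon}" using chart_pair_mem[OF cp] by auto
  note sc = chartwise_superconformalD[OF Aut_chartwise_superconformal(1)[OF T]]
  have TX: "T y \<in> topspace X" if "y \<in> topspace X" for y
    using T that by (auto simp: n2_Aut_def dest: bij_betwE)
  have cX: "y \<in> topspace X" if "y \<in> fst c \<or> y \<in> fst c'" for y
    using that c chart_cover by auto
  have pt: "\<exists>y\<in>fst d. snd d y = (gc w, p, m)" if "d \<in> {Delta, Upsilon}" "p \<in> gr_odd L" "m \<in> gr_odd L" for d w p m
    using chart_point[OF that(1) gc_superspace[OF that(2,3), of w]] by metis
  have dom1: "spoint_body ` dom ?H1 = - {w0}"
  proof -
    have "\<exists>y\<in>fst c. spoint_body (snd c y) = w" for w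
      using pt[OF c(1) gr_zero_mem(2) gr_zero_mem(2), of w] by (metis spoint_body_gc)
    then show ?thesis unfolding coord_expr_body_dom[OF c(1)] using A by (auto, metis)
  qed
  obtain yw where yw: "yw \<in> fst c" "snd c yw = (gc w0, 0, 0)" using pt[OF c(1) gr_zero_mem(2) gr_zero_mem(2)] by blast
  have Tyw: "T yw \<notin> fst Delta" using A yw by auto
  then have Tyw': "T yw \<in> fst Upsilon" using TX cX yw chart_cover by blast
  have H2: "n2_superconformal L ?H2" using sc[OF c(1) _ yw(1) Tyw'] by simp
  obtain h Gp Gm Pp Pm where comp2: "n2_components L ?H2 h Gp Gm Pp Pm"
    using n2_components_exist[OF L H2] by blast
  obtain y1 where y1: "y1 \<in> fst c" "snd c y1 = (gc (w0 + 1), 0, 0)" using pt[OF c(1) gr_zero_mem(2) gr_zero_mem(2)] by blast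
  have H1: "n2_superconformal L ?H1" using sc[OF c(1) _ y1(1), of Delta] A y1 by simp
  obtain y3 where y3: "y3 \<in> fst c'" "spoint_body (snd c' y3) = 0" "T y3 \<in> fst Delta" using B by blast
  have H3: "n2_superconformal L ?H3" using sc[OF c(2) _ y3(1,3)] by simp
  have op: "openin (dewitt L) (dom ?H1)" "openin (dewitt L) (dom ?H2)" "openin (dewitt L) (dom ?H3)"
    using H1 H2 H3 by (auto simp: n2_superconformal_def)
  define V W where "V = spoint_body ` dom ?H2" and "W = spoint_body ` dom ?H3"
  note C1 = n2_componentsD[OF comp1 op(1), unfolded dom1] and C2 = n2_componentsD[OF comp2 op(2), folded V_def]
    and C3 = n2_componentsD[OF comp3 op(3), folded W_def]
  have w0V: "w0 \<in> V"
    unfolding V_def coord_expr_body_dom[OF c(1)] using yw Tyw' by force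
  have W0: "0 \<in> W"
    unfolding W_def coord_expr_body_dom[OF c(2)] using y3 by force
  have inV: "T y \<in> fst Upsilon" if "y \<in> fst c" "spoint_body (snd c y) \<in> V" for y
  proof -
    have "snd c y \<in> dom ?H2"
      using that openin_dewitt(2)[OF op(2)] chart_superspace[OF c(1) that(1)] unfolding V_def by blast
    then show ?thesis using coord_expr_chart[OF c(1) that(1), of Upsilon T] by (auto split: if_splits)
  qed
  have inW: "T y \<in> fst Delta" if "y \<in> fst c'" "spoint_body (snd c' y) \<in> W" for y
  proof -
    have "snd c' y \<in> dom ?H3"
      using that openin_dewitt(2)[OF op(3)] chart_superspace[OF c(2) that(1)] unfolding W_def by blast
    then show ?thesis using coord_expr_chart[OF c(2) that(1), of Delta T] by (auto split: if_splits)
  qed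
  have W_inv: "1 / y \<noteq> w0 \<and> ?H1 (gc (1 / y), gc (\<kappa> * y powi (n - 1)) * p, gc (\<kappa> * y powi (- n - 1)) * m) = ?H3 (gc y, p, m)"
    if y: "y \<in> W" "y \<noteq> 0" and odd: "p \<in> gr_odd L" "m \<in> gr_odd L" for y p m
  proof -
    obtain v where v: "v \<in> fst c'" "snd c' v = (gc y, p, m)" using pt[OF c(2) odd] by blast
    have b: "spoint_body (snd c' v) = y" by (simp add: v)
    have Tv: "T v \<in> fst Delta" using inW v(1) b y by simp
    have vc: "v \<in> fst c" "snd c v = sphere_tr \<kappa> n (gc y, p, m)"
      using chart_pair_transition[OF cp v(1)] b y v by auto
    then have "snd c v = (gc (1 / y), gc (\<kappa> * y powi (n - 1)) * p, gc (\<kappa> * y powi (- n - 1)) * m)"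
      using sphere_tr_gc[OF y(2)] by simp
    then show ?thesis
      using coord_expr_chart[OF c(1) vc(1), of Delta T] coord_expr_chart[OF c(2) v(1), of Delta T] Tv v(2) A vc(1) by auto
  qed
  have W_odd: "gc a * p \<in> gr_odd L" if "p \<in> gr_odd L" for a p using that by auto
  have inf: "f (1 / y) = fh y" "pp (1 / y) = pph y" "pm (1 / y) = pmh y"
      "gc (\<kappa> * y powi (n - 1)) * gp (1 / y) = gph y" "gc (\<kappa> * y powi (- n - 1)) * gm (1 / y) = gmh y"
    if y: "y \<in> W" "y \<noteq> 0" for y
  proof -
    note e = W_inv[OF y, THEN conjunct2]
    have y': "1 / y \<in> - {w0}" using W_inv[OF y, of 0 0] by auto
    show "f (1 / y) = fh y" using e[of 0 0] C1(13)[OF y', of 0 0] C3(13)[OF y(1), of 0 0] by simp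
    have "pp (1 / y) + (gc (\<kappa> * y powi (n - 1)) * p) * gp (1 / y) = pph y + p * gph y" if p: "p \<in> gr_odd L" for p
      using e[OF p gr_zero_mem(2)] C1(13)[OF y' W_odd[OF p] gr_zero_mem(2)] C3(13)[OF y(1) p gr_zero_mem(2)] by simp
    from source_change_half[OF L _ _ this] show "pp (1 / y) = pph y" "gc (\<kappa> * y powi (n - 1)) * gp (1 / y) = gph y"
      using C1(8)[OF y'] C3(8)[OF y(1)] by auto
    have "pm (1 / y) + (gc (\<kappa> * y powi (- n - 1)) * p) * gm (1 / y) = pmh y + p * gmh y" if p: "p \<in> gr_odd L" for p
      using e[OF gr_zero_mem(2) p] C1(13)[OF y' gr_zero_mem(2) W_odd[OF p]] C3(13)[OF y(1) gr_zero_mem(2) p] by simp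
    from source_change_half[OF L _ _ this] show "pm (1 / y) = pmh y" "gc (\<kappa> * y powi (- n - 1)) * gm (1 / y) = gmh y"
      using C1(9)[OF y'] C3(9)[OF y(1)] by auto
  qed
  have tgt: "\<exists>v. ?H2 (gc w, p, m) = Some v \<and> ?H1 (gc w, p, m) = Some (sphere_tr \<i> n v) \<and> spoint_body v \<noteq> 0"
    if w: "w \<in> V" "w \<noteq> w0" and odd: "p \<in> gr_odd L" "m \<in> gr_odd L" for w p m
  proof -
    obtain y where y: "y \<in> fst c" "snd c y = (gc w, p, m)" using pt[OF c(1) odd] by blast
    have Ty: "T y \<in> fst Delta" "T y \<in> fst Upsilon" using A inV y w by auto
    then show ?thesis
      using coord_expr_chart[OF c(1) y(1), of Delta T] coord_expr_chart[OF c(1) y(1), of Upsilon T] y(2)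
        transition[OF Ty(2)] by auto
  qed
  have pole: "f w * h w = 1" "pp w = gc \<i> * Pp w * h w powi (n - 1)" "pm w = gc \<i> * Pm w * h w powi (- n - 1)"
    "gp w = gc \<i> * Gp w * h w powi (n - 1) * (1 - of_int (n - 1) * (Pp w * Pm w * inverse (h w)))"
    "gm w = gc \<i> * Gm w * h w powi (- n - 1) * (1 - of_int (- n - 1) * (Pm w * Pp w * inverse (h w)))"
    if w: "w \<in> V" "w \<noteq> w0" for w
  proof -
    have w': "w \<in> - {w0}" using w by simp
    have hb: "gr_body (h w) \<noteq> 0"
      using tgt[OF w, of 0 0] C2(13)[OF w(1), of 0 0] by (auto simp: spoint_body_def)
    show "f w * h w = 1"
      using tgt[OF w, of 0 0] C2(13)[OF w(1), of 0 0] C1(13)[OF w', of 0 0] hb by (auto simp: sphere_tr_def)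
    have P: "pp w + p * gp w = gc \<i> * (Pp w + p * Gp w) * (h w + p * (Gp w * Pm w)) powi (n - 1)"
      if p: "p \<in> gr_odd L" for p
      using tgt[OF w p gr_zero_mem(2)] C2(13)[OF w(1) p gr_zero_mem(2)] C1(13)[OF w' p gr_zero_mem(2)]
      by (auto simp: sphere_tr_def)
    show "pp w = gc \<i> * Pp w * h w powi (n - 1)"
      "gp w = gc \<i> * Gp w * h w powi (n - 1) * (1 - of_int (n - 1) * (Pp w * Pm w * inverse (h w)))"
      by (rule target_change_half[OF L C2(7)[OF w(1)] hb C2(8)[OF w(1)] C2(10)[OF w(1)] C2(11)[OF w(1)] C1(8)[OF w'] P]; assumption)+
    have M: "pm w + p * gm w = gc \<i> * (Pm w + p * Gm w) * (h w + p * (Gm w * Pp w)) powi (- n - 1)"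
      if p: "p \<in> gr_odd L" for p
      using tgt[OF w gr_zero_mem(2) p] C2(13)[OF w(1) gr_zero_mem(2) p] C1(13)[OF w' gr_zero_mem(2) p]
      by (auto simp: sphere_tr_def)
    show "pm w = gc \<i> * Pm w * h w powi (- n - 1)"
      "gm w = gc \<i> * Gm w * h w powi (- n - 1) * (1 - of_int (- n - 1) * (Pm w * Pp w * inverse (h w)))"
      by (rule target_change_half[OF L C2(7)[OF w(1)] hb C2(9)[OF w(1)] C2(11)[OF w(1)] C2(10)[OF w(1)] C1(9)[OF w'] M]; assumption)+
  qed
  have zero: "gr_body (h w0) = 0"
  proof -
    have "?H2 (snd c yw) = Some (snd Upsilon (T yw))" using coord_expr_chart[OF c(1) yw(1), of Upsilon T] Tyw' by simp
    then have "spoint_body (snd Upsilon (T yw)) = gr_body (h w0)"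
      using n2_components_body[OF comp2 op(2)] yw by fastforce
    then show ?thesis using transition(1)[OF Tyw'] Tyw by simp
  qed
  have body3: "sphere_body (T y) = Some (gr_body (fh (spoint_body (snd c' y))))" if "y \<in> fst c'" "T y \<in> fst Delta" for y
    using n2_components_body[OF comp3 op(3)] coord_expr_chart[OF c(2) that(1), of Delta T] that by (simp add: sphere_body_def)
  have body1: "sphere_body (T y) = Some (gr_body (f (spoint_body (snd c y))))" if "y \<in> fst c" "T y \<in> fst Delta" for y
    using n2_components_body[OF comp1 op(1)] coord_expr_chart[OF c(1) that(1), of Delta T] that by (simp add: sphere_body_def)
  have inj1: "gr_body (f w) \<noteq> gr_body (fh 0)" if w: "w \<noteq> w0" for w
  proof
    assume eq: "gr_body (f w) = gr_body (fh 0)"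
    obtain y where y: "y \<in> fst c" "snd c y = (gc w, 0, 0)" using pt[OF c(1) gr_zero_mem(2) gr_zero_mem(2)] by blast
    have "T y \<in> fst Delta" using A y w by auto
    then have "sphere_body (T y) = sphere_body (T y3)" using body1[OF y(1)] body3[OF y3(1,3)] y y3 eq by simp
    then have e: "sphere_body y = sphere_body y3" using sphere_body_Aut[OF T] cX y y3 by blast
    have n: "y3 \<notin> fst c" using chart_pair_transition(1)[OF cp y3(1)] y3 by simp
    obtain d where d: "d \<in> {Delta, Upsilon}" "y \<in> fst d" "y3 \<in> fst d"
      using same_chart[OF _ _ e] cX y(1) y3(1) by blast
    then have "d = c'" using n cp by (auto simp: chart_pair_def)
    then have "spoint_body (snd c' y) = 0" using sphere_body_eq_iff[OF d] e y3 by simp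
    then show False using chart_pair_transition(1)[OF cp, of y] d y(1) \<open>d = c'\<close> by simp
  qed
  have "inj_on (\<lambda>y. gr_body (fh y)) W"
  proof (rule inj_onI)
    fix y y' assume y: "y \<in> W" "y' \<in> W" "gr_body (fh y) = gr_body (fh y')"
    obtain v where v: "v \<in> fst c'" "snd c' v = (gc y, 0, 0)" using pt[OF c(2) gr_zero_mem(2) gr_zero_mem(2)] by blast
    obtain v' where v': "v' \<in> fst c'" "snd c' v' = (gc y', 0, 0)" using pt[OF c(2) gr_zero_mem(2) gr_zero_mem(2)] by blast
    have "sphere_body (T v) = sphere_body (T v')" using body3[OF v(1)] body3[OF v'(1)] inW v v' y by simp
    then have "sphere_body v = sphere_body v'" using sphere_body_Aut[OF T] cX v v' by blast
    then show "y = y'" using sphere_body_eq_iff[OF c(2) v(1) v'(1)] v v' by simp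
  qed
  then have inj2: "gr_body (sf_deriv fh 0) \<noteq> 0"
    using holomorphic_injective_imp_regular[OF gr_holo_body[OF C3(2)] C3(1) _ W0]
    by (simp add: gr_body_sf_deriv[OF C3(2,1) W0])
  have "pole_data (L - 2) n \<kappa> w0 V W f gp gm pp pm h Gp Gm Pp Pm fh gph gmh pph pmh"
  proof unfold_locales
    show "\<kappa> \<noteq> 0" using cp by (auto simp: chart_pair_def)
    show "1 / y \<noteq> w0" if "y \<in> W" "y \<noteq> 0" for y using W_inv[OF that, of 0 0] by simp
  qed (use C1(2-12) C2(1-11) C3(1-6) w0V W0 inf pole zero inj1 inj2 in simp_all)
  then show ?thesis unfolding W_def by blast
qed

end

section \<open>Identities between even elements\<close>

text \<open>The commutative ring of even elements, as a type on which the simplifier decides ring identities.\<close>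

typedef gre = "gr_even \<infinity>" by blast

instantiation gre :: comm_ring_1
begin
definition "0 = Abs_gre 0"
definition "1 = Abs_gre 1"
definition "a + b = Abs_gre (Rep_gre a + Rep_gre b)"
definition "a - b = Abs_gre (Rep_gre a - Rep_gre b)"
definition "- a = Abs_gre (- Rep_gre a)"
definition "a * b = Abs_gre (Rep_gre a * Rep_gre b)"

lemma Rep_gre_simps:
  "Rep_gre 0 = 0" "Rep_gre 1 = 1" "Rep_gre (a + b) = Rep_gre a + Rep_gre b"
  "Rep_gre (a - b) = Rep_gre a - Rep_gre b" "Rep_gre (- a) = - Rep_gre a"
  "Rep_gre (a * b) = Rep_gre a * Rep_gre b"
  using Rep_gre[of a] Rep_gre[of b]
  by (auto simp: zero_gre_def one_gre_def plus_gre_def minus_gre_def uminus_gre_def times_gre_def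
      intro!: Abs_gre_inverse)

instance
proof
  fix a b c :: gre
  show "a * b = b * a"
    unfolding Rep_gre_inject[symmetric] Rep_gre_simps using gr_even_commute[OF Rep_gre] .
qed (auto simp: Rep_gre_inject[symmetric] Rep_gre_simps algebra_simps)

end

lemma gre_cases:
  assumes "x \<in> gr_even L" obtains x' where "x = Rep_gre x'"
proof -
  have "x \<in> gr_even \<infinity>" using assms gr_alg_mono[of L \<infinity>] by (auto simp: gr_even_def)
  then show thesis using that Abs_gre_inverse by metis
qed

lemma gre_eq_iff: "Rep_gre x = Rep_gre y \<longleftrightarrow> x = y"
  by (rule Rep_gre_inject)

text \<open>The coefficients \<open>N2\<close>, \<open>N1\<close>, \<open>N0\<close> of the product \<open>(p1 w + p0) (m1 w + m0)\<close>.  The relations hold because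
  odd elements anticommute; they imply that the product and its derivative multiply to zero.\<close>

lemma odd_product_relations:
  assumes "p1 \<in> gr_odd L" "p0 \<in> gr_odd L" "m1 \<in> gr_odd L" "m0 \<in> gr_odd L"
  defines "N2 \<equiv> p1 * m1" and "N1 \<equiv> p1 * m0 - m1 * p0" and "N0 \<equiv> p0 * m0"
  shows "N2 * N2 = 0" "N0 * N0 = 0" "N2 * N1 = 0" "N0 * N1 = 0" "N1 * N1 = - 2 * (N2 * N0)"
proof -
  have sq: "p1 * p1 = 0" "p0 * p0 = 0" "m1 * m1 = 0" "m0 * m0 = 0" using assms gr_odd_square by auto
  have ac: "m1 * p1 = - (p1 * m1)" "m0 * p1 = - (p1 * m0)" "p0 * p1 = - (p1 * p0)"
    "m1 * p0 = - (p0 * m1)" "m0 * p0 = - (p0 * m0)" "m0 * m1 = - (m1 * m0)"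
    using assms gr_odd_anticommute by blast+
  have sq': "p1 * (p1 * x) = 0" "p0 * (p0 * x) = 0" "m1 * (m1 * x) = 0" "m0 * (m0 * x) = 0" for x
    using sq by (simp_all flip: mult.assoc)
  have ac': "m1 * (p1 * x) = - (p1 * (m1 * x))" "m0 * (p1 * x) = - (p1 * (m0 * x))" "p0 * (p1 * x) = - (p1 * (p0 * x))"
    "m1 * (p0 * x) = - (p0 * (m1 * x))" "m0 * (p0 * x) = - (p0 * (m0 * x))" "m0 * (m1 * x) = - (m1 * (m0 * x))" for x
    using ac by (simp_all flip: mult.assoc)
  show "N2 * N2 = 0" "N0 * N0 = 0" "N2 * N1 = 0" "N0 * N1 = 0" "N1 * N1 = - 2 * (N2 * N0)"
    unfolding N2_def N1_def N0_def
    by (simp_all add: distrib_left distrib_right left_diff_distrib right_diff_distrib mult.assoc sq ac sq' ac' mult_2)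
qed

lemma cubic_constraint_ring:
  fixes e1 e0 a b c d N2 N1 N0 j1 j0 u :: "'a :: comm_ring_1"
  assumes rel: "N2 * N2 = 0" "N0 * N0 = 0" "N2 * N1 = 0" "N0 * N1 = 0" "N1 * N1 = - 2 * (N2 * N0)"
    and det: "a * d - b * c = 1" and u: "c * u = 1"
    and 3: "e1 * (c * a + N2) = c * c * j1"
    and 2: "e1 * (c * b + d * a + N1) + e0 * (c * a + N2) = c * c * j0 + 2 * (c * d * j1)"
    and 1: "e1 * (d * b + N0) + e0 * (c * b + d * a + N1) = 2 * (c * d * j0) + d * d * j1"
    and 0: "e0 * (d * b + N0) = d * d * j0"
  shows "c * (c * e0 - d * e1) = e1 * (N2 * d * d - N1 * c * d + N0 * c * c)"
proof -
  define \<delta> where "\<delta> = c * e0 - d * e1"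
  define \<nu> where "\<nu> = N2 * d * d - N1 * c * d + N0 * c * c"
  define t where "t = N1 * c - 2 * (N2 * d)"
  have "\<nu> * t = (N2 * N1) * (3 * c * d * d) - (N2 * N2) * (2 * d * d * d)
      - (N1 * N1 + 2 * (N2 * N0)) * (c * c * d) + (N0 * N1) * (c * c * c)"
    unfolding \<nu>_def t_def by (simp add: algebra_simps)
  then have nut: "\<nu> * t = 0" by (simp add: rel)
  have "t * t * t = (N1 * N1 + 2 * (N2 * N0)) * (N1 * c * c * c)
      + (N2 * N1) * (- 2 * N0 * c * c * c - 6 * N1 * c * c * d + 12 * N2 * c * d * d) - (N2 * N2) * (8 * N2 * d * d * d)"
    unfolding t_def by (simp add: algebra_simps)
  then have ttt: "t * t * t = 0" by (simp add: rel)
  have "e1 * \<nu> + \<delta> * t - c * \<delta>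
      = (3 * d * d) * (e1 * (c * a + N2) - c * c * j1)
      - (2 * d * c) * (e1 * (c * b + d * a + N1) + e0 * (c * a + N2) - (c * c * j0 + 2 * (c * d * j1)))
      + (c * c) * (e1 * (d * b + N0) + e0 * (c * b + d * a + N1) - (2 * (c * d * j0) + d * d * j1))
      + \<delta> * c * (a * d - b * c - 1)"
    unfolding \<delta>_def \<nu>_def t_def by (simp add: algebra_simps)
  then have B: "c * \<delta> = e1 * \<nu> + \<delta> * t" by (simp only: 3 2 1 det diff_self mult_zero_right) simp
  have "c * (\<delta> * t) = e1 * (\<nu> * t) + \<delta> * t * t" using arg_cong[OF B, of "\<lambda>x. x * t"] by (simp add: algebra_simps)
  then have "u * (c * (\<delta> * t)) = u * (\<delta> * t * t)" using nut by simp
  moreover have "u * (c * (\<delta> * t)) = (c * u) * (\<delta> * t)" by (simp only: ac_simps)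
  ultimately have c1: "\<delta> * t = u * (\<delta> * t * t)" by (simp only: u mult_1)
  have "\<delta> * t * t = u * (\<delta> * t * t) * t" using arg_cong[OF c1, of "\<lambda>x. x * t"] .
  also have "\<dots> = u * \<delta> * (t * t * t)" by (simp only: mult.assoc)
  also have "\<dots> = 0" by (simp only: ttt mult_zero_right)
  finally have "\<delta> * t = 0" using c1 by simp
  then show ?thesis using B unfolding \<delta>_def \<nu>_def by simp
qed

lemma epsilon_c_ring:
  fixes e1 e0 c d N2 N1 N0 u :: "'a :: comm_ring_1"
  assumes rel: "N2 * N2 = 0" "N0 * N0 = 0" "N2 * N1 = 0" "N0 * N1 = 0" "N1 * N1 = - 2 * (N2 * N0)"
    and u: "c * u = 1"
    and con: "c * (c * e0 - d * e1) = e1 * (N2 * d * d - N1 * c * d + N0 * c * c)"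
  defines "\<epsilon> \<equiv> e1 * u * (1 + N2 * d * u)"
  shows "e1 = \<epsilon> * (c - N2 * d)" "e0 = \<epsilon> * (d + N0 * c - N1 * d - N2 * N0 * d)"
proof -
  have "e1 - \<epsilon> * (c - N2 * d) = (N2 * N2) * (e1 * u * u * d * d) - (c * u - 1) * (e1 + e1 * u * N2 * d)"
    unfolding \<epsilon>_def by (simp add: algebra_simps)
  then show "e1 = \<epsilon> * (c - N2 * d)" by (simp add: rel u)
  have "e0 - \<epsilon> * (d + N0 * c - N1 * d - N2 * N0 * d)
      = (u * u) * (c * (c * e0 - d * e1) - e1 * (N2 * d * d - N1 * c * d + N0 * c * c))
      - (c * u - 1) * (e0 * (c * u + 1))
      + (c * u - 1) * (e1 * u * d - e1 * u * N1 * d + e1 * u * N0 * c - e1 * u * N2 * N0 * d)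
      + (N2 * N1) * (e1 * u * u * d * d) + (N2 * N2) * (e1 * u * u * N0 * d * d)"
    unfolding \<epsilon>_def by (simp add: algebra_simps)
  then show "e0 = \<epsilon> * (d + N0 * c - N1 * d - N2 * N0 * d)" by (simp add: rel u con)
qed

lemma epsilon_d_ring:
  fixes e1 e0 c d N2 N1 N0 v :: "'a :: comm_ring_1"
  assumes rel: "N2 * N2 = 0" "N0 * N0 = 0" "N2 * N1 = 0" "N0 * N1 = 0" "N1 * N1 = - 2 * (N2 * N0)"
    and v: "d * v = 1"
    and con: "d * (d * e1 - c * e0) = - (e0 * (N2 * d * d - N1 * c * d + N0 * c * c))"
  defines "\<epsilon> \<equiv> e0 * v * (1 + N1 - N0 * c * v - N2 * N0)"
  shows "e1 = \<epsilon> * (c - N2 * d)" "e0 = \<epsilon> * (d + N0 * c - N1 * d - N2 * N0 * d)"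
proof -
  have "e1 - \<epsilon> * (c - N2 * d)
      = (v * v) * (d * (d * e1 - c * e0) + e0 * (N2 * d * d - N1 * c * d + N0 * c * c))
      - (d * v - 1) * (e1 * (d * v + 1))
      + (d * v - 1) * (e0 * v * (c - N2 * d + N1 * c - N2 * N0 * c))
      + (N2 * N1) * (e0 * v * d) - (N2 * N2) * (e0 * v * N0 * d)"
    unfolding \<epsilon>_def by (simp add: algebra_simps)
  then show "e1 = \<epsilon> * (c - N2 * d)" by (simp add: rel v con)
  have "e0 - \<epsilon> * (d + N0 * c - N1 * d - N2 * N0 * d)
      = e0 * ((N1 * N1 + 2 * (N2 * N0)) - (N2 * N2) * (N0 * N0) - (N0 * N1) * (2 * c * v) + (N0 * N0) * (c * c * v * v))
      - (d * v - 1) * (e0 * (1 + N1 - N0 * c * v - N2 * N0) * (1 - N1 - N2 * N0))"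
    unfolding \<epsilon>_def by (simp add: algebra_simps)
  then show "e0 = \<epsilon> * (d + N0 * c - N1 * d - N2 * N0 * d)" by (simp add: rel v)
qed

lemma epsilon_product_ring:
  fixes c d N2 N1 N0 \<epsilon> \<epsilon>' :: "'a :: comm_ring_1"
  assumes rel: "N2 * N2 = 0" "N0 * N0 = 0" "N2 * N1 = 0" "N0 * N1 = 0" "N1 * N1 = - 2 * (N2 * N0)"
  shows "\<epsilon> * (c - N2 * d) * (\<epsilon>' * (c + N2 * d)) = \<epsilon> * \<epsilon>' * (c * c)"
    "\<epsilon> * (d + N0 * c - N1 * d - N2 * N0 * d) * (\<epsilon>' * (d - N0 * c + N1 * d - N2 * N0 * d)) = \<epsilon> * \<epsilon>' * (d * d)"
proof -
  have "\<epsilon> * (c - N2 * d) * (\<epsilon>' * (c + N2 * d)) - \<epsilon> * \<epsilon>' * (c * c) = - (N2 * N2) * (\<epsilon> * \<epsilon>' * d * d)"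
    by (simp add: algebra_simps)
  then show "\<epsilon> * (c - N2 * d) * (\<epsilon>' * (c + N2 * d)) = \<epsilon> * \<epsilon>' * (c * c)" by (simp add: rel)
  have "\<epsilon> * (d + N0 * c - N1 * d - N2 * N0 * d) * (\<epsilon>' * (d - N0 * c + N1 * d - N2 * N0 * d)) - \<epsilon> * \<epsilon>' * (d * d)
    = \<epsilon> * \<epsilon>' * ((N2 * N2) * (N0 * N0 * d * d) - (N1 * N1 + 2 * (N2 * N0)) * (d * d) - (N0 * N0) * (c * c)
       + (N0 * N1) * (2 * c * d))"
    by (simp add: algebra_simps)
  then show "\<epsilon> * (d + N0 * c - N1 * d - N2 * N0 * d) * (\<epsilon>' * (d - N0 * c + N1 * d - N2 * N0 * d)) = \<epsilon> * \<epsilon>' * (d * d)"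
    by (simp add: rel)
qed

section \<open>Component functions with a single pole are rational\<close>

lemma gr_holo_powi:
  assumes "gr_holo U \<phi>" "\<And>w. w \<in> U \<Longrightarrow> gr_body (\<phi> w) \<noteq> 0"
  shows "gr_holo U (\<lambda>w. \<phi> w powi k)"
  using assms by (cases "k \<ge> 0") (auto simp: power_int_def intro!: gr_holo_power gr_holo_inverse)

lemma gr_powi_mult:
  assumes "a \<in> gr_even L" "gr_body a \<noteq> 0" "gr_body b \<noteq> 0"
  shows "(a * b) powi k = a powi k * b powi k"
proof -
  have comm: "x * a = a * x" "x * inverse a = inverse a * x" for x
    using gr_even_commute assms gr_inverse_even by blast+
  have 1: "(a * b) ^ j = a ^ j * b ^ j" for j
  proof (induction j)
    case (Suc j)
    have "a * b * (a ^ j * b ^ j) = a * (b * a ^ j) * b ^ j" by (simp add: mult.assoc)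
    also have "b * a ^ j = a ^ j * b" using gr_even_commute gr_even_power[OF assms(1)] by metis
    finally show ?case using Suc by (simp add: mult.assoc)
  qed simp
  have 2: "(inverse b * inverse a) ^ j = inverse a ^ j * inverse b ^ j" for j
  proof (induction j)
    case (Suc j)
    have "inverse b * inverse a * (inverse a ^ j * inverse b ^ j) = inverse b * (inverse a ^ Suc j) * inverse b ^ j"
      by (simp add: mult.assoc)
    also have "inverse b * inverse a ^ Suc j = inverse a ^ Suc j * inverse b"
      using gr_even_commute gr_even_power[OF gr_inverse_even[OF assms(2,1)]] by metis
    finally show ?case using Suc by (simp add: mult.assoc)
  qed simp
  show ?thesis using assms by (simp add: power_int_def 1 2 gr_inverse_mult)
qed

lemma gc_collect: "gc \<alpha> * (gc \<beta> * p) * (r * gc \<gamma>) = gc (\<alpha> * \<beta> * \<gamma>) * (p * r)"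
  by (simp add: gc_commute[of r \<gamma>] gc_left_commute[of p] gc_mult mult.assoc)

context pole_data
begin

lemma moebius:
  obtains a b c d where "a \<in> gr_even L0" "b \<in> gr_even L0" "c \<in> gr_even L0" "d \<in> gr_even L0"
    "a * d - b * c = 1" "gr_body c \<noteq> 0" "\<forall>w. w \<noteq> w0 \<longrightarrow> gr_body (c * gc w + d) \<noteq> 0"
    "gr_body (c * gc w0 + d) = 0" "\<forall>w. w \<noteq> w0 \<longrightarrow> f w * (c * gc w + d) = a * gc w + b"
  by (rule gr_moebius[OF holo(1) even(1) V holo_V(1) pole(1) zero W holo_W(1) infinity(1) injective]) auto

end

locale pole_moebius = pole_data +
  fixes a b c d :: gr
  assumes mem: "a \<in> gr_even L0" "b \<in> gr_even L0" "c \<in> gr_even L0" "d \<in> gr_even L0"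
    and det: "a * d - b * c = 1" and c_unit: "gr_body c \<noteq> 0"
    and x_unit: "\<And>w. w \<noteq> w0 \<Longrightarrow> gr_body (c * gc w + d) \<noteq> 0"
    and x_zero: "gr_body (c * gc w0 + d) = 0"
    and f_eq: "\<And>w. w \<noteq> w0 \<Longrightarrow> f w * (c * gc w + d) = a * gc w + b"
begin

definition x :: "complex \<Rightarrow> gr" where "x w = c * gc w + d"
definition q :: "complex \<Rightarrow> gr" where "q w = a * gc w + b"
definition xi :: "complex \<Rightarrow> gr" where "xi y = c + d * gc y"
definition qi :: "complex \<Rightarrow> gr" where "qi y = a + b * gc y"

lemma even_xq: "x w \<in> gr_even L0" "q w \<in> gr_even L0" "xi w \<in> gr_even L0" "qi w \<in> gr_even L0"
  using mem by (auto simp: x_def q_def xi_def qi_def)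

lemma holo_xq: "gr_holo U x" "gr_holo U q" "gr_holo U xi" "gr_holo U qi"
  unfolding x_def[abs_def] q_def[abs_def] xi_def[abs_def] qi_def[abs_def]
  by (intro gr_holo_add gr_holo_mult gr_holo_const gr_holo_gc_id)+

lemma comm: "e \<in> gr_even L0 \<Longrightarrow> r * e = e * r"
  by (rule gr_even_commute)

lemma x_body: "w \<noteq> w0 \<Longrightarrow> gr_body (x w) \<noteq> 0"
  using x_unit by (simp add: x_def)

lemma f_x: "w \<noteq> w0 \<Longrightarrow> f w * x w = q w"
  using f_eq by (simp add: x_def q_def)

lemma h_body: "w \<in> V \<Longrightarrow> w \<noteq> w0 \<Longrightarrow> gr_body (h w) \<noteq> 0"
  using pole(1)[of w] by (metis gr_body_simps(2,7) mult_zero_right zero_neq_one)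

lemma q_body: "w \<in> V \<Longrightarrow> gr_body (q w) \<noteq> 0"
proof (cases "w = w0")
  case True
  have d: "gr_body d = - gr_body c * w0" using x_zero by (simp add: eq_neg_iff_add_eq_0 add.commute)
  have "gr_body a * gr_body d - gr_body b * gr_body c = 1"
    using arg_cong[OF det, of gr_body] by simp
  then have "- gr_body c * gr_body (q w0) = 1" by (simp add: d q_def algebra_simps)
  then show ?thesis using True by auto
next
  case False
  assume w: "w \<in> V"
  have "gr_body (f w) \<noteq> 0" using pole(1)[OF w False] by (metis gr_body_simps(2,7) mult_zero_left zero_neq_one)
  then show ?thesis using f_x[OF False] x_body[OF False] by (metis gr_body_simps(7) mult_eq_0_iff)
qed

lemma h_x: assumes "w \<in> V" "w \<noteq> w0" shows "q w * h w = x w"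
proof -
  have "q w * h w = x w * f w * h w" using f_x[OF assms(2)] comm[OF even_xq(1)] by metis
  then show ?thesis using pole(1)[OF assms] by (simp add: mult.assoc)
qed

lemma x_powi: assumes "w \<in> V" "w \<noteq> w0" shows "x w powi k = q w powi k * h w powi k"
  using gr_powi_mult[OF even_xq(2) q_body[OF assms(1)] h_body[OF assms]] h_x[OF assms] by simp

lemma x_infinity: assumes "y \<noteq> 0" shows "x (1 / y) * gc y = xi y" "q (1 / y) * gc y = qi y"
  using assms by (simp_all add: x_def q_def xi_def qi_def distrib_right mult.assoc flip: gc_mult)

lemma xi_body: "y \<in> W \<Longrightarrow> gr_body (xi y) \<noteq> 0"
proof (cases "y = 0")
  case True
  then show ?thesis using c_unit by (simp add: xi_def)
next
  case False
  assume "y \<in> W"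
  then have "gr_body (x (1 / y)) \<noteq> 0" using W(3) False x_body by blast
  then show ?thesis using x_infinity(1)[OF False] False by (metis gr_body_simps(3,7) mult_eq_0_iff)
qed

lemma x_infinity_powi: assumes "y \<in> W" "y \<noteq> 0" shows "x (1 / y) powi k * gc (y powi k) = xi y powi k"
  using gr_powi_mult[OF even_xq(1), of "1 / y" "gc y" k] x_body[OF W(3)[OF assms]] assms x_infinity(1)
  by (simp add: gc_powi)

text \<open>Off \<open>w0\<close> near the pole \<open>x = q h\<close> with invertible \<open>q\<close>, and near infinity \<open>x y\<close> is invertible.  So
  \<open>\<phi> x\<^bsup>-k\<^esup>\<close> is regular at the pole and at infinity.\<close>

lemma section_constant:
  assumes \<phi>: "gr_holo (- {w0}) \<phi>" and \<Phi>: "gr_holo V \<Phi>" and A: "gr_holo W A"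
    and V: "\<And>w. w \<in> V \<Longrightarrow> w \<noteq> w0 \<Longrightarrow> \<phi> w = \<Phi> w * h w powi k"
    and W: "\<And>y. y \<in> W \<Longrightarrow> y \<noteq> 0 \<Longrightarrow> gc (\<kappa> * y powi k) * \<phi> (1 / y) = A y"
    and ev: "\<And>w. w \<noteq> w0 \<Longrightarrow> \<phi> w \<in> gr_even L0"
  shows "\<exists>\<epsilon>\<in>gr_even L0. \<forall>w. w \<noteq> w0 \<longrightarrow> \<phi> w = \<epsilon> * x w powi k"
proof -
  have xk: "x w powi k * x w powi (- k) = 1" if "w \<noteq> w0" for w
    using gr_powi_add[OF x_body[OF that], of k "- k"] by simp
  have H1: "gr_holo (- {w0}) (\<lambda>w. \<phi> w * x w powi (- k))"
    using \<phi> x_body by (intro gr_holo_mult gr_holo_powi holo_xq) auto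
  have H2: "gr_holo V (\<lambda>w. \<Phi> w * q w powi (- k))"
    using \<Phi> q_body by (intro gr_holo_mult gr_holo_powi holo_xq) auto
  have H3: "\<phi> w * x w powi (- k) = \<Phi> w * q w powi (- k)" if w: "w \<in> V" "w \<noteq> w0" for w
  proof -
    have "\<phi> w * x w powi (- k) = \<Phi> w * h w powi k * (h w powi (- k) * q w powi (- k))"
      using V[OF w] x_powi[OF w] comm[OF gr_even_powi[OF h_body[OF w] even_V(1)[OF w(1)]]] by simp
    also have "\<dots> = \<Phi> w * (h w powi k * h w powi (- k)) * q w powi (- k)" by (simp add: mult.assoc)
    also have "h w powi k * h w powi (- k) = 1" using gr_powi_add[OF h_body[OF w], of k "- k"] by simp
    finally show ?thesis by simp
  qed
  have H4: "gr_holo W (\<lambda>y. gc (1 / \<kappa>) * A y * xi y powi (- k))"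
    using A xi_body by (intro gr_holo_mult gr_holo_const gr_holo_powi holo_xq) auto
  have H5: "\<phi> (1 / y) * x (1 / y) powi (- k) * gc y ^ 0 = gc (1 / \<kappa>) * A y * xi y powi (- k)"
    if y: "y \<in> W" "y \<noteq> 0" for y
  proof -
    have "gc (1 / \<kappa>) * A y * xi y powi (- k)
      = gc (1 / \<kappa>) * (gc (\<kappa> * y powi k) * \<phi> (1 / y)) * (x (1 / y) powi (- k) * gc (y powi (- k)))"
      using W[OF y] x_infinity_powi[OF y, of "- k"] by simp
    also have "\<dots> = gc (1 / \<kappa> * (\<kappa> * y powi k) * y powi (- k)) * (\<phi> (1 / y) * x (1 / y) powi (- k))"
      by (rule gc_collect)
    also have "1 / \<kappa> * (\<kappa> * y powi k) * y powi (- k) = 1"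
      using kappa y by (simp flip: power_int_add)
    finally show ?thesis by simp
  qed
  obtain r where r: "\<forall>w. w \<noteq> w0 \<longrightarrow> \<phi> w * x w powi (- k) = (\<Sum>j\<le>0. r j * gc w ^ j)"
    "(\<forall>w. w \<noteq> w0 \<longrightarrow> \<phi> w * x w powi (- k) \<in> gr_even L0) \<longrightarrow> (\<forall>j. r j \<in> gr_even L0)"
    by (rule gr_polynomial[OF H1 pole_data.V[OF pole_data_axioms] H2 H3 pole_data.W[OF pole_data_axioms] H4 H5])
  have "r 0 \<in> gr_even L0" using r(2) ev x_body even_xq by (auto intro!: gr_even_times gr_even_powi)
  moreover have "\<phi> w = r 0 * x w powi k" if w: "w \<noteq> w0" for w
  proof -
    have "\<phi> w * x w powi (- k) = r 0" using r(1) w by simp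
    then have "r 0 * x w powi k = \<phi> w * x w powi (- k) * x w powi k" by simp
    also have "\<dots> = \<phi> w * (x w powi (- k) * x w powi k)" by (rule mult.assoc)
    also have "x w powi (- k) * x w powi k = 1" using gr_powi_add[OF x_body[OF w], of "- k" k] by simp
    finally show ?thesis by simp
  qed
  ultimately show ?thesis by blast
qed

lemma section_polynomial:
  assumes \<phi>: "gr_holo (- {w0}) \<phi>" and \<Phi>: "gr_holo V \<Phi>" and A: "gr_holo W A"
    and V: "\<And>w. w \<in> V \<Longrightarrow> w \<noteq> w0 \<Longrightarrow> \<phi> w = \<Phi> w * h w powi (- int N)"
    and W: "\<And>y. y \<in> W \<Longrightarrow> y \<noteq> 0 \<Longrightarrow> \<phi> (1 / y) = A y"
    and odd: "\<And>w. w \<noteq> w0 \<Longrightarrow> \<phi> w \<in> gr_odd L0"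
  shows "\<exists>r. (\<forall>j. r j \<in> gr_odd L0) \<and> (\<forall>w. w \<noteq> w0 \<longrightarrow> \<phi> w * x w ^ N = (\<Sum>j\<le>N. r j * gc w ^ j))"
proof -
  have H1: "gr_holo (- {w0}) (\<lambda>w. \<phi> w * x w ^ N)"
    using \<phi> by (intro gr_holo_mult gr_holo_power holo_xq)
  have H2: "gr_holo V (\<lambda>w. \<Phi> w * q w ^ N)"
    using \<Phi> by (intro gr_holo_mult gr_holo_power holo_xq)
  have H3: "\<phi> w * x w ^ N = \<Phi> w * q w ^ N" if w: "w \<in> V" "w \<noteq> w0" for w
  proof -
    have "q w powi int N * h w powi int N = h w powi int N * q w powi int N"
      by (rule comm[OF gr_even_powi[OF h_body[OF w] even_V(1)[OF w(1)]]])
    then have "x w ^ N = h w powi int N * q w powi int N"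
      using x_powi[OF w, of "int N"] by (simp only: gr_powi_nat)
    then have "\<phi> w * x w ^ N = \<Phi> w * h w powi (- int N) * (h w powi int N * q w powi int N)"
      using V[OF w] by (simp only:)
    also have "\<dots> = \<Phi> w * (h w powi (- int N) * h w powi int N) * q w powi int N" by (simp add: mult.assoc)
    also have "h w powi (- int N) * h w powi int N = 1" using gr_powi_add[OF h_body[OF w], of "- int N" "int N"] by simp
    finally show ?thesis by (simp add: gr_powi_nat)
  qed
  have H4: "gr_holo W (\<lambda>y. A y * xi y ^ N)"
    using A by (intro gr_holo_mult gr_holo_power holo_xq)
  have H5: "\<phi> (1 / y) * x (1 / y) ^ N * gc y ^ N = A y * xi y ^ N" if y: "y \<in> W" "y \<noteq> 0" for y
    using W[OF y] x_infinity_powi[OF y, of "int N"] by (simp add: gr_powi_nat gc_power mult.assoc)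
  obtain r where r: "\<forall>w. w \<noteq> w0 \<longrightarrow> \<phi> w * x w ^ N = (\<Sum>j\<le>N. r j * gc w ^ j)"
    "(\<forall>w. w \<noteq> w0 \<longrightarrow> \<phi> w * x w ^ N \<in> gr_odd L0) \<longrightarrow> (\<forall>j. r j \<in> gr_odd L0)"
    by (rule gr_polynomial[OF H1 pole_data.V[OF pole_data_axioms] H2 H3 pole_data.W[OF pole_data_axioms] H4 H5])
  have "\<phi> w * x w ^ N \<in> gr_odd L0" if "w \<noteq> w0" for w
    using odd[OF that] even_xq by auto
  then show ?thesis using r by blast
qed

lemma section_zero:
  assumes \<phi>: "gr_holo (- {w0}) \<phi>" and \<Phi>: "gr_holo V \<Phi>" and A: "gr_holo W A"
    and V: "\<And>w. w \<in> V \<Longrightarrow> w \<noteq> w0 \<Longrightarrow> \<phi> w = \<Phi> w * h w powi k" and k: "k > 0"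
    and W: "\<And>y. y \<in> W \<Longrightarrow> y \<noteq> 0 \<Longrightarrow> \<phi> (1 / y) = A y" and w: "w \<noteq> w0"
  shows "\<phi> w = 0"
proof -
  have H1: "gr_holo (- {w0}) (\<lambda>w. \<phi> w * x w powi (- k))"
    using \<phi> x_body by (intro gr_holo_mult gr_holo_powi holo_xq) auto
  have H2: "gr_holo V (\<lambda>w. \<Phi> w * q w powi (- k))"
    using \<Phi> q_body by (intro gr_holo_mult gr_holo_powi holo_xq) auto
  have H3: "\<phi> w * x w powi (- k) = \<Phi> w * q w powi (- k)" if w: "w \<in> V" "w \<noteq> w0" for w
  proof -
    have "\<phi> w * x w powi (- k) = \<Phi> w * h w powi k * (h w powi (- k) * q w powi (- k))"
      using V[OF w] x_powi[OF w] comm[OF gr_even_powi[OF h_body[OF w] even_V(1)[OF w(1)]]] by simp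
    also have "\<dots> = \<Phi> w * (h w powi k * h w powi (- k)) * q w powi (- k)" by (simp add: mult.assoc)
    also have "h w powi k * h w powi (- k) = 1" using gr_powi_add[OF h_body[OF w], of k "- k"] by simp
    finally show ?thesis by simp
  qed
  have H4: "gr_holo W (\<lambda>y. A y * xi y powi (- k) * gc y ^ nat k)"
    using A xi_body by (intro gr_holo_mult gr_holo_const gr_holo_powi gr_holo_power holo_xq gr_holo_gc_id) auto
  have H5: "\<phi> (1 / y) * x (1 / y) powi (- k) = A y * xi y powi (- k) * gc y ^ nat k" if y: "y \<in> W" "y \<noteq> 0" for y
  proof -
    have "gc y ^ nat k = gc (y powi k)" using k by (simp add: power_int_def gc_power)
    moreover have "gc (y powi (- k)) * gc (y powi k) = 1"
      using y by (simp flip: gc_mult power_int_add)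
    ultimately show ?thesis
      using W[OF y] x_infinity_powi[OF y, of "- k"] by (metis mult.assoc mult.right_neutral)
  qed
  have "\<phi> w * x w powi (- k) = 0"
  proof (rule gr_vanishing[OF H1 pole_data.V[OF pole_data_axioms] H2 H3 pole_data.W[OF pole_data_axioms] H4 H5 _ w])
    show "A 0 * xi 0 powi (- k) * gc 0 ^ nat k = 0" using k by (simp add: zero_power)
  qed
  then have 0: "\<phi> w * (x w powi (- k) * x w powi k) = 0" by (metis mult.assoc mult_zero_left)
  have "x w powi (- k) * x w powi k = 1" using gr_powi_add[OF x_body[OF w], of "- k" k] by simp
  then show ?thesis using 0 by (simp only: mult_1_right)
qed

end

lemma gr_poly_coeffs:
  assumes "\<And>w. w \<noteq> w0 \<Longrightarrow> (\<Sum>j\<le>N. r j * gc w ^ j) = (\<Sum>j\<le>N. s j * gc w ^ j)" "j \<le> N"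
  shows "r j = s j"
proof (rule gr_eqI)
  fix k
  have ho: "gr_holo UNIV (\<lambda>w. \<Sum>j\<le>N. t j * gc w ^ j)" for t
    by (intro gr_holo_sum gr_holo_mult gr_holo_const gr_holo_power gr_holo_gc_id)
  have "(\<Sum>j\<le>N. (gr_coeff (r j) k - gr_coeff (s j) k) * w ^ j) = 0" for w
  proof -
    have "(\<Sum>j\<le>N. r j * gc w ^ j) = (\<Sum>j\<le>N. s j * gc w ^ j)"
      by (rule gr_holo_eq_puncture[OF open_UNIV ho ho, where ?w0.0 = w0]) (use assms in auto)
    then have "gr_coeff (\<Sum>j\<le>N. r j * gc w ^ j) k = gr_coeff (\<Sum>j\<le>N. s j * gc w ^ j) k" by simp
    then show ?thesis
      by (simp add: right_diff_distrib sum_subtractf mult.commute flip: gc_power)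
  qed
  then have "gr_coeff (r j) k - gr_coeff (s j) k = 0"
    using polyfun_eq_0[of "\<lambda>j. gr_coeff (r j) k - gr_coeff (s j) k" N] assms(2) by blast
  then show "gr_coeff (r j) k = gr_coeff (s j) k" by simp
qed

text \<open>The equation that \<open>cubic_constraint\<close> gives for the numerator \<open>e1 w + e0\<close> if \<open>c\<close> is invertible, and its
  image under the substitution \<open>w = 1 / y\<close>, for invertible \<open>d\<close>.\<close>

definition rational_zero_sol :: "gr \<Rightarrow> gr \<Rightarrow> gr \<Rightarrow> gr \<Rightarrow> gr \<Rightarrow> gr \<Rightarrow> gr \<Rightarrow> bool" where
  "rational_zero_sol c d N2 N1 N0 e1 e0 \<longleftrightarrow>
     gr_body c \<noteq> 0 \<and> c * (c * e0 - d * e1) = e1 * (N2 * d * d - N1 * c * d + N0 * c * c) \<or>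
     gr_body d \<noteq> 0 \<and> d * (d * e1 - c * e0) = - (e0 * (N2 * d * d - N1 * c * d + N0 * c * c))"

text \<open>The component functions at the complex points of \<open>U\<close>, with denominators cleared, for \<open>n = 0\<close>,
  \<open>n = 1\<close> and \<open>n = k \<ge> 2\<close>.  The relations between the parameters that come from the equation for \<open>f'\<close> are not
  part of these definitions.\<close>

definition rational_zero :: "enat \<Rightarrow> complex set \<Rightarrow> gr \<Rightarrow> gr \<Rightarrow> sfun \<Rightarrow> sfun \<Rightarrow> sfun \<Rightarrow> sfun \<Rightarrow> bool" where
  "rational_zero L0 U c d gp gm pp pm \<longleftrightarrow>
    (\<exists>p1\<in>gr_odd L0. \<exists>p0\<in>gr_odd L0. \<exists>m1\<in>gr_odd L0. \<exists>m0\<in>gr_odd L0.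
     \<exists>e1\<in>gr_even L0. \<exists>e0\<in>gr_even L0. \<exists>t1\<in>gr_even L0. \<exists>t0\<in>gr_even L0.
      rational_zero_sol c d (p1 * m1) (p1 * m0 - m1 * p0) (p0 * m0) e1 e0 \<and>
      rational_zero_sol c d (- (p1 * m1)) (- (p1 * m0 - m1 * p0)) (- (p0 * m0)) t1 t0 \<and>
      (\<forall>w\<in>U. pp w * (c * gc w + d) = p1 * gc w + p0 \<and> pm w * (c * gc w + d) = m1 * gc w + m0 \<and>
        gp w * (c * gc w + d) ^ 2 = e1 * gc w + e0 \<and> gm w * (c * gc w + d) ^ 2 = t1 * gc w + t0))"

definition rational_one :: "enat \<Rightarrow> complex set \<Rightarrow> gr \<Rightarrow> gr \<Rightarrow> sfun \<Rightarrow> sfun \<Rightarrow> sfun \<Rightarrow> bool" where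
  "rational_one L0 U c d gp pp pm \<longleftrightarrow>
    (\<exists>p0\<in>gr_odd L0. \<exists>m2\<in>gr_odd L0. \<exists>m1\<in>gr_odd L0. \<exists>m0\<in>gr_odd L0. \<exists>e\<in>gr_even L0.
      \<forall>w\<in>U. pp w = p0 \<and> pm w * (c * gc w + d) ^ 2 = m2 * gc w ^ 2 + m1 * gc w + m0 \<and> gp w = e)"

definition rational_many :: "enat \<Rightarrow> nat \<Rightarrow> complex set \<Rightarrow> gr \<Rightarrow> gr \<Rightarrow> sfun \<Rightarrow> sfun \<Rightarrow> sfun \<Rightarrow> sfun \<Rightarrow> bool" where
  "rational_many L0 k U c d gp gm pp pm \<longleftrightarrow>
    (\<exists>r. (\<forall>j. r j \<in> gr_odd L0) \<and> (\<exists>e\<in>gr_even L0. \<exists>e'\<in>gr_even L0.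
      \<forall>w\<in>U. pp w = 0 \<and> pm w * (c * gc w + d) ^ (k + 1) = (\<Sum>j\<le>k + 1. r j * gc w ^ j) \<and>
        gp w = e * (c * gc w + d) ^ (k - 1) \<and> gm w * (c * gc w + d) ^ (k + 1) = e'))"

lemma gre_of_complex: obtains w' where "gc w = Rep_gre w'"
  by (rule gre_cases[OF gr_even_gc])

text \<open>Write \<open>E N = x\<^sup>2 J - E x q\<close>, where \<open>E = e1 w + e0\<close>, \<open>x = c w + d\<close>, \<open>q = a w + b\<close> and \<open>J = j1 w + j0\<close>.  Let \<open>w\<close> be the zero
  \<open>- d / c\<close> of \<open>x\<close>, where \<open>c q = - 1\<close>.  Differentiating there gives \<open>e1 N + E N' = E\<close>.  Since \<open>N N' = 0\<close>, it
  follows that \<open>E = e1 N\<close> at \<open>- d / c\<close>, and the conclusion is this equation times \<open>c\<^sup>2\<close>.\<close>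

lemma cubic_constraint:
  assumes mem: "a \<in> gr_even L" "b \<in> gr_even L" "c \<in> gr_even L" "d \<in> gr_even L"
    "e1 \<in> gr_even L" "e0 \<in> gr_even L" "j1 \<in> gr_even L" "j0 \<in> gr_even L"
    and odd: "p1 \<in> gr_odd L" "p0 \<in> gr_odd L" "m1 \<in> gr_odd L" "m0 \<in> gr_odd L"
    and det: "a * d - b * c = 1" and c: "gr_body c \<noteq> 0"
  defines "N2 \<equiv> p1 * m1" and "N1 \<equiv> p1 * m0 - m1 * p0" and "N0 \<equiv> p0 * m0"
  assumes eq: "\<And>w. w \<noteq> w0 \<Longrightarrow> (e1 * gc w + e0) * ((a * gc w + b) * (c * gc w + d) + (N2 * gc w ^ 2 + N1 * gc w + N0))
      = (j1 * gc w + j0) * (c * gc w + d) ^ 2"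
  shows "c * (c * e0 - d * e1) = e1 * (N2 * d * d - N1 * c * d + N0 * c * c)"
proof -
  have N: "N2 \<in> gr_even L" "N1 \<in> gr_even L" "N0 \<in> gr_even L"
    using odd unfolding N2_def N1_def N0_def by auto
  obtain a' b' c' d' where r: "a = Rep_gre a'" "b = Rep_gre b'" "c = Rep_gre c'" "d = Rep_gre d'"
    using mem gre_cases by metis
  obtain e1' e0' j1' j0' where s: "e1 = Rep_gre e1'" "e0 = Rep_gre e0'" "j1 = Rep_gre j1'" "j0 = Rep_gre j0'"
    using mem gre_cases by metis
  obtain N2' N1' N0' where t: "N2 = Rep_gre N2'" "N1 = Rep_gre N1'" "N0 = Rep_gre N0'"
    using N gre_cases by metis
  obtain u where u: "inverse c = Rep_gre u" using gre_cases[OF gr_inverse_even[OF c mem(3)]] by metis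
  note rel = odd_product_relations[OF odd, folded N2_def N1_def N0_def]
  have num: "(2 :: gr) = Rep_gre 2" 
    unfolding one_add_one[symmetric] Rep_gre_simps ..
  define rr where "rr j = (if j = 0 then e0' * (d' * b' + N0') else if j = 1 then e1' * (d' * b' + N0') + e0' * (c' * b' + d' * a' + N1')
    else if j = 2 then e1' * (c' * b' + d' * a' + N1') + e0' * (c' * a' + N2') else e1' * (c' * a' + N2'))" for j :: nat
  define ss where "ss j = (if j = 0 then d' * d' * j0' else if j = 1 then 2 * (c' * d' * j0') + d' * d' * j1'
    else if j = 2 then c' * c' * j0' + 2 * (c' * d' * j1') else c' * c' * j1')" for j :: nat
  have "rr j = ss j" if "j \<le> 3" for j
  proof -
    have "Rep_gre (rr j) = Rep_gre (ss j)"
    proof (rule gr_poly_coeffs[OF _ that])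
      fix w assume w: "w \<noteq> w0"
      obtain w' where w': "gc w = Rep_gre w'" by (rule gre_of_complex)
      have "(e1' * w' + e0') * ((a' * w' + b') * (c' * w' + d') + (N2' * (w' * w') + N1' * w' + N0'))
        = (j1' * w' + j0') * ((c' * w' + d') * (c' * w' + d'))"
        using eq[OF w] unfolding r s t w' power2_eq_square Rep_gre_simps[symmetric] gre_eq_iff .
      then have "rr 0 + rr 1 * w' + rr 2 * (w' * w') + rr 3 * (w' * w' * w')
        = ss 0 + ss 1 * w' + ss 2 * (w' * w') + ss 3 * (w' * w' * w')"
        unfolding rr_def ss_def by (simp add: algebra_simps)
      then have "Rep_gre (rr 0 + rr 1 * w' + rr 2 * (w' * w') + rr 3 * (w' * w' * w'))
        = Rep_gre (ss 0 + ss 1 * w' + ss 2 * (w' * w') + ss 3 * (w' * w' * w'))" by simp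
      then show "(\<Sum>j\<le>3. Rep_gre (rr j) * gc w ^ j) = (\<Sum>j\<le>3. Rep_gre (ss j) * gc w ^ j)"
        unfolding w' Rep_gre_simps by (simp add: eval_nat_numeral mult.assoc)
    qed
    then show ?thesis by (simp add: gre_eq_iff)
  qed
  from this[of 0] this[of 1] this[of 2] this[of 3]
  have eqs: "e1' * (c' * a' + N2') = c' * c' * j1'"
    "e1' * (c' * b' + d' * a' + N1') + e0' * (c' * a' + N2') = c' * c' * j0' + 2 * (c' * d' * j1')"
    "e1' * (d' * b' + N0') + e0' * (c' * b' + d' * a' + N1') = 2 * (c' * d' * j0') + d' * d' * j1'"
    "e0' * (d' * b' + N0') = d' * d' * j0'"
    unfolding rr_def ss_def by simp_all
  have rel': "N2' * N2' = 0" "N0' * N0' = 0" "N2' * N1' = 0" "N0' * N1' = 0" "N1' * N1' = - 2 * (N2' * N0')"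
    using rel unfolding t num Rep_gre_simps[symmetric] gre_eq_iff by auto
  have det': "a' * d' - b' * c' = 1" using det unfolding r Rep_gre_simps[symmetric] gre_eq_iff .
  have u': "c' * u = 1" using gr_inverse_right[OF c] unfolding u unfolding r Rep_gre_simps[symmetric] gre_eq_iff .
  show ?thesis
    using cubic_constraint_ring[OF rel' det' u' eqs]
    unfolding r s t Rep_gre_simps[symmetric] gre_eq_iff .
qed

context pole_moebius
begin

lemma pm_polynomial:
  assumes "n \<ge> - 1"
  shows "\<exists>r. (\<forall>j. r j \<in> gr_odd L0) \<and> (\<forall>w. w \<noteq> w0 \<longrightarrow> pm w * x w ^ nat (n + 1) = (\<Sum>j\<le>nat (n + 1). r j * gc w ^ j))"
proof (rule section_polynomial[OF holo(5) _ holo_W(5)])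
  show "gr_holo V (\<lambda>w. gc \<i> * Pm w)" by (intro gr_holo_mult gr_holo_const holo_V)
  show "pm w = gc \<i> * Pm w * h w powi (- int (nat (n + 1)))" if "w \<in> V" "w \<noteq> w0" for w
  proof -
    have "- int (nat (n + 1)) = - n - 1" using assms by simp
    then show ?thesis using pole(3)[OF that] by (simp only:)
  qed
qed (use infinity odd in auto)

lemma pp_polynomial:
  assumes "n \<le> 1"
  shows "\<exists>r. (\<forall>j. r j \<in> gr_odd L0) \<and> (\<forall>w. w \<noteq> w0 \<longrightarrow> pp w * x w ^ nat (1 - n) = (\<Sum>j\<le>nat (1 - n). r j * gc w ^ j))"
proof (rule section_polynomial[OF holo(4) _ holo_W(4)])
  show "gr_holo V (\<lambda>w. gc \<i> * Pp w)" by (intro gr_holo_mult gr_holo_const holo_V)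
  show "pp w = gc \<i> * Pp w * h w powi (- int (nat (1 - n)))" if "w \<in> V" "w \<noteq> w0" for w
  proof -
    have "- int (nat (1 - n)) = n - 1" using assms by simp
    then show ?thesis using pole(2)[OF that] by (simp only:)
  qed
qed (use infinity odd in auto)

lemma pp_zero:
  assumes "n \<ge> 2" "w \<noteq> w0"
  shows "pp w = 0"
proof (rule section_zero[OF holo(4) _ holo_W(4)])
  show "gr_holo V (\<lambda>w. gc \<i> * Pp w)" by (intro gr_holo_mult gr_holo_const holo_V)
qed (use assms pole(2) infinity(2) in auto)

text \<open>As \<open>\<psi>\<^sup>+\<close> vanishes, so does its counterpart \<open>Pp\<close>, and with it the correction terms of \<open>g\<^sup>+\<close> and \<open>g\<^sup>-\<close>.\<close>

lemma rational_many:
  assumes n: "n \<ge> 2"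
  shows "rational_many L0 (nat n) (- {w0}) c d gp gm pp pm"
proof -
  have Pp: "Pp w = 0" if w: "w \<in> V" "w \<noteq> w0" for w
  proof -
    have "gc \<i> * Pp w * h w powi (n - 1) = 0" using pole(2)[OF w] pp_zero[OF n w(2)] by simp
    then have "gc \<i> * Pp w * (h w powi (n - 1) * h w powi (- (n - 1))) = 0" by (metis mult.assoc mult_zero_left)
    moreover have "h w powi (n - 1) * h w powi (- (n - 1)) = 1"
      using gr_powi_add[OF h_body[OF w], of "n - 1" "- (n - 1)"] by simp
    ultimately have "gc \<i> * Pp w = gc \<i> * 0" by (simp only: mult_1_right mult_zero_right)
    then show ?thesis by (subst (asm) gc_cancel) auto
  qed
  have "\<exists>e\<in>gr_even L0. \<forall>w. w \<noteq> w0 \<longrightarrow> gp w = e * x w powi (n - 1)"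
  proof (rule section_constant[OF holo(2) _ holo_W(2)])
    show "gr_holo V (\<lambda>w. gc \<i> * Gp w)" by (intro gr_holo_mult gr_holo_const holo_V)
    show "gp w = gc \<i> * Gp w * h w powi (n - 1)" if "w \<in> V" "w \<noteq> w0" for w
      using pole(4)[OF that] Pp[OF that] by simp
  qed (use infinity even in auto)
  then obtain e where e: "e \<in> gr_even L0" "\<And>w. w \<noteq> w0 \<Longrightarrow> gp w = e * x w powi (n - 1)" by blast
  have "\<exists>e\<in>gr_even L0. \<forall>w. w \<noteq> w0 \<longrightarrow> gm w = e * x w powi (- n - 1)"
  proof (rule section_constant[OF holo(3) _ holo_W(3)])
    show "gr_holo V (\<lambda>w. gc \<i> * Gm w)" by (intro gr_holo_mult gr_holo_const holo_V)
    show "gm w = gc \<i> * Gm w * h w powi (- n - 1)" if "w \<in> V" "w \<noteq> w0" for w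
      using pole(5)[OF that] Pp[OF that] by simp
  qed (use infinity even in auto)
  then obtain e' where e': "e' \<in> gr_even L0" "\<And>w. w \<noteq> w0 \<Longrightarrow> gm w = e' * x w powi (- n - 1)" by blast
  obtain r where r: "\<And>j. r j \<in> gr_odd L0"
    "\<And>w. w \<noteq> w0 \<Longrightarrow> pm w * x w ^ nat (n + 1) = (\<Sum>j\<le>nat (n + 1). r j * gc w ^ j)"
    using pm_polynomial n by auto
  have k: "nat (n + 1) = nat n + 1" "nat (n - 1) = nat n - 1" using n by auto
  have "gp w = e * x w ^ (nat n - 1)" if "w \<noteq> w0" for w
    using e(2)[OF that] n k(2) by (simp add: power_int_def)
  moreover have "gm w * x w ^ (nat n + 1) = e'" if "w \<noteq> w0" for w
  proof -
    have "x w ^ (nat n + 1) = x w powi (n + 1)" using n k(1) by (simp add: power_int_def)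
    moreover have "x w powi (- n - 1) * x w powi (n + 1) = 1"
      using gr_powi_add[OF x_body[OF that], of "- n - 1" "n + 1"] by simp
    ultimately show ?thesis using e'(2)[OF that] by (simp add: mult.assoc)
  qed
  ultimately show ?thesis
    unfolding rational_many_def using r e(1) e'(1) pp_zero[OF n] k(1)
    by (intro exI[of _ r] conjI bexI[of _ e] bexI[of _ e']) (auto simp flip: x_def)
qed

text \<open>The correction term of \<open>g\<^sup>+\<close> has the factor \<open>n - 1 = 0\<close>.\<close>

lemma rational_one:
  assumes n: "n = 1"
  shows "rational_one L0 (- {w0}) c d gp pp pm"
proof -
  have "\<exists>e\<in>gr_even L0. \<forall>w. w \<noteq> w0 \<longrightarrow> gp w = e * x w powi (n - 1)"
  proof (rule section_constant[OF holo(2) _ holo_W(2)])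
    show "gr_holo V (\<lambda>w. gc \<i> * Gp w)" by (intro gr_holo_mult gr_holo_const holo_V)
    show "gp w = gc \<i> * Gp w * h w powi (n - 1)" if "w \<in> V" "w \<noteq> w0" for w
      using pole(4)[OF that] n by simp
  qed (use infinity even in auto)
  then obtain e where e: "e \<in> gr_even L0" "\<And>w. w \<noteq> w0 \<Longrightarrow> gp w = e" using n by auto
  obtain r where r: "\<And>j. r j \<in> gr_odd L0" "\<And>w. w \<noteq> w0 \<Longrightarrow> pm w * x w ^ 2 = (\<Sum>j\<le>2. r j * gc w ^ j)"
    using pm_polynomial n by auto
  have "\<exists>r :: nat \<Rightarrow> gr. (\<forall>j. r j \<in> gr_odd L0) \<and> (\<forall>w. w \<noteq> w0 \<longrightarrow> pp w = r 0)"
    using pp_polynomial n by simp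
  then obtain s :: "nat \<Rightarrow> gr" where s: "\<And>j. s j \<in> gr_odd L0" "\<And>w. w \<noteq> w0 \<Longrightarrow> pp w = s 0" by metis
  have pmx: "pm w * (c * gc w + d) ^ 2 = r 2 * gc w ^ 2 + r 1 * gc w + r 0" if "w \<noteq> w0" for w
    using r(2)[OF that] unfolding x_def by (simp add: eval_nat_numeral add_ac)
  show ?thesis
    unfolding rational_one_def
    by (rule bexI[of _ "s 0"], rule bexI[of _ "r 2"], rule bexI[of _ "r 1"], rule bexI[of _ "r 0"], rule bexI[of _ e])
      (use r(1) e s pmx in auto)
qed

text \<open>Near the pole \<open>x g\<^sup>+\<close> is not regular: the correction \<open>B = Pp Pm\<close> contributes another pole.  Regular are
  \<open>x\<^sup>2 g\<^sup>+\<close> and, as \<open>N = x\<^sup>2 \<psi>\<^sup>+ \<psi>\<^sup>- = - B q\<^sup>2\<close> cancels the correction, also \<open>g\<^sup>+ (q x + N)\<close>.  Both have a simple pole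
  at infinity, so both are linear polynomials.  Eliminating \<open>g\<^sup>+\<close> gives the cubic identity of
  \<open>cubic_constraint\<close>.\<close>

lemma gp_zero:
  assumes n: "n = 0" and odd: "p1 \<in> gr_odd L0" "p0 \<in> gr_odd L0" "m1 \<in> gr_odd L0" "m0 \<in> gr_odd L0"
    and lin: "\<And>w. w \<noteq> w0 \<Longrightarrow> pp w * x w = p1 * gc w + p0" "\<And>w. w \<noteq> w0 \<Longrightarrow> pm w * x w = m1 * gc w + m0"
  shows "\<exists>e1\<in>gr_even L0. \<exists>e0\<in>gr_even L0. (\<forall>w. w \<noteq> w0 \<longrightarrow> gp w * x w ^ 2 = e1 * gc w + e0) \<and>
    c * (c * e0 - d * e1) = e1 * (p1 * m1 * d * d - (p1 * m0 - m1 * p0) * c * d + p0 * m0 * c * c)"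
proof -
  define B where "B w = Pp w * Pm w" for w
  define N where "N w = (pp w * x w) * (pm w * x w)" for w
  have B: "B w \<in> gr_even L0" "B w * B w = 0" if "w \<in> V" for w
    using gr_odd_multiple_square[OF odd_V[OF that]] odd_V[OF that] by (auto simp: B_def)
  have N_even: "N w \<in> gr_even L0" if "w \<noteq> w0" for w
    unfolding N_def using pole_data.odd[OF pole_data_axioms that] even_xq by auto
  have local: "gp w * x w ^ 2 = gc \<i> * Gp w * q w * (x w + B w * q w)"
    "gp w * (q w * x w + N w) = gc \<i> * Gp w * (q w * q w)" if w: "w \<in> V" "w \<noteq> w0" for w
  proof -
    have ih: "inverse (h w) \<in> gr_even L0" using gr_inverse_even[OF h_body[OF w] even_V(1)[OF w(1)]] .
    have hp: "h w powi (- 1) = inverse (h w)" by (simp add: power_int_def)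
    have gp: "gp w = gc \<i> * Gp w * inverse (h w) * (1 + B w * inverse (h w))"
      using pole(4)[OF w] n by (simp add: hp B_def mult.assoc)
    have ihx: "inverse (h w) * x w = q w"
      using h_x[OF w] h_body[OF w] comm[OF even_xq(2), of _ w] by (metis gr_inverse_left mult.assoc mult_1)
    have pp: "pp w * x w = gc \<i> * Pp w * q w"
      using pole(2)[OF w] n ihx by (simp add: hp mult.assoc)
    have pm: "pm w * x w = gc \<i> * Pm w * q w"
      using pole(3)[OF w] n ihx by (simp add: hp mult.assoc)
    have "N w = gc \<i> * Pp w * (q w * (gc \<i> * Pm w)) * q w" unfolding N_def pp pm by (simp add: mult.assoc)
    also have "q w * (gc \<i> * Pm w) = gc \<i> * Pm w * q w" using comm[OF even_xq(2)] by metis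
    also have "gc \<i> * Pp w * (gc \<i> * Pm w * q w) * q w = gc (\<i> * \<i>) * (B w * (q w * q w))"
      by (simp only: B_def mult.assoc gc_left_commute[of "Pp w"] gc_mult)
    also have "gc (\<i> * \<i>) = - 1" by (simp add: gc_minus)
    finally have N: "N w = - (B w * (q w * q w))" by simp
    obtain G' i' B' q' x' where g: "Gp w = Rep_gre G'" "inverse (h w) = Rep_gre i'" "B w = Rep_gre B'"
      "q w = Rep_gre q'" "x w = Rep_gre x'"
      using gre_cases even_V(2)[OF w(1)] ih B(1)[OF w(1)] even_xq by metis
    obtain I where I: "gc \<i> = Rep_gre I" by (rule gre_of_complex)
    have ix: "i' * x' = q'" using ihx unfolding g Rep_gre_simps[symmetric] gre_eq_iff .
    have BB: "B' * B' = 0" using B(2)[OF w(1)] unfolding g Rep_gre_simps[symmetric] gre_eq_iff .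
    obtain h' where h': "h w = Rep_gre h'" using gre_cases even_V(1)[OF w(1)] by metis
    show "gp w * x w ^ 2 = gc \<i> * Gp w * q w * (x w + B w * q w)"
      unfolding gp power2_eq_square unfolding g I Rep_gre_simps[symmetric] gre_eq_iff ix[symmetric]
      by (simp add: algebra_simps)
    have "gp w * (q w * x w + N w) = Rep_gre (I * G' * (q' * q') - I * G' * (i' * i') * (B' * B') * (q' * q') )"
    proof -
      have "I * G' * i' * (1 + B' * i') * (q' * x' + - (B' * (q' * q')))
         = I * G' * q' * (i' * x') + I * G' * i' * B' * q' * (i' * x') - I * G' * i' * B' * q' * q'
           - I * G' * (i' * i') * (B' * B') * (q' * q')"
        by (simp add: algebra_simps)
      then have "I * G' * i' * (1 + B' * i') * (q' * x' + - (B' * (q' * q'))) = I * G' * (q' * q') - I * G' * (i' * i') * (B' * B') * (q' * q')"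
        unfolding ix by (simp add: algebra_simps)
      then show ?thesis unfolding gp N unfolding g I Rep_gre_simps[symmetric] gre_eq_iff .
    qed
    then show "gp w * (q w * x w + N w) = gc \<i> * Gp w * (q w * q w)"
      unfolding BB unfolding g I by (simp add: Rep_gre_simps)
  qed
  have infy: "gp (1 / y) = gc (y / \<kappa>) * gph y" if y: "y \<in> W" "y \<noteq> 0" for y
  proof -
    have "gph y = gc (\<kappa> * inverse y) * gp (1 / y)" using infinity(4)[OF y] n by simp
    then have "gc (y / \<kappa>) * gph y = gc (y / \<kappa> * (\<kappa> * inverse y)) * gp (1 / y)"
      by (simp only: gc_mult mult.assoc)
    also have "y / \<kappa> * (\<kappa> * inverse y) = 1" using kappa y by simp
    finally show ?thesis by simp
  qed
  note VV = pole_data.V[OF pole_data_axioms] and WW = pole_data.W[OF pole_data_axioms]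
  have H1: "gr_holo (- {w0}) (\<lambda>w. gp w * x w ^ 2)" by (intro gr_holo_mult gr_holo_power holo_xq holo)
  have H2: "gr_holo V (\<lambda>w. gc \<i> * Gp w * q w * (x w + B w * q w))"
    unfolding B_def by (intro gr_holo_mult gr_holo_add gr_holo_const holo_xq holo_V)
  have H4: "gr_holo W (\<lambda>y. gc (1 / \<kappa>) * gph y * xi y ^ 2)"
    by (intro gr_holo_mult gr_holo_power gr_holo_const holo_xq holo_W)
  have sc: "gc (y / \<kappa>) * G * (X * Y) * gc y ^ 1 = gc (1 / \<kappa>) * G * ((X * gc y) * (Y * gc y))"
    for y G X Y
  proof -
    have "gc (y / \<kappa>) * G * (X * Y) * gc y ^ 1 = gc y * (gc (y / \<kappa>) * G * (X * Y))"
      unfolding power_one_right by (rule gc_commute)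
    also have "\<dots> = gc (y * (y / \<kappa>)) * (G * (X * Y))" by (simp only: gc_mult mult.assoc)
    also have "y * (y / \<kappa>) = 1 / \<kappa> * (y * y)" by simp
    also have "gc (1 / \<kappa> * (y * y)) * (G * (X * Y)) = gc (1 / \<kappa>) * (gc y * (gc y * (G * (X * Y))))"
      by (simp only: gc_mult mult.assoc)
    also have "\<dots> = gc (1 / \<kappa>) * G * ((X * gc y) * (Y * gc y))"
      by (simp only: gc_commute[of X y] gc_commute[of Y y] gc_left_commute[of X] gc_left_commute[of G] mult.assoc)
    finally show ?thesis .
  qed
  have H5: "gp (1 / y) * x (1 / y) ^ 2 * gc y ^ 1 = gc (1 / \<kappa>) * gph y * xi y ^ 2" if y: "y \<in> W" "y \<noteq> 0" for y
    using sc[of y "gph y" "x (1 / y)" "x (1 / y)"] infy[OF y] x_infinity(1)[OF y(2)]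
    by (simp only: power2_eq_square)
  obtain r where r: "\<forall>w. w \<noteq> w0 \<longrightarrow> gp w * x w ^ 2 = (\<Sum>j\<le>1. r j * gc w ^ j)"
    "(\<forall>w. w \<noteq> w0 \<longrightarrow> gp w * x w ^ 2 \<in> gr_even L0) \<longrightarrow> (\<forall>j. r j \<in> gr_even L0)"
    by (rule gr_polynomial[OF H1 VV H2 local(1) WW H4 H5])
  have "\<forall>w. w \<noteq> w0 \<longrightarrow> gp w * x w ^ 2 \<in> gr_even L0"
    by (intro allI impI gr_even_times gr_even_power even(2) even_xq)
  then have re: "r j \<in> gr_even L0" for j using r(2) by blast
  have K1: "gr_holo (- {w0}) (\<lambda>w. gp w * (q w * x w + N w))"
    unfolding N_def by (intro gr_holo_mult gr_holo_add holo_xq holo)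
  have K2: "gr_holo V (\<lambda>w. gc \<i> * Gp w * (q w * q w))"
    by (intro gr_holo_mult gr_holo_const holo_xq holo_V)
  have K4: "gr_holo W (\<lambda>y. gc (1 / \<kappa>) * gph y * (qi y * xi y + (pph y * xi y) * (pmh y * xi y)))"
    by (intro gr_holo_mult gr_holo_add gr_holo_const holo_xq holo_W)
  have K5: "gp (1 / y) * (q (1 / y) * x (1 / y) + N (1 / y)) * gc y ^ 1
      = gc (1 / \<kappa>) * gph y * (qi y * xi y + (pph y * xi y) * (pmh y * xi y))" if y: "y \<in> W" "y \<noteq> 0" for y
  proof -
    have "gp (1 / y) * (q (1 / y) * x (1 / y) + N (1 / y)) * gc y ^ 1
      = gc (y / \<kappa>) * gph y * (q (1 / y) * x (1 / y)) * gc y ^ 1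
      + gc (y / \<kappa>) * gph y * ((pp (1 / y) * x (1 / y)) * (pm (1 / y) * x (1 / y))) * gc y ^ 1"
      unfolding infy[OF y] N_def by (simp only: distrib_left distrib_right)
    also have "\<dots> = gc (1 / \<kappa>) * gph y * ((q (1 / y) * gc y) * (x (1 / y) * gc y))
      + gc (1 / \<kappa>) * gph y * ((pp (1 / y) * x (1 / y) * gc y) * (pm (1 / y) * x (1 / y) * gc y))"
      unfolding sc ..
    finally show ?thesis
      using infinity(2,3)[OF y] x_infinity[OF y(2)] by (simp only: mult.assoc distrib_left)
  qed
  obtain j where j: "\<forall>w. w \<noteq> w0 \<longrightarrow> gp w * (q w * x w + N w) = (\<Sum>i\<le>1. j i * gc w ^ i)"
    "(\<forall>w. w \<noteq> w0 \<longrightarrow> gp w * (q w * x w + N w) \<in> gr_even L0) \<longrightarrow> (\<forall>i. j i \<in> gr_even L0)"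
    by (rule gr_polynomial[OF K1 VV K2 local(2) WW K4 K5])
  have je: "j i \<in> gr_even L0" for i
  proof -
    have "gp w * (q w * x w + N w) \<in> gr_even L0" if "w \<noteq> w0" for w
      by (intro gr_even_times gr_even_add even(2)[OF that] even_xq N_even[OF that])
    then show ?thesis using j(2) by blast
  qed
  have gpx: "gp w * x w ^ 2 = r 1 * gc w + r 0" and gpN: "gp w * (q w * x w + N w) = j 1 * gc w + j 0"
    if "w \<noteq> w0" for w
    using r(1) j(1) that by (simp_all add: add.commute)
  have "c * (c * r 0 - d * r 1) = r 1 * (p1 * m1 * d * d - (p1 * m0 - m1 * p0) * c * d + p0 * m0 * c * c)"
  proof (rule cubic_constraint[OF mem re re je je odd det c_unit, where ?w0.0 = w0])
    fix w assume w: "w \<noteq> w0"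
    have ac: "p0 * m1 = - (m1 * p0)" using gr_odd_anticommute[OF odd(3,2)] .
    have "N w = (p1 * gc w + p0) * (m1 * gc w + m0)" unfolding N_def lin[OF w] ..
    also have "\<dots> = p1 * m1 * gc w ^ 2 + (p1 * m0 - m1 * p0) * gc w + p0 * m0"
    proof -
      have wm: "gc w * m1 = m1 * gc w" "gc w * m0 = m0 * gc w" "gc w * (m1 * gc w) = m1 * (gc w * gc w)"
        by (rule gc_commute[symmetric], rule gc_commute[symmetric], rule gc_left_commute[symmetric])
      have ac': "p0 * (m1 * gc w) = - (m1 * (p0 * gc w))" using ac by (simp flip: mult.assoc)
      show ?thesis
        by (simp add: distrib_left distrib_right left_diff_distrib power2_eq_square mult.assoc wm ac')
    qed
    finally have N: "N w = p1 * m1 * gc w ^ 2 + (p1 * m0 - m1 * p0) * gc w + p0 * m0" .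
    have "(gp w * x w ^ 2) * (q w * x w + N w) = (gp w * (q w * x w + N w)) * x w ^ 2"
      using comm[OF gr_even_power[OF even_xq(1), of w 2], of "q w * x w + N w"] by (simp only: mult.assoc)
    then show "(r 1 * gc w + r 0) * ((a * gc w + b) * (c * gc w + d) + (p1 * m1 * gc w ^ 2 + (p1 * m0 - m1 * p0) * gc w + p0 * m0))
      = (j 1 * gc w + j 0) * (c * gc w + d) ^ 2"
      unfolding gpx[OF w] gpN[OF w] unfolding N x_def q_def .
  qed
  then show ?thesis using re gpx by blast
qed

lemma swapped: "pole_moebius L0 (- n) \<kappa> w0 V W f gm gp pm pp h Gm Gp Pm Pp fh gmh gph pmh pph a b c d"
proof unfold_locales
  show "sf_deriv f w = sf_deriv pm w * pp w - pm w * sf_deriv pp w + gm w * gp w" if w: "w \<noteq> w0" for w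
  proof -
    have "sf_deriv pp w \<in> gr_odd L0" "sf_deriv pm w \<in> gr_odd L0"
      unfolding sf_deriv_eq_taylor using w odd holo
      by (auto intro!: gr_taylor_mem(2)[of "- {w0}"])
    then have "sf_deriv pm w * pp w = - (pp w * sf_deriv pm w)" "pm w * sf_deriv pp w = - (sf_deriv pp w * pm w)"
      using odd[OF w] gr_odd_anticommute by blast+
    then show ?thesis using superconformal[OF w] comm[OF even(2)[OF w], of "gm w"] by simp
  qed
qed (simp_all only: minus_minus,
    (fact kappa V W holo holo_V holo_W even odd even_V odd_V pole zero infinity injective mem det c_unit x_unit x_zero f_eq)+)

lemma rational_zero:
  assumes n: "n = 0"
  shows "rational_zero L0 (- {w0}) c d gp gm pp pm"
proof -
  interpret S: pole_moebius L0 "- n" \<kappa> w0 V W f gm gp pm pp h Gm Gp Pm Pp fh gmh gph pmh pph a b c d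
    by (rule swapped)
  obtain r where r: "\<forall>j. r j \<in> gr_odd L0" "\<forall>w. w \<noteq> w0 \<longrightarrow> pp w * x w ^ 1 = (\<Sum>j\<le>1. r j * gc w ^ j)"
    using pp_polynomial n by auto
  obtain s where s: "\<forall>j. s j \<in> gr_odd L0" "\<forall>w. w \<noteq> w0 \<longrightarrow> pm w * x w ^ 1 = (\<Sum>j\<le>1. s j * gc w ^ j)"
    using pm_polynomial n by auto
  have pp: "pp w * x w = r 1 * gc w + r 0" and pm: "pm w * x w = s 1 * gc w + s 0" if "w \<noteq> w0" for w
    using r(2) s(2) that by (simp_all add: add.commute)
  have rs: "r j \<in> gr_odd L0" "s j \<in> gr_odd L0" for j using r s by auto
  have "\<exists>e1\<in>gr_even L0. \<exists>e0\<in>gr_even L0. (\<forall>w. w \<noteq> w0 \<longrightarrow> gp w * x w ^ 2 = e1 * gc w + e0) \<and>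
    c * (c * e0 - d * e1) = e1 * (r 1 * s 1 * d * d - (r 1 * s 0 - s 1 * r 0) * c * d + r 0 * s 0 * c * c)"
    by (rule gp_zero[OF n rs(1) rs(1) rs(2) rs(2)]) (use pp pm in auto)
  then obtain e1 e0 where e: "e1 \<in> gr_even L0" "e0 \<in> gr_even L0" "\<forall>w. w \<noteq> w0 \<longrightarrow> gp w * x w ^ 2 = e1 * gc w + e0"
    "c * (c * e0 - d * e1) = e1 * (r 1 * s 1 * d * d - (r 1 * s 0 - s 1 * r 0) * c * d + r 0 * s 0 * c * c)"
    by (elim bexE conjE) (rule that)
  have "\<exists>t1\<in>gr_even L0. \<exists>t0\<in>gr_even L0. (\<forall>w. w \<noteq> w0 \<longrightarrow> gm w * x w ^ 2 = t1 * gc w + t0) \<and>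
    c * (c * t0 - d * t1) = t1 * (s 1 * r 1 * d * d - (s 1 * r 0 - r 1 * s 0) * c * d + s 0 * r 0 * c * c)"
    by (rule S.gp_zero[OF _ rs(2) rs(2) rs(1) rs(1)]) (use pp pm n in auto)
  then obtain t1 t0 where t: "t1 \<in> gr_even L0" "t0 \<in> gr_even L0" "\<forall>w. w \<noteq> w0 \<longrightarrow> gm w * x w ^ 2 = t1 * gc w + t0"
    "c * (c * t0 - d * t1) = t1 * (s 1 * r 1 * d * d - (s 1 * r 0 - r 1 * s 0) * c * d + s 0 * r 0 * c * c)"
    by (elim bexE conjE) (rule that)
  have ac: "s 1 * r 1 = - (r 1 * s 1)" "s 1 * r 0 - r 1 * s 0 = - (r 1 * s 0 - s 1 * r 0)" "s 0 * r 0 = - (r 0 * s 0)"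
    by (rule gr_odd_anticommute[OF rs(1) rs(2)], simp, rule gr_odd_anticommute[OF rs(1) rs(2)])
  show ?thesis
    unfolding rational_zero_def
  proof (rule bexI[of _ "r 1"], rule bexI[of _ "r 0"], rule bexI[of _ "s 1"], rule bexI[of _ "s 0"],
      rule bexI[of _ e1], rule bexI[of _ e0], rule bexI[of _ t1], rule bexI[of _ t0], intro conjI ballI)
    show "rational_zero_sol c d (r 1 * s 1) (r 1 * s 0 - s 1 * r 0) (r 0 * s 0) e1 e0"
      unfolding rational_zero_sol_def using c_unit e(4) by blast
    show "rational_zero_sol c d (- (r 1 * s 1)) (- (r 1 * s 0 - s 1 * r 0)) (- (r 0 * s 0)) t1 t0"
      unfolding rational_zero_sol_def using c_unit t(4)[unfolded ac] by blast
    fix w assume "w \<in> - {w0}"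
    then have w: "w \<noteq> w0" by simp
    show "pp w * (c * gc w + d) = r 1 * gc w + r 0" using pp[OF w] unfolding x_def .
    show "pm w * (c * gc w + d) = s 1 * gc w + s 0" using pm[OF w] unfolding x_def .
    show "gp w * (c * gc w + d) ^ 2 = e1 * gc w + e0" using e(3) w unfolding x_def by blast
    show "gm w * (c * gc w + d) ^ 2 = t1 * gc w + t0" using t(3) w unfolding x_def by blast
  qed (rule rs e(1,2) t(1,2))+
qed

end

section \<open>Exchange of the two source coordinates\<close>

text \<open>So \<open>(c, d)\<close> is replaced by \<open>\<i> (d, c)\<close>; the factor \<open>\<i>\<close> keeps the determinant equal to 1.\<close>

lemma denominator_swap:
  assumes "y \<noteq> 0"
  shows "gc \<i> * d * gc y + gc \<i> * c = gc (\<i> * y) * (c * gc (1 / y) + d)"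
proof -
  have "gc (\<i> * y) * (c * gc (1 / y) + d) = gc (\<i> * y) * (gc (1 / y) * c) + gc (\<i> * y) * d"
    by (simp only: distrib_left gc_commute[of c])
  also have "gc (\<i> * y) * (gc (1 / y) * c) = gc (\<i> * y * (1 / y)) * c" by (simp only: gc_mult mult.assoc)
  also have "gc (\<i> * y) * d = gc \<i> * (d * gc y)" by (simp only: gc_mult mult.assoc gc_commute[of d])
  finally show ?thesis using assms by (simp add: mult.assoc add.commute)
qed

lemma gc_mult_power: "(gc t * a) ^ k = gc (t ^ k) * a ^ k"
proof (induction k)
  case (Suc k)
  have "gc t * a * (gc (t ^ k) * a ^ k) = gc (t * t ^ k) * (a * a ^ k)"
    by (simp only: mult.assoc gc_left_commute[of a] gc_mult)
  with Suc show ?case by simp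
qed simp

lemma gc_move: "gc s * a * (gc t * b) = gc (s * t) * (a * b)"
  by (simp only: mult.assoc gc_left_commute[of a] gc_mult)

lemma poly_reverse:
  assumes "y \<noteq> 0"
  shows "gc (t * y ^ K) * (\<Sum>j\<le>K. r j * gc (1 / y) ^ j) = (\<Sum>j\<le>K. (gc t * r (K - j)) * gc y ^ j)"
proof -
  have "gc (t * y ^ K) * (\<Sum>j\<le>K. r j * gc (1 / y) ^ j) = (\<Sum>j\<le>K. (gc t * r j) * gc y ^ (K - j))"
    unfolding sum_distrib_left
  proof (rule sum.cong)
    fix j assume j: "j \<in> {..K}"
    have "gc (t * y ^ K) * (r j * gc (1 / y) ^ j) = gc (t * y ^ K * (1 / y) ^ j) * r j"
      by (simp only: gc_power[symmetric] gc_commute[of "r j"] gc_mult mult.assoc)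
    also have "t * y ^ K * (1 / y) ^ j = t * y ^ (K - j)"
      using j assms by (simp add: power_diff power_one_over divide_inverse power_inverse)
    also have "gc (t * y ^ (K - j)) * r j = gc t * r j * gc y ^ (K - j)"
      by (simp only: gc_power[symmetric] gc_commute[of "gc t * r j"] gc_commute[of "r j"] gc_mult[of t]
          mult.commute[of t] gc_mult mult.assoc)
        (metis gc_mult mult.assoc mult.commute)
    finally show "gc (t * y ^ K) * (r j * gc (1 / y) ^ j) = gc t * r j * gc y ^ (K - j)" .
  qed simp
  also have "\<dots> = (\<Sum>j\<le>K. (gc t * r (K - j)) * gc y ^ j)"
    by (rule sum.reindex_bij_witness[of _ "\<lambda>j. K - j" "\<lambda>j. K - j"]) auto
  finally show ?thesis .
qed

lemma rational_many_swap:
  assumes raw: "rational_many L0 k (- {0}) c d gp gm pp pm"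
    and inf: "\<And>y. y \<noteq> 0 \<Longrightarrow> pp (1 / y) = pph y" "\<And>y. y \<noteq> 0 \<Longrightarrow> pm (1 / y) = pmh y"
      "\<And>y. y \<noteq> 0 \<Longrightarrow> gc (\<kappa> * y powi (int k - 1)) * gp (1 / y) = gph y"
      "\<And>y. y \<noteq> 0 \<Longrightarrow> gc (\<kappa> * y powi (- int k - 1)) * gm (1 / y) = gmh y" and k: "k \<ge> 1"
  shows "rational_many L0 k (- {0}) (gc \<i> * d) (gc \<i> * c) gph gmh pph pmh"
proof -
  obtain r where r: "\<forall>j. r j \<in> gr_odd L0" and ex: "\<exists>e\<in>gr_even L0. \<exists>e'\<in>gr_even L0.
      \<forall>w\<in>- {0}. pp w = 0 \<and> pm w * (c * gc w + d) ^ (k + 1) = (\<Sum>j\<le>k + 1. r j * gc w ^ j) \<and>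
        gp w = e * (c * gc w + d) ^ (k - 1) \<and> gm w * (c * gc w + d) ^ (k + 1) = e'"
    using raw unfolding rational_many_def by (elim exE conjE) (rule that)
  from ex obtain e e' where e: "e \<in> gr_even L0" "e' \<in> gr_even L0"
    and all: "\<forall>w\<in>- {0}. pp w = 0 \<and> pm w * (c * gc w + d) ^ (k + 1) = (\<Sum>j\<le>k + 1. r j * gc w ^ j) \<and>
        gp w = e * (c * gc w + d) ^ (k - 1) \<and> gm w * (c * gc w + d) ^ (k + 1) = e'"
    by (elim bexE) (rule that)
  show ?thesis unfolding rational_many_def
  proof (rule exI[of _ "\<lambda>j. gc (\<i> ^ (k + 1)) * r (k + 1 - j)"], rule conjI, use r in blast,
      rule bexI[of _ "gc (\<kappa> * (1 / \<i>) ^ (k - 1)) * e"], rule bexI[of _ "gc (\<kappa> * \<i> ^ (k + 1)) * e'"], intro ballI conjI)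
    fix y :: complex assume "y \<in> - {0}"
    then have y: "y \<noteq> 0" by simp
    then have w: "1 / y \<in> - {0}" by simp
    let ?X = "c * gc (1 / y) + d"
    note X = denominator_swap[OF y, of d c] and A = bspec[OF all w]
    show "pph y = 0" using inf(1)[OF y] A by simp
    have "pmh y * (gc \<i> * d * gc y + gc \<i> * c) ^ (k + 1) = pm (1 / y) * (gc ((\<i> * y) ^ (k + 1)) * ?X ^ (k + 1))"
      unfolding X gc_mult_power inf(2)[OF y] ..
    also have "\<dots> = gc ((\<i> * y) ^ (k + 1)) * (pm (1 / y) * ?X ^ (k + 1))" by (rule gc_left_commute)
    also have "pm (1 / y) * ?X ^ (k + 1) = (\<Sum>j\<le>k + 1. r j * gc (1 / y) ^ j)" using A by blast
    also have "(\<i> * y) ^ (k + 1) = \<i> ^ (k + 1) * y ^ (k + 1)" by (rule power_mult_distrib)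
    finally show "pmh y * (gc \<i> * d * gc y + gc \<i> * c) ^ (k + 1) = (\<Sum>j\<le>k + 1. gc (\<i> ^ (k + 1)) * r (k + 1 - j) * gc y ^ j)"
      unfolding poly_reverse[OF y] .
    have p: "y powi (int k - 1) = y ^ (k - 1)" using k by (simp add: power_int_def nat_diff_distrib)
    have "gc (\<kappa> * (1 / \<i>) ^ (k - 1)) * e * (gc \<i> * d * gc y + gc \<i> * c) ^ (k - 1)
      = gc (\<kappa> * (1 / \<i>) ^ (k - 1) * (\<i> * y) ^ (k - 1)) * (e * ?X ^ (k - 1))"
      unfolding X gc_mult_power gc_move ..
    also have "\<kappa> * (1 / \<i>) ^ (k - 1) * (\<i> * y) ^ (k - 1) = \<kappa> * y powi (int k - 1)"
    proof -
      have "(1 / \<i>) ^ (k - 1) * (\<i> * y) ^ (k - 1) = (1 / \<i> * (\<i> * y)) ^ (k - 1)"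
        by (rule power_mult_distrib[symmetric])
      also have "1 / \<i> * (\<i> * y) = y" by simp
      finally show ?thesis unfolding p by (simp only: mult.assoc)
    qed
    also have "e * ?X ^ (k - 1) = gp (1 / y)" using A by simp
    finally show "gph y = gc (\<kappa> * (1 / \<i>) ^ (k - 1)) * e * (gc \<i> * d * gc y + gc \<i> * c) ^ (k - 1)"
      using inf(3)[OF y] by simp
    have "y powi (- int k - 1) * y powi int (k + 1) = 1" using y by (simp flip: power_int_add)
    then have p': "y powi (- int k - 1) * y ^ (k + 1) = 1" by (simp only: power_int_of_nat)
    have "gmh y * (gc \<i> * d * gc y + gc \<i> * c) ^ (k + 1)
      = gc (\<kappa> * y powi (- int k - 1) * (\<i> * y) ^ (k + 1)) * (gm (1 / y) * ?X ^ (k + 1))"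
      unfolding X gc_mult_power inf(4)[OF y, symmetric] gc_move ..
    also have "\<kappa> * y powi (- int k - 1) * (\<i> * y) ^ (k + 1) = \<kappa> * \<i> ^ (k + 1) * (y powi (- int k - 1) * y ^ (k + 1))"
      unfolding power_mult_distrib by (simp only: ac_simps)
    also have "gm (1 / y) * ?X ^ (k + 1) = e'" using A by blast
    finally show "gmh y * (gc \<i> * d * gc y + gc \<i> * c) ^ (k + 1) = gc (\<kappa> * \<i> ^ (k + 1)) * e'"
      unfolding p' by simp
  qed (use e in auto)
qed

lemma rational_one_swap:
  assumes raw: "rational_one L0 (- {0}) c d gp pp pm"
    and inf: "\<And>y. y \<noteq> 0 \<Longrightarrow> pp (1 / y) = pph y" "\<And>y. y \<noteq> 0 \<Longrightarrow> pm (1 / y) = pmh y"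
      "\<And>y. y \<noteq> 0 \<Longrightarrow> gc (\<kappa> * y powi (1 - 1)) * gp (1 / y) = gph y"
  shows "rational_one L0 (- {0}) (gc \<i> * d) (gc \<i> * c) gph pph pmh"
proof -
  obtain p0 m2 m1 m0 e where o: "p0 \<in> gr_odd L0" "m2 \<in> gr_odd L0" "m1 \<in> gr_odd L0" "m0 \<in> gr_odd L0" "e \<in> gr_even L0"
    and all: "\<forall>w\<in>- {0}. pp w = p0 \<and> pm w * (c * gc w + d) ^ 2 = m2 * gc w ^ 2 + m1 * gc w + m0 \<and> gp w = e"
    using raw unfolding rational_one_def by (elim bexE) (rule that)
  have od: "gc t * v \<in> gr_odd L0" if "v \<in> gr_odd L0" for t v using that by auto
  show ?thesis unfolding rational_one_def
  proof (rule bexI[OF _ o(1)], rule bexI[OF _ od[OF o(4), of "- 1"]], rule bexI[OF _ od[OF o(3), of "- 1"]],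
      rule bexI[OF _ od[OF o(2), of "- 1"]], rule bexI[OF _ gr_even_times[OF gr_even_gc o(5), of \<kappa>]], intro ballI conjI)
    fix y :: complex assume "y \<in> - {0}"
    then have y: "y \<noteq> 0" by simp
    then have w: "1 / y \<in> - {0}" by simp
    let ?X = "c * gc (1 / y) + d"
    note X = denominator_swap[OF y, of d c] and A = bspec[OF all w]
    show "pph y = p0" using inf(1)[OF y] A by simp
    show "gph y = gc \<kappa> * e" using inf(3)[OF y] A by simp
    have "pmh y * (gc \<i> * d * gc y + gc \<i> * c) ^ 2 = pm (1 / y) * (gc ((\<i> * y) ^ 2) * ?X ^ 2)"
      unfolding X gc_mult_power inf(2)[OF y] ..
    also have "\<dots> = gc ((\<i> * y) ^ 2) * (pm (1 / y) * ?X ^ 2)" by (rule gc_left_commute)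
    also have "pm (1 / y) * ?X ^ 2 = (\<Sum>j\<le>2. (\<lambda>j. if j = 0 then m0 else if j = 1 then m1 else m2) j * gc (1 / y) ^ j)"
      using A by (simp add: eval_nat_numeral add_ac)
    also have "(\<i> * y) ^ 2 = (- 1) * y ^ 2" by (simp add: power_mult_distrib)
    finally show "pmh y * (gc \<i> * d * gc y + gc \<i> * c) ^ 2
      = gc (- 1) * m0 * gc y ^ 2 + gc (- 1) * m1 * gc y + gc (- 1) * m2"
      unfolding poly_reverse[OF y] by (simp add: eval_nat_numeral add_ac)
  qed
qed

lemma rational_zero_sol_swap:
  assumes mem: "c \<in> gr_even L0" "d \<in> gr_even L0" "N2 \<in> gr_even L0" "N1 \<in> gr_even L0" "N0 \<in> gr_even L0"
      "e1 \<in> gr_even L0" "e0 \<in> gr_even L0"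
    and sol: "rational_zero_sol c d N2 N1 N0 e1 e0"
  shows "rational_zero_sol (gc \<i> * d) (gc \<i> * c) (- N0) (- N1) (- N2) (gc t * e0) (gc t * e1)"
proof -
  obtain c' d' e1' e0' where r: "c = Rep_gre c'" "d = Rep_gre d'" "e1 = Rep_gre e1'" "e0 = Rep_gre e0'"
    using mem gre_cases by metis
  obtain N2' N1' N0' where s: "N2 = Rep_gre N2'" "N1 = Rep_gre N1'" "N0 = Rep_gre N0'"
    using mem gre_cases by metis
  obtain I where I: "gc \<i> = Rep_gre I" by (rule gre_of_complex)
  obtain T where T: "gc t = Rep_gre T" by (rule gre_of_complex)
  have "gc \<i> * gc \<i> = - 1" by (simp flip: gc_mult add: gc_minus)
  then have II: "I * I = - 1" unfolding I unfolding Rep_gre_simps[symmetric] gre_eq_iff .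
  have "I * x * (I * y) = - (x * y)" for x y
  proof -
    have "I * x * (I * y) = (I * I) * (x * y)" by (simp only: ac_simps)
    then show ?thesis using II by simp
  qed
  have id1: "I * d' * (I * d' * (T * e1') - I * c' * (T * e0')) = - (T * (d' * (d' * e1' - c' * e0')))"
  proof -
    have "I * d' * (I * d' * (T * e1') - I * c' * (T * e0')) = (I * I) * (T * (d' * (d' * e1' - c' * e0')))"
      by (simp add: algebra_simps)
    then show ?thesis using II by simp
  qed
  have id2: "I * c' * (I * c' * (T * e0') - I * d' * (T * e1')) = - (T * (c' * (c' * e0' - d' * e1')))"
  proof -
    have "I * c' * (I * c' * (T * e0') - I * d' * (T * e1')) = (I * I) * (T * (c' * (c' * e0' - d' * e1')))"
      by (simp add: algebra_simps)
    then show ?thesis using II by simp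
  qed
  have id3: "- N0' * (I * c') * (I * c') - - N1' * (I * d') * (I * c') + - N2' * (I * d') * (I * d')
    = N2' * d' * d' - N1' * c' * d' + N0' * c' * c'"
  proof -
    have "- N0' * (I * c') * (I * c') - - N1' * (I * d') * (I * c') + - N2' * (I * d') * (I * d')
      = (I * I) * (- (N2' * d' * d' - N1' * c' * d' + N0' * c' * c'))" by (simp add: algebra_simps)
    then show ?thesis using II by simp
  qed
  have b: "gr_body (gc \<i> * c) \<noteq> 0 \<longleftrightarrow> gr_body c \<noteq> 0" "gr_body (gc \<i> * d) \<noteq> 0 \<longleftrightarrow> gr_body d \<noteq> 0" by auto
  have sol': "gr_body c \<noteq> 0 \<and> c' * (c' * e0' - d' * e1') = e1' * (N2' * d' * d' - N1' * c' * d' + N0' * c' * c') \<or>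
     gr_body d \<noteq> 0 \<and> d' * (d' * e1' - c' * e0') = - (e0' * (N2' * d' * d' - N1' * c' * d' + N0' * c' * c'))"
    using sol unfolding rational_zero_sol_def unfolding r s Rep_gre_simps[symmetric] gre_eq_iff .
  have "gr_body d \<noteq> 0 \<and> - (T * (d' * (d' * e1' - c' * e0'))) = T * e0' * (N2' * d' * d' - N1' * c' * d' + N0' * c' * c') \<or>
    gr_body c \<noteq> 0 \<and> - (T * (c' * (c' * e0' - d' * e1'))) = - (T * e1' * (N2' * d' * d' - N1' * c' * d' + N0' * c' * c'))"
    using sol'
  proof (elim disjE conjE)
    assume "gr_body c \<noteq> 0" and 1: "c' * (c' * e0' - d' * e1') = e1' * (N2' * d' * d' - N1' * c' * d' + N0' * c' * c')"
    then show ?thesis unfolding 1 by (simp only: mult.assoc) simp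
  next
    assume "gr_body d \<noteq> 0" and 1: "d' * (d' * e1' - c' * e0') = - (e0' * (N2' * d' * d' - N1' * c' * d' + N0' * c' * c'))"
    then show ?thesis unfolding 1 by (simp only: mult.assoc mult_minus_right minus_minus) simp
  qed
  then show ?thesis
    unfolding rational_zero_sol_def b
    unfolding r s I T Rep_gre_simps[symmetric] gre_eq_iff id1 id2 id3 .
qed

lemma rational_zero_swap:
  assumes raw: "rational_zero L0 (- {0}) c d gp gm pp pm" and mem: "c \<in> gr_even L0" "d \<in> gr_even L0"
    and inf: "\<And>y. y \<noteq> 0 \<Longrightarrow> pp (1 / y) = pph y" "\<And>y. y \<noteq> 0 \<Longrightarrow> pm (1 / y) = pmh y"
      "\<And>y. y \<noteq> 0 \<Longrightarrow> gc (\<kappa> * y powi (- 1)) * gp (1 / y) = gph y"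
      "\<And>y. y \<noteq> 0 \<Longrightarrow> gc (\<kappa> * y powi (- 1)) * gm (1 / y) = gmh y"
  shows "rational_zero L0 (- {0}) (gc \<i> * d) (gc \<i> * c) gph gmh pph pmh"
proof -
  obtain p1 p0 m1 m0 e1 e0 t1 t0 where o: "p1 \<in> gr_odd L0" "p0 \<in> gr_odd L0" "m1 \<in> gr_odd L0" "m0 \<in> gr_odd L0"
    and e: "e1 \<in> gr_even L0" "e0 \<in> gr_even L0" "t1 \<in> gr_even L0" "t0 \<in> gr_even L0"
    and all: "rational_zero_sol c d (p1 * m1) (p1 * m0 - m1 * p0) (p0 * m0) e1 e0 \<and>
      rational_zero_sol c d (- (p1 * m1)) (- (p1 * m0 - m1 * p0)) (- (p0 * m0)) t1 t0 \<and>
      (\<forall>w\<in>- {0}. pp w * (c * gc w + d) = p1 * gc w + p0 \<and> pm w * (c * gc w + d) = m1 * gc w + m0 \<and>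
        gp w * (c * gc w + d) ^ 2 = e1 * gc w + e0 \<and> gm w * (c * gc w + d) ^ 2 = t1 * gc w + t0)"
    using raw unfolding rational_zero_def by (elim bexE) (rule that)
  have all3: "\<forall>w\<in>- {0}. pp w * (c * gc w + d) = p1 * gc w + p0 \<and> pm w * (c * gc w + d) = m1 * gc w + m0 \<and>
        gp w * (c * gc w + d) ^ 2 = e1 * gc w + e0 \<and> gm w * (c * gc w + d) ^ 2 = t1 * gc w + t0"
    using all by (elim conjE)
  have od: "gc t * v \<in> gr_odd L0" if "v \<in> gr_odd L0" for t v using that by auto
  have ev: "gc t * v \<in> gr_even L0" if "v \<in> gr_even L0" for t v using that by auto
  have ii: "gc \<i> * v * (gc \<i> * v') = - (v * v')" for v v'
    unfolding gc_move by (simp add: gc_minus)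
  have ac: "m0 * p1 = - (p1 * m0)" "p0 * m1 = - (m1 * p0)"
    using gr_odd_anticommute[OF o(1,4)] gr_odd_anticommute[OF o(3,2)] by auto
  have N: "gc \<i> * p0 * (gc \<i> * m0) = - (p0 * m0)"
    "gc \<i> * p0 * (gc \<i> * m1) - gc \<i> * m0 * (gc \<i> * p1) = - (p1 * m0 - m1 * p0)"
    "gc \<i> * p1 * (gc \<i> * m1) = - (p1 * m1)"
    unfolding ii ac by simp_all
  have Nev: "p1 * m1 \<in> gr_even L0" "p1 * m0 - m1 * p0 \<in> gr_even L0" "p0 * m0 \<in> gr_even L0"
    using o by auto
  have lin: "gc (t * y) * (u1 * gc (1 / y) + u0) = gc t * u0 * gc y + gc t * u1" if "y \<noteq> 0" for t y u1 u0
  proof -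
    have "gc (t * y) * (u1 * gc (1 / y) + u0) = gc (t * y ^ 1) * (\<Sum>j\<le>1. (\<lambda>j. if j = 0 then u0 else u1) j * gc (1 / y) ^ j)"
      by (simp add: add.commute)
    also have "\<dots> = gc t * u0 * gc y + gc t * u1" unfolding poly_reverse[OF that] by (simp add: add.commute)
    finally show ?thesis .
  qed
  show ?thesis unfolding rational_zero_def
  proof (rule bexI[OF _ od[OF o(2), of \<i>]], rule bexI[OF _ od[OF o(1), of \<i>]], rule bexI[OF _ od[OF o(4), of \<i>]],
      rule bexI[OF _ od[OF o(3), of \<i>]], rule bexI[OF _ ev[OF e(2), of "- \<kappa>"]], rule bexI[OF _ ev[OF e(1), of "- \<kappa>"]],
      rule bexI[OF _ ev[OF e(4), of "- \<kappa>"]], rule bexI[OF _ ev[OF e(3), of "- \<kappa>"]], intro conjI ballI)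
    show "rational_zero_sol (gc \<i> * d) (gc \<i> * c) (gc \<i> * p0 * (gc \<i> * m0)) (gc \<i> * p0 * (gc \<i> * m1) - gc \<i> * m0 * (gc \<i> * p1))
       (gc \<i> * p1 * (gc \<i> * m1)) (gc (- \<kappa>) * e0) (gc (- \<kappa>) * e1)"
      unfolding N by (rule rational_zero_sol_swap[OF mem Nev e(1,2) conjunct1[OF all]])
    show "rational_zero_sol (gc \<i> * d) (gc \<i> * c) (- (gc \<i> * p0 * (gc \<i> * m0))) (- (gc \<i> * p0 * (gc \<i> * m1) - gc \<i> * m0 * (gc \<i> * p1)))
       (- (gc \<i> * p1 * (gc \<i> * m1))) (gc (- \<kappa>) * t0) (gc (- \<kappa>) * t1)"
      unfolding N
      by (rule rational_zero_sol_swap[OF mem gr_even_uminus[OF Nev(1)] gr_even_uminus[OF Nev(2)] gr_even_uminus[OF Nev(3)]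
          e(3,4) conjunct1[OF conjunct2[OF all]]])
    fix y :: complex assume "y \<in> - {0}"
    then have y: "y \<noteq> 0" by simp
    then have w: "1 / y \<in> - {0}" by simp
    let ?X = "c * gc (1 / y) + d"
    note X = denominator_swap[OF y, of d c]
    have A: "pp (1 / y) * ?X = p1 * gc (1 / y) + p0 \<and> pm (1 / y) * ?X = m1 * gc (1 / y) + m0 \<and>
        gp (1 / y) * ?X ^ 2 = e1 * gc (1 / y) + e0 \<and> gm (1 / y) * ?X ^ 2 = t1 * gc (1 / y) + t0"
      using all3 w by (rule bspec)
    have A1: "pp (1 / y) * ?X = p1 * gc (1 / y) + p0" using A by (elim conjE)
    have A2: "pm (1 / y) * ?X = m1 * gc (1 / y) + m0" using A by (elim conjE)
    have A3: "gp (1 / y) * ?X ^ 2 = e1 * gc (1 / y) + e0" using A by (elim conjE)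
    have A4: "gm (1 / y) * ?X ^ 2 = t1 * gc (1 / y) + t0" using A by (elim conjE)
    have l1: "pp (1 / y) * (gc (\<i> * y) * ?X) = gc (\<i> * y) * (pp (1 / y) * ?X)"
      "pm (1 / y) * (gc (\<i> * y) * ?X) = gc (\<i> * y) * (pm (1 / y) * ?X)"
      by (rule gc_left_commute)+
    show "pph y * (gc \<i> * d * gc y + gc \<i> * c) = gc \<i> * p0 * gc y + gc \<i> * p1"
      unfolding X inf(1)[OF y, symmetric] l1 A1 by (rule lin[OF y])
    show "pmh y * (gc \<i> * d * gc y + gc \<i> * c) = gc \<i> * m0 * gc y + gc \<i> * m1"
      unfolding X inf(2)[OF y, symmetric] l1 A2 by (rule lin[OF y])
    have s: "\<kappa> * y powi (- 1) * (\<i> * y) ^ 2 = - \<kappa> * y"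
    proof -
      have "\<kappa> * y powi (- 1) * (\<i> * y) ^ 2 = \<kappa> * (\<i> * \<i>) * (inverse y * y) * y"
        by (simp only: power_int_minus power_int_1_right power2_eq_square ac_simps)
      then show ?thesis using y by simp
    qed
    show "gph y * (gc \<i> * d * gc y + gc \<i> * c) ^ 2 = gc (- \<kappa>) * e0 * gc y + gc (- \<kappa>) * e1"
      unfolding X inf(3)[OF y, symmetric] gc_mult_power gc_move A3 s by (rule lin[OF y])
    show "gmh y * (gc \<i> * d * gc y + gc \<i> * c) ^ 2 = gc (- \<kappa>) * t0 * gc y + gc (- \<kappa>) * t1"
      unfolding X inf(4)[OF y, symmetric] gc_mult_power gc_move A4 s by (rule lin[OF y])
  qed
qed

section \<open>Consequences of the superconformal condition\<close>

lemma holo_linear: "gr_holo U (\<lambda>w. u1 * gc w + u0)"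
  by (intro gr_holo_add gr_holo_mult gr_holo_const gr_holo_gc_id)

lemma sf_deriv_linear: "sf_deriv (\<lambda>w. u1 * gc w + u0) w = u1"
  using sf_deriv_add[OF gr_holo_mult[OF gr_holo_const gr_holo_gc_id] gr_holo_const, of UNIV w u1 u0]
    sf_deriv_mult[OF gr_holo_const gr_holo_gc_id, of UNIV w u1]
  by (simp add: sf_deriv_const sf_deriv_gc)

lemma sf_val_linear: "z \<in> gr_even L \<Longrightarrow> sf_val (\<lambda>w. u1 * gc w + u0) z = u1 * z + u0"
  using sf_val_add[OF gr_holo_mult[OF gr_holo_const gr_holo_gc_id] gr_holo_const, of UNIV z u1 u0]
    sf_val_mult[OF gr_holo_const gr_holo_gc_id, of UNIV z L u1]
  by (simp add: sf_val_const sf_val_id)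

lemma sf_val_polynomial:
  assumes "z \<in> gr_even L"
  shows "sf_val (\<lambda>w. \<Sum>j\<le>N. r j * gc w ^ j) z = (\<Sum>j\<le>N. r j * z ^ j)"
proof -
  have "sf_val (\<lambda>w. \<Sum>j\<le>N. r j * gc w ^ j) z = (\<Sum>j\<le>N. sf_val (\<lambda>w. r j * gc w ^ j) z)"
    by (rule sf_val_sum[of _ UNIV]) (auto intro!: gr_holo_mult gr_holo_const gr_holo_power gr_holo_gc_id)
  also have "\<dots> = (\<Sum>j\<le>N. r j * z ^ j)"
  proof (rule sum.cong)
    fix j
    show "sf_val (\<lambda>w. r j * gc w ^ j) z = r j * z ^ j"
    using sf_val_mult[OF gr_holo_const gr_holo_power[OF gr_holo_gc_id], of UNIV z L "r j" j]
      sf_val_power[OF gr_holo_gc_id, of UNIV z L j] assms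
      by (simp add: sf_val_const sf_val_id)
  qed simp
  finally show ?thesis .
qed

text \<open>The situation of the classification: \<open>U\<close> is the domain in the coordinate of \<open>Delta\<close>, that is,
  \<open>\<complex>\<close> or \<open>\<complex> - {w0}\<close>, according to whether \<open>T\<close> fixes infinity or not.\<close>

locale rational_data =
  fixes L0 :: enat and w0 :: complex and U :: "complex set" and f gp gm pp pm :: sfun and a b c d :: gr
  assumes U: "open U" "- {w0} \<subseteq> U"
    and holo: "gr_holo U f" "gr_holo U gp" "gr_holo U gm" "gr_holo U pp" "gr_holo U pm"
    and even: "\<And>w. w \<in> U \<Longrightarrow> f w \<in> gr_even L0" "\<And>w. w \<in> U \<Longrightarrow> gp w \<in> gr_even L0" "\<And>w. w \<in> U \<Longrightarrow> gm w \<in> gr_even L0"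
    and odd: "\<And>w. w \<in> U \<Longrightarrow> pp w \<in> gr_odd L0" "\<And>w. w \<in> U \<Longrightarrow> pm w \<in> gr_odd L0"
    and superconformal: "\<And>w. w \<in> U \<Longrightarrow> sf_deriv f w = sf_deriv pp w * pm w - pp w * sf_deriv pm w + gp w * gm w"
    and mem: "a \<in> gr_even L0" "b \<in> gr_even L0" "c \<in> gr_even L0" "d \<in> gr_even L0"
    and det: "a * d - b * c = 1"
    and x_unit: "\<And>w. w \<in> U \<Longrightarrow> gr_body (c * gc w + d) \<noteq> 0"
    and f_eq: "\<And>w. w \<in> U \<Longrightarrow> f w * (c * gc w + d) = a * gc w + b"
begin

definition x :: "complex \<Rightarrow> gr" where "x w = c * gc w + d"

lemma x_even: "x w \<in> gr_even L0"
  using mem by (auto simp: x_def)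

lemma x_holo: "gr_holo V x"
  unfolding x_def[abs_def] by (rule holo_linear)

lemma x_deriv: "sf_deriv x w = c"
  unfolding x_def[abs_def] by (rule sf_deriv_linear)

lemma comm: "e \<in> gr_even L0 \<Longrightarrow> r * e = e * r"
  by (rule gr_even_commute)

lemma deriv_times_x:
  assumes "gr_holo U \<phi>" "\<And>w. w \<in> U \<Longrightarrow> \<phi> w * x w = \<psi> w" "w \<in> U"
  shows "sf_deriv \<phi> w * x w + \<phi> w * c = sf_deriv \<psi> w"
  using sf_deriv_mult[OF assms(1) x_holo U(1) assms(3)]
    sf_deriv_cong[OF gr_holo_mult[OF assms(1) x_holo] U(1) assms(3), of \<psi>] assms(2)
  by (simp add: x_deriv)

text \<open>The derivative of a Moebius transformation of determinant 1 is \<open>1 / x\<^sup>2\<close>.\<close>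

lemma f_deriv: assumes w: "w \<in> U" shows "sf_deriv f w * (x w * x w) = 1"
proof -
  have 1: "sf_deriv f w * x w + f w * c = a"
    using deriv_times_x[OF holo(1) _ w, of "\<lambda>w. a * gc w + b"] f_eq by (simp add: sf_deriv_linear x_def)
  have fx: "f w * x w = a * gc w + b" using f_eq[OF w] by (simp add: x_def)
  have "sf_deriv f w * x w = a - f w * c" using 1 by (simp add: eq_diff_eq)
  then have "sf_deriv f w * (x w * x w) = (a - f w * c) * x w" by (simp flip: mult.assoc)
  also have "\<dots> = a * x w - f w * (c * x w)" by (simp add: left_diff_distrib mult.assoc)
  also have "c * x w = x w * c" by (rule comm[OF x_even])
  also have "f w * (x w * c) = (a * gc w + b) * c" using fx by (simp flip: mult.assoc)
  also have "a * x w - (a * gc w + b) * c = a * d - b * c + a * (c * gc w - gc w * c)"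
    by (simp add: x_def algebra_simps)
  also have "c * gc w = gc w * c" by (rule gc_commute)
  finally show ?thesis using det by simp
qed

lemma U_nonempty: obtains w where "w \<in> U" "w \<noteq> w0"
proof -
  have "w0 + 1 \<in> U" using U(2) by auto
  then show thesis using that[of "w0 + 1"] by simp
qed

text \<open>Here the equation for \<open>f'\<close> reads \<open>1 / x\<^sup>2 = g\<^sup>+ g\<^sup>-\<close>.\<close>

lemma many_units:
  assumes k: "k \<ge> 1" and e: "e \<in> gr_even L0" "e' \<in> gr_even L0"
    and eq: "\<And>w. w \<in> U \<Longrightarrow> pp w = 0" "\<And>w. w \<in> U \<Longrightarrow> gp w = e * x w ^ (k - 1)"
      "\<And>w. w \<in> U \<Longrightarrow> gm w * x w ^ (k + 1) = e'"
  shows "gr_body e \<noteq> 0" "e' = inverse e"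
proof -
  obtain w where w: "w \<in> U" by (rule U_nonempty)
  have "sf_deriv pp w = 0"
    using sf_deriv_cong[OF holo(4) U(1) w, of "\<lambda>_. 0"] eq(1) by (simp add: sf_deriv_const)
  then have "gp w * gm w * (x w * x w) = 1"
    using superconformal[OF w] f_deriv[OF w] eq(1)[OF w] by simp
  also have "gp w * gm w * (x w * x w) = e * (x w ^ (k - 1) * gm w) * (x w * x w)"
    by (simp add: eq(2)[OF w] mult.assoc)
  also have "x w ^ (k - 1) * gm w = gm w * x w ^ (k - 1)"
    by (rule comm[OF gr_even_power[OF x_even], symmetric])
  also have "e * (gm w * x w ^ (k - 1)) * (x w * x w) = e * (gm w * (x w ^ (k - 1) * (x w * x w)))"
    by (simp only: mult.assoc)
  also have "x w ^ (k - 1) * (x w * x w) = x w ^ (k + 1)"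
  proof -
    have "x w ^ (k - 1) * (x w * x w) = x w ^ (k - 1 + 2)" unfolding power_add power2_eq_square ..
    also have "k - 1 + 2 = k + 1" using k by simp
    finally show ?thesis .
  qed
  finally have ee: "e * e' = 1" unfolding eq(3)[OF w] .
  then show b: "gr_body e \<noteq> 0" by (metis gr_body_simps(2,7) mult_zero_left zero_neq_one)
  show "e' = inverse e" using gr_inverse_eqI[OF ee] ee comm[OF e(1), of e'] by simp
qed

text \<open>Here the equation for \<open>f'\<close> reads \<open>1 / x\<^sup>2 = - p0 (\<psi>\<^sup>-)' + e g\<^sup>-\<close>.  At a point where \<open>x\<close> is invertible it
  forces \<open>e\<close> to have a body.\<close>

lemma one_gm:
  assumes o: "p0 \<in> gr_odd L0" "m2 \<in> gr_odd L0" "m1 \<in> gr_odd L0" "m0 \<in> gr_odd L0" and e: "e \<in> gr_even L0"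
    and eq: "\<And>w. w \<in> U \<Longrightarrow> pp w = p0" "\<And>w. w \<in> U \<Longrightarrow> pm w * x w ^ 2 = m2 * gc w ^ 2 + m1 * gc w + m0"
      "\<And>w. w \<in> U \<Longrightarrow> gp w = e"
  shows "gr_body e \<noteq> 0"
    and "w \<in> U \<Longrightarrow> gm w * (e * x w ^ 3) = x w + p0 * (2 * m2 * d * gc w - m1 * (c * gc w - d) - 2 * m0 * c)"
proof -
  have main: "gm w * (e * x w ^ 3) = x w + p0 * (2 * m2 * d * gc w - m1 * (c * gc w - d) - 2 * m0 * c)"
    if w: "w \<in> U" for w
  proof -
    let ?w = "gc w"
    have "sf_deriv pp w = 0"
      using sf_deriv_cong[OF holo(4) U(1) w, of "\<lambda>_. p0"] eq(1) by (simp add: sf_deriv_const)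
    then have sc: "e * gm w = sf_deriv f w + p0 * sf_deriv pm w"
      using superconformal[OF w] eq(1,3)[OF w] by (simp add: algebra_simps)
    have h2: "gr_holo U (\<lambda>w. pm w * (x w * x w))" by (intro gr_holo_mult holo x_holo)
    have "sf_deriv (\<lambda>w. pm w * (x w * x w)) w = sf_deriv pm w * (x w * x w) + pm w * (c * x w + x w * c)"
      using sf_deriv_mult[OF holo(5) gr_holo_mult[OF x_holo x_holo] U(1) w] sf_deriv_mult[OF x_holo x_holo U(1) w]
      by (simp add: x_deriv)
    moreover have "sf_deriv (\<lambda>w. pm w * (x w * x w)) w = sf_deriv (\<lambda>w. m2 * (gc w * gc w) + (m1 * gc w + m0)) w"
      by (rule sf_deriv_cong[OF h2 U(1) w]) (use eq(2) in \<open>simp add: power2_eq_square add.assoc\<close>)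
    moreover have "sf_deriv (\<lambda>w. m2 * (gc w * gc w) + (m1 * gc w + m0)) w = m2 * (?w + ?w) + m1"
    proof -
      note g = gr_holo_gc_id[of UNIV]
      have "sf_deriv (\<lambda>w. m2 * (gc w * gc w)) w = m2 * (?w + ?w)"
        using sf_deriv_mult[OF gr_holo_const gr_holo_mult[OF g g], of w m2] sf_deriv_mult[OF g g, of w]
        by (simp add: sf_deriv_const sf_deriv_gc)
      then show ?thesis
        using sf_deriv_add[OF gr_holo_mult[OF gr_holo_const gr_holo_mult[OF g g]] holo_linear, of w m2 m1 m0]
        by (simp add: sf_deriv_linear)
    qed
    ultimately have der: "sf_deriv pm w * (x w * x w) = m2 * (?w + ?w) + m1 - pm w * (c * x w + x w * c)"
      by (simp add: eq_diff_eq)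
    have cx: "c * x w = x w * c" by (rule comm[OF x_even])
    have "sf_deriv pm w * (x w * x w * x w) = (m2 * (?w + ?w) + m1 - pm w * (x w * c + x w * c)) * x w"
      using der unfolding cx by (simp flip: mult.assoc)
    also have "\<dots> = (m2 * (?w + ?w) + m1) * x w - (pm w * (x w * (c * x w)) + pm w * (x w * (c * x w)))"
      by (simp only: left_diff_distrib distrib_left distrib_right mult.assoc)
    also have "pm w * (x w * (c * x w)) = (m2 * ?w ^ 2 + m1 * ?w + m0) * c"
      unfolding cx using eq(2)[OF w] by (simp add: power2_eq_square mult.assoc)
         (simp flip: mult.assoc)
    also have "(m2 * (?w + ?w) + m1) * x w - ((m2 * ?w ^ 2 + m1 * ?w + m0) * c + (m2 * ?w ^ 2 + m1 * ?w + m0) * c)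
      = 2 * m2 * d * ?w - m1 * (c * ?w - d) - 2 * m0 * c"
    proof -
      have cw: "c * ?w = ?w * c" "d * ?w = ?w * d" by (rule gc_commute)+
      show ?thesis
        by (simp add: x_def cw power2_eq_square distrib_left distrib_right right_diff_distrib mult.assoc mult_2)
    qed
    finally have pm3: "sf_deriv pm w * (x w * x w * x w) = 2 * m2 * d * ?w - m1 * (c * ?w - d) - 2 * m0 * c" .
    have "gm w * (e * x w ^ 3) = e * gm w * (x w * x w * x w)"
      using comm[OF e, of "gm w"] by (simp add: power3_eq_cube flip: mult.assoc)
    also have "\<dots> = sf_deriv f w * (x w * x w) * x w + p0 * (sf_deriv pm w * (x w * x w * x w))"
      unfolding sc by (simp add: distrib_right mult.assoc)
    finally show ?thesis unfolding f_deriv[OF w] pm3 by simp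
  qed
  show "w \<in> U \<Longrightarrow> gm w * (e * x w ^ 3) = x w + p0 * (2 * m2 * d * gc w - m1 * (c * gc w - d) - 2 * m0 * c)"
    by (rule main)
  obtain w where w: "w \<in> U" by (rule U_nonempty)
  have "gr_body (gm w * (e * x w ^ 3)) = gr_body (x w)"
    unfolding main[OF w] using gr_body_odd[OF o(1)] by simp
  moreover have "gr_body (x w) \<noteq> 0" using x_unit[OF w] by (simp only: x_def not_False_eq_True)
  ultimately show "gr_body e \<noteq> 0" by auto
qed

text \<open>The equation for \<open>f'\<close> times \<open>x\<^sup>4\<close>.\<close>

lemma zero_product:
  assumes o: "p1 \<in> gr_odd L0" "p0 \<in> gr_odd L0" "m1 \<in> gr_odd L0" "m0 \<in> gr_odd L0"
    and eq: "\<And>w. w \<in> U \<Longrightarrow> pp w * x w = p1 * gc w + p0" "\<And>w. w \<in> U \<Longrightarrow> pm w * x w = m1 * gc w + m0"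
    and w: "w \<in> U"
  shows "(gp w * x w ^ 2) * (gm w * x w ^ 2) = (1 - p1 * m0 - m1 * p0) * x w ^ 2"
proof -
  let ?X = "x w" and ?P = "p1 * gc w + p0" and ?M = "m1 * gc w + m0"
  have dp: "sf_deriv pp w * ?X = p1 - pp w * c"
    using deriv_times_x[OF holo(4) eq(1) w] by (simp add: sf_deriv_linear eq_diff_eq)
  have dm: "sf_deriv pm w * ?X = m1 - pm w * c"
    using deriv_times_x[OF holo(5) eq(2) w] by (simp add: sf_deriv_linear eq_diff_eq)
  have X: "r * ?X = ?X * r" for r by (rule comm[OF x_even])
  have mv: "(r * s) * (?X * ?X) = (r * ?X) * (s * ?X)" for r s
  proof -
    have "(r * ?X) * (s * ?X) = r * (?X * s) * ?X" by (simp only: mult.assoc)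
    also have "?X * s = s * ?X" by (rule X[symmetric])
    finally show ?thesis by (simp only: mult.assoc)
  qed
  have "(sf_deriv pp w * pm w) * (?X * ?X) = (p1 - pp w * c) * ?M" unfolding mv dp eq(2)[OF w] ..
  moreover have "(pp w * sf_deriv pm w) * (?X * ?X) = ?P * (m1 - pm w * c)" unfolding mv dm eq(1)[OF w] ..
  moreover have "pp w * c * ?M = ?P * (pm w * c)"
  proof -
    have "pp w * c * ?M = pp w * (c * pm w) * ?X" unfolding eq(2)[OF w, symmetric] by (simp only: mult.assoc)
    also have "c * pm w = pm w * c" by (rule comm[OF mem(3), symmetric])
    also have "pp w * (pm w * c) * ?X = pp w * (pm w * c * ?X)" by (simp only: mult.assoc)
    also have "pm w * c * ?X = ?X * (pm w * c)" by (rule X)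
    also have "pp w * (?X * (pm w * c)) = ?P * (pm w * c)" unfolding eq(1)[OF w, symmetric] by (simp only: mult.assoc)
    finally show ?thesis .
  qed
  moreover have "p1 * ?M - ?P * m1 = p1 * m0 + m1 * p0"
  proof -
    have "p0 * m1 = - (m1 * p0)" by (rule gr_odd_anticommute[OF o(3,2)])
    moreover have "gc w * m1 = m1 * gc w" by (rule gc_commute[symmetric])
    ultimately show ?thesis by (simp add: distrib_left distrib_right mult.assoc)
  qed
  ultimately have "(sf_deriv pp w * pm w - pp w * sf_deriv pm w) * (?X * ?X) = p1 * m0 + m1 * p0"
    by (simp add: left_diff_distrib right_diff_distrib)
  moreover have "gp w * gm w = sf_deriv f w - (sf_deriv pp w * pm w - pp w * sf_deriv pm w)"
    using superconformal[OF w] by simp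
  ultimately have g: "gp w * gm w * (?X * ?X) = 1 - p1 * m0 - m1 * p0"
    using f_deriv[OF w] by (simp add: left_diff_distrib)
  have "(gp w * ?X ^ 2) * (gm w * ?X ^ 2) = gp w * (?X ^ 2 * gm w) * ?X ^ 2" by (simp only: mult.assoc)
  also have "?X ^ 2 * gm w = gm w * ?X ^ 2" by (rule comm[OF gr_even_power[OF x_even], symmetric])
  also have "gp w * (gm w * ?X ^ 2) * ?X ^ 2 = gp w * gm w * (?X * ?X) * ?X ^ 2"
    by (simp only: mult.assoc power2_eq_square)
  finally show ?thesis unfolding g .
qed

lemma swapped: "rational_data L0 w0 U f gm gp pm pp a b c d"
proof unfold_locales
  show "sf_deriv f w = sf_deriv pm w * pp w - pm w * sf_deriv pp w + gm w * gp w" if w: "w \<in> U" for w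
  proof -
    have "sf_deriv pp w \<in> gr_odd L0" "sf_deriv pm w \<in> gr_odd L0"
      unfolding sf_deriv_eq_taylor
      by (rule gr_taylor_mem(2)[OF holo(4) U(1) w odd(1)], assumption)
         (rule gr_taylor_mem(2)[OF holo(5) U(1) w odd(2)], assumption)
    then have "sf_deriv pm w * pp w = - (pp w * sf_deriv pm w)" "pm w * sf_deriv pp w = - (sf_deriv pp w * pm w)"
      using odd[OF w] gr_odd_anticommute by blast+
    then show ?thesis using superconformal[OF w] comm[OF even(2)[OF w], of "gm w"] by simp
  qed
qed (fact U holo even odd mem det x_unit f_eq)+

end

text \<open>The equation determines one coefficient of \<open>e1 w + e0\<close> from the other.  Its solutions are the
  multiples of one polynomial, whose coefficients are \<open>c\<close> and \<open>d\<close> up to nilpotent terms.  If \<open>c\<close> is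
  invertible then \<open>\<epsilon> = (e1 / c) (1 + N2 d / c)\<close>, and if \<open>d\<close> is, then \<open>\<epsilon> = (e0 / d) (1 + N1 - N0 c / d - N2 N0)\<close>.\<close>

lemma rational_zero_epsilon:
  assumes mem: "c \<in> gr_even L0" "d \<in> gr_even L0" "N2 \<in> gr_even L0" "N1 \<in> gr_even L0" "N0 \<in> gr_even L0"
      "e1 \<in> gr_even L0" "e0 \<in> gr_even L0"
    and rel: "N2 * N2 = 0" "N0 * N0 = 0" "N2 * N1 = 0" "N0 * N1 = 0" "N1 * N1 = - 2 * (N2 * N0)"
    and sol: "rational_zero_sol c d N2 N1 N0 e1 e0"
  shows "\<exists>\<epsilon>\<in>gr_even L0. e1 = \<epsilon> * (c - N2 * d) \<and> e0 = \<epsilon> * (d + N0 * c - N1 * d - N2 * N0 * d)"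
proof -
  obtain c' d' e1' e0' where r: "c = Rep_gre c'" "d = Rep_gre d'" "e1 = Rep_gre e1'" "e0 = Rep_gre e0'"
    using mem gre_cases by metis
  obtain N2' N1' N0' where s: "N2 = Rep_gre N2'" "N1 = Rep_gre N1'" "N0 = Rep_gre N0'"
    using mem gre_cases by metis
  have num: "(2 :: gr) = Rep_gre 2"
    unfolding one_add_one[symmetric] Rep_gre_simps ..
  have rel': "N2' * N2' = 0" "N0' * N0' = 0" "N2' * N1' = 0" "N0' * N1' = 0" "N1' * N1' = - 2 * (N2' * N0')"
    using rel unfolding s num Rep_gre_simps[symmetric] gre_eq_iff by auto
  show ?thesis using sol unfolding rational_zero_sol_def
  proof (elim disjE conjE)
    assume c: "gr_body c \<noteq> 0" and con: "c * (c * e0 - d * e1) = e1 * (N2 * d * d - N1 * c * d + N0 * c * c)"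
    obtain u where u: "inverse c = Rep_gre u" using gre_cases[OF gr_inverse_even[OF c mem(1)]] by metis
    have u': "c' * u = 1" using gr_inverse_right[OF c] unfolding u unfolding r Rep_gre_simps[symmetric] gre_eq_iff .
    have con': "c' * (c' * e0' - d' * e1') = e1' * (N2' * d' * d' - N1' * c' * d' + N0' * c' * c')"
      using con unfolding r s Rep_gre_simps[symmetric] gre_eq_iff .
    show ?thesis
    proof (rule bexI[of _ "e1 * inverse c * (1 + N2 * d * inverse c)"], rule conjI)
      show "e1 = e1 * inverse c * (1 + N2 * d * inverse c) * (c - N2 * d)"
        unfolding u unfolding r s Rep_gre_simps[symmetric] gre_eq_iff by (rule epsilon_c_ring(1)[OF rel' u' con'])
      show "e0 = e1 * inverse c * (1 + N2 * d * inverse c) * (d + N0 * c - N1 * d - N2 * N0 * d)"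
        unfolding u unfolding r s Rep_gre_simps[symmetric] gre_eq_iff by (rule epsilon_c_ring(2)[OF rel' u' con'])
      show "e1 * inverse c * (1 + N2 * d * inverse c) \<in> gr_even L0"
        by (intro gr_even_times gr_even_add gr_even_one mem gr_inverse_even c)
    qed
  next
    assume d: "gr_body d \<noteq> 0" and con: "d * (d * e1 - c * e0) = - (e0 * (N2 * d * d - N1 * c * d + N0 * c * c))"
    obtain v where v: "inverse d = Rep_gre v" using gre_cases[OF gr_inverse_even[OF d mem(2)]] by metis
    have v': "d' * v = 1" using gr_inverse_right[OF d] unfolding v unfolding r Rep_gre_simps[symmetric] gre_eq_iff .
    have con': "d' * (d' * e1' - c' * e0') = - (e0' * (N2' * d' * d' - N1' * c' * d' + N0' * c' * c'))"
      using con unfolding r s Rep_gre_simps[symmetric] gre_eq_iff .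
    show ?thesis
    proof (rule bexI[of _ "e0 * inverse d * (1 + N1 - N0 * c * inverse d - N2 * N0)"], rule conjI)
      show "e1 = e0 * inverse d * (1 + N1 - N0 * c * inverse d - N2 * N0) * (c - N2 * d)"
        unfolding v unfolding r s Rep_gre_simps[symmetric] gre_eq_iff by (rule epsilon_d_ring(1)[OF rel' v' con'])
      show "e0 = e0 * inverse d * (1 + N1 - N0 * c * inverse d - N2 * N0) * (d + N0 * c - N1 * d - N2 * N0 * d)"
        unfolding v unfolding r s Rep_gre_simps[symmetric] gre_eq_iff by (rule epsilon_d_ring(2)[OF rel' v' con'])
      show "e0 * inverse d * (1 + N1 - N0 * c * inverse d - N2 * N0) \<in> gr_even L0"
        by (intro gr_even_times gr_even_add gr_even_diff gr_even_one mem gr_inverse_even d)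
    qed
  qed
qed

text \<open>The numerator of \<open>g\<^sup>-\<close> is that of \<open>g\<^sup>+\<close> with \<open>N2\<close>, \<open>N1\<close>, \<open>N0\<close> negated; in the products of leading and of
  constant coefficients the nilpotent terms cancel.\<close>

lemma epsilon_product:
  assumes mem: "c \<in> gr_even L0" "d \<in> gr_even L0" "N2 \<in> gr_even L0" "N1 \<in> gr_even L0" "N0 \<in> gr_even L0"
      "\<epsilon> \<in> gr_even L0" "\<epsilon>' \<in> gr_even L0"
    and rel: "N2 * N2 = 0" "N0 * N0 = 0" "N2 * N1 = 0" "N0 * N1 = 0" "N1 * N1 = - 2 * (N2 * N0)"
  shows "\<epsilon> * (c - N2 * d) * (\<epsilon>' * (c + N2 * d)) = \<epsilon> * \<epsilon>' * (c * c)"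
    "\<epsilon> * (d + N0 * c - N1 * d - N2 * N0 * d) * (\<epsilon>' * (d - N0 * c + N1 * d - N2 * N0 * d)) = \<epsilon> * \<epsilon>' * (d * d)"
proof -
  obtain c' d' e1' e0' where r: "c = Rep_gre c'" "d = Rep_gre d'" "\<epsilon> = Rep_gre e1'" "\<epsilon>' = Rep_gre e0'"
    using mem gre_cases by metis
  obtain N2' N1' N0' where s: "N2 = Rep_gre N2'" "N1 = Rep_gre N1'" "N0 = Rep_gre N0'"
    using mem gre_cases by metis
  have num: "(2 :: gr) = Rep_gre 2"
    unfolding one_add_one[symmetric] Rep_gre_simps ..
  have rel': "N2' * N2' = 0" "N0' * N0' = 0" "N2' * N1' = 0" "N0' * N1' = 0" "N1' * N1' = - 2 * (N2' * N0')"
    using rel unfolding s num Rep_gre_simps[symmetric] gre_eq_iff by auto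
  show "\<epsilon> * (c - N2 * d) * (\<epsilon>' * (c + N2 * d)) = \<epsilon> * \<epsilon>' * (c * c)"
    "\<epsilon> * (d + N0 * c - N1 * d - N2 * N0 * d) * (\<epsilon>' * (d - N0 * c + N1 * d - N2 * N0 * d)) = \<epsilon> * \<epsilon>' * (d * d)"
    unfolding r s Rep_gre_simps[symmetric] gre_eq_iff by (rule epsilon_product_ring[OF rel'])+
qed

section \<open>Values of the component functions at points with soul\<close>

context rational_data
begin

lemma val_x:
  assumes "gr_body z \<in> U"
  shows "gr_body (c * z + d) \<noteq> 0"
  using x_unit[OF assms] by simp

text \<open>Evaluation at \<open>z\<close> preserves an identity with cleared denominators.\<close>

lemma val_times_x:
  assumes z: "z \<in> gr_even L" "gr_body z \<in> U" and \<phi>: "gr_holo U \<phi>"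
    and eq: "\<And>w. w \<in> U \<Longrightarrow> \<phi> w * x w ^ N = \<psi> w"
  shows "sf_val \<phi> z * (c * z + d) ^ N = sf_val \<psi> z"
proof -
  have "sf_val (\<lambda>w. \<phi> w * x w ^ N) z = sf_val \<phi> z * sf_val x z ^ N"
    using sf_val_mult[OF \<phi> gr_holo_power[OF x_holo] U(1) z(2,1)] sf_val_power[OF x_holo U(1) z(2,1)] by simp
  moreover have "sf_val x z = c * z + d"
    unfolding x_def[abs_def] by (rule sf_val_linear[OF z(1)])
  moreover have "sf_val (\<lambda>w. \<phi> w * x w ^ N) z = sf_val \<psi> z"
    by (rule sf_val_cong[OF gr_holo_mult[OF \<phi> gr_holo_power[OF x_holo]] U(1) z(2) eq])
  ultimately show ?thesis by simp
qed

lemma val_const: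
  assumes z: "z \<in> gr_even L" "gr_body z \<in> U" and \<phi>: "gr_holo U \<phi>"
    and eq: "\<And>w. w \<in> U \<Longrightarrow> \<phi> w = e"
  shows "sf_val \<phi> z = e"
  using sf_val_cong[OF \<phi> U(1) z(2) eq] by (simp add: sf_val_const)

lemma divide_x:
  assumes "gr_body z \<in> U" "A * (c * z + d) ^ N = B"
  shows "A = B / (c * z + d) ^ N"
  using gr_divide_eqI[of "(c * z + d) ^ N" A B] val_x[OF assms(1)] assms(2) by (simp del: gr_body_simps)

lemma val_f:
  assumes "z \<in> gr_even L" "gr_body z \<in> U"
  shows "sf_val f z = (a * z + b) / (c * z + d)"
  using divide_x[OF assms(2), of "sf_val f z" 1] val_times_x[OF assms holo(1), of 1 "\<lambda>w. a * gc w + b"] f_eq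
    sf_val_linear[OF assms(1), of a b]
  by (simp add: x_def)

lemma components_many:
  assumes raw: "rational_many L0 k U c d gp gm pp pm" and k: "k \<ge> 2" and S: "\<forall>z\<in>S. z \<in> gr_even L \<and> gr_body z \<in> U"
  shows "\<exists>q. (\<forall>j\<le>k + 1. q j \<in> gr_odd L0) \<and> (\<exists>e\<in>gr_even_units L0. \<forall>z\<in>S.
      sf_val pp z = 0 \<and> sf_val pm z = (\<Sum>j\<le>k + 1. q j * z ^ j) / (c * z + d) powi (int k + 1) \<and>
      sf_val gp z = e * (c * z + d) powi (int k - 1) \<and> sf_val gm z = inverse e * (c * z + d) powi (- int k - 1))"
proof -
  obtain r where r: "\<forall>j. r j \<in> gr_odd L0" and ex: "\<exists>e\<in>gr_even L0. \<exists>e'\<in>gr_even L0.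
      \<forall>w\<in>U. pp w = 0 \<and> pm w * (c * gc w + d) ^ (k + 1) = (\<Sum>j\<le>k + 1. r j * gc w ^ j) \<and>
        gp w = e * (c * gc w + d) ^ (k - 1) \<and> gm w * (c * gc w + d) ^ (k + 1) = e'"
    using raw unfolding rational_many_def by (elim exE conjE) (rule that)
  from ex obtain e e' where e: "e \<in> gr_even L0" "e' \<in> gr_even L0"
    and all': "\<forall>w\<in>U. pp w = 0 \<and> pm w * (c * gc w + d) ^ (k + 1) = (\<Sum>j\<le>k + 1. r j * gc w ^ j) \<and>
        gp w = e * (c * gc w + d) ^ (k - 1) \<and> gm w * (c * gc w + d) ^ (k + 1) = e'"
    by (elim bexE) (rule that)
  note all = all'[folded x_def]
  have eq: "pp w = 0" "pm w * x w ^ (k + 1) = (\<Sum>j\<le>k + 1. r j * gc w ^ j)"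
    "gp w = e * x w ^ (k - 1)" "gm w * x w ^ (k + 1) = e'" if "w \<in> U" for w
    using all that by simp_all
  have k1: "k \<ge> 1" using k by simp
  note un = many_units[OF k1 e eq(1) eq(3) eq(4)]
  show ?thesis
  proof (rule exI[of _ r], rule conjI, use r in blast, rule bexI[of _ e], intro ballI conjI)
    fix z assume "z \<in> S"
    then have z: "z \<in> gr_even L" "gr_body z \<in> U" using S by auto
    have p: "(c * z + d) powi (int k + 1) = (c * z + d) ^ (k + 1)"
      "(c * z + d) powi (int k - 1) = (c * z + d) ^ (k - 1)"
      "(c * z + d) powi (- int k - 1) = inverse ((c * z + d) ^ (k + 1))"
      using k val_x[OF z(2)] by (simp_all add: power_int_def nat_add_distrib nat_diff_distrib gr_inverse_power del: gr_body_simps power_Suc)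
    show "sf_val pp z = 0" by (rule val_const[OF z holo(4) eq(1)])
    show "sf_val pm z = (\<Sum>j\<le>k + 1. r j * z ^ j) / (c * z + d) powi (int k + 1)"
      unfolding p by (rule divide_x[OF z(2)]) (rule trans[OF val_times_x[OF z holo(5) eq(2)] sf_val_polynomial[OF z(1)]])
    have "sf_val gp z * (c * z + d) ^ 0 = sf_val (\<lambda>w. e * x w ^ (k - 1)) z"
      by (rule val_times_x[OF z holo(2)]) (use eq(3) in simp)
    moreover have "e * (c * z + d) ^ (k - 1) = sf_val (\<lambda>w. e * x w ^ (k - 1)) z"
    proof -
      have "sf_val (\<lambda>w. e * x w ^ (k - 1)) z = sf_val (\<lambda>w. e) z * sf_val (\<lambda>w. x w ^ (k - 1)) z"
        by (rule sf_val_mult[OF gr_holo_const gr_holo_power[OF x_holo] U(1) z(2,1)])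
      also have "sf_val (\<lambda>w. x w ^ (k - 1)) z = sf_val x z ^ (k - 1)" by (rule sf_val_power[OF x_holo U(1) z(2,1)])
      also have "sf_val x z = c * z + d" unfolding x_def[abs_def] by (rule sf_val_linear[OF z(1)])
      finally show ?thesis by (simp add: sf_val_const)
    qed
    ultimately show "sf_val gp z = e * (c * z + d) powi (int k - 1)" unfolding p by simp
    have "sf_val gm z = e' / (c * z + d) ^ (k + 1)"
      by (rule divide_x[OF z(2)]) (use val_times_x[OF z holo(3), of "k + 1" "\<lambda>_. e'"] eq(4) in \<open>simp add: sf_val_const\<close>)
    then show "sf_val gm z = inverse e * (c * z + d) powi (- int k - 1)"
      by (simp only: p un(2) gr_divide_inverse)
  qed (use e un in \<open>simp add: gr_even_units_iff\<close>)
qed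

lemma components_one:
  assumes raw: "rational_one L0 U c d gp pp pm" and S: "\<forall>z\<in>S. z \<in> gr_even L \<and> gr_body z \<in> U"
  shows "\<exists>p0\<in>gr_odd L0. \<exists>m2\<in>gr_odd L0. \<exists>m1\<in>gr_odd L0. \<exists>m0\<in>gr_odd L0. \<exists>e\<in>gr_even_units L0. \<forall>z\<in>S.
      sf_val pp z = p0 \<and> sf_val pm z = (m2 * z ^ 2 + m1 * z + m0) / (c * z + d) ^ 2 \<and> sf_val gp z = e \<and>
      sf_val gm z = 1 / (e * (c * z + d) ^ 2)
        + p0 * (2 * m2 * d * z - m1 * (c * z - d) - 2 * m0 * c) / (e * (c * z + d) ^ 3)"
proof -
  obtain p0 m2 m1 m0 e where o: "p0 \<in> gr_odd L0" "m2 \<in> gr_odd L0" "m1 \<in> gr_odd L0" "m0 \<in> gr_odd L0" "e \<in> gr_even L0"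
    and all': "\<forall>w\<in>U. pp w = p0 \<and> pm w * (c * gc w + d) ^ 2 = m2 * gc w ^ 2 + m1 * gc w + m0 \<and> gp w = e"
    using raw unfolding rational_one_def by (elim bexE) (rule that)
  note all = all'[folded x_def]
  have eq: "pp w = p0" "pm w * x w ^ 2 = m2 * gc w ^ 2 + m1 * gc w + m0" "gp w = e" if "w \<in> U" for w
    using all that by simp_all
  have eb: "gr_body e \<noteq> 0" by (rule one_gm(1)[OF o eq]) 
  have gm: "gm w * (e * x w ^ 3) = x w + p0 * (2 * m2 * d * gc w - m1 * (c * gc w - d) - 2 * m0 * c)" if "w \<in> U" for w
    using one_gm(2)[OF o eq that] .
  show ?thesis
  proof (rule bexI[OF _ o(1)], rule bexI[OF _ o(2)], rule bexI[OF _ o(3)], rule bexI[OF _ o(4)], rule bexI[of _ e], intro ballI conjI)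
    fix z assume "z \<in> S"
    then have z: "z \<in> gr_even L" "gr_body z \<in> U" using S by auto
    let ?x = "c * z + d" and ?r = "p0 * (2 * m2 * d * z - m1 * (c * z - d) - 2 * m0 * c)"
    show "sf_val pp z = p0" by (rule val_const[OF z holo(4) eq(1)])
    show "sf_val gp z = e" by (rule val_const[OF z holo(2) eq(3)])
    have "(\<lambda>w. m2 * gc w ^ 2 + m1 * gc w + m0) = (\<lambda>w. \<Sum>j\<le>2. (\<lambda>j. if j = 0 then m0 else if j = 1 then m1 else m2) j * gc w ^ j)"
      by (simp add: eval_nat_numeral add_ac)
    then have "sf_val (\<lambda>w. m2 * gc w ^ 2 + m1 * gc w + m0) z = (\<Sum>j\<le>2. (\<lambda>j. if j = 0 then m0 else if j = 1 then m1 else m2) j * z ^ j)"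
      by (simp only: sf_val_polynomial[OF z(1)])
    also have "\<dots> = m2 * z ^ 2 + m1 * z + m0" by (simp add: eval_nat_numeral add_ac)
    finally have "sf_val (\<lambda>w. m2 * gc w ^ 2 + m1 * gc w + m0) z = m2 * z ^ 2 + m1 * z + m0" .
    moreover have "sf_val pm z * ?x ^ 2 = sf_val (\<lambda>w. m2 * gc w ^ 2 + m1 * gc w + m0) z"
      by (rule val_times_x[OF z holo(5) eq(2)])
    ultimately show "sf_val pm z = (m2 * z ^ 2 + m1 * z + m0) / ?x ^ 2"
      by (intro divide_x[OF z(2)]) simp
    \<comment> \<open>The numerator is linear in \<open>w\<close>, so its value at \<open>z\<close> is known.\<close>
    have lin: "x w + p0 * (2 * m2 * d * gc w - m1 * (c * gc w - d) - 2 * m0 * c)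
      = (c + p0 * (2 * m2 * d - m1 * c)) * gc w + (d + p0 * (m1 * d - 2 * m0 * c))" for w
      by (simp add: x_def algebra_simps)
    have "sf_val (\<lambda>w. gm w * e) z * ?x ^ 3 = sf_val (\<lambda>w. (c + p0 * (2 * m2 * d - m1 * c)) * gc w + (d + p0 * (m1 * d - 2 * m0 * c))) z"
      by (rule val_times_x[OF z gr_holo_mult[OF holo(3) gr_holo_const]]) (use gm lin in \<open>simp add: mult.assoc\<close>)
    also have "sf_val (\<lambda>w. gm w * e) z = sf_val gm z * e"
      using sf_val_mult[OF holo(3) gr_holo_const U(1) z(2,1)] by (simp add: sf_val_const)
    also have "sf_val (\<lambda>w. (c + p0 * (2 * m2 * d - m1 * c)) * gc w + (d + p0 * (m1 * d - 2 * m0 * c))) z = ?x + ?r"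
      unfolding sf_val_linear[OF z(1)] by (simp add: algebra_simps)
    finally have "sf_val gm z * (e * ?x ^ 3) = ?x + ?r" by (simp add: mult.assoc)
    then have "sf_val gm z = (?x + ?r) / (e * ?x ^ 3)"
      using eb val_x[OF z(2)] by (intro gr_divide_eqI) (auto simp del: gr_body_simps(4))
    also have "\<dots> = ?x / (e * ?x ^ 3) + ?r / (e * ?x ^ 3)" by (simp add: gr_divide_inverse distrib_right)
    also have "?x / (e * ?x ^ 3) = 1 / (e * ?x ^ 2)"
    proof (rule gr_divide_eqI)
      have xb: "gr_body ?x \<noteq> 0" by (rule val_x[OF z(2)])
      show "gr_body (e * ?x ^ 2) \<noteq> 0" using eb xb by (simp del: gr_body_simps(4))
      have "?x / (e * ?x ^ 3) * (e * ?x ^ 2) = ?x * (inverse (e * ?x ^ 2 * ?x) * (e * ?x ^ 2))"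
        by (simp add: gr_divide_inverse power3_eq_cube power2_eq_square mult.assoc)
      also have "inverse (e * ?x ^ 2 * ?x) = inverse ?x * inverse (e * ?x ^ 2)"
        using eb xb by (intro gr_inverse_mult) (auto simp del: gr_body_simps(4))
      also have "inverse ?x * inverse (e * ?x ^ 2) * (e * ?x ^ 2) = inverse ?x"
        using eb xb by (simp add: mult.assoc del: gr_body_simps(4))
      also have "?x * inverse ?x = 1" by (rule gr_inverse_right[OF xb])
      finally show "?x / (e * ?x ^ 3) * (e * ?x ^ 2) = 1" .
    qed
    finally show "sf_val gm z = 1 / (e * ?x ^ 2) + ?r / (e * ?x ^ 3)" .
  qed (use o(5) eb in \<open>simp add: gr_even_units_iff\<close>)
qed

lemma val_quadratic_pole:
  assumes z: "z \<in> gr_even L" "gr_body z \<in> U" and \<phi>: "gr_holo U \<phi>"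
    and eq: "\<And>w. w \<in> U \<Longrightarrow> \<phi> w * x w ^ 2 = e1 * gc w + e0" and e: "e1 = \<epsilon> * c + f1" "e0 = \<epsilon> * d + f0"
  shows "sf_val \<phi> z = \<epsilon> / (c * z + d) + (f1 * z + f0) / (c * z + d) ^ 2"
proof -
  let ?x = "c * z + d"
  have xb: "gr_body ?x \<noteq> 0" by (rule val_x[OF z(2)])
  have "sf_val \<phi> z * ?x ^ 2 = e1 * z + e0"
    using val_times_x[OF z \<phi> eq] sf_val_linear[OF z(1)] by simp
  also have "\<dots> = \<epsilon> * ?x + (f1 * z + f0)" unfolding e by (simp add: algebra_simps)
  finally have "sf_val \<phi> z = (\<epsilon> * ?x + (f1 * z + f0)) / ?x ^ 2" by (rule divide_x[OF z(2)])
  also have "\<dots> = \<epsilon> * (?x * inverse (?x * ?x)) + (f1 * z + f0) / ?x ^ 2"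
    by (simp only: gr_divide_inverse distrib_right[of "\<epsilon> * ?x"] mult.assoc[of \<epsilon> ?x] power2_eq_square)
  also have "inverse (?x * ?x) = inverse ?x * inverse ?x" by (rule gr_inverse_mult[OF xb xb])
  also have "?x * (inverse ?x * inverse ?x) = inverse ?x" using xb by (simp del: gr_body_simps flip: mult.assoc)
  finally show ?thesis by (simp only: gr_divide_inverse)
qed

text \<open>The numerator \<open>\<epsilon> ((c - N2 d) z + (d + N0 c - N1 d - N2 N0 d))\<close> of \<open>g\<^sup>+\<close> is split as \<open>\<epsilon> (c z + d)\<close> plus a
  nilpotent rest, which is \<open>fp z + hp\<close>.  The product of the two factors follows from the coefficients of
  \<open>zero_product\<close> at \<open>w\<^sup>2\<close> and at \<open>1\<close>, since \<open>c\<close> or \<open>d\<close> is invertible.\<close>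

lemma components_zero:
  assumes raw: "rational_zero L0 U c d gp gm pp pm" and S: "\<forall>z\<in>S. z \<in> gr_even L \<and> gr_body z \<in> U"
  shows "\<exists>p1\<in>gr_odd L0. \<exists>p0\<in>gr_odd L0. \<exists>m1\<in>gr_odd L0. \<exists>m0\<in>gr_odd L0.
     \<exists>ep\<in>gr_even_units L0. \<exists>em\<in>gr_even_units L0.
     \<exists>fp\<in>gr_even L0. \<exists>fm\<in>gr_even L0. \<exists>hp\<in>gr_even L0. \<exists>hm\<in>gr_even L0.
       ep * em = 1 - p1 * m0 - m1 * p0 \<and>
       fp = - (ep * p1 * m1 * d) \<and>
       fm = em * p1 * m1 * d \<and>
       hp = ep * (p0 * m0 * c - (p1 * m0 - m1 * p0) * d - p1 * m1 * p0 * m0 * d) \<and>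
       hm = - (em * (p0 * m0 * c - (p1 * m0 - m1 * p0) * d + p1 * m1 * p0 * m0 * d)) \<and>
       (\<forall>z\<in>S.
          sf_val pp z = (p1 * z + p0) / (c * z + d) \<and>
          sf_val pm z = (m1 * z + m0) / (c * z + d) \<and>
          sf_val gp z = ep / (c * z + d) + (fp * z + hp) / (c * z + d) ^ 2 \<and>
          sf_val gm z = em / (c * z + d) + (fm * z + hm) / (c * z + d) ^ 2)"
proof -
  obtain p1 p0 m1 m0 e1 e0 t1 t0 where o: "p1 \<in> gr_odd L0" "p0 \<in> gr_odd L0" "m1 \<in> gr_odd L0" "m0 \<in> gr_odd L0"
    and e: "e1 \<in> gr_even L0" "e0 \<in> gr_even L0" and t: "t1 \<in> gr_even L0" "t0 \<in> gr_even L0"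
    and all: "rational_zero_sol c d (p1 * m1) (p1 * m0 - m1 * p0) (p0 * m0) e1 e0 \<and>
      rational_zero_sol c d (- (p1 * m1)) (- (p1 * m0 - m1 * p0)) (- (p0 * m0)) t1 t0 \<and>
      (\<forall>w\<in>U. pp w * (c * gc w + d) = p1 * gc w + p0 \<and> pm w * (c * gc w + d) = m1 * gc w + m0 \<and>
        gp w * (c * gc w + d) ^ 2 = e1 * gc w + e0 \<and> gm w * (c * gc w + d) ^ 2 = t1 * gc w + t0)"
    using raw unfolding rational_zero_def by (elim bexE) (rule that)
  note sol1 = all[THEN conjunct1] and sol2 = all[THEN conjunct2, THEN conjunct1]
    and all3 = all[THEN conjunct2, THEN conjunct2, folded x_def]
  have eq: "pp w * x w = p1 * gc w + p0" "pm w * x w = m1 * gc w + m0"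
    "gp w * x w ^ 2 = e1 * gc w + e0" "gm w * x w ^ 2 = t1 * gc w + t0" if "w \<in> U" for w
    using all3 that by simp_all
  define N2 N1 N0 where N: "N2 = p1 * m1" "N1 = p1 * m0 - m1 * p0" "N0 = p0 * m0"
  have Ne: "N2 \<in> gr_even L0" "N1 \<in> gr_even L0" "N0 \<in> gr_even L0" using o unfolding N by auto
  note rel = odd_product_relations[OF o, folded N]
  have relm: "- N2 * - N2 = 0" "- N0 * - N0 = 0" "- N2 * - N1 = 0" "- N0 * - N1 = 0" "- N1 * - N1 = - 2 * (- N2 * - N0)"
    using rel by simp_all
  obtain \<epsilon> where \<epsilon>: "\<epsilon> \<in> gr_even L0" and e_eq: "e1 = \<epsilon> * (c - N2 * d)" "e0 = \<epsilon> * (d + N0 * c - N1 * d - N2 * N0 * d)"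
    using rational_zero_epsilon[OF mem(3,4) Ne e rel sol1[folded N]] by (elim bexE conjE) (rule that)
  obtain \<epsilon>' where \<epsilon>': "\<epsilon>' \<in> gr_even L0" and "t1 = \<epsilon>' * (c - - N2 * d)" "t0 = \<epsilon>' * (d + - N0 * c - - N1 * d - - N2 * - N0 * d)"
    using rational_zero_epsilon[OF mem(3,4) gr_even_uminus[OF Ne(1)] gr_even_uminus[OF Ne(2)] gr_even_uminus[OF Ne(3)] t relm sol2[folded N]]
    by (elim bexE conjE) (rule that)
  then have t_eq: "t1 = \<epsilon>' * (c + N2 * d)" "t0 = \<epsilon>' * (d - N0 * c + N1 * d - N2 * N0 * d)" by simp_all
  let ?K = "1 - p1 * m0 - m1 * p0"
  have ev: "x \<in> gr_even L0 \<Longrightarrow> y * x = x * y" for x y by (rule comm)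
  have coeff: "e1 * t1 = ?K * (c * c)" "e0 * t0 = ?K * (d * d)"
  proof -
    \<comment> \<open>Both sides of \<open>zero_product\<close> are quadratic polynomials in \<open>w\<close>, with coefficients \<open>rr\<close> and \<open>ss\<close>.\<close>
    define rr where "rr j = (if j = 0 then e0 * t0 else if j = 1 then e1 * t0 + e0 * t1 else e1 * t1)" for j :: nat
    define B where "B = c * d + d * c"
    define ss where "ss j = (if j = 0 then ?K * (d * d) else if j = 1 then ?K * B else ?K * (c * c))" for j :: nat
    have "rr j = ss j" if "j \<le> 2" for j
    proof (rule gr_poly_coeffs[OF _ that])
      fix w assume "w \<noteq> w0"
      then have w: "w \<in> U" using U(2) by auto
      let ?w = "gc w"
      have wc: "?w * y = y * ?w" "?w * (y * v) = y * (?w * v)" for y v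
        by (rule gc_commute[symmetric], rule gc_left_commute[symmetric])
      have "(e1 * ?w + e0) * (t1 * ?w + t0) = ?K * ((c * ?w + d) * (c * ?w + d))"
        using zero_product[OF o eq(1,2) w] unfolding eq(3)[OF w] eq(4)[OF w] by (simp only: x_def power2_eq_square)
      moreover have "(e1 * ?w + e0) * (t1 * ?w + t0) = rr 0 + rr 1 * ?w + rr 2 * ?w ^ 2"
      proof -
        have "e1 * ?w * (t1 * ?w) = e1 * t1 * (?w * ?w)" "e1 * ?w * t0 = e1 * t0 * ?w"
          using wc(1)[of t1] wc(1)[of t0] by (metis mult.assoc)+
        then show ?thesis unfolding rr_def power2_eq_square by (simp add: distrib_left distrib_right mult.assoc)
      qed
      moreover have "?K * ((c * ?w + d) * (c * ?w + d)) = ss 0 + ss 1 * ?w + ss 2 * ?w ^ 2"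
      proof -
        have "c * ?w * (c * ?w) = c * c * (?w * ?w)" "c * ?w * d = c * d * ?w"
          using wc(1)[of c] wc(1)[of d] by (metis mult.assoc)+
        then have "(c * ?w + d) * (c * ?w + d) = c * c * (?w * ?w) + B * ?w + d * d"
          by (simp add: B_def distrib_left distrib_right mult.assoc)
        then show ?thesis unfolding ss_def power2_eq_square
          by (simp only: if_True if_False zero_neq_one one_neq_zero distrib_left[of ?K] mult.assoc[of ?K])
            (simp add: add_ac mult.assoc)
      qed
      ultimately show "(\<Sum>j\<le>2. rr j * ?w ^ j) = (\<Sum>j\<le>2. ss j * ?w ^ j)"
        by (simp add: eval_nat_numeral add_ac)
    qed
    from this[of 2] this[of 0] show "e1 * t1 = ?K * (c * c)" "e0 * t0 = ?K * (d * d)"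
      unfolding rr_def ss_def by simp_all
  qed
  note pr = epsilon_product[OF mem(3,4) Ne \<epsilon> \<epsilon>' rel]
  have prod: "\<epsilon> * \<epsilon>' = ?K"
  proof -
    have "gr_body a * gr_body d - gr_body b * gr_body c = 1" using arg_cong[OF det, of gr_body] by simp
    then have "gr_body c \<noteq> 0 \<or> gr_body d \<noteq> 0" by auto
    moreover have "\<epsilon> * \<epsilon>' * (c * c) = ?K * (c * c)" using coeff(1) pr(1) unfolding e_eq t_eq by simp
    moreover have "\<epsilon> * \<epsilon>' * (d * d) = ?K * (d * d)" using coeff(2) pr(2) unfolding e_eq t_eq by simp
    moreover have canc: "u = v" if "u * (g * g) = v * (g * g)" "gr_body g \<noteq> 0" for u v g :: gr
    proof -
      have "u * (g * g) * inverse (g * g) = v * (g * g) * inverse (g * g)" using that(1) by simp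
      then show ?thesis using that(2) by (simp add: mult.assoc[of _ "g * g"])
    qed
    ultimately show ?thesis by blast
  qed
  have Kb: "gr_body ?K = 1" using gr_body_odd[OF o(1)] gr_body_odd[OF o(3)] by simp
  have units: "gr_body \<epsilon> \<noteq> 0" "gr_body \<epsilon>' \<noteq> 0" using arg_cong[OF prod, of gr_body] unfolding Kb by auto
  have NN: "p1 * m1 * p0 * m0 = N2 * N0" by (simp add: N mult.assoc)
  let ?fp = "- (\<epsilon> * p1 * m1 * d)" and ?fm = "\<epsilon>' * p1 * m1 * d"
    and ?hp = "\<epsilon> * (p0 * m0 * c - (p1 * m0 - m1 * p0) * d - p1 * m1 * p0 * m0 * d)"
    and ?hm = "- (\<epsilon>' * (p0 * m0 * c - (p1 * m0 - m1 * p0) * d + p1 * m1 * p0 * m0 * d))"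
  have fN: "?fp = - (\<epsilon> * (N2 * d))" "?fm = \<epsilon>' * (N2 * d)" "?hp = \<epsilon> * (N0 * c - N1 * d - N2 * N0 * d)"
    "?hm = - (\<epsilon>' * (N0 * c - N1 * d + N2 * N0 * d))"
    unfolding NN unfolding N by (simp_all only: mult.assoc)
  have fe: "?fp \<in> gr_even L0" "?fm \<in> gr_even L0" "?hp \<in> gr_even L0" "?hm \<in> gr_even L0"
    unfolding fN by (intro gr_even_uminus gr_even_times gr_even_add gr_even_diff \<epsilon> \<epsilon>' Ne mem)+
  have dec: "e1 = \<epsilon> * c + ?fp" "e0 = \<epsilon> * d + ?hp" "t1 = \<epsilon>' * c + ?fm" "t0 = \<epsilon>' * d + ?hm"
    unfolding fN e_eq t_eq by (simp_all add: distrib_left right_diff_distrib)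
  show ?thesis
  proof (rule bexI[OF _ o(1)], rule bexI[OF _ o(2)], rule bexI[OF _ o(3)], rule bexI[OF _ o(4)],
      rule bexI[of _ \<epsilon>], rule bexI[of _ \<epsilon>'], rule bexI[OF _ fe(1)], rule bexI[OF _ fe(2)], rule bexI[OF _ fe(3)],
      rule bexI[OF _ fe(4)], intro conjI ballI refl)
    show "\<epsilon> * \<epsilon>' = ?K" by (rule prod)
    fix z assume "z \<in> S"
    then have z: "z \<in> gr_even L" "gr_body z \<in> U" using S by auto
    have one: "\<phi> w * x w ^ 1 = \<psi> w" if "\<phi> w * x w = \<psi> w" for \<phi> \<psi> w using that by simp
    show "sf_val pp z = (p1 * z + p0) / (c * z + d)"
      using divide_x[OF z(2), of "sf_val pp z" 1 "p1 * z + p0"] val_times_x[OF z holo(4), of 1 "\<lambda>w. p1 * gc w + p0"] eq(1) sf_val_linear[OF z(1), of p1 p0] by simp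
    show "sf_val pm z = (m1 * z + m0) / (c * z + d)"
      using divide_x[OF z(2), of "sf_val pm z" 1 "m1 * z + m0"] val_times_x[OF z holo(5), of 1 "\<lambda>w. m1 * gc w + m0"] eq(2) sf_val_linear[OF z(1), of m1 m0] by simp
    show "sf_val gp z = \<epsilon> / (c * z + d) + (?fp * z + ?hp) / (c * z + d) ^ 2"
      by (rule val_quadratic_pole[OF z holo(2) eq(3) dec(1,2)])
    show "sf_val gm z = \<epsilon>' / (c * z + d) + (?fm * z + ?hm) / (c * z + d) ^ 2"
      by (rule val_quadratic_pole[OF z holo(3) eq(4) dec(3,4)])
  qed (use \<epsilon> \<epsilon>' units in \<open>auto simp: gr_even_units_iff\<close>)
qed

end

section \<open>The component functions of an automorphism\<close>

definition rational_sections ::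
  "enat \<Rightarrow> int \<Rightarrow> complex set \<Rightarrow> gr \<Rightarrow> gr \<Rightarrow> sfun \<Rightarrow> sfun \<Rightarrow> sfun \<Rightarrow> sfun \<Rightarrow> bool" where
  "rational_sections L0 n U c d gp gm pp pm \<longleftrightarrow>
    (n = 0 \<longrightarrow> rational_zero L0 U c d gp gm pp pm) \<and>
    (n = 1 \<longrightarrow> rational_one L0 U c d gp pp pm) \<and>
    (n = - 1 \<longrightarrow> rational_one L0 U c d gm pm pp) \<and>
    (n \<ge> 2 \<longrightarrow> rational_many L0 (nat n) U c d gp gm pp pm) \<and>
    (n \<le> - 2 \<longrightarrow> rational_many L0 (nat (- n)) U c d gm gp pm pp)"

lemma (in pole_moebius) rational_sections: "rational_sections L0 n (- {w0}) c d gp gm pp pm"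
proof -
  interpret S: pole_moebius L0 "- n" \<kappa> w0 V W f gm gp pm pp h Gm Gp Pm Pp fh gmh gph pmh pph a b c d
    by (rule swapped)
  show ?thesis
    unfolding rational_sections_def using rational_zero rational_one rational_many S.rational_one S.rational_many by auto
qed

lemma rational_sections_swap:
  assumes raw: "rational_sections L0 n (- {0}) c d gp gm pp pm" and mem: "c \<in> gr_even L0" "d \<in> gr_even L0"
    and inf: "\<And>y. y \<noteq> 0 \<Longrightarrow> pp (1 / y) = pph y" "\<And>y. y \<noteq> 0 \<Longrightarrow> pm (1 / y) = pmh y"
      "\<And>y. y \<noteq> 0 \<Longrightarrow> gc (\<kappa> * y powi (n - 1)) * gp (1 / y) = gph y"
      "\<And>y. y \<noteq> 0 \<Longrightarrow> gc (\<kappa> * y powi (- n - 1)) * gm (1 / y) = gmh y"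
  shows "rational_sections L0 n (- {0}) (gc \<i> * d) (gc \<i> * c) gph gmh pph pmh"
  unfolding rational_sections_def
proof (intro conjI impI)
  note raw' = raw[unfolded rational_sections_def]
  show "rational_zero L0 (- {0}) (gc \<i> * d) (gc \<i> * c) gph gmh pph pmh" if n: "n = 0"
  proof (rule rational_zero_swap[where pp = pp and pph = pph and pm = pm and pmh = pmh, OF _ mem inf(1,2)])
    show "rational_zero L0 (- {0}) c d gp gm pp pm" using raw' n by blast
    show "gc (\<kappa> * y powi (- 1)) * gp (1 / y) = gph y" "gc (\<kappa> * y powi (- 1)) * gm (1 / y) = gmh y" if "y \<noteq> 0" for y
      using inf(3,4)[OF that] n by simp_all
  qed
  show "rational_one L0 (- {0}) (gc \<i> * d) (gc \<i> * c) gph pph pmh" if n: "n = 1"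
  proof (rule rational_one_swap[where pp = pp and pph = pph and pm = pm and pmh = pmh, OF _ inf(1,2)])
    show "rational_one L0 (- {0}) c d gp pp pm" using raw' n by blast
    show "gc (\<kappa> * y powi (1 - 1)) * gp (1 / y) = gph y" if "y \<noteq> 0" for y
      using inf(3)[OF that] n by simp
  qed
  show "rational_one L0 (- {0}) (gc \<i> * d) (gc \<i> * c) gmh pmh pph" if n: "n = - 1"
  proof (rule rational_one_swap[where pp = pm and pph = pmh and pm = pp and pmh = pph, OF _ inf(2,1)])
    show "rational_one L0 (- {0}) c d gm pm pp" using raw' n by blast
    show "gc (\<kappa> * y powi (1 - 1)) * gm (1 / y) = gmh y" if "y \<noteq> 0" for y
      using inf(4)[OF that] n by simp
  qed
  show "rational_many L0 (nat n) (- {0}) (gc \<i> * d) (gc \<i> * c) gph gmh pph pmh" if n: "2 \<le> n"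
  proof (rule rational_many_swap[where pp = pp and pph = pph and pm = pm and pmh = pmh, OF _ inf(1,2)])
    show "rational_many L0 (nat n) (- {0}) c d gp gm pp pm" using raw' n by blast
    show "gc (\<kappa> * y powi (int (nat n) - 1)) * gp (1 / y) = gph y"
      "gc (\<kappa> * y powi (- int (nat n) - 1)) * gm (1 / y) = gmh y" if "y \<noteq> 0" for y
      using inf(3,4)[OF that] n by simp_all
  qed (use n in auto)
  show "rational_many L0 (nat (- n)) (- {0}) (gc \<i> * d) (gc \<i> * c) gmh gph pmh pph" if n: "n \<le> - 2"
  proof (rule rational_many_swap[where pp = pm and pph = pmh and pm = pp and pmh = pph, OF _ inf(2,1)])
    show "rational_many L0 (nat (- n)) (- {0}) c d gm gp pm pp" using raw' n by blast
    show "gc (\<kappa> * y powi (int (nat (- n)) - 1)) * gm (1 / y) = gmh y"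
      "gc (\<kappa> * y powi (- int (nat (- n)) - 1)) * gp (1 / y) = gph y" if "y \<noteq> 0" for y
      using inf(3,4)[OF that] n by simp_all
  qed (use n in auto)
qed

lemma eq_extend:
  assumes "gr_holo UNIV \<phi>" "gr_holo UNIV \<psi>" "\<And>w. w \<noteq> w0 \<Longrightarrow> \<phi> w = \<psi> w"
  shows "\<phi> w = \<psi> w"
  by (rule gr_holo_eq_puncture[OF open_UNIV assms(1,2)]) (use assms(3) in auto)

lemma holo_power_x: "gr_holo U \<phi> \<Longrightarrow> gr_holo U (\<lambda>w. \<phi> w * (c * gc w + d) ^ N)"
  by (intro gr_holo_mult gr_holo_power holo_linear)

lemma holo_polynomial: "gr_holo U (\<lambda>w. \<Sum>j\<le>N. r j * gc w ^ j)"
  by (intro gr_holo_sum gr_holo_mult gr_holo_const gr_holo_power gr_holo_gc_id)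

text \<open>If \<open>T\<close> fixes infinity, the formulas extend over the exceptional point by continuity.\<close>

lemma rational_zero_extend:
  assumes "rational_zero L0 (- {w0}) c d gp gm pp pm"
    and ho: "gr_holo UNIV gp" "gr_holo UNIV gm" "gr_holo UNIV pp" "gr_holo UNIV pm"
  shows "rational_zero L0 UNIV c d gp gm pp pm"
proof -
  have iff: "(\<forall>w\<in>- {w0}. pp w * (c * gc w + d) = p1 * gc w + p0 \<and> pm w * (c * gc w + d) = m1 * gc w + m0 \<and>
        gp w * (c * gc w + d) ^ 2 = e1 * gc w + e0 \<and> gm w * (c * gc w + d) ^ 2 = t1 * gc w + t0) \<longleftrightarrow>
      (\<forall>w\<in>UNIV. pp w * (c * gc w + d) = p1 * gc w + p0 \<and> pm w * (c * gc w + d) = m1 * gc w + m0 \<and>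
        gp w * (c * gc w + d) ^ 2 = e1 * gc w + e0 \<and> gm w * (c * gc w + d) ^ 2 = t1 * gc w + t0)" (is "?A \<longleftrightarrow> ?B")
    for p1 p0 m1 m0 e1 e0 t1 t0
  proof
    assume a: ?A
    show ?B
    proof (intro ballI conjI)
      fix w
      show "pp w * (c * gc w + d) = p1 * gc w + p0"
        by (rule eq_extend[OF gr_holo_mult[OF ho(3) holo_linear] holo_linear]) (use a in auto)
      show "pm w * (c * gc w + d) = m1 * gc w + m0"
        by (rule eq_extend[OF gr_holo_mult[OF ho(4) holo_linear] holo_linear]) (use a in auto)
      show "gp w * (c * gc w + d) ^ 2 = e1 * gc w + e0"
        by (rule eq_extend[OF holo_power_x[OF ho(1)] holo_linear]) (use a in auto)
      show "gm w * (c * gc w + d) ^ 2 = t1 * gc w + t0"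
        by (rule eq_extend[OF holo_power_x[OF ho(2)] holo_linear]) (use a in auto)
    qed
  qed blast
  show ?thesis using assms(1) unfolding rational_zero_def iff .
qed

lemma rational_one_extend:
  assumes "rational_one L0 (- {w0}) c d gp pp pm"
    and ho: "gr_holo UNIV gp" "gr_holo UNIV pp" "gr_holo UNIV pm"
  shows "rational_one L0 UNIV c d gp pp pm"
proof -
  have quad: "gr_holo UNIV (\<lambda>w. m2 * gc w ^ 2 + m1 * gc w + m0)" for m2 m1 m0
    by (intro gr_holo_add gr_holo_mult gr_holo_const gr_holo_power gr_holo_gc_id)
  have iff: "(\<forall>w\<in>- {w0}. pp w = p0 \<and> pm w * (c * gc w + d) ^ 2 = m2 * gc w ^ 2 + m1 * gc w + m0 \<and> gp w = e) \<longleftrightarrow>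
      (\<forall>w\<in>UNIV. pp w = p0 \<and> pm w * (c * gc w + d) ^ 2 = m2 * gc w ^ 2 + m1 * gc w + m0 \<and> gp w = e)" (is "?A \<longleftrightarrow> ?B")
    for p0 m2 m1 m0 e
  proof
    assume a: ?A
    show ?B
    proof (intro ballI conjI)
      fix w
      show "pp w = p0" by (rule eq_extend[OF ho(2) gr_holo_const]) (use a in auto)
      show "gp w = e" by (rule eq_extend[OF ho(1) gr_holo_const]) (use a in auto)
      show "pm w * (c * gc w + d) ^ 2 = m2 * gc w ^ 2 + m1 * gc w + m0"
        by (rule eq_extend[OF holo_power_x[OF ho(3)] quad]) (use a in auto)
    qed
  qed blast
  show ?thesis using assms(1) unfolding rational_one_def iff .
qed

lemma rational_many_extend:
  assumes "rational_many L0 k (- {w0}) c d gp gm pp pm"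
    and ho: "gr_holo UNIV gp" "gr_holo UNIV gm" "gr_holo UNIV pp" "gr_holo UNIV pm"
  shows "rational_many L0 k UNIV c d gp gm pp pm"
proof -
  have iff: "(\<forall>w\<in>- {w0}. pp w = 0 \<and> pm w * (c * gc w + d) ^ (k + 1) = (\<Sum>j\<le>k + 1. r j * gc w ^ j) \<and>
        gp w = e * (c * gc w + d) ^ (k - 1) \<and> gm w * (c * gc w + d) ^ (k + 1) = e') \<longleftrightarrow>
      (\<forall>w\<in>UNIV. pp w = 0 \<and> pm w * (c * gc w + d) ^ (k + 1) = (\<Sum>j\<le>k + 1. r j * gc w ^ j) \<and>
        gp w = e * (c * gc w + d) ^ (k - 1) \<and> gm w * (c * gc w + d) ^ (k + 1) = e')" (is "?A \<longleftrightarrow> ?B")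
    for r e e'
  proof
    assume a: ?A
    show ?B
    proof (intro ballI conjI)
      fix w
      show "pp w = 0" by (rule eq_extend[OF ho(3) gr_holo_const]) (use a in auto)
      show "pm w * (c * gc w + d) ^ (k + 1) = (\<Sum>j\<le>k + 1. r j * gc w ^ j)"
        by (rule eq_extend[OF holo_power_x[OF ho(4)] holo_polynomial], rule a[rule_format, THEN conjunct2, THEN conjunct1]) simp
      show "gp w = e * (c * gc w + d) ^ (k - 1)"
        by (rule eq_extend[OF ho(1) holo_power_x[OF gr_holo_const]]) (use a in auto)
      show "gm w * (c * gc w + d) ^ (k + 1) = e'"
        by (rule eq_extend[OF holo_power_x[OF ho(2)] gr_holo_const], rule a[rule_format, THEN conjunct2, THEN conjunct2, THEN conjunct2]) simp
    qed
  qed blast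
  show ?thesis using assms(1) unfolding rational_many_def iff .
qed

lemma rational_sections_extend:
  assumes "rational_sections L0 n (- {w0}) c d gp gm pp pm"
    and ho: "gr_holo UNIV gp" "gr_holo UNIV gm" "gr_holo UNIV pp" "gr_holo UNIV pm"
  shows "rational_sections L0 n UNIV c d gp gm pp pm"
  unfolding rational_sections_def
proof (intro conjI impI)
  note raw = assms(1)[unfolded rational_sections_def]
  show "rational_zero L0 UNIV c d gp gm pp pm" if "n = 0"
    by (rule rational_zero_extend[OF _ ho, where ?w0.0 = w0]) (use raw that in blast)
  show "rational_one L0 UNIV c d gp pp pm" if "n = 1"
    by (rule rational_one_extend[OF _ ho(1,3,4), where ?w0.0 = w0]) (use raw that in blast)
  show "rational_one L0 UNIV c d gm pm pp" if "n = - 1"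
    by (rule rational_one_extend[OF _ ho(2,4,3), where ?w0.0 = w0]) (use raw that in blast)
  show "rational_many L0 (nat n) UNIV c d gp gm pp pm" if "2 \<le> n"
    by (rule rational_many_extend[OF _ ho, where ?w0.0 = w0]) (use raw that in blast)
  show "rational_many L0 (nat (- n)) UNIV c d gm gp pm pp" if "n \<le> - 2"
    by (rule rational_many_extend[OF _ ho(2,1,4,3), where ?w0.0 = w0]) (use raw that in blast)
qed

context n2_sphere_charts
begin

lemma body_dom:
  assumes c: "c \<in> {Delta, Upsilon}" and V: "\<forall>y\<in>fst c. R y \<in> fst d \<longleftrightarrow> spoint_body (snd c y) \<in> V"
  shows "spoint_body ` dom (coord_expr c d R) = V"
proof -
  have "\<exists>y\<in>fst c. spoint_body (snd c y) = w" for w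
    using chart_point[OF c gc_superspace[OF gr_zero_mem(2) gr_zero_mem(2), of w]] by (metis spoint_body_gc)
  then show ?thesis unfolding coord_expr_body_dom[OF c] using V by (auto, metis)
qed

lemma coord_expr_superconformal:
  assumes T: "T \<in> Aut" and d: "d = Delta \<or> d = Upsilon"
  shows "n2_superconformal L (coord_expr d Delta T)"
proof -
  obtain c c' \<kappa> w0 where cp: "chart_pair c c' \<kappa>"
    and A: "\<forall>y\<in>fst c. T y \<in> fst Delta \<longleftrightarrow> spoint_body (snd c y) \<noteq> w0"
    and B: "\<exists>y\<in>fst c'. spoint_body (snd c' y) = 0 \<and> T y \<in> fst Delta"
    and "c = Delta \<or> c = Upsilon \<and> w0 = 0 \<and> (\<forall>y\<in>fst Delta. T y \<in> fst Delta)"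
    by (rule pole_configuration[OF T])
  have c: "c \<in> {Delta, Upsilon}" by (rule chart_pair_mem[OF cp, THEN conjunct1])
  obtain u where u: "u \<in> fst c" "snd c u = (gc (w0 + 1), 0, 0)"
    by (rule chart_point[OF c gc_superspace[OF gr_zero_mem(2) gr_zero_mem(2)]])
  have "T u \<in> fst Delta" using A[rule_format, OF u(1)] unfolding u(2) spoint_body_gc by simp
  with u(1) have y: "\<exists>y\<in>fst c. T y \<in> fst Delta" by (rule bexI[rotated])
  have y': "\<exists>y\<in>fst c'. T y \<in> fst Delta" using B by blast
  have "\<exists>y\<in>fst Delta. T y \<in> fst Delta" "\<exists>y\<in>fst Upsilon. T y \<in> fst Delta"
    using cp[unfolded chart_pair_def] y y' by (elim disjE conjE; simp)+
  then have "n2_superconformal L (coord_expr Delta Delta T)" "n2_superconformal L (coord_expr Upsilon Delta T)"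
    by (auto elim!: bexE intro!: chartwise_superconformalD[OF Aut_chartwise_superconformal(1)[OF T]])
  then show ?thesis using d by blast
qed

text \<open>If \<open>Delta\<close> contains the pole, its coordinate is the source coordinate of \<open>pole_data\<close>.  Otherwise the
  given component functions are those of the other source coordinate, \<open>fh\<close> and so on, and the domain
  is all of \<open>\<complex>\<close>; the formulas hold for \<open>y = 1 / w \<noteq> 0\<close> by substitution and at \<open>0\<close> by continuity.\<close>

lemma Aut_rational:
  assumes T: "T \<in> Aut" and comp: "n2_components L (coord_expr Delta Delta T) f gp gm pp pm"
  defines "U \<equiv> spoint_body ` dom (coord_expr Delta Delta T)"
  shows "\<exists>a b c d w0. rational_data (L - 2) w0 U f gp gm pp pm a b c d \<and> rational_sections (L - 2) n U c d gp gm pp pm"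
proof -
  obtain c c' \<kappa> w0 where cp: "chart_pair c c' \<kappa>"
    and A: "\<forall>y\<in>fst c. T y \<in> fst Delta \<longleftrightarrow> spoint_body (snd c y) \<noteq> w0"
    and B: "\<exists>y\<in>fst c'. spoint_body (snd c' y) = 0 \<and> T y \<in> fst Delta"
    and cases: "c = Delta \<or> c = Upsilon \<and> w0 = 0 \<and> (\<forall>y\<in>fst Delta. T y \<in> fst Delta)"
    by (rule pole_configuration[OF T])
  have op: "openin (dewitt L) (dom (coord_expr Delta Delta T))"
    using coord_expr_superconformal[OF T, of Delta] by (simp add: n2_superconformal_def)
  have ex: "\<exists>f gp gm pp pm. n2_components L (coord_expr Upsilon Delta T) f gp gm pp pm"
    using n2_components_exist[OF L coord_expr_superconformal[OF T, of Upsilon]] by simp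
  note C = n2_componentsD[OF comp op, folded U_def]
  have data: "rational_data (L - 2) w0 U f gp gm pp pm a b c d"
    if "- {w0} \<subseteq> U" "a \<in> gr_even (L - 2)" "b \<in> gr_even (L - 2)" "c \<in> gr_even (L - 2)" "d \<in> gr_even (L - 2)"
      "a * d - b * c = 1" "\<And>w. w \<in> U \<Longrightarrow> gr_body (c * gc w + d) \<noteq> 0"
      "\<And>w. w \<in> U \<Longrightarrow> f w * (c * gc w + d) = a * gc w + b" for a b c d
    by unfold_locales (fact C(1-12) that)+
  show ?thesis
  proof (cases "c = Delta")
    case True
    have c': "c' = Upsilon" using cp True sphere by (auto simp: chart_pair_def)
    obtain fh gph gmh pph pmh where comp3: "n2_components L (coord_expr c' Delta T) fh gph gmh pph pmh"
      using ex c' by blast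
    have U: "U = - {w0}" unfolding U_def by (rule body_dom) (use A True in auto)
    obtain V h Gp Gm Pp Pm where pd: "pole_data (L - 2) n \<kappa> w0 V (spoint_body ` dom (coord_expr c' Delta T))
      f gp gm pp pm h Gp Gm Pp Pm fh gph gmh pph pmh"
      using pole_data_exists[OF T cp A B _ comp3] comp True by blast
    interpret P: pole_data "L - 2" n \<kappa> w0 V "spoint_body ` dom (coord_expr c' Delta T)"
      f gp gm pp pm h Gp Gm Pp Pm fh gph gmh pph pmh by (rule pd)
    obtain a b c d where m: "a \<in> gr_even (L - 2)" "b \<in> gr_even (L - 2)" "c \<in> gr_even (L - 2)" "d \<in> gr_even (L - 2)"
      "a * d - b * c = 1" "gr_body c \<noteq> 0" "\<forall>w. w \<noteq> w0 \<longrightarrow> gr_body (c * gc w + d) \<noteq> 0"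
      "gr_body (c * gc w0 + d) = 0" "\<forall>w. w \<noteq> w0 \<longrightarrow> f w * (c * gc w + d) = a * gc w + b"
      by (rule P.moebius)
    interpret M: pole_moebius "L - 2" n \<kappa> w0 V "spoint_body ` dom (coord_expr c' Delta T)"
      f gp gm pp pm h Gp Gm Pp Pm fh gph gmh pph pmh a b c d
      by unfold_locales (use m in blast)+
    have "rational_data (L - 2) w0 U f gp gm pp pm a b c d"
      by (rule data) (use m U in auto)
    moreover have "rational_sections (L - 2) n U c d gp gm pp pm" unfolding U by (rule M.rational_sections)
    ultimately show ?thesis by blast
  next
    case False
    then have w0: "w0 = 0" and TD: "\<forall>y\<in>fst Delta. T y \<in> fst Delta" and c: "c = Upsilon" using cases by auto
    have c': "c' = Delta" using cp c False by (auto simp: chart_pair_def)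
    have U: "U = UNIV" unfolding U_def by (rule body_dom) (use TD in auto)
    obtain f1 gp1 gm1 pp1 pm1 where comp1: "n2_components L (coord_expr c Delta T) f1 gp1 gm1 pp1 pm1"
      using ex c by blast
    obtain V h Gp Gm Pp Pm where pd: "pole_data (L - 2) n \<kappa> w0 V (spoint_body ` dom (coord_expr c' Delta T))
      f1 gp1 gm1 pp1 pm1 h Gp Gm Pp Pm f gp gm pp pm"
      using pole_data_exists[OF T cp A B comp1] comp c' by blast
    interpret P: pole_data "L - 2" n \<kappa> 0 V UNIV f1 gp1 gm1 pp1 pm1 h Gp Gm Pp Pm f gp gm pp pm
      using pd unfolding w0 c' U_def[symmetric] U .
    obtain a b c d where m: "a \<in> gr_even (L - 2)" "b \<in> gr_even (L - 2)" "c \<in> gr_even (L - 2)" "d \<in> gr_even (L - 2)"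
      "a * d - b * c = 1" "gr_body c \<noteq> 0" "\<forall>w. w \<noteq> 0 \<longrightarrow> gr_body (c * gc w + d) \<noteq> 0"
      "gr_body (c * gc 0 + d) = 0" "\<forall>w. w \<noteq> 0 \<longrightarrow> f1 w * (c * gc w + d) = a * gc w + b"
      by (rule P.moebius)
    interpret M: pole_moebius "L - 2" n \<kappa> 0 V UNIV f1 gp1 gm1 pp1 pm1 h Gp Gm Pp Pm f gp gm pp pm a b c d
      by unfold_locales (use m in blast)+
    have "rational_sections (L - 2) n (- {0}) (gc \<i> * d) (gc \<i> * c) gp gm pp pm"
      by (rule rational_sections_swap[OF M.rational_sections m(3,4) P.infinity(2-5)]) auto
    then have "rational_sections (L - 2) n U (gc \<i> * d) (gc \<i> * c) gp gm pp pm"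
      using rational_sections_extend C(3-6) unfolding U by blast
    moreover have "rational_data (L - 2) w0 U f gp gm pp pm (gc \<i> * b) (gc \<i> * a) (gc \<i> * d) (gc \<i> * c)"
    proof (rule data)
      have "gc \<i> * b * (gc \<i> * c) - gc \<i> * a * (gc \<i> * d) = gc (\<i> * \<i>) * (b * c - a * d)"
        unfolding gc_move by (simp only: right_diff_distrib)
      also have "gc (\<i> * \<i>) = - 1" using gc_diff[of 0 1] by simp
      also have "- 1 * (b * c - a * d) = a * d - b * c" by simp
      finally show "gc \<i> * b * (gc \<i> * c) - gc \<i> * a * (gc \<i> * d) = 1" using m(5) by simp
      show "gr_body (gc \<i> * d * gc w + gc \<i> * c) \<noteq> 0" for w
      proof (cases "w = 0")
        case False
        then show ?thesis unfolding denominator_swap[OF False] using m(7)[rule_format, of "1 / w"] False by simp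
      qed (use m(6) in simp)
      show "f w * (gc \<i> * d * gc w + gc \<i> * c) = gc \<i> * b * gc w + gc \<i> * a" for w
      proof (rule eq_extend[where ?w0.0 = 0 and \<phi> = "\<lambda>w. f w * (gc \<i> * d * gc w + gc \<i> * c)"
            and \<psi> = "\<lambda>w. gc \<i> * b * gc w + gc \<i> * a"])
        show "gr_holo UNIV (\<lambda>w. f w * (gc \<i> * d * gc w + gc \<i> * c))"
          using C(2) unfolding U by (intro gr_holo_mult holo_linear)
        show "gr_holo UNIV (\<lambda>w. gc \<i> * b * gc w + gc \<i> * a)" by (rule holo_linear)
        fix w :: complex assume w: "w \<noteq> 0"
        have "f w * (gc \<i> * d * gc w + gc \<i> * c) = gc (\<i> * w) * (f1 (1 / w) * (c * gc (1 / w) + d))"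
          unfolding denominator_swap[OF w] gc_left_commute using P.infinity(1)[of w] w by simp
        also have "f1 (1 / w) * (c * gc (1 / w) + d) = a * gc (1 / w) + b" using m(9) w by simp
        finally show "f w * (gc \<i> * d * gc w + gc \<i> * c) = gc \<i> * b * gc w + gc \<i> * a"
          unfolding denominator_swap[OF w] .
      qed
    qed (use m U in auto)
    ultimately show ?thesis by blast
  qed
qed

section \<open>Uniqueness\<close>

text \<open>Over a single point of the sphere, agreement follows from agreement around it.\<close>

lemma Aut_agree_extend:
  assumes T: "T \<in> Aut" and T': "T' \<in> Aut" and cd: "c \<in> {Delta, Upsilon}" "d \<in> {Delta, Upsilon}"
    and y: "y \<in> fst c" "T y \<in> fst d" "T' y \<in> fst d"
    and agree: "\<And>y'. y' \<in> fst c \<Longrightarrow> spoint_body (snd c y') \<noteq> spoint_body (snd c y) \<Longrightarrow> T y' = T' y'"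
  shows "T y = T' y"
proof -
  let ?H = "coord_expr c d T" and ?H' = "coord_expr c d T'"
  have H: "n2_superconformal L ?H" "n2_superconformal L ?H'"
    using chartwise_superconformalD[OF Aut_chartwise_superconformal(1)[OF T] cd y(1,2)] chartwise_superconformalD[OF Aut_chartwise_superconformal(1)[OF T'] cd y(1,3)] .
  then have op: "openin (dewitt L) (dom ?H)" "openin (dewitt L) (dom ?H')" by (auto simp: n2_superconformal_def)
  let ?V = "spoint_body ` dom ?H \<inter> spoint_body ` dom ?H'"
  note val = coord_expr_chart[OF cd(1) y(1), of d T] coord_expr_chart[OF cd(1) y(1), of d T']
  have "?H (snd c y) = ?H' (snd c y)"
  proof (rule n2_superconformal_unique_extension[OF L H])
    show "open ?V" using openin_dewitt(1)[OF op(1)] openin_dewitt(1)[OF op(2)] by blast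
    show "snd c y \<in> superspace L" by (rule chart_superspace[OF cd(1) y(1)])
    have "snd c y \<in> dom ?H" "snd c y \<in> dom ?H'" using val y by auto
    then show "spoint_body (snd c y) \<in> ?V" by blast
    fix x assume x: "x \<in> superspace L" "spoint_body x \<noteq> spoint_body (snd c y)"
    obtain y' where y': "y' \<in> fst c" "snd c y' = x" by (rule chart_point[OF cd(1) x(1)])
    then have "T y' = T' y'" using agree x(2) by blast
    then show "?H x = ?H' x"
      using coord_expr_chart[OF cd(1) y'(1), of d T] coord_expr_chart[OF cd(1) y'(1), of d T'] y'(2) by simp
  qed auto
  then have "snd d (T y) = snd d (T' y)" using val y by simp
  then show ?thesis using chart_bij[OF cd(2)] y by (meson bij_betw_imp_inj_on inj_onD)
qed

text \<open>The point sent to infinity and the point at infinity itself remain to be treated.  On bodies both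
  automorphisms send the same point of \<open>Delta\<close>, if any, to infinity, so at a missing point their values
  lie in a common chart, where \<open>Aut_agree_extend\<close> applies.\<close>

lemma Aut_determined:
  assumes T: "T \<in> Aut" and T': "T' \<in> Aut"
    and eq: "coord_expr Delta Delta T' = coord_expr Delta Delta T" and y: "y \<in> topspace X"
  shows "T' y = T y"
proof -
  have X: "R u \<in> topspace X" if "R \<in> Aut" "u \<in> topspace X" for R u
    using that by (auto simp: n2_Aut_def dest: bij_betwE)
  have DX: "u \<in> topspace X" if "u \<in> fst Delta" for u using that chart_cover by blast
  have sphere_body: "u \<in> fst Delta \<longleftrightarrow> sphere_body u \<noteq> None" for u by (simp add: sphere_body_def)
  have dom: "T' u \<in> fst Delta \<longleftrightarrow> T u \<in> fst Delta" if u: "u \<in> fst Delta" for u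
    using coord_expr_chart[of Delta u Delta T] coord_expr_chart[of Delta u Delta T'] u eq by (auto split: if_splits)
  have inner: "T' u = T u" if u: "u \<in> fst Delta" "T u \<in> fst Delta" for u
  proof -
    have "snd Delta (T' u) = snd Delta (T u)"
      using coord_expr_chart[of Delta u Delta T] coord_expr_chart[of Delta u Delta T'] u eq dom[OF u(1)] by auto
    then show ?thesis using chart_bij[of Delta] u dom[OF u(1)] by (meson bij_betw_imp_inj_on inj_onD insertI1)
  qed
  have D: "T' u = T u" if u: "u \<in> fst Delta" for u
  proof (cases "T u \<in> fst Delta")
    case False
    have U: "T u \<in> fst Upsilon" "T' u \<in> fst Upsilon"
      using False dom[OF u] X[OF T DX[OF u]] X[OF T' DX[OF u]] chart_cover by blast+
    show ?thesis
    proof (rule Aut_agree_extend[OF T' T _ _ u U(2,1)])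
      fix v assume v: "v \<in> fst Delta" "spoint_body (snd Delta v) \<noteq> spoint_body (snd Delta u)"
      then have "sphere_body v \<noteq> sphere_body u" using sphere_body_eq_iff[of Delta v u] u by simp
      then have "sphere_body (T v) \<noteq> sphere_body (T u)" using sphere_body_Aut[OF T DX[OF v(1)] DX[OF u]] by simp
      then have "T v \<in> fst Delta" using False sphere_body[of "T v"] sphere_body[of "T u"] by simp
      then show "T' v = T v" by (rule inner[OF v(1)])
    qed auto
  qed (rule inner[OF u])
  show ?thesis
  proof (cases "y \<in> fst Delta")
    case False
    then have U: "y \<in> fst Upsilon" and sy: "sphere_body y = None" using y chart_cover by (auto simp: sphere_body_def)
    \<comment> \<open>By injectivity on bodies and surjectivity, exactly one point of the sphere is sent to infinity.\<close>
    have pole: "R y \<in> fst Delta \<longleftrightarrow> (\<exists>u\<in>fst Delta. R u \<notin> fst Delta)" if R: "R \<in> Aut" for R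
    proof
      assume Ry: "R y \<in> fst Delta"
      have "bij_betw R (topspace X) (topspace X)" using R unfolding n2_Aut_def by simp
      then have "y \<in> R ` topspace X" using y by (simp only: bij_betw_imp_surj_on)
      then obtain u where u: "y = R u" "u \<in> topspace X" by (rule imageE)
      have "R u \<notin> fst Delta" using False u(1) by simp
      moreover have "sphere_body (R u) \<noteq> sphere_body (R y)"
      proof -
        have "sphere_body (R u) = None" using sy unfolding u(1) .
        moreover have "sphere_body (R y) \<noteq> None" using Ry unfolding sphere_body .
        ultimately show ?thesis by metis
      qed
      then have "sphere_body u \<noteq> sphere_body y" using sphere_body_Aut[OF R u(2) y] by simp
      then have "u \<in> fst Delta" unfolding sphere_body sy .
      ultimately show "\<exists>u\<in>fst Delta. R u \<notin> fst Delta" by (rule_tac bexI)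
    next
      assume "\<exists>u\<in>fst Delta. R u \<notin> fst Delta"
      then obtain u where u: "u \<in> fst Delta" "R u \<notin> fst Delta" by (rule bexE)
      have "sphere_body u \<noteq> sphere_body y" using u(1) unfolding sphere_body sy .
      then have "sphere_body (R u) \<noteq> sphere_body (R y)" using sphere_body_Aut[OF R DX[OF u(1)] y] by simp
      then show "R y \<in> fst Delta" using u(2) sphere_body[of "R u"] sphere_body[of "R y"] by metis
    qed
    have iff: "T' y \<in> fst Delta \<longleftrightarrow> T y \<in> fst Delta"
      unfolding pole[OF T] pole[OF T'] by (simp only: dom cong: bex_cong)
    have "\<exists>e\<in>{Delta, Upsilon}. T' y \<in> fst e \<and> T y \<in> fst e"
    proof (cases "T y \<in> fst Delta")
      case True
      then show ?thesis using iff by simp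
    next
      case False
      then show ?thesis using iff X[OF T y] X[OF T' y] chart_cover[of "T y"] chart_cover[of "T' y"] by simp
    qed
    then obtain e where e: "e \<in> {Delta, Upsilon}" "T' y \<in> fst e" "T y \<in> fst e"
      by (elim bexE conjE) (rule that)
    show ?thesis
    proof (rule Aut_agree_extend[OF T' T _ e(1) U e(2,3)])
      fix v assume v: "v \<in> fst Upsilon" "spoint_body (snd Upsilon v) \<noteq> spoint_body (snd Upsilon y)"
      then have "sphere_body v \<noteq> sphere_body y" using sphere_body_eq_iff[of Upsilon v y] U by simp
      then have "v \<in> fst Delta" unfolding sphere_body sy .
      then show "T' v = T v" by (rule D)
    qed simp
  qed (rule D)
qed

end

section \<open>The classification\<close>

text \<open>The case \<open>n = 1\<close> with the odd variables exchanged; \<open>m0\<close> moves past an odd factor, whence the sign.\<close>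

lemma components_minus_one:
  assumes data: "rational_data (L - 2) w0 U f gp gm pp pm a b c d" and raw: "rational_one (L - 2) U c d gm pm pp"
    and S: "\<forall>z\<in>S. z \<in> gr_even L \<and> gr_body z \<in> U"
  shows "\<exists>p2\<in>gr_odd (L - 2). \<exists>p1\<in>gr_odd (L - 2). \<exists>p0\<in>gr_odd (L - 2). \<exists>m0\<in>gr_odd (L - 2).
      \<exists>e\<in>gr_even_units (L - 2). \<forall>z\<in>S.
      sf_val pp z = (p2 * z ^ 2 + p1 * z + p0) / (c * z + d) ^ 2 \<and> sf_val pm z = m0 \<and>
      sf_val gp z = 1 / (e * (c * z + d) ^ 2)
        - (2 * p2 * d * z - p1 * (c * z - d) - 2 * p0 * c) * m0 / (e * (c * z + d) ^ 3) \<and>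
      sf_val gm z = e"
proof -
  interpret rational_data "L - 2" w0 U f gp gm pp pm a b c d by (rule data)
  interpret S: rational_data "L - 2" w0 U f gm gp pm pp a b c d by (rule swapped)
  obtain m0 p2 p1 p0 e where o: "m0 \<in> gr_odd (L - 2)" "p2 \<in> gr_odd (L - 2)" "p1 \<in> gr_odd (L - 2)"
      "p0 \<in> gr_odd (L - 2)" "e \<in> gr_even_units (L - 2)"
    and all: "\<forall>z\<in>S. sf_val pm z = m0 \<and> sf_val pp z = (p2 * z ^ 2 + p1 * z + p0) / (c * z + d) ^ 2 \<and>
      sf_val gm z = e \<and> sf_val gp z = 1 / (e * (c * z + d) ^ 2)
        + m0 * (2 * p2 * d * z - p1 * (c * z - d) - 2 * p0 * c) / (e * (c * z + d) ^ 3)"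
    using S.components_one[OF raw S] by (elim bexE) (rule that)
  show ?thesis
  proof (rule bexI[OF _ o(2)], rule bexI[OF _ o(3)], rule bexI[OF _ o(4)], rule bexI[OF _ o(1)], rule bexI[OF _ o(5)],
      rule ballI)
    fix z assume z: "z \<in> S"
    let ?r = "2 * p2 * d * z - p1 * (c * z - d) - 2 * p0 * c"
    have r: "?r \<in> gr_odd L"
    proof -
      have e: "z \<in> gr_even L" "c \<in> gr_even L" "d \<in> gr_even L" using bspec[OF S z] mem gr_even_minus by auto
      have p: "p2 \<in> gr_odd L" "p1 \<in> gr_odd L" "p0 \<in> gr_odd L" using o gr_odd_minus by auto
      have t: "2 * p2 * d * z \<in> gr_odd L" "2 * p0 * c \<in> gr_odd L"
        unfolding mult_2 by (intro gr_odd_even_times gr_odd_add p e)+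
      show ?thesis
        by (rule gr_odd_diff[OF gr_odd_diff[OF t(1) gr_odd_even_times[OF p(2)]] t(2)]) (intro gr_even_diff gr_even_times e)
    qed
    have "m0 * ?r = - (?r * m0)" by (rule gr_odd_anticommute[OF r o(1)])
    then show "sf_val pp z = (p2 * z ^ 2 + p1 * z + p0) / (c * z + d) ^ 2 \<and> sf_val pm z = m0 \<and>
      sf_val gp z = 1 / (e * (c * z + d) ^ 2) - ?r * m0 / (e * (c * z + d) ^ 3) \<and> sf_val gm z = e"
      using all[rule_format, OF z] by (simp only: gr_divide_inverse mult_minus_left add_uminus_conv_diff simp_thms)
  qed
qed

lemma components_all:
  assumes data: "rational_data (L - 2) w0 U f gp gm pp pm a b c d"
    and sec: "rational_sections (L - 2) n U c d gp gm pp pm"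
    and S: "\<forall>z\<in>S. z \<in> gr_even L \<and> gr_body z \<in> U"
  shows "(\<forall>z\<in>S. c * z + d \<in> gr_even_units L \<and> sf_val f z = (a * z + b) / (c * z + d)) \<and>
        (n = 0 \<longrightarrow>
          (\<exists>p1\<in>gr_odd (L - 2). \<exists>p0\<in>gr_odd (L - 2). \<exists>m1\<in>gr_odd (L - 2). \<exists>m0\<in>gr_odd (L - 2).
           \<exists>ep\<in>gr_even_units (L - 2). \<exists>em\<in>gr_even_units (L - 2).
           \<exists>fp\<in>gr_even (L - 2). \<exists>fm\<in>gr_even (L - 2). \<exists>hp\<in>gr_even (L - 2). \<exists>hm\<in>gr_even (L - 2).
             ep * em = 1 - p1 * m0 - m1 * p0 \<and>
             fp = - (ep * p1 * m1 * d) \<and>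
             fm = em * p1 * m1 * d \<and>
             hp = ep * (p0 * m0 * c - (p1 * m0 - m1 * p0) * d - p1 * m1 * p0 * m0 * d) \<and>
             hm = - (em * (p0 * m0 * c - (p1 * m0 - m1 * p0) * d + p1 * m1 * p0 * m0 * d)) \<and>
             (\<forall>z\<in>S.
                sf_val pp z = (p1 * z + p0) / (c * z + d) \<and>
                sf_val pm z = (m1 * z + m0) / (c * z + d) \<and>
                sf_val gp z = ep / (c * z + d) + (fp * z + hp) / (c * z + d) ^ 2 \<and>
                sf_val gm z = em / (c * z + d) + (fm * z + hm) / (c * z + d) ^ 2))) \<and>
        (n = 1 \<longrightarrow>
          (\<exists>p0\<in>gr_odd (L - 2). \<exists>m2\<in>gr_odd (L - 2). \<exists>m1\<in>gr_odd (L - 2). \<exists>m0\<in>gr_odd (L - 2).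
           \<exists>e\<in>gr_even_units (L - 2).
             \<forall>z\<in>S.
                sf_val pp z = p0 \<and>
                sf_val pm z = (m2 * z ^ 2 + m1 * z + m0) / (c * z + d) ^ 2 \<and>
                sf_val gp z = e \<and>
                sf_val gm z = 1 / (e * (c * z + d) ^ 2)
                  + p0 * (2 * m2 * d * z - m1 * (c * z - d) - 2 * m0 * c)
                      / (e * (c * z + d) ^ 3))) \<and>
        (n = - 1 \<longrightarrow>
          (\<exists>p2\<in>gr_odd (L - 2). \<exists>p1\<in>gr_odd (L - 2). \<exists>p0\<in>gr_odd (L - 2). \<exists>m0\<in>gr_odd (L - 2).
           \<exists>e\<in>gr_even_units (L - 2).
             \<forall>z\<in>S.
                sf_val pp z = (p2 * z ^ 2 + p1 * z + p0) / (c * z + d) ^ 2 \<and>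
                sf_val pm z = m0 \<and>
                sf_val gp z = 1 / (e * (c * z + d) ^ 2)
                  - (2 * p2 * d * z - p1 * (c * z - d) - 2 * p0 * c) * m0
                      / (e * (c * z + d) ^ 3) \<and>
                sf_val gm z = e)) \<and>
        (n \<ge> 2 \<longrightarrow>
          (\<exists>q. (\<forall>j\<le>nat (n + 1). q j \<in> gr_odd (L - 2)) \<and>
           (\<exists>e\<in>gr_even_units (L - 2).
             \<forall>z\<in>S.
                sf_val pp z = 0 \<and>
                sf_val pm z = (\<Sum>j\<le>nat (n + 1). q j * z ^ j) / (c * z + d) powi (n + 1) \<and>
                sf_val gp z = e * (c * z + d) powi (n - 1) \<and>
                sf_val gm z = inverse e * (c * z + d) powi (- n - 1)))) \<and>
        (n \<le> - 2 \<longrightarrow>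
          (\<exists>q. (\<forall>j\<le>nat (- n + 1). q j \<in> gr_odd (L - 2)) \<and>
           (\<exists>e\<in>gr_even_units (L - 2).
             \<forall>z\<in>S.
                sf_val pp z = (\<Sum>j\<le>nat (- n + 1). q j * z ^ j) / (c * z + d) powi (- n + 1) \<and>
                sf_val pm z = 0 \<and>
                sf_val gp z = inverse e * (c * z + d) powi (n - 1) \<and>
                sf_val gm z = e * (c * z + d) powi (- n - 1))))"
proof -
  interpret rational_data "L - 2" w0 U f gp gm pp pm a b c d by (rule data)
  interpret S: rational_data "L - 2" w0 U f gm gp pm pp a b c d by (rule swapped)
  note sec' = sec[unfolded rational_sections_def]
  show ?thesis
  proof (intro conjI[OF ballI] conjI[OF impI] impI)
    fix z assume "z \<in> S"
    then have z: "z \<in> gr_even L" "gr_body z \<in> U" using S by auto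
    have "c \<in> gr_even L" "d \<in> gr_even L" using mem gr_even_minus by auto
    then have "c * z + d \<in> gr_even L" by (intro gr_even_add gr_even_times z)
    then show "c * z + d \<in> gr_even_units L \<and> sf_val f z = (a * z + b) / (c * z + d)"
      using val_x[OF z(2)] val_f[OF z] unfolding gr_even_units_iff by (intro conjI)
  next
    assume "n = 0"
    then have "rational_zero (L - 2) U c d gp gm pp pm" by (rule sec'[THEN conjunct1, THEN mp])
    from components_zero[OF this S] show "\<exists>p1\<in>gr_odd (L - 2). \<exists>p0\<in>gr_odd (L - 2). \<exists>m1\<in>gr_odd (L - 2). \<exists>m0\<in>gr_odd (L - 2).
           \<exists>ep\<in>gr_even_units (L - 2). \<exists>em\<in>gr_even_units (L - 2).
           \<exists>fp\<in>gr_even (L - 2). \<exists>fm\<in>gr_even (L - 2). \<exists>hp\<in>gr_even (L - 2). \<exists>hm\<in>gr_even (L - 2).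
             ep * em = 1 - p1 * m0 - m1 * p0 \<and>
             fp = - (ep * p1 * m1 * d) \<and>
             fm = em * p1 * m1 * d \<and>
             hp = ep * (p0 * m0 * c - (p1 * m0 - m1 * p0) * d - p1 * m1 * p0 * m0 * d) \<and>
             hm = - (em * (p0 * m0 * c - (p1 * m0 - m1 * p0) * d + p1 * m1 * p0 * m0 * d)) \<and>
             (\<forall>z\<in>S.
                sf_val pp z = (p1 * z + p0) / (c * z + d) \<and>
                sf_val pm z = (m1 * z + m0) / (c * z + d) \<and>
                sf_val gp z = ep / (c * z + d) + (fp * z + hp) / (c * z + d) ^ 2 \<and>
                sf_val gm z = em / (c * z + d) + (fm * z + hm) / (c * z + d) ^ 2)" .
  next
    assume "n = 1"
    then have "rational_one (L - 2) U c d gp pp pm" by (rule sec'[THEN conjunct2, THEN conjunct1, THEN mp])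
    from components_one[OF this S] show "\<exists>p0\<in>gr_odd (L - 2). \<exists>m2\<in>gr_odd (L - 2). \<exists>m1\<in>gr_odd (L - 2). \<exists>m0\<in>gr_odd (L - 2).
           \<exists>e\<in>gr_even_units (L - 2).
             \<forall>z\<in>S.
                sf_val pp z = p0 \<and>
                sf_val pm z = (m2 * z ^ 2 + m1 * z + m0) / (c * z + d) ^ 2 \<and>
                sf_val gp z = e \<and>
                sf_val gm z = 1 / (e * (c * z + d) ^ 2)
                  + p0 * (2 * m2 * d * z - m1 * (c * z - d) - 2 * m0 * c)
                      / (e * (c * z + d) ^ 3)" .
  next
    assume "n = - 1"
    then have "rational_one (L - 2) U c d gm pm pp" by (rule sec'[THEN conjunct2, THEN conjunct2, THEN conjunct1, THEN mp])
    from components_minus_one[OF data this S] show "\<exists>p2\<in>gr_odd (L - 2). \<exists>p1\<in>gr_odd (L - 2). \<exists>p0\<in>gr_odd (L - 2). \<exists>m0\<in>gr_odd (L - 2).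
           \<exists>e\<in>gr_even_units (L - 2).
             \<forall>z\<in>S.
                sf_val pp z = (p2 * z ^ 2 + p1 * z + p0) / (c * z + d) ^ 2 \<and>
                sf_val pm z = m0 \<and>
                sf_val gp z = 1 / (e * (c * z + d) ^ 2)
                  - (2 * p2 * d * z - p1 * (c * z - d) - 2 * p0 * c) * m0
                      / (e * (c * z + d) ^ 3) \<and>
                sf_val gm z = e" .
  next
    assume n: "2 \<le> n"
    then have r: "rational_many (L - 2) (nat n) U c d gp gm pp pm"
      by (rule sec'[THEN conjunct2, THEN conjunct2, THEN conjunct2, THEN conjunct1, THEN mp])
    have k: "2 \<le> nat n" "nat n + 1 = nat (n + 1)" "int (nat n) = n" using n by simp_all
    from components_many[OF r k(1) S] show "\<exists>q. (\<forall>j\<le>nat (n + 1). q j \<in> gr_odd (L - 2)) \<and>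
           (\<exists>e\<in>gr_even_units (L - 2).
             \<forall>z\<in>S.
                sf_val pp z = 0 \<and>
                sf_val pm z = (\<Sum>j\<le>nat (n + 1). q j * z ^ j) / (c * z + d) powi (n + 1) \<and>
                sf_val gp z = e * (c * z + d) powi (n - 1) \<and>
                sf_val gm z = inverse e * (c * z + d) powi (- n - 1))"
      unfolding k(2,3) .
  next
    assume n: "n \<le> - 2"
    then have r: "rational_many (L - 2) (nat (- n)) U c d gm gp pm pp"
      by (rule sec'[THEN conjunct2, THEN conjunct2, THEN conjunct2, THEN conjunct2, THEN mp])
    have k: "2 \<le> nat (- n)" "nat (- n) + 1 = nat (- n + 1)" "int (nat (- n)) = - n" "- (- n) = n" using n by simp_all
    obtain q e where q: "\<forall>j\<le>nat (- n + 1). q j \<in> gr_odd (L - 2)" "e \<in> gr_even_units (L - 2)"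
      and all: "\<forall>z\<in>S. sf_val pm z = 0 \<and>
                sf_val pp z = (\<Sum>j\<le>nat (- n + 1). q j * z ^ j) / (c * z + d) powi (- n + 1) \<and>
                sf_val gm z = e * (c * z + d) powi (- n - 1) \<and>
                sf_val gp z = inverse e * (c * z + d) powi (n - 1)"
      using S.components_many[OF r k(1) S] unfolding k(2,3,4) by (elim exE conjE bexE) (rule that)
    show "\<exists>q. (\<forall>j\<le>nat (- n + 1). q j \<in> gr_odd (L - 2)) \<and>
           (\<exists>e\<in>gr_even_units (L - 2).
             \<forall>z\<in>S.
                sf_val pp z = (\<Sum>j\<le>nat (- n + 1). q j * z ^ j) / (c * z + d) powi (- n + 1) \<and>
                sf_val pm z = 0 \<and>
                sf_val gp z = inverse e * (c * z + d) powi (n - 1) \<and>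
                sf_val gm z = e * (c * z + d) powi (- n - 1))"
    proof (rule exI[of _ q], rule conjI[OF q(1)], rule bexI[OF _ q(2)], rule ballI)
      fix z assume "z \<in> S"
      note h = all[rule_format, OF this]
      show "sf_val pp z = (\<Sum>j\<le>nat (- n + 1). q j * z ^ j) / (c * z + d) powi (- n + 1) \<and>
                sf_val pm z = 0 \<and>
                sf_val gp z = inverse e * (c * z + d) powi (n - 1) \<and>
                sf_val gm z = e * (c * z + d) powi (- n - 1)"
        by (intro conjI h[THEN conjunct1] h[THEN conjunct2, THEN conjunct1]
            h[THEN conjunct2, THEN conjunct2, THEN conjunct1] h[THEN conjunct2, THEN conjunct2, THEN conjunct2])
    qed
  qed
qed

theorem theorem4p1:
  fixes L :: enat and n :: int and X :: "'s topology"
    and Delta Upsilon :: "'s chart" and T :: "'s \<Rightarrow> 's"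
  assumes L: "2 \<le> L"
    and sphere: "n2_sphere L n X Delta Upsilon"
    and T: "T \<in> n2_Aut L X {Delta, Upsilon}"
  shows "(\<forall>T'\<in>n2_Aut L X {Delta, Upsilon}.
            coord_expr Delta Delta T' = coord_expr Delta Delta T \<longrightarrow> (\<forall>x\<in>topspace X. T' x = T x)) \<and>
    (\<exists>f gp gm pp pm. n2_components L (coord_expr Delta Delta T) f gp gm pp pm) \<and>
    (\<forall>f gp gm pp pm. n2_components L (coord_expr Delta Delta T) f gp gm pp pm \<longrightarrow>
      (\<exists>a\<in>gr_even (L - 2). \<exists>b\<in>gr_even (L - 2). \<exists>c\<in>gr_even (L - 2). \<exists>d\<in>gr_even (L - 2).
        a * d - b * c = 1 \<and>
        (\<forall>z\<in>even_dom (coord_expr Delta Delta T).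
           c * z + d \<in> gr_even_units L \<and> sf_val f z = (a * z + b) / (c * z + d)) \<and>
        (n = 0 \<longrightarrow>
          (\<exists>p1\<in>gr_odd (L - 2). \<exists>p0\<in>gr_odd (L - 2). \<exists>m1\<in>gr_odd (L - 2). \<exists>m0\<in>gr_odd (L - 2).
           \<exists>ep\<in>gr_even_units (L - 2). \<exists>em\<in>gr_even_units (L - 2).
           \<exists>fp\<in>gr_even (L - 2). \<exists>fm\<in>gr_even (L - 2). \<exists>hp\<in>gr_even (L - 2). \<exists>hm\<in>gr_even (L - 2).
             ep * em = 1 - p1 * m0 - m1 * p0 \<and>
             fp = - (ep * p1 * m1 * d) \<and>
             fm = em * p1 * m1 * d \<and>
             hp = ep * (p0 * m0 * c - (p1 * m0 - m1 * p0) * d - p1 * m1 * p0 * m0 * d) \<and>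
             hm = - (em * (p0 * m0 * c - (p1 * m0 - m1 * p0) * d + p1 * m1 * p0 * m0 * d)) \<and>
             (\<forall>z\<in>even_dom (coord_expr Delta Delta T).
                sf_val pp z = (p1 * z + p0) / (c * z + d) \<and>
                sf_val pm z = (m1 * z + m0) / (c * z + d) \<and>
                sf_val gp z = ep / (c * z + d) + (fp * z + hp) / (c * z + d) ^ 2 \<and>
                sf_val gm z = em / (c * z + d) + (fm * z + hm) / (c * z + d) ^ 2))) \<and>
        (n = 1 \<longrightarrow>
          (\<exists>p0\<in>gr_odd (L - 2). \<exists>m2\<in>gr_odd (L - 2). \<exists>m1\<in>gr_odd (L - 2). \<exists>m0\<in>gr_odd (L - 2).
           \<exists>e\<in>gr_even_units (L - 2).
             \<forall>z\<in>even_dom (coord_expr Delta Delta T).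
                sf_val pp z = p0 \<and>
                sf_val pm z = (m2 * z ^ 2 + m1 * z + m0) / (c * z + d) ^ 2 \<and>
                sf_val gp z = e \<and>
                sf_val gm z = 1 / (e * (c * z + d) ^ 2)
                  + p0 * (2 * m2 * d * z - m1 * (c * z - d) - 2 * m0 * c)
                      / (e * (c * z + d) ^ 3))) \<and>
        (n = - 1 \<longrightarrow>
          (\<exists>p2\<in>gr_odd (L - 2). \<exists>p1\<in>gr_odd (L - 2). \<exists>p0\<in>gr_odd (L - 2). \<exists>m0\<in>gr_odd (L - 2).
           \<exists>e\<in>gr_even_units (L - 2).
             \<forall>z\<in>even_dom (coord_expr Delta Delta T).
                sf_val pp z = (p2 * z ^ 2 + p1 * z + p0) / (c * z + d) ^ 2 \<and>
                sf_val pm z = m0 \<and>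
                sf_val gp z = 1 / (e * (c * z + d) ^ 2)
                  - (2 * p2 * d * z - p1 * (c * z - d) - 2 * p0 * c) * m0
                      / (e * (c * z + d) ^ 3) \<and>
                sf_val gm z = e)) \<and>
        (n \<ge> 2 \<longrightarrow>
          (\<exists>q. (\<forall>j\<le>nat (n + 1). q j \<in> gr_odd (L - 2)) \<and>
           (\<exists>e\<in>gr_even_units (L - 2).
             \<forall>z\<in>even_dom (coord_expr Delta Delta T).
                sf_val pp z = 0 \<and>
                sf_val pm z = (\<Sum>j\<le>nat (n + 1). q j * z ^ j) / (c * z + d) powi (n + 1) \<and>
                sf_val gp z = e * (c * z + d) powi (n - 1) \<and>
                sf_val gm z = inverse e * (c * z + d) powi (- n - 1)))) \<and>
        (n \<le> - 2 \<longrightarrow>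
          (\<exists>q. (\<forall>j\<le>nat (- n + 1). q j \<in> gr_odd (L - 2)) \<and>
           (\<exists>e\<in>gr_even_units (L - 2).
             \<forall>z\<in>even_dom (coord_expr Delta Delta T).
                sf_val pp z = (\<Sum>j\<le>nat (- n + 1). q j * z ^ j) / (c * z + d) powi (- n + 1) \<and>
                sf_val pm z = 0 \<and>
                sf_val gp z = inverse e * (c * z + d) powi (n - 1) \<and>
                sf_val gm z = e * (c * z + d) powi (- n - 1))))))"
proof -
  interpret n2_sphere_charts L n X Delta Upsilon by unfold_locales (rule L sphere)+
  let ?H = "coord_expr Delta Delta T"
  have H: "n2_superconformal L ?H" by (rule coord_expr_superconformal[OF T]) simp
  then have op: "openin (dewitt L) (dom ?H)" by (simp add: n2_superconformal_def)
  have S: "\<forall>z\<in>even_dom ?H. z \<in> gr_even L \<and> gr_body z \<in> spoint_body ` dom ?H"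
  proof
    fix z assume "z \<in> even_dom ?H"
    then have z: "(z, 0, 0) \<in> dom ?H" unfolding even_dom_def by simp
    moreover have "(z, 0, 0) \<in> superspace L" using z openin_dewitt(2)[OF op] by blast
    ultimately show "z \<in> gr_even L \<and> gr_body z \<in> spoint_body ` dom ?H" by (force simp: superspace_def spoint_body_def)
  qed
  show ?thesis
  proof (rule conjI, intro ballI impI, rule Aut_determined[OF T], assumption+, rule conjI[OF n2_components_exist[OF L H]],
      intro allI impI)
    fix f gp gm pp pm assume comp: "n2_components L ?H f gp gm pp pm"
    obtain a b c d w0 where data: "rational_data (L - 2) w0 (spoint_body ` dom ?H) f gp gm pp pm a b c d"
      and sec: "rational_sections (L - 2) n (spoint_body ` dom ?H) c d gp gm pp pm"
      using Aut_rational[OF T comp] by (elim exE conjE) (rule that)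
    interpret R: rational_data "L - 2" w0 "spoint_body ` dom ?H" f gp gm pp pm a b c d by (rule data)
    show "(\<exists>a\<in>gr_even (L - 2). \<exists>b\<in>gr_even (L - 2). \<exists>c\<in>gr_even (L - 2). \<exists>d\<in>gr_even (L - 2).
        a * d - b * c = 1 \<and>
        (\<forall>z\<in>even_dom (coord_expr Delta Delta T).
           c * z + d \<in> gr_even_units L \<and> sf_val f z = (a * z + b) / (c * z + d)) \<and>
        (n = 0 \<longrightarrow>
          (\<exists>p1\<in>gr_odd (L - 2). \<exists>p0\<in>gr_odd (L - 2). \<exists>m1\<in>gr_odd (L - 2). \<exists>m0\<in>gr_odd (L - 2).
           \<exists>ep\<in>gr_even_units (L - 2). \<exists>em\<in>gr_even_units (L - 2).
           \<exists>fp\<in>gr_even (L - 2). \<exists>fm\<in>gr_even (L - 2). \<exists>hp\<in>gr_even (L - 2). \<exists>hm\<in>gr_even (L - 2).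
             ep * em = 1 - p1 * m0 - m1 * p0 \<and>
             fp = - (ep * p1 * m1 * d) \<and>
             fm = em * p1 * m1 * d \<and>
             hp = ep * (p0 * m0 * c - (p1 * m0 - m1 * p0) * d - p1 * m1 * p0 * m0 * d) \<and>
             hm = - (em * (p0 * m0 * c - (p1 * m0 - m1 * p0) * d + p1 * m1 * p0 * m0 * d)) \<and>
             (\<forall>z\<in>even_dom (coord_expr Delta Delta T).
                sf_val pp z = (p1 * z + p0) / (c * z + d) \<and>
                sf_val pm z = (m1 * z + m0) / (c * z + d) \<and>
                sf_val gp z = ep / (c * z + d) + (fp * z + hp) / (c * z + d) ^ 2 \<and>
                sf_val gm z = em / (c * z + d) + (fm * z + hm) / (c * z + d) ^ 2))) \<and>
        (n = 1 \<longrightarrow>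
          (\<exists>p0\<in>gr_odd (L - 2). \<exists>m2\<in>gr_odd (L - 2). \<exists>m1\<in>gr_odd (L - 2). \<exists>m0\<in>gr_odd (L - 2).
           \<exists>e\<in>gr_even_units (L - 2).
             \<forall>z\<in>even_dom (coord_expr Delta Delta T).
                sf_val pp z = p0 \<and>
                sf_val pm z = (m2 * z ^ 2 + m1 * z + m0) / (c * z + d) ^ 2 \<and>
                sf_val gp z = e \<and>
                sf_val gm z = 1 / (e * (c * z + d) ^ 2)
                  + p0 * (2 * m2 * d * z - m1 * (c * z - d) - 2 * m0 * c)
                      / (e * (c * z + d) ^ 3))) \<and>
        (n = - 1 \<longrightarrow>
          (\<exists>p2\<in>gr_odd (L - 2). \<exists>p1\<in>gr_odd (L - 2). \<exists>p0\<in>gr_odd (L - 2). \<exists>m0\<in>gr_odd (L - 2).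
           \<exists>e\<in>gr_even_units (L - 2).
             \<forall>z\<in>even_dom (coord_expr Delta Delta T).
                sf_val pp z = (p2 * z ^ 2 + p1 * z + p0) / (c * z + d) ^ 2 \<and>
                sf_val pm z = m0 \<and>
                sf_val gp z = 1 / (e * (c * z + d) ^ 2)
                  - (2 * p2 * d * z - p1 * (c * z - d) - 2 * p0 * c) * m0
                      / (e * (c * z + d) ^ 3) \<and>
                sf_val gm z = e)) \<and>
        (n \<ge> 2 \<longrightarrow>
          (\<exists>q. (\<forall>j\<le>nat (n + 1). q j \<in> gr_odd (L - 2)) \<and>
           (\<exists>e\<in>gr_even_units (L - 2).
             \<forall>z\<in>even_dom (coord_expr Delta Delta T).
                sf_val pp z = 0 \<and>
                sf_val pm z = (\<Sum>j\<le>nat (n + 1). q j * z ^ j) / (c * z + d) powi (n + 1) \<and>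
                sf_val gp z = e * (c * z + d) powi (n - 1) \<and>
                sf_val gm z = inverse e * (c * z + d) powi (- n - 1)))) \<and>
        (n \<le> - 2 \<longrightarrow>
          (\<exists>q. (\<forall>j\<le>nat (- n + 1). q j \<in> gr_odd (L - 2)) \<and>
           (\<exists>e\<in>gr_even_units (L - 2).
             \<forall>z\<in>even_dom (coord_expr Delta Delta T).
                sf_val pp z = (\<Sum>j\<le>nat (- n + 1). q j * z ^ j) / (c * z + d) powi (- n + 1) \<and>
                sf_val pm z = 0 \<and>
                sf_val gp z = inverse e * (c * z + d) powi (n - 1) \<and>
                sf_val gm z = e * (c * z + d) powi (- n - 1)))))"
      by (rule bexI[OF _ R.mem(1)], rule bexI[OF _ R.mem(2)], rule bexI[OF _ R.mem(3)], rule bexI[OF _ R.mem(4)],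
          rule conjI[OF R.det], rule components_all[OF data sec S])
  qed
qed

end
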